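(* Let $K\subset S^3$ be a knot admitting an even symmetric union presentation $D\cup(-D^\ast)(\infty,n_1,\dots,n_k)$ (all $n_i$ even) with partial knot $K_D$, and let $\varphi_D\colon G(K)\twoheadrightarrow G(K_D)$ be the associated epimorphism (described in the context). Let $\mathbb{F}$ be a field, let $\rho_D\colon G(K_D)\to \mathrm{GL}(d,\mathbb{F})$ be a representation, and let $\mu_D\in G(K_D)$ be a fixed meridian element. Then the equality $$\Delta_{K,\rho_D\circ\varphi_D}(t)=\Delta_{K_D,\rho_D}(t)^2\,\det\bigl(\rho_D(\mu_D)t-I_d\bigr)$$ holds up to multiplication by a unit in $\mathbb{F}[t,t^{-1}]$. In particular, $\deg\Delta_{K,\rho_D\circ\varphi_D}(t)=2\deg\Delta_{K_D,\rho_D}(t)+d$, where the degree of a rational expression is the degree of its numerator minus the degree of its denominator.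
   Context: For a knot $K\subset S^3$, $E(K)$ is its exterior and $G(K)=\pi_1(E(K))$ its knot group. **Symmetric unions.** Let $D$ be an unoriented planar diagram of a knot $K_D$, lying on one side of an axis in the plane, and let $D^\ast$ be the diagram obtained by reflecting $D$ across the axis (a diagram of the mirror image). Let $B_0,B_1,\dots,B_k$ be disjoint balls centred along the axis, each invariant under the reflection and each meeting $D$ in a trivial arc, so that $(B_i,B_i\cap(D\cup D^\ast))$ is a trivial tangle (the $0$-tangle: two arcs parallel to the axis exchanged by the reflection). Replace the tangle in $B_0$ by the $\infty$-tangle (two arcs crossing the axis perpendicularly, without crossings), which gives the connected sum of $D$ and $-D^\ast$. For $i=1,\dots,k$ replace the trivial tangle in $B_i$ by an $n_i$-tangle, $n_i\in\mathbb{Z}$ (the two arcs are twisted by $n_i$ signed half-twists about the axis, giving $|n_i|$ crossings on the axis). The resulting diagram $(D\cup D^\ast)(\infty,n_1,\dots,n_k)$ is a symmetric union of $D$ and $D^\ast$. A knot having such a diagram admits a symmetric union presentation with partial knot $K_D$. The presentation is even if all $n_i$ are even; then, for oriented $D$, it inherits an orientation from $D\sharp(-D^\ast)$ (where $-$ denotes reversed orientation) and is denoted $D\cup(-D^\ast)(\infty,n_1,\dots,n_k)$. **The epimorphism $\varphi_D$.** For an even symmetric union, $\varphi_D\colon G(K)\to G(K_D)$ is defined on Wirtinger generators of the oriented diagram $D\cup(-D^\ast)(\infty,n_1,\dots,n_k)$: the generator of an arc coming from $D$, and the generator of the mirror-image arc coming from $-D^\ast$, are both sent to the Wirtinger generator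 of the corresponding arc of $D$; the generators of the arcs in the twist region $B_i$ (respectively in $B_0$) are all sent to the Wirtinger generator of the arc of $D$ passing through $B_i$ (respectively $B_0$). It is a well-defined epimorphism sending a meridian of $K$ to a meridian of $K_D$ and killing the longitude of $K$. **Twisted Alexander polynomial (Wada).** For an oriented knot $K$, take a Wirtinger presentation $G(K)=\langle x_1,\dots,x_N\mid r_1,\dots,r_{N-1}\rangle$ (one relator removed), let $\alpha\colon G(K)\to\langle t\rangle\cong\mathbb{Z}$ be the abelianization with $\alpha(x_i)=t$, and let $\rho\colon G(K)\to \mathrm{GL}(d,\mathbb{F})$ be a representation. Let $\Phi\colon\mathbb{Z}[F_N]\to M(d,\mathbb{F}[t,t^{-1}])$ be the ring homomorphism from the group ring of the free group $F_N$ on $x_1,\dots,x_N$ determined by $\Phi(x_i)=\alpha(x_i)\rho(x_i)$. Let $A$ be the $(N-1)\times N$ block matrix with blocks $\Phi(\partial r_i/\partial x_j)$ (Fox derivatives), and let $A_{x_j}$ be the $d(N-1)\times d(N-1)$ matrix obtained by deleting the $j$th block column. Then $$\Delta_{K,\rho}(t)=\frac{\det A_{x_j}}{\det\Phi(x_j-1)},$$ well-defined up to multiplication by a unit of $\mathbb{F}[t,t^{-1}]$ and independent of the choices. The degree of a nonzero Laurent polynomial is its highest exponent minus its lowest exponent; by convention $\deg 0=-\infty$. *)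

theory Defs
  imports
    "HOL-Library.Poly_Mapping"
    "HOL-Library.Extended_Real"
    "HOL-Computational_Algebra.Fraction_Field"
    "HOL-Algebra.Coset"
    "HOL-Algebra.Generated_Groups"
    "Jordan_Normal_Form.Determinant"
begin

section \<open>Oriented link diagrams\<close>

text \<open>
  A plane diagram in general position with respect to the height function is cut by horizontal
  lines into finitely many horizontal walls, and every wall is a row of elementary bricks read from
  left to right. A diagram is the list of its walls, read from bottom to top. A \<^emph>\<open>level\<close> is a
  horizontal line between two walls; level \<open>l\<close> lies below wall number \<open>l\<close>.

  \<open>Cup b\<close> is a local minimum and \<open>Cap\<close> a local maximum. Strands are oriented: the state of a level
  records for each strand, from left to right, whether it points upwards, and the left strand
  leaving \<open>Cup b\<close> points upwards iff \<open>b\<close>. In \<open>Cross s\<close> two strands cross; the overpassing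
  strand runs between bottom left and top right if \<open>s\<close>, and between bottom right and top left
  otherwise.
\<close>

datatype brick = Vert | Cup bool | Cap | Cross bool

type_synonym wall = "brick list"
type_synonym diagram = "wall list"

fun ins :: "brick \<Rightarrow> nat" where
  "ins Vert = 1" | "ins (Cup b) = 0" | "ins Cap = 2" | "ins (Cross s) = 2"

fun outs :: "brick \<Rightarrow> nat" where
  "outs Vert = 1" | "outs (Cup b) = 2" | "outs Cap = 0" | "outs (Cross s) = 2"

fun wall_top :: "wall \<Rightarrow> bool list \<Rightarrow> bool list option" where
  "wall_top [] [] = Some []"
| "wall_top (Vert # w) (a # st) = map_option (\<lambda>r. a # r) (wall_top w st)"
| "wall_top (Cup b # w) st = map_option (\<lambda>r. b # (\<not> b) # r) (wall_top w st)"
| "wall_top (Cap # w) (a # b # st) = (if a \<noteq> b then wall_top w st else None)"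
| "wall_top (Cross s # w) (a # b # st) = map_option (\<lambda>r. b # a # r) (wall_top w st)"
| "wall_top _ _ = None"

definition level_state :: "diagram \<Rightarrow> nat \<Rightarrow> bool list option" where
  "level_state D l = foldl (\<lambda>st w. Option.bind st (wall_top w)) (Some []) (take l D)"

definition oriented_diagram :: "diagram \<Rightarrow> bool" where
  "oriented_diagram D \<longleftrightarrow> level_state D (length D) = Some []"

definition strands :: "diagram \<Rightarrow> nat \<Rightarrow> bool list" where
  "strands D l = the (level_state D l)"

text \<open>The point \<open>(l, i)\<close> is the intersection of level \<open>l\<close> with its strand number \<open>i\<close>.\<close>

type_synonym point = "nat \<times> nat"

definition points :: "diagram \<Rightarrow> point set" where
  "points D = {(l, i). l \<le> length D \<and> i < length (strands D l)}"

text \<open>The brick \<open>D ! l ! k\<close> starts at bottom position \<open>bot_pos D l k\<close> and at top position \<open>top_pos D l k\<close>.\<close>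

definition bricks :: "diagram \<Rightarrow> (nat \<times> nat) set" where
  "bricks D = {(l, k). l < length D \<and> k < length (D ! l)}"

definition bot_pos :: "diagram \<Rightarrow> nat \<Rightarrow> nat \<Rightarrow> nat" where
  "bot_pos D l k = sum_list (map ins (take k (D ! l)))"

definition top_pos :: "diagram \<Rightarrow> nat \<Rightarrow> nat \<Rightarrow> nat" where
  "top_pos D l k = sum_list (map outs (take k (D ! l)))"

text \<open>The two ends of the unbroken curves in a brick with lower left corner \<open>(l, a)\<close> and upper left
  corner \<open>(l + 1, b)\<close>, and the ends of the curve interrupted by an overpass.\<close>

fun brick_curves :: "brick \<Rightarrow> nat \<Rightarrow> nat \<Rightarrow> nat \<Rightarrow> (point \<times> point) set" where
  "brick_curves Vert l a b = {((l, a), (l + 1, b))}"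
| "brick_curves (Cup c) l a b = {((l + 1, b), (l + 1, b + 1))}"
| "brick_curves Cap l a b = {((l, a), (l, a + 1))}"
| "brick_curves (Cross s) l a b =
    (if s then {((l, a), (l + 1, b + 1))} else {((l, a + 1), (l + 1, b))})"

fun brick_unders :: "brick \<Rightarrow> nat \<Rightarrow> nat \<Rightarrow> nat \<Rightarrow> (point \<times> point) set" where
  "brick_unders (Cross s) l a b =
    (if s then {((l, a + 1), (l + 1, b))} else {((l, a), (l + 1, b + 1))})"
| "brick_unders _ l a b = {}"

definition curves :: "diagram \<Rightarrow> (point \<times> point) set" where
  "curves D = (\<Union>(l, k)\<in>bricks D. brick_curves (D ! l ! k) l (bot_pos D l k) (top_pos D l k))"

definition unders :: "diagram \<Rightarrow> (point \<times> point) set" where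
  "unders D = (\<Union>(l, k)\<in>bricks D. brick_unders (D ! l ! k) l (bot_pos D l k) (top_pos D l k))"

text \<open>A knot diagram is a diagram with exactly one component.\<close>

definition knot_diagram :: "diagram \<Rightarrow> bool" where
  "knot_diagram D \<longleftrightarrow> oriented_diagram D \<and> points D \<noteq> {} \<and>
     (\<forall>p\<in>points D. \<forall>q\<in>points D. equivclp (\<lambda>x y. (x, y) \<in> curves D \<union> unders D) p q)"

text \<open>The arcs, running from underpass to underpass, as sets of points.\<close>

type_synonym arc = "point set"

definition arc_of :: "diagram \<Rightarrow> point \<Rightarrow> arc" where
  "arc_of D p = {q. equivclp (\<lambda>x y. (x, y) \<in> curves D) p q}"

definition arcs :: "diagram \<Rightarrow> arc set" where
  "arcs D = arc_of D ` points D"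

definition crossings :: "diagram \<Rightarrow> (nat \<times> nat) set" where
  "crossings D = {(l, k) \<in> bricks D. \<exists>s. D ! l ! k = Cross s}"

text \<open>The overpassing arc at a crossing, and the underpassing arcs on the left and on the right of
  the overpass with respect to its orientation.\<close>

definition crossing_points :: "diagram \<Rightarrow> nat \<times> nat \<Rightarrow> point \<times> point \<times> point" where
  "crossing_points D = (\<lambda>(l, k).
     let a = bot_pos D l k; b = top_pos D l k in
     if D ! l ! k = Cross True
     then (if strands D l ! a
           then ((l, a), (l + 1, b), (l, a + 1))
           else ((l, a), (l, a + 1), (l + 1, b)))
     else (if strands D l ! (a + 1)
           then ((l, a + 1), (l, a), (l + 1, b + 1))
           else ((l, a + 1), (l + 1, b + 1), (l, a))))"

definition over_arc :: "diagram \<Rightarrow> nat \<times> nat \<Rightarrow> arc" where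
  "over_arc D c = arc_of D (fst (crossing_points D c))"

definition left_arc :: "diagram \<Rightarrow> nat \<times> nat \<Rightarrow> arc" where
  "left_arc D c = arc_of D (fst (snd (crossing_points D c)))"

definition right_arc :: "diagram \<Rightarrow> nat \<times> nat \<Rightarrow> arc" where
  "right_arc D c = arc_of D (snd (snd (crossing_points D c)))"


section \<open>Free groups and Fox calculus\<close>

text \<open>The free group on a type, written additively (but not commutative), so that
  \<open>'x free_group \<Rightarrow>\<^sub>0 int\<close> with the convolution product is its integral group ring. A letter
  \<open>(x, True)\<close> is the generator \<open>x\<close> and \<open>(x, False)\<close> its inverse.\<close>

definition free_cancel :: "('x \<times> bool) list \<Rightarrow> ('x \<times> bool) list \<Rightarrow> bool" where
  "free_cancel u v \<longleftrightarrow> (\<exists>a x b c. u = a @ [(x, b), (x, \<not> b)] @ c \<and> v = a @ c)"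

definition free_equiv :: "('x \<times> bool) list \<Rightarrow> ('x \<times> bool) list \<Rightarrow> bool" where
  "free_equiv = equivclp free_cancel"

lemma free_equiv_equivp: "equivp free_equiv"
  by (simp add: free_equiv_def)

quotient_type 'x free_group = "('x \<times> bool) list" / free_equiv
  by (rule free_equiv_equivp)

lemma free_equiv_refl [simp]: "free_equiv u u"
  by (meson equivp_reflp free_equiv_equivp)

lemma free_equiv_sym: "free_equiv u v \<Longrightarrow> free_equiv v u"
  by (meson equivp_symp free_equiv_equivp)

lemma free_equiv_trans: "free_equiv u v \<Longrightarrow> free_equiv v w \<Longrightarrow> free_equiv u w"
  by (meson equivp_transp free_equiv_equivp)

lemma free_equiv_cancel: "free_cancel u v \<Longrightarrow> free_equiv u v"
  unfolding free_equiv_def by (simp add: r_into_equivclp)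

lemma free_equiv_lift:
  assumes "free_equiv u v"
    and "\<And>u v. free_cancel u v \<Longrightarrow> R (f u) (f v)" and "equivp R"
  shows "R (f u) (f v)"
  using assms(1) unfolding free_equiv_def
proof (induction rule: equivclp_induct)
  case base
  then show ?case using assms(3) by (simp add: equivp_reflp)
next
  case (step y z)
  then show ?case by (meson assms(2,3) equivp_symp equivp_transp)
qed

lemma free_equiv_append_left: "free_equiv u v \<Longrightarrow> free_equiv (a @ u) (a @ v)"
proof (erule free_equiv_lift[where R = free_equiv and f = "\<lambda>u. a @ u"])
  fix u v :: "('a \<times> bool) list"
  assume "free_cancel u v"
  then obtain b x s c where "u = b @ [(x, s), (x, \<not> s)] @ c" "v = b @ c"
    unfolding free_cancel_def by blast
  then have "free_cancel (a @ u) (a @ v)"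
    unfolding free_cancel_def by (metis append.assoc)
  then show "free_equiv (a @ u) (a @ v)" by (rule free_equiv_cancel)
qed (rule free_equiv_equivp)

lemma free_equiv_append_right: "free_equiv u v \<Longrightarrow> free_equiv (u @ a) (v @ a)"
proof (erule free_equiv_lift[where R = free_equiv and f = "\<lambda>u. u @ a"])
  fix u v :: "('a \<times> bool) list"
  assume "free_cancel u v"
  then obtain b x s c where "u = b @ [(x, s), (x, \<not> s)] @ c" "v = b @ c"
    unfolding free_cancel_def by blast
  then have "free_cancel (u @ a) (v @ a)"
    unfolding free_cancel_def by (metis append.assoc)
  then show "free_equiv (u @ a) (v @ a)" by (rule free_equiv_cancel)
qed (rule free_equiv_equivp)

definition inv_word :: "('x \<times> bool) list \<Rightarrow> ('x \<times> bool) list" where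
  "inv_word u = rev (map (\<lambda>(x, b). (x, \<not> b)) u)"

lemma inv_word_left: "free_equiv (inv_word u @ u) []"
proof (induction u)
  case Nil
  then show ?case by (simp add: inv_word_def)
next
  case (Cons a u)
  obtain x b where a: "a = (x, b)" by (cases a)
  have "free_cancel (inv_word (a # u) @ a # u) (inv_word u @ u)"
    unfolding free_cancel_def inv_word_def a
    by (intro exI[of _ "rev (map (\<lambda>(x, b). (x, \<not> b)) u)"] exI[of _ x]
        exI[of _ "\<not> b"] exI[of _ u]) simp
  then show ?case using Cons free_equiv_cancel free_equiv_trans by blast
qed

lemma inv_word_equiv: "free_equiv u v \<Longrightarrow> free_equiv (inv_word u) (inv_word v)"
proof (erule free_equiv_lift[where R = free_equiv and f = inv_word])
  fix u v :: "('a \<times> bool) list"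
  assume "free_cancel u v"
  then obtain b x s c where uv: "u = b @ [(x, s), (x, \<not> s)] @ c" "v = b @ c"
    unfolding free_cancel_def by blast
  have "free_cancel (inv_word u) (inv_word v)"
    unfolding free_cancel_def inv_word_def uv
    by (intro exI[of _ "rev (map (\<lambda>(x, b). (x, \<not> b)) c)"] exI[of _ x]
        exI[of _ s] exI[of _ "rev (map (\<lambda>(x, b). (x, \<not> b)) b)"]) simp
  then show "free_equiv (inv_word u) (inv_word v)" by (rule free_equiv_cancel)
qed (rule free_equiv_equivp)

instantiation free_group :: (type) group_add
begin

lift_definition zero_free_group :: "'a free_group" is "[]" .

lift_definition plus_free_group :: "'a free_group \<Rightarrow> 'a free_group \<Rightarrow> 'a free_group" is "(@)"
  by (meson free_equiv_append_left free_equiv_append_right free_equiv_trans)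

lift_definition uminus_free_group :: "'a free_group \<Rightarrow> 'a free_group" is inv_word
  by (rule inv_word_equiv)

definition minus_free_group :: "'a free_group \<Rightarrow> 'a free_group \<Rightarrow> 'a free_group" where
  "minus_free_group a b = a + - b"

instance
proof
  fix a b c :: "'a free_group"
  show "a + b + c = a + (b + c)" by transfer simp
  show "0 + a = a" by transfer simp
  show "a + 0 = a" by transfer simp
  show "- a + a = 0" by transfer (rule inv_word_left)
  show "a + - b = a - b" by (simp add: minus_free_group_def)
qed

end

lift_definition of_word :: "('x \<times> bool) list \<Rightarrow> 'x free_group" is "\<lambda>u. u" .

definition gen :: "'x \<Rightarrow> 'x free_group" where
  "gen x = of_word [(x, True)]"

lift_definition map_free :: "('x \<Rightarrow> 'y) \<Rightarrow> 'x free_group \<Rightarrow> 'y free_group"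
  is "\<lambda>f. map (\<lambda>(x, b). (f x, b))"
proof -
  fix f :: "'x \<Rightarrow> 'y" and u v :: "('x \<times> bool) list"
  assume "free_equiv u v"
  then show "free_equiv (map (\<lambda>(x, b). (f x, b)) u) (map (\<lambda>(x, b). (f x, b)) v)"
  proof (rule free_equiv_lift[where R = free_equiv])
  fix u v :: "('x \<times> bool) list"
  assume "free_cancel u v"
  then obtain b x s c where uv: "u = b @ [(x, s), (x, \<not> s)] @ c" "v = b @ c"
    unfolding free_cancel_def by blast
  have "free_cancel (map (\<lambda>(x, b). (f x, b)) u) (map (\<lambda>(x, b). (f x, b)) v)"
    unfolding free_cancel_def uv by fastforce
  then show "free_equiv (map (\<lambda>(x, b). (f x, b)) u) (map (\<lambda>(x, b). (f x, b)) v)"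
    by (rule free_equiv_cancel)
  qed (rule free_equiv_equivp)
qed

lift_definition exponent_sum :: "'x free_group \<Rightarrow> int"
  is "\<lambda>u. \<Sum>(x, b)\<leftarrow>u. if b then 1 else - 1"
  by (erule free_equiv_lift) (auto simp: free_cancel_def identity_equivp)

fun fox_word :: "'x \<Rightarrow> ('x \<times> bool) list \<Rightarrow> 'x free_group \<Rightarrow>\<^sub>0 int" where
  "fox_word x [] = 0"
| "fox_word x ((y, b) # u) =
     (if x = y then (if b then 1 else - Poly_Mapping.single (- gen y) 1) else 0)
     + Poly_Mapping.single (if b then gen y else - gen y) 1 * fox_word x u"

lemma fox_word_cancel: "free_cancel u v \<Longrightarrow> fox_word x u = fox_word x v"
proof -
  assume "free_cancel u v"
  then obtain a y b c where uv: "u = a @ [(y, b), (y, \<not> b)] @ c" "v = a @ c"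
    unfolding free_cancel_def by blast
  show ?thesis unfolding uv
    by (induction a) (auto simp: algebra_simps mult.assoc[symmetric] mult_single single_one)
qed

lift_definition fox :: "'x \<Rightarrow> 'x free_group \<Rightarrow> 'x free_group \<Rightarrow>\<^sub>0 int" is fox_word
  by (erule free_equiv_lift) (auto simp: identity_equivp fox_word_cancel)

definition free_group_on :: "'x set \<Rightarrow> 'x free_group monoid" where
  "free_group_on X = \<lparr>carrier = of_word ` {u. fst ` set u \<subseteq> X}, monoid.mult = (+), one = 0\<rparr>"


section \<open>The knot group\<close>

definition normal_closure :: "('g, 'b) monoid_scheme \<Rightarrow> 'g set \<Rightarrow> 'g set" where
  "normal_closure G R =
     generate G {g \<otimes>\<^bsub>G\<^esub> r \<otimes>\<^bsub>G\<^esub> inv\<^bsub>G\<^esub> g | g r. g \<in> carrier G \<and> r \<in> R}"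

text \<open>
  Wirtinger relators. A generator is the loop which starts above the plane, passes below its arc
  from right to left and returns; loops are composed from left to right. Going below both
  strands of a crossing in the two possible ways yields \<open>over \<cdot> left = right \<cdot> over\<close>, whatever the
  orientation of the lower strand. The group of these relators is the fundamental group of the
  knot exterior by Wirtinger's theorem.
\<close>

definition relator :: "diagram \<Rightarrow> nat \<times> nat \<Rightarrow> arc free_group" where
  "relator D c = gen (over_arc D c) + gen (left_arc D c) - gen (over_arc D c) - gen (right_arc D c)"

definition relator_closure :: "diagram \<Rightarrow> arc free_group set" where
  "relator_closure D = normal_closure (free_group_on (arcs D)) (relator D ` crossings D)"

definition knot_group :: "diagram \<Rightarrow> arc free_group set monoid" where
  "knot_group D = free_group_on (arcs D) Mod relator_closure D"

definition group_class :: "diagram \<Rightarrow> arc free_group \<Rightarrow> arc free_group set" where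
  "group_class D w = relator_closure D #>\<^bsub>free_group_on (arcs D)\<^esub> w"

text \<open>The meridians, oriented like the Wirtinger generators (inverses of meridians are excluded).\<close>

definition meridians :: "diagram \<Rightarrow> arc free_group set set" where
  "meridians D = {g \<otimes>\<^bsub>knot_group D\<^esub> group_class D (gen x) \<otimes>\<^bsub>knot_group D\<^esub> inv\<^bsub>knot_group D\<^esub> g
     | g x. g \<in> carrier (knot_group D) \<and> x \<in> arcs D}"

text \<open>The abelianization, with \<open>\<langle>t\<rangle>\<close> identified with the integers.\<close>

definition abelianization :: "diagram \<Rightarrow> arc free_group set \<Rightarrow> int" where
  "abelianization D g = the_elem (exponent_sum ` g)"

definition GL :: "nat \<Rightarrow> 'a :: field mat monoid" where
  "GL d = units_of (ring_mat TYPE('a) d ())"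


section \<open>Twisted Alexander polynomials\<close>

text \<open>The Laurent polynomial ring is the monoid algebra of the additive group of integers;
  \<open>Poly_Mapping.single n c\<close> is the monomial with exponent \<open>n\<close> and coefficient \<open>c\<close>.\<close>

type_synonym 'a laurent = "int \<Rightarrow>\<^sub>0 'a"

definition Phi :: "diagram \<Rightarrow> nat \<Rightarrow> (arc free_group set \<Rightarrow> 'a :: field mat)
    \<Rightarrow> (arc free_group \<Rightarrow>\<^sub>0 int) \<Rightarrow> 'a laurent mat" where
  "Phi D d \<rho> z = mat d d (\<lambda>(i, j).
     \<Sum>w\<in>Poly_Mapping.keys z. of_int (Poly_Mapping.lookup z w) *
       Poly_Mapping.single (abelianization D (group_class D w)) (\<rho> (group_class D w) $$ (i, j)))"

definition block_mat :: "nat \<Rightarrow> nat \<Rightarrow> nat \<Rightarrow> (nat \<Rightarrow> nat \<Rightarrow> 'b mat) \<Rightarrow> 'b mat" where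
  "block_mat d m n B = mat (m * d) (n * d) (\<lambda>(i, j). B (i div d) (j div d) $$ (i mod d, j mod d))"

text \<open>The Fox matrix with rows indexed by the relators \<open>rs\<close> and columns by the generators \<open>xs\<close>.\<close>

definition fox_matrix :: "diagram \<Rightarrow> nat \<Rightarrow> (arc free_group set \<Rightarrow> 'a :: field mat)
    \<Rightarrow> arc free_group list \<Rightarrow> arc list \<Rightarrow> 'a laurent mat" where
  "fox_matrix D d \<rho> rs xs =
     block_mat d (length rs) (length xs) (\<lambda>i j. Phi D d \<rho> (fox (xs ! j) (rs ! i)))"

text \<open>A numbering of the arcs and of all but one of the crossings. A knot diagram has as many
  arcs as crossings, unless it is a crossingless circle; the latter has one arc, and no relator is
  left out.\<close>

definition wirtinger_presentation :: "diagram \<Rightarrow> arc list \<Rightarrow> arc free_group list \<Rightarrow> bool" where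
  "wirtinger_presentation D xs rs \<longleftrightarrow> distinct xs \<and> set xs = arcs D \<and>
     (\<exists>cs. distinct cs \<and> set cs \<subseteq> crossings D \<and> rs = map (relator D) cs) \<and>
     length xs = length rs + 1"

text \<open>\<open>\<Delta>\<close> is the twisted Alexander polynomial calculated from some Wirtinger presentation of the
  diagram and some deleted block column.\<close>

definition twisted_alexander :: "diagram \<Rightarrow> nat \<Rightarrow> (arc free_group set \<Rightarrow> 'a :: field mat)
    \<Rightarrow> 'a laurent fract \<Rightarrow> bool" where
  "twisted_alexander D d \<rho> \<Delta> \<longleftrightarrow> (\<exists>xs rs x. wirtinger_presentation D xs rs \<and> x \<in> set xs \<and>
     \<Delta> = Fraction_Field.Fract (det (fox_matrix D d \<rho> rs (remove1 x xs)))
               (det (Phi D d \<rho> (Poly_Mapping.single (gen x) 1 - 1))))"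

definition eq_up_to_unit :: "'a :: field laurent fract \<Rightarrow> 'a laurent fract \<Rightarrow> bool" where
  "eq_up_to_unit f g \<longleftrightarrow> (\<exists>u. u dvd 1 \<and> f = Fraction_Field.Fract u 1 * g)"

text \<open>The polynomial \<open>det (A t - I)\<close>.\<close>

definition det_At_minus_I :: "nat \<Rightarrow> 'a :: field mat \<Rightarrow> 'a laurent" where
  "det_At_minus_I d A = det (map_mat (Poly_Mapping.single 1) A - 1\<^sub>m d)"

definition laurent_degree :: "'a :: field laurent \<Rightarrow> ereal" where
  "laurent_degree p = (if p = 0 then - \<infinity>
     else ereal (of_int (Max (Poly_Mapping.keys p) - Min (Poly_Mapping.keys p))))"

text \<open>The degree of a rational function, well defined by the two lemmas that follow.\<close>

definition fract_degree :: "'a :: field laurent fract \<Rightarrow> ereal" where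
  "fract_degree f =
     (THE k. \<exists>p q. q \<noteq> 0 \<and> f = Fraction_Field.Fract p q \<and> k = laurent_degree p - laurent_degree q)"

lemma keys_mult_extremal:
  fixes p q :: "'a :: field laurent"
  assumes "p \<noteq> 0" "q \<noteq> 0"
  shows "Max (Poly_Mapping.keys (p * q)) = Max (Poly_Mapping.keys p) + Max (Poly_Mapping.keys q)"
    and "Min (Poly_Mapping.keys (p * q)) = Min (Poly_Mapping.keys p) + Min (Poly_Mapping.keys q)"
proof -
  let ?K = Poly_Mapping.keys
  have fin: "finite (?K p)" "finite (?K q)" "?K p \<noteq> {}" "?K q \<noteq> {}" using assms by auto
  have lookup: "Poly_Mapping.lookup (p * q) (a + b) =
      Poly_Mapping.lookup p a * Poly_Mapping.lookup q b"
    if uniq: "\<And>x y. x \<in> ?K p \<Longrightarrow> y \<in> ?K q \<Longrightarrow> a + b = x + y \<Longrightarrow> x = a \<and> y = b" for a b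
  proof -
    have "Poly_Mapping.lookup (p * q) (a + b) =
        (\<Sum>(x, y). Poly_Mapping.lookup p x * Poly_Mapping.lookup q y when a + b = x + y)"
      by (simp add: times_poly_mapping.rep_eq prod_fun_unfold_prod)
    also have "\<dots> = (\<Sum>xy. (case xy of (x, y) \<Rightarrow> Poly_Mapping.lookup p x * Poly_Mapping.lookup q y)
        when (a, b) = xy)"
    proof (rule Sum_any.cong)
      fix xy :: "int \<times> int"
      obtain x y where xy: "xy = (x, y)" by (cases xy)
      have "x = a \<and> y = b \<or> Poly_Mapping.lookup p x * Poly_Mapping.lookup q y = 0"
        if "a + b = x + y"
        using uniq[of x y] that by (auto simp: in_keys_iff)
      then show "(case xy of (x, y) \<Rightarrow>
            Poly_Mapping.lookup p x * Poly_Mapping.lookup q y when a + b = x + y) =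
          ((case xy of (x, y) \<Rightarrow> Poly_Mapping.lookup p x * Poly_Mapping.lookup q y)
            when (a, b) = xy)"
        unfolding xy by (auto simp: when_def)
    qed
    also have "\<dots> = Poly_Mapping.lookup p a * Poly_Mapping.lookup q b" by simp
    finally show ?thesis .
  qed
  have sub: "?K (p * q) \<subseteq> {a + b | a b. a \<in> ?K p \<and> b \<in> ?K q}" by (rule keys_mult)
  show "Max (?K (p * q)) = Max (?K p) + Max (?K q)"
  proof (rule Max_eqI)
    have "Poly_Mapping.lookup (p * q) (Max (?K p) + Max (?K q)) =
        Poly_Mapping.lookup p (Max (?K p)) * Poly_Mapping.lookup q (Max (?K q))"
      using fin by (intro lookup) (smt (verit) Max_ge)+
    moreover have "Max (?K p) \<in> ?K p" "Max (?K q) \<in> ?K q" using fin by (auto intro: Max_in)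
    ultimately show "Max (?K p) + Max (?K q) \<in> ?K (p * q)" by (simp add: in_keys_iff)
  next
    fix y assume "y \<in> ?K (p * q)"
    then show "y \<le> Max (?K p) + Max (?K q)" using sub fin by (force intro: add_mono Max_ge)
  qed simp
  show "Min (?K (p * q)) = Min (?K p) + Min (?K q)"
  proof (rule Min_eqI)
    have "Poly_Mapping.lookup (p * q) (Min (?K p) + Min (?K q)) =
        Poly_Mapping.lookup p (Min (?K p)) * Poly_Mapping.lookup q (Min (?K q))"
      using fin by (intro lookup) (smt (verit) Min_le)+
    moreover have "Min (?K p) \<in> ?K p" "Min (?K q) \<in> ?K q" using fin by (auto intro: Min_in)
    ultimately show "Min (?K p) + Min (?K q) \<in> ?K (p * q)" by (simp add: in_keys_iff)
  next
    fix y assume "y \<in> ?K (p * q)"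
    then show "Min (?K p) + Min (?K q) \<le> y" using sub fin by (force intro: add_mono Min_le)
  qed simp
qed

lemma fract_degree_Fract:
  fixes p q :: "'a :: field laurent"
  assumes "q \<noteq> 0"
  shows "fract_degree (Fraction_Field.Fract p q) = laurent_degree p - laurent_degree q"
  unfolding fract_degree_def
proof (rule the_equality)
  show "\<exists>p' q'. q' \<noteq> 0 \<and> Fraction_Field.Fract p q = Fraction_Field.Fract p' q' \<and>
      laurent_degree p - laurent_degree q = laurent_degree p' - laurent_degree q'"
    using assms by blast
next
  fix k
  assume "\<exists>p' q'. q' \<noteq> 0 \<and> Fraction_Field.Fract p q = Fraction_Field.Fract p' q' \<and>
      k = laurent_degree p' - laurent_degree q'"
  then obtain p' q' where *: "q' \<noteq> 0" "p * q' = p' * q"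
    and k: "k = laurent_degree p' - laurent_degree q'"
    using assms by (auto simp: eq_fract)
  show "k = laurent_degree p - laurent_degree q"
  proof (cases "p = 0")
    case True
    then have "p' = 0" using * assms by auto
    with True show ?thesis using k * assms by (simp add: laurent_degree_def)
  next
    case False
    then have "p' \<noteq> 0" using * assms by auto
    with False * assms keys_mult_extremal[of p q'] keys_mult_extremal[of p' q]
    show ?thesis by (simp add: k laurent_degree_def)
  qed
qed


section \<open>Symmetric unions\<close>

text \<open>
  The axis is vertical, and \<open>D\<close> lies to the left of it. The ball \<open>B\<^sub>0\<close> sits at level \<open>h0\<close> and
  contains an arc of the rightmost strand there; \<open>ts = [(h\<^sub>1, n\<^sub>1), \<dots>, (h\<^sub>k, n\<^sub>k)]\<close> lists the
  levels of the other balls and the twist numbers. There is one ball per level, which is no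
  restriction since walls consisting of \<open>Vert\<close> may be inserted into \<open>D\<close>.
\<close>

definition symmetric_union_data :: "diagram \<Rightarrow> nat \<Rightarrow> (nat \<times> int) list \<Rightarrow> bool" where
  "symmetric_union_data D h0 ts \<longleftrightarrow> distinct (h0 # map fst ts) \<and>
     (\<forall>h \<in> set (h0 # map fst ts). h < length D \<and> strands D h \<noteq> [])"

text \<open>The mirror image in the vertical axis with reversed orientation. A cup remains a cup with
  the same parameter: mirroring exchanges its two strands, and reversing both restores the
  orientation from left to right.\<close>

fun mirror_brick :: "brick \<Rightarrow> brick" where
  "mirror_brick Vert = Vert" | "mirror_brick (Cup b) = Cup b"
| "mirror_brick Cap = Cap" | "mirror_brick (Cross s) = Cross (\<not> s)"

definition mirror_wall :: "wall \<Rightarrow> wall" where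
  "mirror_wall w = rev (map mirror_brick w)"

text \<open>A wall in which the brick \<open>b\<close> on the axis has \<open>m\<close> vertical strands on both sides.\<close>

definition axis_wall :: "nat \<Rightarrow> brick \<Rightarrow> wall" where
  "axis_wall m b = replicate m Vert @ [b] @ replicate m Vert"

text \<open>The walls of the tangle on the axis at level \<open>l\<close>. In the \<open>n\<close>-tangle the \<open>\<bar>n\<bar>\<close> half twists
  are stacked along the axis.\<close>

definition axis_tangle :: "diagram \<Rightarrow> nat \<Rightarrow> (nat \<times> int) list \<Rightarrow> nat \<Rightarrow> wall list" where
  "axis_tangle D h0 ts l = (let m = length (strands D l) - 1 in
     if l = h0 then [axis_wall m Cap, axis_wall m (Cup (last (strands D l)))]
     else case map_of ts l of None \<Rightarrow> []
       | Some n \<Rightarrow> replicate (nat \<bar>n\<bar>) (axis_wall m (Cross (n > 0))))"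

definition symmetric_union :: "diagram \<Rightarrow> nat \<Rightarrow> (nat \<times> int) list \<Rightarrow> diagram" where
  "symmetric_union D h0 ts =
     concat (map (\<lambda>l. axis_tangle D h0 ts l @ [D ! l @ mirror_wall (D ! l)]) [0..<length D])"

text \<open>
  Folding along the axis sends the points of the symmetric union to points of \<open>D\<close>:
  \<open>folded_levels D h0 ts ! l ! i\<close> is the image of the point \<open>(l, i)\<close>. Points in the twist
  region of a ball go to the strand of \<open>D\<close> passing through this ball, or to the strand of \<open>D\<close>
  which they face. The middle level of the \<open>\<infinity>\<close>-tangle lacks the two strands next to the axis.
\<close>

definition level_points :: "diagram \<Rightarrow> nat \<Rightarrow> point list" where
  "level_points D l = map (Pair l) [0..<length (strands D l)]"

definition folded_tangle :: "diagram \<Rightarrow> nat \<Rightarrow> (nat \<times> int) list \<Rightarrow> nat \<Rightarrow> point list list" where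
  "folded_tangle D h0 ts l = (let r = level_points D l in
     if l = h0 then [r @ rev r, butlast r @ rev (butlast r)]
     else case map_of ts l of None \<Rightarrow> []
       | Some n \<Rightarrow> replicate (nat \<bar>n\<bar>) (r @ rev r))"

definition folded_levels :: "diagram \<Rightarrow> nat \<Rightarrow> (nat \<times> int) list \<Rightarrow> point list list" where
  "folded_levels D h0 ts =
     concat (map (\<lambda>l. folded_tangle D h0 ts l @ [level_points D l @ rev (level_points D l)])
       [0..<length D])"

definition fold_arc :: "diagram \<Rightarrow> nat \<Rightarrow> (nat \<times> int) list \<Rightarrow> arc \<Rightarrow> arc" where
  "fold_arc D h0 ts a = the_elem ((\<lambda>(l, i). arc_of D (folded_levels D h0 ts ! l ! i)) ` a)"

text \<open>The epimorphism \<open>\<phi>\<^sub>D\<close>, induced by \<^const>\<open>fold_arc\<close> on the generators.\<close>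

definition phi :: "diagram \<Rightarrow> nat \<Rightarrow> (nat \<times> int) list
    \<Rightarrow> arc free_group set \<Rightarrow> arc free_group set" where
  "phi D h0 ts g = the_elem ((\<lambda>w. group_class D (map_free (fold_arc D h0 ts) w)) ` g)"

end

theory Submission
  imports Defs "HOL-Library.Function_Algebras"
begin

text \<open>
  Wada's polynomial is \<open>\<delta> / det (M y - 1)\<close>, where \<open>\<delta>\<close> is the determinant of a square presentation of
  the module generated by a block of \<open>d\<close> variables for each arc, with the Fox derivatives of the
  Wirtinger relators and the block of the arc \<open>y\<close> as relations. As the generator of a Fitting ideal,
  \<open>\<delta>\<close> depends only on the module, up to a unit.

  On a symmetric union a solution of the Fox relations is determined by its values \<open>f\<close> on the left half
  and by the differences \<open>g\<close> between the left half and its mirror image. An even twist region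
  does not change \<open>g\<close>, and in the \<open>\<infinity>\<close>-tangle \<open>g\<close> vanishes; so \<open>g\<close> runs through the module of
  \<open>D\<close> with \<open>y\<close> the arc through \<open>B\<^sub>0\<close>. The relations on \<open>f\<close> are those of \<open>D\<close> cut open in \<open>B\<^sub>0\<close>, with
  inhomogeneous terms in \<open>g\<close>. The presentation is therefore block triangular with two blocks of
  determinant \<open>\<delta>\<^sub>D\<close>, whence \<open>\<delta>\<^sub>K = \<delta>\<^sub>D\<^sup>2\<close>. The denominators of both knots are
  \<open>det (t \<rho>(\<mu>) - 1)\<close>.
\<close>

section \<open>Determinants of presentations\<close>

text \<open>That both diagonal blocks have the same determinant is not evident. Each half of the
  union is \<open>D\<close> with two loose ends in \<open>B\<^sub>0\<close>, and the relation for
  the arc \<open>y\<close> kills only the lower one. The upper end is killed as well because of the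
  loop around all strands of a level: its Fox derivative passes unchanged through every brick whose
  relations hold, and it is trivial at the bottom and at the top, so the one strand on which the two
  sides of the cut could differ has to agree. The same loop shows that any single Wirtinger relation
  follows from the others; so the module can be defined by all crossings, with no relator singled
  out.

  The arcs of the union are hard to describe, since the tangles on the axis splice them. All systems
  are therefore stated on the points of the levels; arcs return because a solution is constant along
  curves. Presentations with different generators and of different sizes are compared by surjections
  in both directions: each gives a divisibility, and in a domain the two together give a
  unit.\<close>

definition scale_form :: "'r::comm_ring_1 \<Rightarrow> ('w \<Rightarrow> 'r) \<Rightarrow> 'w \<Rightarrow> 'r" where
  "scale_form c f = (\<lambda>x. c * f x)"

interpretation forms: Modules.module "scale_form :: 'r::comm_ring_1 \<Rightarrow> ('w \<Rightarrow> 'r) \<Rightarrow> 'w \<Rightarrow> 'r"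
  by unfold_locales (auto simp: scale_form_def fun_eq_iff algebra_simps)

definition form_det :: "('w \<Rightarrow> 'r::comm_ring_1) list \<Rightarrow> 'w list \<Rightarrow> 'r" where
  "form_det fs ws = det (mat (length fs) (length ws) (\<lambda>(i, j). (fs ! i) (ws ! j)))"

text \<open>A module on the generators \<open>V\<close> with relation submodule \<open>L\<close> and
  as many relations as generators. A form is a row of the matrix and gives the coefficient of each
  generator. The orderings are existential, so \<open>\<delta>\<close> matters only up to a unit.
  Forms vanish outside \<open>V\<close>, since otherwise \<open>L\<close> could carry coefficients
  that the determinant does not see.\<close>

definition presents :: "'w set \<Rightarrow> ('w \<Rightarrow> 'r::comm_ring_1) set \<Rightarrow> 'r \<Rightarrow> bool" where
  "presents V L \<delta> \<longleftrightarrow> (\<exists>ws fs. distinct ws \<and> set ws = V \<and> length fs = length ws \<and>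
     (\<forall>f\<in>set fs. \<forall>x. x \<notin> V \<longrightarrow> f x = 0) \<and> forms.span (set fs) = L \<and> \<delta> = form_det fs ws)"

definition unit_form :: "'w \<Rightarrow> 'w \<Rightarrow> 'r::comm_ring_1" where
  "unit_form v = (\<lambda>x. if x = v then 1 else 0)"

lemma sum_nth_distinct:
  assumes "distinct ws"
  shows "(\<Sum>k<length ws. F (ws ! k)) = sum F (set ws)"
proof -
  have "bij_betw ((!) ws) {..<length ws} (set ws)" by (rule bij_betw_nth[OF assms]) auto
  then show ?thesis by (rule sum.reindex_bij_betw)
qed

lemma span_list:
  assumes "f \<in> forms.span (set fs)"
  shows "\<exists>a. f = (\<lambda>x. \<Sum>i<length fs. a i * (fs ! i) x)"
  using assms
proof (induction rule: forms.span_induct_alt)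
  case base
  show ?case by (rule exI[of _ "\<lambda>_. 0"]) (simp add: fun_eq_iff)
next
  case (step c g h)
  then obtain a j where a: "h = (\<lambda>x. \<Sum>i<length fs. a i * (fs ! i) x)"
    and j: "j < length fs" "g = fs ! j" by (auto simp: in_set_conv_nth)
  have "scale_form c g + h = (\<lambda>x. \<Sum>i<length fs. (a i + (if i = j then c else 0)) * (fs ! i) x)"
    using j by (simp add: fun_eq_iff scale_form_def a ring_distribs sum.distrib if_distrib[of "\<lambda>u. u * _"] cong: if_cong)
  then show ?case by (rule exI[of _ "\<lambda>i. a i + (if i = j then c else 0)"])
qed

text \<open>The homomorphism of free modules given by the images \<open>s v\<close> of the
  generators.\<close>

definition linear_ext :: "'v set \<Rightarrow> ('v \<Rightarrow> 'w \<Rightarrow> 'r::comm_ring_1) \<Rightarrow> ('v \<Rightarrow> 'r) \<Rightarrow> 'w \<Rightarrow> 'r" where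
  "linear_ext V s f = (\<lambda>x. \<Sum>v\<in>V. f v * s v x)"

lemma linear_ext_add: "linear_ext V s (f + g) = linear_ext V s f + linear_ext V s g"
  by (simp add: linear_ext_def fun_eq_iff ring_distribs sum.distrib)

lemma linear_ext_diff: "linear_ext V s (f - g) = linear_ext V s f - linear_ext V s g"
  by (simp add: linear_ext_def fun_eq_iff ring_distribs sum_subtractf)

lemma linear_ext_scale: "linear_ext V s (scale_form c f) = scale_form c (linear_ext V s f)"
  by (simp add: linear_ext_def scale_form_def fun_eq_iff sum_distrib_left mult.assoc)

lemma linear_ext_0: "linear_ext V s 0 = 0"
  by (simp add: linear_ext_def fun_eq_iff)

lemma linear_ext_unit: "finite V \<Longrightarrow> v \<in> V \<Longrightarrow> linear_ext V s (unit_form v) = s v"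
  by (simp add: linear_ext_def unit_form_def fun_eq_iff if_distrib[of "\<lambda>u. u * _"] cong: if_cong)

lemma linear_ext_span:
  assumes "f \<in> forms.span S" "\<And>g. g \<in> S \<Longrightarrow> linear_ext V s g \<in> L" "forms.subspace L"
  shows "linear_ext V s f \<in> L"
  using assms(1)
proof (induction rule: forms.span_induct_alt)
  case base
  show ?case unfolding linear_ext_0 using assms(3) by (rule forms.subspace_0)
next
  case (step c g h)
  then show ?case
    unfolding linear_ext_add linear_ext_scale
    using assms(2,3) by (intro forms.subspace_add forms.subspace_scale)
qed

text \<open>A surjection from the module presented by \<open>L'\<close> onto the one presented by \<open>L\<close> gives a
  factorisation of one block matrix through the other, hence divisibility of Fitting generators.\<close>

lemma presents_dvd:
  fixes \<delta> :: "'r::idom"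
  assumes L: "presents V L \<delta>" and L': "presents W L' \<delta>'"
    and rel: "\<And>g. g \<in> L' \<Longrightarrow> linear_ext W s g \<in> L"
    and surj: "\<And>v. v \<in> V \<Longrightarrow> \<exists>g. linear_ext W s g - unit_form v \<in> L"
  shows "\<delta> dvd \<delta>'"
proof -
  obtain vs fs where vs: "distinct vs" "set vs = V" "length fs = length vs"
    "forms.span (set fs) = L" "\<delta> = form_det fs vs"
    using L unfolding presents_def by blast
  obtain ws gs where ws: "distinct ws" "set ws = W" "length gs = length ws"
    "forms.span (set gs) = L'" "\<delta>' = form_det gs ws"
    using L' unfolding presents_def by blast
  define n m where "n = length vs" and "m = length ws"
  define A where "A = mat n n (\<lambda>(i, j). (fs ! i) (vs ! j))"
  define B where "B = mat m m (\<lambda>(i, j). (gs ! i) (ws ! j))"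
  define Q where "Q = mat m n (\<lambda>(i, j). s (ws ! i) (vs ! j))"
  have "\<exists>a. linear_ext W s (gs ! i) = (\<lambda>x. \<Sum>k<n. a k * (fs ! k) x)" if "i < m" for i
  proof -
    have "gs ! i \<in> forms.span (set gs)" using that ws by (intro forms.span_base) (simp add: m_def)
    then have "linear_ext W s (gs ! i) \<in> forms.span (set fs)" using rel ws vs by blast
    from span_list[OF this] show ?thesis using vs by (simp add: n_def)
  qed
  then obtain u where u: "\<And>i. i < m \<Longrightarrow>
      linear_ext W s (gs ! i) = (\<lambda>x. \<Sum>k<n. u i k * (fs ! k) x)" by metis
  have "\<exists>g a. linear_ext W s g - unit_form (vs ! i) = (\<lambda>x. \<Sum>k<n. a k * (fs ! k) x)"
    if "i < n" for i
  proof -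
    have "vs ! i \<in> V" using that vs by (auto simp: n_def)
    from surj[OF this] obtain g where "linear_ext W s g - unit_form (vs ! i) \<in> forms.span (set fs)"
      using vs by blast
    from span_list[OF this] show ?thesis using vs by (auto simp: n_def)
  qed
  then obtain p y where py: "\<And>i. i < n \<Longrightarrow>
      linear_ext W s (p i) - unit_form (vs ! i) = (\<lambda>x. \<Sum>k<n. y i k * (fs ! k) x)" by metis
  define P where "P = mat n m (\<lambda>(i, j). p i (ws ! j))"
  define Y where "Y = mat n n (\<lambda>(i, j). y i j)"
  define U where "U = mat m n (\<lambda>(i, j). u i j)"
  have lin: "(\<Sum>k<m. f (ws ! k) * s (ws ! k) x) = linear_ext W s f x" for f x
    using sum_nth_distinct[OF ws(1), of "\<lambda>w. f w * s w x"] ws by (simp add: linear_ext_def m_def)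
  have carr: "A \<in> carrier_mat n n" "B \<in> carrier_mat m m" "Q \<in> carrier_mat m n"
    "P \<in> carrier_mat n m" "Y \<in> carrier_mat n n" "U \<in> carrier_mat m n"
    unfolding A_def B_def Q_def P_def Y_def U_def by simp_all
  have BQ: "B * Q = U * A"
  proof (rule eq_matI)
    fix i j assume ij: "i < dim_row (U * A)" "j < dim_col (U * A)"
    then have ij: "i < m" "j < n" using carr by auto
    have "(B * Q) $$ (i, j) = (\<Sum>k<m. (gs ! i) (ws ! k) * s (ws ! k) (vs ! j))"
      using ij by (simp add: B_def Q_def scalar_prod_def lessThan_atLeast0)
    also have "\<dots> = (\<Sum>k<n. u i k * (fs ! k) (vs ! j))" using ij by (simp add: lin u)
    also have "\<dots> = (U * A) $$ (i, j)"
      using ij by (simp add: U_def A_def scalar_prod_def lessThan_atLeast0)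
    finally show "(B * Q) $$ (i, j) = (U * A) $$ (i, j)" .
  qed (use carr in auto)
  have PQ: "P * Q = 1\<^sub>m n + Y * A"
  proof (rule eq_matI)
    fix i j assume ij: "i < dim_row (1\<^sub>m n + Y * A)" "j < dim_col (1\<^sub>m n + Y * A)"
    then have ij: "i < n" "j < n" using carr by auto
    have "(P * Q) $$ (i, j) = (\<Sum>k<m. p i (ws ! k) * s (ws ! k) (vs ! j))"
      using ij by (simp add: P_def Q_def scalar_prod_def lessThan_atLeast0)
    also have "\<dots> = linear_ext W s (p i) (vs ! j)" by (simp add: lin)
    also have "\<dots> = unit_form (vs ! i) (vs ! j) + (\<Sum>k<n. y i k * (fs ! k) (vs ! j))"
      using fun_cong[OF py[OF ij(1)], of "vs ! j"] by (simp add: algebra_simps)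
    also have "unit_form (vs ! i) (vs ! j) = 1\<^sub>m n $$ (i, j)"
      using ij vs(1) by (auto simp: unit_form_def n_def nth_eq_iff_index_eq)
    also have "\<dots> + (\<Sum>k<n. y i k * (fs ! k) (vs ! j)) = (1\<^sub>m n + Y * A) $$ (i, j)"
      using ij by (simp add: Y_def A_def scalar_prod_def lessThan_atLeast0)
    finally show "(P * Q) $$ (i, j) = (1\<^sub>m n + Y * A) $$ (i, j)" .
  qed (use carr in auto)
  \<comment> \<open>\<open>B * Q = U * A\<close> says that relations go to relations,
    \<open>P * Q = 1 + Y * A\<close> that the map is onto. Both are packed into
    \<open>?Z * ?N1 = ?N2\<close> with \<open>det ?N1 = det A\<close> and
    \<open>det ?N2 = det B\<close>. So \<open>det ?Z\<close> is the cofactor, although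
    \<open>A\<close> and \<open>B\<close> differ in size.\<close>
  let ?Z = "four_block_mat (- Y) (- P) U B"
  let ?N1 = "four_block_mat A (0\<^sub>m n m) (- Q) (1\<^sub>m m)"
  let ?N2 = "four_block_mat (1\<^sub>m n) (- P) (0\<^sub>m m n) B"
  have "?Z * ?N1 = four_block_mat (- Y * A + - P * - Q) (- Y * 0\<^sub>m n m + - P * 1\<^sub>m m)
      (U * A + B * - Q) (U * 0\<^sub>m n m + B * 1\<^sub>m m)"
    by (rule mult_four_block_mat) (use carr in auto)
  also have "- Y * A + - P * - Q = 1\<^sub>m n"
  proof -
    have "- Y * A + - P * - Q = - (Y * A) + P * Q" using carr by simp
    also have "\<dots> = - (Y * A) + (1\<^sub>m n + Y * A)" by (simp add: PQ)
    also have "\<dots> = 1\<^sub>m n" by (rule eq_matI) (use carr in auto)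
    finally show ?thesis .
  qed
  also have "- Y * 0\<^sub>m n m + - P * 1\<^sub>m m = - P"
    using carr by simp
  also have "U * A + B * - Q = 0\<^sub>m m n"
    using carr by (intro eq_matI) (auto simp: BQ)
  also have "U * 0\<^sub>m n m + B * 1\<^sub>m m = B"
    using carr by simp
  finally have "?Z * ?N1 = ?N2" .
  moreover have "det (?Z * ?N1) = det ?Z * det ?N1"
    by (rule det_mult[where n = "n + m"]) (use carr in auto)
  moreover have "det ?N1 = det A * det (1\<^sub>m m)"
    by (rule det_four_block_mat_upper_right_zero) (use carr in auto)
  moreover have "det ?N2 = det (1\<^sub>m n) * det B"
    by (rule det_four_block_mat_lower_left_zero) (use carr in auto)
  ultimately have "det B = det ?Z * det A" by simp
  then show ?thesis
    unfolding vs(5) ws(5) form_det_def using vs(3) ws(3) by (simp add: A_def B_def n_def m_def)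
qed

text \<open>Forms of \<open>L2\<close> do not involve \<open>ws\<close>, while those of
  \<open>fs\<close> may involve \<open>V2\<close>: the matrix is block upper triangular and the
  coupling block drops out of the determinant. That block is where the twist terms will sit.\<close>

lemma presents_triangular:
  fixes \<delta> :: "'r::idom"
  assumes ws: "distinct ws" "length fs = length ws" and V2: "presents V2 L2 \<delta>" "set ws \<inter> V2 = {}"
    and supp: "\<And>f x. f \<in> set fs \<Longrightarrow> x \<notin> set ws \<union> V2 \<Longrightarrow> f x = 0"
  shows "presents (set ws \<union> V2) (forms.span (set fs \<union> L2)) (form_det fs ws * \<delta>)"
proof -
  obtain vs gs where vs: "distinct vs" "set vs = V2" "length gs = length vs"
    "\<And>g x. g \<in> set gs \<Longrightarrow> x \<notin> V2 \<Longrightarrow> g x = 0"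
    "forms.span (set gs) = L2" "\<delta> = form_det gs vs"
    using V2(1) unfolding presents_def by blast
  define n m where "n = length ws" and "m = length vs"
  define A where "A = mat n n (\<lambda>(i, j). (fs ! i) (ws ! j))"
  define B where "B = mat n m (\<lambda>(i, j). (fs ! i) (vs ! j))"
  define C where "C = mat m m (\<lambda>(i, j). (gs ! i) (vs ! j))"
  have carr: "A \<in> carrier_mat n n" "B \<in> carrier_mat n m" "C \<in> carrier_mat m m"
    unfolding A_def B_def C_def by simp_all
  have "mat (n + m) (n + m) (\<lambda>(i, j). ((fs @ gs) ! i) ((ws @ vs) ! j)) = four_block_mat A B (0\<^sub>m m n) C"
  proof (rule eq_matI)
    fix i j assume "i < dim_row (four_block_mat A B (0\<^sub>m m n) C)"
      "j < dim_col (four_block_mat A B (0\<^sub>m m n) C)"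
    then have ij: "i < n + m" "j < n + m" using carr by auto
    have "gs ! (i - n) \<in> set gs" if "\<not> i < n" using that ij vs(3) by (simp add: m_def)
    moreover have "ws ! j \<notin> V2" if "j < n" using that V2(2) nth_mem[of j ws] unfolding n_def by blast
    ultimately show "mat (n + m) (n + m) (\<lambda>(i, j). ((fs @ gs) ! i) ((ws @ vs) ! j)) $$ (i, j) =
        four_block_mat A B (0\<^sub>m m n) C $$ (i, j)"
      using ij carr ws(2) vs(3,4) by (auto simp: A_def B_def C_def nth_append n_def)
  qed (use carr in auto)
  then have "form_det (fs @ gs) (ws @ vs) = det (four_block_mat A B (0\<^sub>m m n) C)"
    using ws vs by (simp add: form_det_def n_def m_def)
  also have "\<dots> = det A * det C"
    by (rule det_four_block_mat_lower_left_zero) (use carr in auto)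
  also have "\<dots> = form_det fs ws * \<delta>"
    using ws vs by (simp add: A_def C_def form_det_def n_def m_def)
  finally have det: "form_det fs ws * \<delta> = form_det (fs @ gs) (ws @ vs)" by simp
  have "forms.span (set fs \<union> forms.span (set gs)) = forms.span (set fs \<union> set gs)"
    by (simp add: forms.span_Un forms.span_span)
  then show ?thesis
    unfolding presents_def det using ws vs V2(2) supp
    by (intro exI[of _ "ws @ vs"] exI[of _ "fs @ gs"]) auto
qed

text \<open>Serves to kill the block of one arc: an identity block leaves the determinant
  alone.\<close>

lemma presents_unit_forms:
  assumes "finite V"
  shows "presents V (forms.span (unit_form ` V)) (1 :: 'r::comm_ring_1)"
proof -
  obtain ws where ws: "distinct ws" "set ws = V" using finite_distinct_list[OF assms] by blast
  have "mat (length ws) (length ws) (\<lambda>(i, j). (map unit_form ws ! i) (ws ! j)) = (1\<^sub>m (length ws) :: 'r mat)"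
    by (rule eq_matI) (use ws in \<open>auto simp: unit_form_def nth_eq_iff_index_eq\<close>)
  then have "form_det (map unit_form ws) ws = (1 :: 'r)"
    by (simp add: form_det_def)
  then show ?thesis unfolding presents_def using ws
    by (intro exI[of _ ws] exI[of _ "map unit_form ws"]) (auto simp: unit_form_def)
qed

lemma dvd_antisym_unit:
  fixes a b :: "'r::idom"
  assumes "a dvd b" "b dvd a"
  shows "\<exists>u. u dvd 1 \<and> a = u * b"
proof -
  obtain u where u: "b = a * u" using assms(1) by (rule dvdE)
  obtain v where "a = b * v" using assms(2) by (rule dvdE)
  note uv = u this
  have "a * (1 - u * v) = a - (a * u) * v" by (simp add: algebra_simps)
  also have "\<dots> = a - b * v" by (simp only: uv(1))
  also have "\<dots> = 0" using uv(2) by simp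
  finally have "a * (1 - u * v) = 0" .
  then have "a = 0 \<or> 1 = u * v" by (simp only: mult_eq_0_iff right_minus_eq)
  then consider "a = 0" | "u * v = 1" by metis
  then show ?thesis
  proof cases
    case 1
    then show ?thesis using u by (intro exI[of _ 1]) simp
  next
    case 2
    then show ?thesis using uv(2) by (metis dvd_triv_right mult.commute)
  qed
qed

text \<open>Cramer's rule for forms that annihilate the vectors \<open>c 0, \<dots>, c (d - 1)\<close>: deleting one or
  another block of \<open>d\<close> columns.\<close>

lemma form_det_exchange:
  fixes c :: "nat \<Rightarrow> 'w \<Rightarrow> 'r::idom"
  assumes dist: "distinct (ws @ us @ vs)" and len: "length us = d" "length vs = d"
    "length fs = length ws + d"
    and ann: "\<And>f k. f \<in> set fs \<Longrightarrow> k < d \<Longrightarrow> (\<Sum>w\<in>set (ws @ us @ vs). f w * c k w) = 0"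
  shows "form_det fs (ws @ us) * det (mat d d (\<lambda>(i, k). c k (us ! i))) =
    (- 1) ^ d * (form_det fs (ws @ vs) * det (mat d d (\<lambda>(i, k). c k (vs ! i))))"
proof -
  define n where "n = length ws"
  \<comment> \<open>Right multiplication by \<open>?C\<close>, whose determinant is
    \<open>det F\<close>, replaces the last \<open>d\<close> columns by the combinations with
    coefficients \<open>e\<close>. The result depends on \<open>us\<close> and \<open>e\<close> only
    through these sums.\<close>
  have mult: "form_det fs (ws @ us) * det (mat d d (\<lambda>(i, k). e k (us ! i))) =
      det (mat (n + d) (n + d) (\<lambda>(i, j). if j < n then (fs ! i) (ws ! j)
        else \<Sum>w\<in>set (ws @ us). (fs ! i) w * e (j - n) w))"
    if us: "distinct (ws @ us)" "length us = d" for us and e :: "nat \<Rightarrow> 'w \<Rightarrow> 'r"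
  proof -
    define A where "A = mat (n + d) (n + d) (\<lambda>(i, j). (fs ! i) ((ws @ us) ! j))"
    define E where "E = mat n d (\<lambda>(i, k). e k (ws ! i))"
    define F where "F = mat d d (\<lambda>(i, k). e k (us ! i))"
    let ?C = "four_block_mat (1\<^sub>m n) E (0\<^sub>m d n) F"
    have C: "?C \<in> carrier_mat (n + d) (n + d)" by (simp add: F_def)
    have entry: "?C $$ (k, j) = (if j < n then (if k = j then 1 else 0) else e (j - n) ((ws @ us) ! k))"
      if "k < n + d" "j < n + d" for k j
      using that by (auto simp: E_def F_def nth_append n_def)
    have "A * ?C = mat (n + d) (n + d) (\<lambda>(i, j). if j < n then (fs ! i) (ws ! j)
        else \<Sum>w\<in>set (ws @ us). (fs ! i) w * e (j - n) w)"
    proof (rule eq_matI, goal_cases)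
      case (1 i j)
      then have ij: "i < n + d" "j < n + d" by auto
      have "(A * ?C) $$ (i, j) = (\<Sum>k<n + d. (fs ! i) ((ws @ us) ! k) * ?C $$ (k, j))"
        using ij C by (simp add: A_def scalar_prod_def lessThan_atLeast0 del: index_mat_four_block)
      also have "\<dots> = (\<Sum>k<n + d. (fs ! i) ((ws @ us) ! k) *
          (if j < n then (if k = j then 1 else 0) else e (j - n) ((ws @ us) ! k)))"
        using ij by (intro sum.cong refl) (simp only: entry lessThan_iff)
      also have "\<dots> = (if j < n then (fs ! i) (ws ! j)
          else \<Sum>w\<in>set (ws @ us). (fs ! i) w * e (j - n) w)"
      proof (cases "j < n")
        case True
        then show ?thesis by (simp add: if_distrib[of "\<lambda>u. _ * u"] n_def nth_append cong: if_cong)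
      next
        case False
        have "(\<Sum>k<length (ws @ us). (fs ! i) ((ws @ us) ! k) * e (j - n) ((ws @ us) ! k)) =
            (\<Sum>w\<in>set (ws @ us). (fs ! i) w * e (j - n) w)"
          by (rule sum_nth_distinct[OF us(1)])
        with False us show ?thesis by (simp add: n_def)
      qed
      finally show ?case using ij by simp
    qed (simp_all add: A_def E_def F_def)
    moreover have "det (A * ?C) = det A * det ?C"
      by (rule det_mult[OF _ C]) (simp add: A_def)
    moreover have "det ?C = det (1\<^sub>m n) * det F"
      by (rule det_four_block_mat_lower_left_zero[where n = n and m = d]) (simp_all add: E_def F_def)
    ultimately show ?thesis using us len by (simp add: form_det_def A_def F_def n_def)
  qed
  \<comment> \<open>As the total sum vanishes, the sum over \<open>ws\<close> and \<open>us\<close>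
    is minus the sum over \<open>vs\<close>. With \<open>e = - c\<close> on \<open>vs\<close> and 0
    on \<open>ws\<close>, both products become the same matrix; the sign in the statement is the
    determinant of the negated \<open>d\<close> by \<open>d\<close> block.\<close>
  have neg: "(\<Sum>w\<in>set (ws @ us). f w * c k w) = (\<Sum>w\<in>set (ws @ vs). f w * (if w \<in> set vs then - c k w else 0))"
    if "f \<in> set fs" "k < d" for f k
  proof -
    have "(\<Sum>w\<in>set (ws @ us @ vs). f w * c k w) = (\<Sum>w\<in>set (ws @ us). f w * c k w) + (\<Sum>w\<in>set vs. f w * c k w)"
      using dist by (subst sum.union_disjoint[symmetric]) (auto simp: Un_assoc)
    moreover have "(\<Sum>w\<in>set (ws @ vs). f w * (if w \<in> set vs then - c k w else 0)) =
        (\<Sum>w\<in>set vs. f w * - c k w)"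
      using dist by (intro sum.mono_neutral_cong_right) auto
    ultimately show ?thesis using ann[OF that] by (simp add: sum_negf add_eq_0_iff2)
  qed
  have "form_det fs (ws @ us) * det (mat d d (\<lambda>(i, k). c k (us ! i))) =
      form_det fs (ws @ vs) * det (mat d d (\<lambda>(i, k). if vs ! i \<in> set vs then - c k (vs ! i) else 0))"
  proof (subst (1 2) mult, goal_cases)
    case 5
    show ?case
      by (intro arg_cong[of _ _ det] eq_matI) (use len in \<open>auto simp: neg n_def[symmetric] simp del: set_append\<close>)
  qed (use dist len in auto)
  also have "mat d d (\<lambda>(i, k). if vs ! i \<in> set vs then - c k (vs ! i) else 0) =
      (- 1) \<cdot>\<^sub>m mat d d (\<lambda>(i, k). c k (vs ! i))"
    using len by (intro eq_matI) auto
  finally show ?thesis by (simp add: det_smult)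
qed

section \<open>Fox relations on a diagram\<close>

text \<open>Rows from \<open>d\<close> on are left alone, so that the identity matrix acts as the
  identity on all functions and invertible matrices act invertibly, without any carrier
  condition.\<close>

definition block_act :: "nat \<Rightarrow> 'r::comm_ring_1 mat \<Rightarrow> (nat \<Rightarrow> 'w \<Rightarrow> 'r) \<Rightarrow> nat \<Rightarrow> 'w \<Rightarrow> 'r" where
  "block_act d M X = (\<lambda>k x. if k < d then (\<Sum>j<d. M $$ (k, j) * X j x) else X k x)"

lemma block_act_add: "block_act d M (X + Y) = block_act d M X + block_act d M Y"
  by (auto simp: block_act_def fun_eq_iff ring_distribs sum.distrib)

lemma block_act_one: "block_act d (1\<^sub>m d) X = X"
  by (auto simp: block_act_def fun_eq_iff if_distrib[of "\<lambda>u. u * _"] cong: if_cong)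

lemma block_act_mult:
  assumes "M \<in> carrier_mat d d" "N \<in> carrier_mat d d"
  shows "block_act d (M * N) X = block_act d M (block_act d N X)"
proof -
  have "(\<Sum>j<d. (M * N) $$ (k, j) * X j x) = (\<Sum>i<d. M $$ (k, i) * (\<Sum>j<d. N $$ (i, j) * X j x))"
    if "k < d" for k x
  proof -
    have "(\<Sum>j<d. (M * N) $$ (k, j) * X j x) = (\<Sum>j<d. \<Sum>i<d. M $$ (k, i) * N $$ (i, j) * X j x)"
      using that assms by (simp add: scalar_prod_def lessThan_atLeast0 sum_distrib_right)
    also have "\<dots> = (\<Sum>i<d. \<Sum>j<d. M $$ (k, i) * N $$ (i, j) * X j x)" by (rule sum.swap)
    finally show ?thesis by (simp add: sum_distrib_left mult.assoc)
  qed
  then show ?thesis by (auto simp: block_act_def fun_eq_iff)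
qed

text \<open>The submodule of \<open>d\<close>-tuples over \<open>L\<close>; \<open>rows\<close> goes
  the other way. Fox relations come in blocks of \<open>d\<close> forms, whereas
  \<open>presents\<close> counts single forms.\<close>

definition blocks :: "nat \<Rightarrow> 'm set \<Rightarrow> (nat \<Rightarrow> 'm) set" where
  "blocks d L = {X. \<forall>k<d. X k \<in> L}"

definition rows :: "nat \<Rightarrow> (nat \<Rightarrow> 'm) set \<Rightarrow> 'm set" where
  "rows d S = (\<Union>X\<in>S. X ` {..<d})"

lemma rows_Un: "rows d (S \<union> S') = rows d S \<union> rows d S'"
  by (auto simp: rows_def)

lemma subset_blocks_span_rows: "S \<subseteq> blocks d (forms.span (rows d S))"
  by (auto simp: blocks_def rows_def intro!: forms.span_base)

lemma rows_subset: "S \<subseteq> blocks d L \<Longrightarrow> rows d S \<subseteq> L"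
  by (auto simp: blocks_def rows_def)

lemma block_act_closed:
  assumes "forms.subspace L" "X \<in> blocks d L"
  shows "block_act d M X \<in> blocks d L"
proof -
  have "(\<lambda>x. \<Sum>j<d. M $$ (k, j) * X j x) \<in> L" for k
  proof -
    have "(\<Sum>j<d. scale_form (M $$ (k, j)) (X j)) \<in> L"
      using assms by (intro forms.subspace_sum forms.subspace_scale) (auto simp: blocks_def)
    also have "(\<Sum>j<d. scale_form (M $$ (k, j)) (X j)) = (\<lambda>x. \<Sum>j<d. M $$ (k, j) * X j x)"
    proof -
      have "(\<Sum>j\<in>A. scale_form (M $$ (k, j)) (X j)) x = (\<Sum>j\<in>A. M $$ (k, j) * X j x)" for x and A :: "nat set"
        by (induction A rule: infinite_finite_induct) (auto simp: scale_form_def)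
      then show ?thesis by (simp add: fun_eq_iff)
    qed
    finally show ?thesis .
  qed
  then show ?thesis using assms(2) by (auto simp: block_act_def blocks_def fun_eq_iff)
qed

definition var :: "'v \<Rightarrow> nat \<Rightarrow> 'v \<times> nat \<Rightarrow> 'r::comm_ring_1" where
  "var v = (\<lambda>k. unit_form (v, k))"

definition block_ext :: "nat \<Rightarrow> 'v set \<Rightarrow> ('v \<Rightarrow> nat \<Rightarrow> 'w \<Rightarrow> 'r::comm_ring_1)
    \<Rightarrow> (nat \<Rightarrow> 'v \<times> nat \<Rightarrow> 'r) \<Rightarrow> nat \<Rightarrow> 'w \<Rightarrow> 'r" where
  "block_ext d V s X = (\<lambda>k. linear_ext (V \<times> {..<d}) (\<lambda>(v, j). s v j) (X k))"

lemma block_ext_add: "block_ext d V s (X + Y) = block_ext d V s X + block_ext d V s Y"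
  unfolding block_ext_def by (rule ext) (simp only: linear_ext_add plus_fun_apply)

lemma block_ext_diff: "block_ext d V s (X - Y) = block_ext d V s X - block_ext d V s Y"
  unfolding block_ext_def by (rule ext) (simp only: linear_ext_diff minus_apply)

lemma block_ext_act: "block_ext d V s (block_act d M X) = block_act d M (block_ext d V s X)"
proof -
  have "(\<Sum>w\<in>W. (\<Sum>j<d. M $$ (k, j) * X j w) * f w) =
      (\<Sum>j<d. M $$ (k, j) * (\<Sum>w\<in>W. X j w * f w))" for k W and f :: "_ \<Rightarrow> _"
  proof -
    have "(\<Sum>w\<in>W. (\<Sum>j<d. M $$ (k, j) * X j w) * f w) = (\<Sum>w\<in>W. \<Sum>j<d. M $$ (k, j) * X j w * f w)"
      by (simp add: sum_distrib_right)
    also have "\<dots> = (\<Sum>j<d. \<Sum>w\<in>W. M $$ (k, j) * X j w * f w)" by (rule sum.swap)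
    finally show ?thesis by (simp add: sum_distrib_left mult.assoc)
  qed
  then show ?thesis
    by (auto simp: block_ext_def block_act_def linear_ext_def fun_eq_iff)
qed

lemma block_ext_var:
  assumes "finite V" "v \<in> V" "k < d"
  shows "block_ext d V s (var v) k = s v k"
  using assms by (simp add: block_ext_def var_def linear_ext_unit)

lemma block_ext_span:
  assumes "f \<in> forms.span (rows d S)" "\<And>X. X \<in> S \<Longrightarrow> block_ext d V s X \<in> blocks d L" "forms.subspace L"
  shows "linear_ext (V \<times> {..<d}) (\<lambda>(v, j). s v j) f \<in> L"
  using assms(1)
proof (rule linear_ext_span)
  fix g assume "g \<in> rows d S"
  then obtain X k where "X \<in> S" "k < d" "g = X k" by (auto simp: rows_def)
  then show "linear_ext (V \<times> {..<d}) (\<lambda>(v, j). s v j) g \<in> L"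
    using assms(2) by (auto simp: blocks_def block_ext_def)
qed fact

text \<open>A row of bricks carrying data on the strands below and above it.\<close>

inductive wall_ok :: "(brick \<Rightarrow> 'a list \<Rightarrow> 'b list \<Rightarrow> bool) \<Rightarrow> wall \<Rightarrow> 'a list \<Rightarrow> 'b list \<Rightarrow> bool" for P where
  Nil: "wall_ok P [] [] []"
| Cons: "P b xs ys \<Longrightarrow> length xs = ins b \<Longrightarrow> length ys = outs b \<Longrightarrow> wall_ok P w xs' ys' \<Longrightarrow>
    wall_ok P (b # w) (xs @ xs') (ys @ ys')"

lemma wall_ok_Cons_iff: "wall_ok P (b # w) xs ys \<longleftrightarrow> ins b \<le> length xs \<and> outs b \<le> length ys \<and>
    P b (take (ins b) xs) (take (outs b) ys) \<and> wall_ok P w (drop (ins b) xs) (drop (outs b) ys)"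
proof
  assume "wall_ok P (b # w) xs ys"
  then show "ins b \<le> length xs \<and> outs b \<le> length ys \<and>
    P b (take (ins b) xs) (take (outs b) ys) \<and> wall_ok P w (drop (ins b) xs) (drop (outs b) ys)"
    by cases auto
next
  assume "ins b \<le> length xs \<and> outs b \<le> length ys \<and>
    P b (take (ins b) xs) (take (outs b) ys) \<and> wall_ok P w (drop (ins b) xs) (drop (outs b) ys)"
  then show "wall_ok P (b # w) xs ys"
    using wall_ok.Cons[of P b "take (ins b) xs" "take (outs b) ys" w "drop (ins b) xs" "drop (outs b) ys"]
    by simp
qed

lemma wall_ok_Nil_iff [simp]: "wall_ok P [] xs ys \<longleftrightarrow> xs = [] \<and> ys = []"
  by (auto elim: wall_ok.cases intro: wall_ok.Nil)

abbreviation width_in :: "wall \<Rightarrow> nat" where "width_in w \<equiv> sum_list (map ins w)"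
abbreviation width_out :: "wall \<Rightarrow> nat" where "width_out w \<equiv> sum_list (map outs w)"

lemma wall_ok_length: "wall_ok P w xs ys \<Longrightarrow> length xs = width_in w \<and> length ys = width_out w"
  by (induction rule: wall_ok.induct) auto

lemma wall_ok_append:
  assumes "length xs = width_in w" "length ys = width_out w"
  shows "wall_ok P (w @ w') (xs @ xs') (ys @ ys') \<longleftrightarrow> wall_ok P w xs ys \<and> wall_ok P w' xs' ys'"
  using assms by (induction w arbitrary: xs ys) (auto simp: wall_ok_Cons_iff)

lemma wall_ok_mono:
  assumes "wall_ok P w xs ys" "\<And>b xs ys. b \<in> set w \<Longrightarrow> P b xs ys \<Longrightarrow> Q b xs ys"
  shows "wall_ok Q w xs ys"
  using assms by (induction rule: wall_ok.induct) (auto intro: wall_ok.intros)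

lemma wall_ok_map:
  assumes "wall_ok P w xs ys" "\<And>b xs ys. P b xs ys \<Longrightarrow> Q b (map f xs) (map g ys)"
  shows "wall_ok Q w (map f xs) (map g ys)"
  using assms by (induction rule: wall_ok.induct) (auto intro: wall_ok.intros)

lemma ins_mirror [simp]: "ins (mirror_brick b) = ins b" and outs_mirror [simp]: "outs (mirror_brick b) = outs b"
  by (cases b; simp)+

lemma width_mirror [simp]: "width_in (mirror_wall w) = width_in w" "width_out (mirror_wall w) = width_out w"
  by (simp_all add: mirror_wall_def rev_map[symmetric] sum_list_rev o_def)

lemma wall_ok_mirror:
  assumes "wall_ok P w xs ys"
    "\<And>b xs ys. P b xs ys \<Longrightarrow> Q (mirror_brick b) (rev (map f xs)) (rev (map g ys))"
  shows "wall_ok Q (mirror_wall w) (rev (map f xs)) (rev (map g ys))"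
  using assms(1)
proof (induction rule: wall_ok.induct)
  case Nil
  then show ?case by (simp add: mirror_wall_def)
next
  case (Cons b xs ys w xs' ys')
  have "wall_ok Q (mirror_wall w @ [mirror_brick b]) (rev (map f xs') @ rev (map f xs))
      (rev (map g ys') @ rev (map g ys))"
    using Cons assms(2) wall_ok_length[OF Cons(4)]
    by (subst wall_ok_append) (auto simp: wall_ok_Cons_iff)
  then show ?case by (simp add: mirror_wall_def)
qed

lemma wall_ok_nth: "wall_ok P w xs ys \<longleftrightarrow> length xs = width_in w \<and> length ys = width_out w \<and>
    (\<forall>k<length w. P (w ! k) (take (ins (w ! k)) (drop (width_in (take k w)) xs))
       (take (outs (w ! k)) (drop (width_out (take k w)) ys)))"
proof (induction w arbitrary: xs ys)
  case Nil
  then show ?case by auto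
next
  case (Cons b w)
  have split: "(\<forall>k<Suc n. R k) \<longleftrightarrow> R 0 \<and> (\<forall>k<n. R (Suc k))" for R and n :: nat
    using less_Suc_eq_0_disj by auto
  show ?case
    unfolding wall_ok_Cons_iff Cons length_Cons split
    by (auto simp: add.commute)
qed

lemma wall_ok_replicate_Vert:
  "wall_ok P (replicate m Vert) xs ys \<longleftrightarrow> length xs = m \<and> length ys = m \<and> (\<forall>i<m. P Vert [xs ! i] [ys ! i])"
proof -
  have "take (Suc 0) (drop k xs) = [xs ! k]" if "k < length xs" for k
    using that by (metis Cons_nth_drop_Suc take0 take_Suc_Cons)
  moreover have "take (Suc 0) (drop k ys) = [ys ! k]" if "k < length ys" for k
    using that by (metis Cons_nth_drop_Suc take0 take_Suc_Cons)
  moreover have "width_in (replicate k Vert) = k" "width_out (replicate k Vert) = k" for k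
    by (induction k) auto
  ultimately show ?thesis unfolding wall_ok_nth by auto
qed

section \<open>Orientations, labels and Fox relations of a brick\<close>

fun brick_states :: "brick \<Rightarrow> bool list \<Rightarrow> bool list \<Rightarrow> bool" where
  "brick_states Vert [a] [a'] = (a' = a)"
| "brick_states (Cup b) [] [c, c'] = (c = b \<and> c' = (\<not> b))"
| "brick_states Cap [a, a'] [] = (a' = (\<not> a))"
| "brick_states (Cross s) [a, a'] [c, c'] = (c = a' \<and> c' = a)"
| "brick_states _ _ _ = False"

text \<open>Turns the recursive orientation check into a brick-by-brick condition, so that
  orientations can be carried along with labels and values.\<close>

lemma wall_top_iff: "wall_top w st = Some st' \<longleftrightarrow> wall_ok brick_states w st st'"
proof (induction w st arbitrary: st' rule: wall_top.induct)
  case (2 w a st)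
  then show ?case by (cases st') (auto simp: wall_ok_Cons_iff)
next
  case (3 b w st)
  then show ?case by (cases st'; cases "tl st'") (auto simp: wall_ok_Cons_iff)
next
  case (4 w a b st)
  then show ?case by (auto simp: wall_ok_Cons_iff)
next
  case (5 s w a b st)
  then show ?case by (cases st'; cases "tl st'") (auto simp: wall_ok_Cons_iff)
qed (auto simp: wall_ok_Cons_iff)

text \<open>The conditions that do not involve the values. \<open>C\<close> takes the labels of the
  over, left and right strand in the order of \<open>crossing_points\<close>; it will stand for an
  identity of matrices as well as for membership in a relator closure.\<close>

fun brick_shape :: "('g \<Rightarrow> 'g \<Rightarrow> 'g \<Rightarrow> bool) \<Rightarrow> brick \<Rightarrow> (bool \<times> 'g \<times> 'm) list \<Rightarrow> (bool \<times> 'g \<times> 'm) list \<Rightarrow> bool" where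
  "brick_shape C Vert [(a, g, x)] [(a', g', x')] \<longleftrightarrow> a' = a \<and> g' = g"
| "brick_shape C (Cup b) [] [(c, h, y), (c', h', y')] \<longleftrightarrow> c = b \<and> c' = (\<not> b) \<and> h' = h"
| "brick_shape C Cap [(a, g, x), (a', g', x')] [] \<longleftrightarrow> a' = (\<not> a) \<and> g' = g"
| "brick_shape C (Cross s) [(a, g, x), (a', g', x')] [(c, h, y), (c', h', y')] \<longleftrightarrow> c = a' \<and> c' = a \<and>
     (if s then h' = g \<and> (if a then C g h g' else C g g' h)
      else h = g' \<and> (if a' then C g' g h' else C g' h' g))"
| "brick_shape C _ _ _ \<longleftrightarrow> False"

text \<open>The Fox derivative of the relation \<open>a b = e a\<close>.\<close>

definition cross_rel :: "('g \<Rightarrow> 'm \<Rightarrow> 'm::ab_group_add) \<Rightarrow> 'g \<Rightarrow> 'm \<Rightarrow> 'm \<Rightarrow> 'g \<Rightarrow> 'm \<Rightarrow> 'm" where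
  "cross_rel T a x y e z = x + T a y - z - T e x"

text \<open>A crossing gives two relations and any other brick one, that is half the number of its
  ends. This makes the system on the points of a diagram square. The equation along the overpass
  comes first and is addressed by \<open>hd\<close>.\<close>

fun brick_rels :: "('g \<Rightarrow> 'm \<Rightarrow> 'm::ab_group_add) \<Rightarrow> brick \<Rightarrow> (bool \<times> 'g \<times> 'm) list \<Rightarrow> (bool \<times> 'g \<times> 'm) list \<Rightarrow> 'm list" where
  "brick_rels T Vert [(a, g, x)] [(a', g', x')] = [x' - x]"
| "brick_rels T (Cup b) [] [(c, h, y), (c', h', y')] = [y' - y]"
| "brick_rels T Cap [(a, g, x), (a', g', x')] [] = [x' - x]"
| "brick_rels T (Cross s) [(a, g, x), (a', g', x')] [(c, h, y), (c', h', y')] =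
     (if s then [y' - x, if a then cross_rel T g x y g' x' else cross_rel T g x x' h y]
      else [y - x', if a' then cross_rel T g' x' x h' y' else cross_rel T g' x' y' g x])"
| "brick_rels T _ _ _ = []"

text \<open>\<open>T g\<close> is the action of the generator \<open>g\<close> on the coefficients, \<open>Ti g\<close> that of its inverse, and
  \<open>C a b e\<close> stands for the relation \<open>a b = e a\<close>.\<close>

locale actions =
  fixes T Ti :: "'g \<Rightarrow> 'm::ab_group_add \<Rightarrow> 'm" and C :: "'g \<Rightarrow> 'g \<Rightarrow> 'g \<Rightarrow> bool"
  assumes T_add: "T g (x + y) = T g x + T g y" and Ti_add: "Ti g (x + y) = Ti g x + Ti g y"
    and T_Ti [simp]: "T g (Ti g x) = x" and Ti_T [simp]: "Ti g (T g x) = x"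
    and C_comm: "C a b e \<Longrightarrow> T a (T b x) = T e (T a x)"
    and C_refl: "C a a a"
begin

lemma T_0 [simp]: "T g 0 = 0" using T_add[of g 0 0] by simp
lemma Ti_0 [simp]: "Ti g 0 = 0" using Ti_add[of g 0 0] by simp
lemma T_diff: "T g (x - y) = T g x - T g y" using T_add[of g "x - y" y] by (simp add: algebra_simps)
lemma Ti_diff: "Ti g (x - y) = Ti g x - Ti g y" using Ti_add[of g "x - y" y] by (simp add: algebra_simps)

text \<open>The Fox derivative of the loop around the first strands of a level, from right to left.\<close>

definition fox_step :: "'m \<Rightarrow> bool \<times> 'g \<times> 'm \<Rightarrow> 'm" where
  "fox_step z = (\<lambda>(a, g, x). if a then x + T g z else Ti g (z - x))"

text \<open>On the axis both strands of a crossing carry the same label \<open>g\<close> and point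
  in opposite directions, so its two relations can be solved for the upper values. \<open>a\<close>
  tells whether the lower left strand points upwards.\<close>

definition twist :: "'g \<Rightarrow> bool \<Rightarrow> bool \<Rightarrow> 'm \<times> 'm \<Rightarrow> 'm \<times> 'm" where
  "twist g s a = (\<lambda>(x, y). let t = (if a then Ti g else T g) (x - y) in if s then (x - t, x) else (y, y + t))"

fun twists :: "'g \<Rightarrow> bool \<Rightarrow> bool \<Rightarrow> nat \<Rightarrow> 'm \<times> 'm \<Rightarrow> 'm \<times> 'm" where
  "twists g s a 0 p = p"
| "twists g s a (Suc n) p = twist g s (a = even n) (twists g s a n p)"

lemma twist_shift: "twist g s a (x + z, y + z) = (fst (twist g s a (x, y)) + z, snd (twist g s a (x, y)) + z)"
  by (simp add: twist_def Let_def)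

lemma twists_shift: "twists g s a n (x + z, y + z) =
    (fst (twists g s a n (x, y)) + z, snd (twists g s a n (x, y)) + z)"
proof (induction n)
  case (Suc n)
  then show ?case
    using twist_shift[of g s "a = even n" "fst (twists g s a n (x, y))" z "snd (twists g s a n (x, y))"] by simp
qed simp

lemma twist_diff: "fst (twist g s a p) - snd (twist g s a p) =
    - (if a then Ti g else T g) (fst p - snd p)"
  by (simp add: twist_def Let_def case_prod_unfold)

text \<open>A half twist multiplies the difference of the two strands by \<open>- T g\<close> or by
  \<open>- Ti g\<close>, and consecutive half twists use opposite ones because the left strand
  alternates in direction. They cancel in pairs; this is where the evenness of the twist numbers
  enters.\<close>

lemma twists_even_diff: "fst (twists g s a n p) - snd (twists g s a n p) =
    (if even n then fst p - snd p else - (if a then Ti g else T g) (fst p - snd p))"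
proof (induction n)
  case (Suc n)
  have minus: "T g (- x) = - T g x" "Ti g (- x) = - Ti g x" for x
    using T_diff[of g 0 x] Ti_diff[of g 0 x] by simp_all
  show ?case using Suc by (cases a; cases "even n"; simp add: twist_diff minus)
qed simp

definition twist_jump :: "'g \<Rightarrow> bool \<Rightarrow> bool \<Rightarrow> nat \<Rightarrow> 'm \<Rightarrow> 'm" where
  "twist_jump g s a n x = snd (twists g s a n (x, 0))"

text \<open>Twisting commutes with adding a constant to both strands. As an even region also keeps
  their difference, it shifts both by one amount that depends on the difference alone: the term that
  makes the relations on the left half inhomogeneous.\<close>

lemma twists_even:
  assumes "even n"
  shows "twists g s a n (x, y) = (x + twist_jump g s a n (x - y), y + twist_jump g s a n (x - y))"
proof -
  have "twists g s a n (x, y) = (fst (twists g s a n (x - y, 0)) + y, snd (twists g s a n (x - y, 0)) + y)"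
    using twists_shift[of g s a n "x - y" y 0] by simp
  moreover have "fst (twists g s a n (x - y, 0)) = snd (twists g s a n (x - y, 0)) + (x - y)"
    using twists_even_diff[of g s a n "(x - y, 0)"] assms by (simp add: algebra_simps)
  ultimately show ?thesis by (simp add: twist_jump_def algebra_simps)
qed

end

text \<open>\<open>U\<close> is the submodule of relations, and congruence modulo \<open>U\<close>
  replaces equality in the quotient. With representatives, one solution can be read in several
  quotients at once.\<close>

locale actions_mod = actions T Ti C for T Ti :: "'g \<Rightarrow> 'm::ab_group_add \<Rightarrow> 'm" and C +
  fixes U :: "'m set"
  assumes U_0: "0 \<in> U" and U_add: "x \<in> U \<Longrightarrow> y \<in> U \<Longrightarrow> x + y \<in> U" and U_minus: "x \<in> U \<Longrightarrow> - x \<in> U"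
    and U_T: "x \<in> U \<Longrightarrow> T g x \<in> U" and U_Ti: "x \<in> U \<Longrightarrow> Ti g x \<in> U"
begin

definition eqv :: "'m \<Rightarrow> 'm \<Rightarrow> bool" (infix "\<approx>" 50) where "x \<approx> y \<longleftrightarrow> x - y \<in> U"

lemma eqv_refl [simp]: "x \<approx> x" using U_0 by (simp add: eqv_def)
lemma eqv_sym: "x \<approx> y \<Longrightarrow> y \<approx> x" using U_minus[of "x - y"] by (simp add: eqv_def)
lemma eqv_trans [trans]: "x \<approx> y \<Longrightarrow> y \<approx> z \<Longrightarrow> x \<approx> z"
  using U_add[of "x - y" "y - z"] by (simp add: eqv_def)
lemma eqv_add: "x \<approx> y \<Longrightarrow> x' \<approx> y' \<Longrightarrow> x + x' \<approx> y + y'"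
  using U_add[of "x - y" "x' - y'"] by (simp add: eqv_def algebra_simps)
lemma eqv_diff: "x \<approx> y \<Longrightarrow> x' \<approx> y' \<Longrightarrow> x - x' \<approx> y - y'"
  using U_add[of "x - y" "- (x' - y')"] U_minus[of "x' - y'"] by (simp add: eqv_def algebra_simps)
lemma eqv_T: "x \<approx> y \<Longrightarrow> T g x \<approx> T g y" using U_T by (simp add: eqv_def flip: T_diff)
lemma eqv_Ti: "x \<approx> y \<Longrightarrow> Ti g x \<approx> Ti g y" using U_Ti by (simp add: eqv_def flip: Ti_diff)
lemma eqv_0: "x \<in> U \<longleftrightarrow> x \<approx> 0" by (simp add: eqv_def)
lemma eqv_T_cancel: "T g x \<approx> T g y \<longleftrightarrow> x \<approx> y" using eqv_T[of x y g] eqv_Ti[of "T g x" "T g y" g] by auto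
lemma eqv_Ti_cancel: "Ti g x \<approx> Ti g y \<longleftrightarrow> x \<approx> y" using eqv_Ti[of x y g] eqv_T[of "Ti g x" "Ti g y" g] by auto

lemma cross_rel_mem: "cross_rel T a x y e z \<in> U \<longleftrightarrow> x + T a y \<approx> z + T e x"
  by (simp add: cross_rel_def eqv_def algebra_simps)

lemma cross_rel_cong:
  assumes "cross_rel T a x y e z \<in> U" "x \<approx> x'" "y \<approx> y'" "z \<approx> z'"
  shows "cross_rel T a x' y' e z' \<in> U"
proof -
  have "x' + T a y' \<approx> x + T a y" using assms by (intro eqv_add eqv_T) (auto intro: eqv_sym)
  also have "\<dots> \<approx> z + T e x" using assms(1) by (simp add: cross_rel_mem)
  also have "\<dots> \<approx> z' + T e x'" using assms by (intro eqv_add eqv_T)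
  finally show ?thesis by (simp add: cross_rel_mem)
qed

definition brick_sys :: "brick \<Rightarrow> (bool \<times> 'g \<times> 'm) list \<Rightarrow> (bool \<times> 'g \<times> 'm) list \<Rightarrow> bool" where
  "brick_sys b xs ys \<longleftrightarrow> brick_shape C b xs ys \<and> set (brick_rels T b xs ys) \<subseteq> U"

lemma fox_step_eqv: "z \<approx> z' \<Longrightarrow> fox_step z p \<approx> fox_step z' p"
  by (cases p) (auto simp: fox_step_def intro!: eqv_add eqv_T eqv_Ti eqv_diff)

lemma fox_step_eqv2: "z \<approx> z' \<Longrightarrow> x \<approx> x' \<Longrightarrow> fox_step z (a, g, x) \<approx> fox_step z' (a, g, x')"
  by (auto simp: fox_step_def intro!: eqv_add eqv_T eqv_Ti eqv_diff)

lemma fox_step_cancel: "fox_step z p \<approx> fox_step z' p \<longleftrightarrow> z \<approx> z'"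
proof (cases p)
  case (fields a g x)
  have "x + T g z \<approx> x + T g z' \<longleftrightarrow> T g z \<approx> T g z'" "z - x \<approx> z' - x \<longleftrightarrow> z \<approx> z'"
    by (simp_all add: eqv_def)
  then show ?thesis using fields by (auto simp: fox_step_def eqv_T_cancel eqv_Ti_cancel)
qed

lemma fox_step_cancel_value:
  assumes "fox_step z (a, g, x) \<approx> fox_step z (a, g, y)"
  shows "x \<approx> y"
proof (cases a)
  case True
  then show ?thesis using assms by (simp add: fox_step_def eqv_def)
next
  case False
  then have "z - x \<approx> z - y" using assms by (simp add: fox_step_def eqv_Ti_cancel)
  then have "y \<approx> x" by (simp add: eqv_def)
  then show ?thesis by (rule eqv_sym)
qed

lemma foldl_fox_step_cancel: "foldl fox_step z xs \<approx> foldl fox_step z' xs \<longleftrightarrow> z \<approx> z'"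
  by (induction xs arbitrary: z z') (auto simp: fox_step_cancel)

end

context actions_mod
begin

lemma U_T_iff: "T g x \<in> U \<longleftrightarrow> x \<in> U" using U_T[of x g] U_Ti[of "T g x" g] by auto
lemma U_minus_iff: "- x \<in> U \<longleftrightarrow> x \<in> U" using U_minus[of x] U_minus[of "- x"] by auto

text \<open>The two sides are the Fox derivatives of the two ways below a crossing, so their
  difference is the derivative of the Wirtinger relation up to a sign and an invertible action. The
  relation does not see the direction of the lower strand, but the words of the two ways do; hence
  four cases.\<close>

lemma fox_step_crossing:
  assumes C: "if a then C g h g' else C g g' h"
  shows "foldl fox_step z [(a, g, x), (c, g', x')] \<approx> foldl fox_step z [(c, h, y), (a, g, x)] \<longleftrightarrow>
    (if a then cross_rel T g x y g' x' else cross_rel T g x x' h y) \<in> U"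
    (is "?P \<approx> ?Q \<longleftrightarrow> ?R \<in> U")
proof -
  consider "a" "c" | "a" "\<not> c" | "\<not> a" "c" | "\<not> a" "\<not> c" by blast
  then show ?thesis
  proof cases
    case 1
    then have "?P - ?Q = - ?R"
      using C_comm[of g h g' z] C by (simp add: fox_step_def cross_rel_def T_add)
    then show ?thesis unfolding eqv_def by (simp only: U_minus_iff)
  next
    case 2
    then have "T g' (T g (Ti h (z - y))) = T g z - T g y"
      using C_comm[of g h g' "Ti h (z - y)"] C by (simp add: T_diff)
    then have "T g' (?P - ?Q) = ?R"
      using 2 by (simp add: fox_step_def cross_rel_def T_add T_diff)
    then show ?thesis unfolding eqv_def by (metis U_T_iff)
  next
    case 3
    then have "T g (?P - ?Q) = ?R"
      using C_comm[of g g' h "Ti g (z - x)"] C by (simp add: fox_step_def cross_rel_def T_add T_diff)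
    then show ?thesis unfolding eqv_def by (metis U_T_iff)
  next
    case 4
    have R: "T g (T g' (?P - ?Q)) = - ?R"
    proof -
      have "T g (T g' (?P - ?Q)) = T g (T g' ?P) - T h (T g ?Q)"
        using C_comm[of g g' h] C 4 by (simp add: T_diff)
      then show ?thesis using 4 by (simp add: fox_step_def cross_rel_def T_add T_diff)
    qed
    have "?P - ?Q \<in> U \<longleftrightarrow> T g (T g' (?P - ?Q)) \<in> U" by (simp only: U_T_iff)
    then show ?thesis unfolding eqv_def R U_minus_iff .
  qed
qed

lemma fox_step_eqv_value:
  assumes "z \<approx> z'" "x \<approx> x'"
  shows "foldl fox_step z [p, (a, g, x)] \<approx> foldl fox_step z' [p, (a, g, x')]"
    and "foldl fox_step z [(a, g, x), p] \<approx> foldl fox_step z' [(a, g, x'), p]"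
  using assms by (auto intro: fox_step_eqv2 fox_step_eqv)

lemma eqv_cong: "x \<approx> x' \<Longrightarrow> y \<approx> y' \<Longrightarrow> x \<approx> y \<longleftrightarrow> x' \<approx> y'"
  by (meson eqv_sym eqv_trans)

lemma brick_fox_crossing:
  assumes shape: "brick_shape C (Cross s) xs ys" and z: "z \<approx> z'"
    and over: "hd (brick_rels T (Cross s) xs ys) \<in> U"
  shows "foldl fox_step z xs \<approx> foldl fox_step z' ys \<longleftrightarrow> set (brick_rels T (Cross s) xs ys) \<subseteq> U"
proof -
  obtain a g x a' g' x' c h y c' h' y' where xs: "xs = [(a, g, x), (a', g', x')]"
    and ys: "ys = [(c, h, y), (c', h', y')]"
    using shape by (cases "(C, Cross s, xs, ys)" rule: brick_shape.cases) auto
  show ?thesis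
  proof (cases s)
    case True
    have y': "y' \<approx> x" and C: "if a then C g h g' else C g g' h" and eqs: "c = a'" "c' = a" "h' = g"
      using shape over True by (auto simp: xs ys eqv_def)
    have "foldl fox_step z' ys \<approx> foldl fox_step z [(a', h, y), (a, g, x)]"
      unfolding ys eqs by (intro fox_step_eqv_value eqv_sym[OF z] y')
    then have "foldl fox_step z xs \<approx> foldl fox_step z' ys \<longleftrightarrow>
        foldl fox_step z xs \<approx> foldl fox_step z [(a', h, y), (a, g, x)]"
      by (intro eqv_cong eqv_refl)
    then show ?thesis
      unfolding xs fox_step_crossing[OF C] using over True by (auto simp: xs ys)
  next
    case False
    have y: "y \<approx> x'" and C: "if a' then C g' g h' else C g' h' g" and eqs: "c = a'" "c' = a" "h = g'"
      using shape over False by (auto simp: xs ys eqv_def)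
    have "foldl fox_step z' ys \<approx> foldl fox_step z [(a', g', x'), (a, h', y')]"
      unfolding ys eqs by (intro fox_step_eqv_value eqv_sym[OF z] y)
    then have "foldl fox_step z' ys \<approx> foldl fox_step z xs \<longleftrightarrow>
        foldl fox_step z [(a', g', x'), (a, h', y')] \<approx> foldl fox_step z xs"
      by (intro eqv_cong eqv_refl)
    then have "foldl fox_step z xs \<approx> foldl fox_step z' ys \<longleftrightarrow>
        (if a' then cross_rel T g' x' x h' y' else cross_rel T g' x' y' g x) \<in> U"
      unfolding xs fox_step_crossing[OF C] by (meson eqv_sym)
    then show ?thesis using over False by (auto simp: xs ys)
  qed
qed

definition fox_preserving :: "brick \<Rightarrow> (bool \<times> 'g \<times> 'm) list \<Rightarrow> (bool \<times> 'g \<times> 'm) list \<Rightarrow> bool" where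
  "fox_preserving b xs ys \<longleftrightarrow> (\<forall>z z'. z \<approx> z' \<longrightarrow> foldl fox_step z xs \<approx> foldl fox_step z' ys)"

text \<open>The two strands of a cup or a cap are passed in opposite directions with congruent
  values and cancel; a crossing is settled by its relation.\<close>

lemma brick_sys_fox_preserving:
  assumes sys: "brick_sys b xs ys"
  shows "fox_preserving b xs ys"
  unfolding fox_preserving_def
proof (intro allI impI)
  fix z z' assume z: "z \<approx> z'"
  show "foldl fox_step z xs \<approx> foldl fox_step z' ys"
  proof (cases b)
    case Vert
    with sys z show ?thesis
      by (cases "(C, b, xs, ys)" rule: brick_shape.cases)
        (auto simp: brick_sys_def eqv_def[symmetric] intro: fox_step_eqv2 eqv_sym)
  next
    case (Cup c)
    then obtain h y y' where ys: "xs = []" "ys = [(c, h, y), (\<not> c, h, y')]" and y: "y' \<approx> y"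
      using sys by (cases "(C, b, xs, ys)" rule: brick_shape.cases) (auto simp: brick_sys_def eqv_def)
    have "foldl fox_step z' ys \<approx> foldl fox_step z' [(c, h, y), (\<not> c, h, y)]"
      unfolding ys by (intro fox_step_eqv_value y eqv_refl)
    also have "\<dots> = z'" by (simp add: fox_step_def)
    finally have "foldl fox_step z' ys \<approx> z'" .
    then show ?thesis unfolding ys(1) using z by (auto intro: eqv_sym eqv_trans)
  next
    case Cap
    then obtain a g x x' where xs: "ys = []" "xs = [(a, g, x), (\<not> a, g, x')]" and x: "x' \<approx> x"
      using sys by (cases "(C, b, xs, ys)" rule: brick_shape.cases) (auto simp: brick_sys_def eqv_def)
    have "foldl fox_step z xs \<approx> foldl fox_step z [(a, g, x), (\<not> a, g, x)]"
      unfolding xs by (intro fox_step_eqv_value x eqv_refl)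
    also have "\<dots> = z" by (simp add: fox_step_def)
    finally show ?thesis unfolding xs(1) using z by (auto intro: eqv_trans)
  next
    case (Cross s)
    have "brick_rels T (Cross s) xs ys \<noteq> []"
      using sys Cross by (cases "(C, b, xs, ys)" rule: brick_shape.cases) (auto simp: brick_sys_def)
    then have "hd (brick_rels T (Cross s) xs ys) \<in> set (brick_rels T (Cross s) xs ys)" by simp
    then show ?thesis
      using brick_fox_crossing[of s xs ys z z'] sys z Cross by (auto simp: brick_sys_def)
  qed
qed

lemma wall_fox_preserving:
  assumes "wall_ok fox_preserving w xs ys" "z \<approx> z'"
  shows "foldl fox_step z xs \<approx> foldl fox_step z' ys"
  using assms
  by (induction arbitrary: z z' rule: wall_ok.induct) (auto simp: fox_preserving_def)

lemma wall_sys_fox: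
  assumes "wall_ok brick_sys w xs ys" "z \<approx> z'"
  shows "foldl fox_step z xs \<approx> foldl fox_step z' ys"
  by (rule wall_fox_preserving[OF wall_ok_mono[OF assms(1)] assms(2)])
    (rule brick_sys_fox_preserving)

text \<open>The bricks to the left of \<open>k0\<close> carry the congruence up to it. Those to its
  right act invertibly on loops and can be cancelled, which leaves the congruence across
  \<open>k0\<close> alone.\<close>

lemma wall_fox_missing:
  assumes "k0 < length w" "length xs = width_in w" "length ys = width_out w"
    "\<And>k. k < length w \<Longrightarrow> k \<noteq> k0 \<Longrightarrow>
       fox_preserving (w ! k) (take (ins (w ! k)) (drop (width_in (take k w)) xs))
         (take (outs (w ! k)) (drop (width_out (take k w)) ys))"
    "z \<approx> z'" "foldl fox_step z xs \<approx> foldl fox_step z' ys"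
  shows "\<exists>v v'. v \<approx> v' \<and> foldl fox_step v (take (ins (w ! k0)) (drop (width_in (take k0 w)) xs)) \<approx>
    foldl fox_step v' (take (outs (w ! k0)) (drop (width_out (take k0 w)) ys))"
  using assms
proof (induction w arbitrary: k0 xs ys z z')
  case (Cons b w)
  let ?xs1 = "take (ins b) xs" and ?xs2 = "drop (ins b) xs"
  let ?ys1 = "take (outs b) ys" and ?ys2 = "drop (outs b) ys"
  have split: "foldl fox_step v xs = foldl fox_step (foldl fox_step v ?xs1) ?xs2"
    "foldl fox_step v ys = foldl fox_step (foldl fox_step v ?ys1) ?ys2" for v
    by (simp_all flip: foldl_append)
  have other: "fox_preserving (w ! k) (take (ins (w ! k)) (drop (width_in (take k w)) ?xs2))
      (take (outs (w ! k)) (drop (width_out (take k w)) ?ys2))" if "k < length w" "Suc k \<noteq> k0" for k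
    using Cons.prems(4)[of "Suc k"] that by (simp add: add.commute)
  show ?case
  proof (cases k0)
    case 0
    have "wall_ok fox_preserving w ?xs2 ?ys2"
      unfolding wall_ok_nth using Cons.prems other 0 by auto
    then have "foldl fox_step (foldl fox_step z ?xs1) ?xs2 \<approx> foldl fox_step (foldl fox_step z ?xs1) ?ys2"
      by (rule wall_fox_preserving) simp
    then have "foldl fox_step (foldl fox_step z ?xs1) ?ys2 \<approx> foldl fox_step (foldl fox_step z' ?ys1) ?ys2"
      using Cons.prems(6) unfolding split by (meson eqv_sym eqv_trans)
    then show ?thesis using Cons.prems(5) 0 by (auto simp: foldl_fox_step_cancel)
  next
    case (Suc k1)
    have "fox_preserving b ?xs1 ?ys1" using Cons.prems(4)[of 0] Suc by simp
    then have "foldl fox_step z ?xs1 \<approx> foldl fox_step z' ?ys1"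
      using Cons.prems(5) by (simp add: fox_preserving_def)
    then have "\<exists>v v'. v \<approx> v' \<and>
        foldl fox_step v (take (ins (w ! k1)) (drop (width_in (take k1 w)) ?xs2)) \<approx>
        foldl fox_step v' (take (outs (w ! k1)) (drop (width_out (take k1 w)) ?ys2))"
      using Cons.prems other Suc unfolding split by (intro Cons.IH) auto
    then show ?thesis using Suc by (simp add: add.commute)
  qed
qed simp

end

section \<open>Systems of relations on a whole diagram\<close>

definition level :: "diagram \<Rightarrow> (point \<Rightarrow> 'g) \<Rightarrow> (point \<Rightarrow> 'm) \<Rightarrow> nat \<Rightarrow> (bool \<times> 'g \<times> 'm) list" where
  "level E \<gamma> v l = map (\<lambda>i. (strands E l ! i, \<gamma> (l, i), v (l, i))) [0..<length (strands E l)]"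

definition bottom_slice :: "diagram \<Rightarrow> (point \<Rightarrow> 'g) \<Rightarrow> (point \<Rightarrow> 'm) \<Rightarrow> nat \<Rightarrow> nat \<Rightarrow> (bool \<times> 'g \<times> 'm) list" where
  "bottom_slice E \<gamma> v l k = map (\<lambda>i. (strands E l ! i, \<gamma> (l, i), v (l, i)))
     [bot_pos E l k..<bot_pos E l k + ins (E ! l ! k)]"

definition top_slice :: "diagram \<Rightarrow> (point \<Rightarrow> 'g) \<Rightarrow> (point \<Rightarrow> 'm) \<Rightarrow> nat \<Rightarrow> nat \<Rightarrow> (bool \<times> 'g \<times> 'm) list" where
  "top_slice E \<gamma> v l k = map (\<lambda>i. (strands E (Suc l) ! i, \<gamma> (Suc l, i), v (Suc l, i)))
     [top_pos E l k..<top_pos E l k + outs (E ! l ! k)]"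

text \<open>There are two value functions because a tangle may be inserted at a level:
  \<open>u\<close> is read where a wall starts, just above the level, and \<open>v\<close> where a
  wall ends, just below it. An ordinary solution has \<open>u = v\<close>.\<close>

definition diagram_sys :: "(brick \<Rightarrow> (bool \<times> 'g \<times> 'm) list \<Rightarrow> (bool \<times> 'g \<times> 'm) list \<Rightarrow> bool)
    \<Rightarrow> diagram \<Rightarrow> (point \<Rightarrow> 'g) \<Rightarrow> (point \<Rightarrow> 'm) \<Rightarrow> (point \<Rightarrow> 'm) \<Rightarrow> bool" where
  "diagram_sys P E \<gamma> u v \<longleftrightarrow>
     (\<forall>(l, k)\<in>bricks E. P (E ! l ! k) (bottom_slice E \<gamma> u l k) (top_slice E \<gamma> v l k))"

lemma level_state_Suc:
  "l < length E \<Longrightarrow> level_state E (Suc l) = Option.bind (level_state E l) (wall_top (E ! l))"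
  by (simp add: level_state_def take_Suc_conv_app_nth)

lemma level_state_Some:
  assumes "oriented_diagram E" "l \<le> length E"
  shows "level_state E l = Some (strands E l)"
proof -
  have "level_state E (length E) \<noteq> None" using assms(1) by (simp add: oriented_diagram_def)
  with assms(2) have "level_state E l \<noteq> None"
  proof (induction l rule: inc_induct)
    case (step l)
    then show ?case using level_state_Suc[of l E] by (cases "level_state E l") auto
  qed
  then show ?thesis by (auto simp: strands_def)
qed

lemma strands_0 [simp]: "strands E 0 = []"
  by (simp add: strands_def level_state_def)

lemma strands_length [simp]: "oriented_diagram E \<Longrightarrow> strands E (length E) = []"
  by (simp add: strands_def oriented_diagram_def)

lemma wall_states:
  assumes "oriented_diagram E" "l < length E"
  shows "wall_ok brick_states (E ! l) (strands E l) (strands E (Suc l))"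
  using level_state_Some[OF assms(1), of l] level_state_Some[OF assms(1), of "Suc l"]
    level_state_Suc[OF assms(2)] assms(2)
  by (simp flip: wall_top_iff)

lemma length_strands:
  assumes "oriented_diagram E" "l < length E"
  shows "length (strands E l) = width_in (E ! l)" "length (strands E (Suc l)) = width_out (E ! l)"
  using wall_ok_length[OF wall_states[OF assms]] by auto

lemma width_take: "k < length w \<Longrightarrow> width_in (take k w) + ins (w ! k) \<le> width_in w"
  "k < length w \<Longrightarrow> width_out (take k w) + outs (w ! k) \<le> width_out w"
proof -
  assume k: "k < length w"
  have "w = take k w @ w ! k # drop (Suc k) w" using k by (rule id_take_nth_drop)
  then have "width_in w = width_in (take k w) + ins (w ! k) + width_in (drop (Suc k) w)"
    "width_out w = width_out (take k w) + outs (w ! k) + width_out (drop (Suc k) w)"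
    by (metis (no_types, lifting) map_append sum_list_append list.simps(9) sum_list.Cons add.assoc)+
  then show "width_in (take k w) + ins (w ! k) \<le> width_in w"
    "width_out (take k w) + outs (w ! k) \<le> width_out w" by simp_all
qed

lemma bottom_slice_eq:
  assumes "oriented_diagram E" "(l, k) \<in> bricks E"
  shows "take (ins (E ! l ! k)) (drop (width_in (take k (E ! l))) (level E \<gamma> u l)) = bottom_slice E \<gamma> u l k"
  using length_strands(1)[OF assms(1), of l] width_take(1)[of k "E ! l"] assms(2)
  by (simp add: level_def bottom_slice_def bricks_def bot_pos_def take_map drop_map take_upt)

lemma top_slice_eq:
  assumes "oriented_diagram E" "(l, k) \<in> bricks E"
  shows "take (outs (E ! l ! k)) (drop (width_out (take k (E ! l))) (level E \<gamma> u (Suc l))) = top_slice E \<gamma> u l k"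
  using length_strands(2)[OF assms(1), of l] width_take(2)[of k "E ! l"] assms(2)
  by (simp add: level_def top_slice_def bricks_def top_pos_def take_map drop_map take_upt)

lemma length_level [simp]: "length (level E \<gamma> u l) = length (strands E l)"
  by (simp add: level_def)

lemma diagram_sys_walls:
  assumes "oriented_diagram E"
  shows "diagram_sys P E \<gamma> u v \<longleftrightarrow>
    (\<forall>l<length E. wall_ok P (E ! l) (level E \<gamma> u l) (level E \<gamma> v (Suc l)))"
proof -
  have "wall_ok P (E ! l) (level E \<gamma> u l) (level E \<gamma> v (Suc l)) \<longleftrightarrow>
      (\<forall>k<length (E ! l). P (E ! l ! k) (bottom_slice E \<gamma> u l k) (top_slice E \<gamma> v l k))"
    if "l < length E" for l
    unfolding wall_ok_nth using length_strands[OF assms that]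
    by (auto simp: bottom_slice_eq[OF assms] top_slice_eq[OF assms] bricks_def that)
  then show ?thesis by (auto simp: diagram_sys_def bricks_def)
qed

lemma brick_states_slices:
  assumes "oriented_diagram E" "(l, k) \<in> bricks E"
  shows "brick_states (E ! l ! k) (map ((!) (strands E l)) [bot_pos E l k..<bot_pos E l k + ins (E ! l ! k)])
    (map ((!) (strands E (Suc l))) [top_pos E l k..<top_pos E l k + outs (E ! l ! k)])"
proof -
  have l: "l < length E" and k: "k < length (E ! l)" using assms(2) by (auto simp: bricks_def)
  have take_drop: "take n (drop a xs) = map ((!) xs) [a..<a + n]" if "a + n \<le> length xs" for a n and xs :: "bool list"
    using that by (intro nth_equalityI) auto
  have "brick_states (E ! l ! k) (take (ins (E ! l ! k)) (drop (width_in (take k (E ! l))) (strands E l)))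
      (take (outs (E ! l ! k)) (drop (width_out (take k (E ! l))) (strands E (Suc l))))"
    using wall_states[OF assms(1) l] k unfolding wall_ok_nth by blast
  then show ?thesis
    using length_strands[OF assms(1) l] width_take[OF k]
    by (simp add: take_drop bot_pos_def top_pos_def)
qed

lemma brick_shape_slices:
  assumes E: "oriented_diagram E" "(l, k) \<in> bricks E"
    and curves: "\<And>p q. (p, q) \<in> curves E \<Longrightarrow> \<gamma> q = \<gamma> p"
    and cross: "\<And>p q r. (l, k) \<in> crossings E \<Longrightarrow> crossing_points E (l, k) = (p, q, r) \<Longrightarrow> C (\<gamma> p) (\<gamma> q) (\<gamma> r)"
  shows "brick_shape C (E ! l ! k) (bottom_slice E \<gamma> u l k) (top_slice E \<gamma> v l k)"
proof -
  have curve: "\<gamma> q = \<gamma> p" if "(p, q) \<in> brick_curves (E ! l ! k) l (bot_pos E l k) (top_pos E l k)" for p q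
    using that E(2) by (intro curves) (auto simp: curves_def)
  show ?thesis
  proof (cases "E ! l ! k")
    case (Cross s)
    then have c: "(l, k) \<in> crossings E" using E(2) by (auto simp: crossings_def)
    show ?thesis
      using Cross curve cross[OF c] brick_states_slices[OF E]
      by (cases s) (auto simp: bottom_slice_def top_slice_def crossing_points_def Let_def)
  qed (use curve brick_states_slices[OF E] in \<open>auto simp: bottom_slice_def top_slice_def\<close>)
qed

context actions_mod
begin

lemma brick_sys_slices:
  assumes E: "oriented_diagram E" "(l, k) \<in> bricks E"
    and shape: "brick_shape C (E ! l ! k) (bottom_slice E \<gamma> u l k) (top_slice E \<gamma> u l k)"
    and curves: "\<And>p q. (p, q) \<in> curves E \<Longrightarrow> u q \<approx> u p"
    and cross: "\<And>p q r. (l, k) \<in> crossings E \<Longrightarrow> crossing_points E (l, k) = (p, q, r) \<Longrightarrow>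
      cross_rel T (\<gamma> p) (u p) (u q) (\<gamma> r) (u r) \<in> U"
  shows "brick_sys (E ! l ! k) (bottom_slice E \<gamma> u l k) (top_slice E \<gamma> u l k)"
proof -
  have curve: "u q - u p \<in> U" if "(p, q) \<in> brick_curves (E ! l ! k) l (bot_pos E l k) (top_pos E l k)" for p q
    using curves[of p q] that E(2) by (auto simp: curves_def eqv_def)
  have sym: "x - y \<in> U" if "y - x \<in> U" for x y using U_minus[OF that] by simp
  show ?thesis
  proof (cases "E ! l ! k")
    case (Cross s)
    then have c: "(l, k) \<in> crossings E" using E(2) by (auto simp: crossings_def)
    show ?thesis
      using Cross curve cross[OF c] shape
      by (cases s) (auto simp: bottom_slice_def top_slice_def crossing_points_def Let_def brick_sys_def)
  qed (use curve shape in \<open>auto simp: bottom_slice_def top_slice_def brick_sys_def\<close>)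
qed

lemma diagram_sys_curves:
  assumes "diagram_sys brick_sys E \<gamma> u u" "(p, q) \<in> curves E"
  shows "u p \<approx> u q"
proof -
  obtain l k where lk: "(l, k) \<in> bricks E" "(p, q) \<in> brick_curves (E ! l ! k) l (bot_pos E l k) (top_pos E l k)"
    using assms(2) by (auto simp: curves_def)
  then have "brick_sys (E ! l ! k) (bottom_slice E \<gamma> u l k) (top_slice E \<gamma> u l k)"
    using assms(1) by (auto simp: diagram_sys_def)
  then have "u q \<approx> u p" using lk(2)
    by (cases "E ! l ! k") (auto simp: brick_sys_def bottom_slice_def top_slice_def eqv_def split: if_splits)
  then show ?thesis by (rule eqv_sym)
qed

lemma diagram_sys_crossing:
  assumes "diagram_sys brick_sys E \<gamma> u u" "c \<in> crossings E" "crossing_points E c = (p, q, r)"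
    "oriented_diagram E"
  shows "cross_rel T (\<gamma> p) (u p) (u q) (\<gamma> r) (u r) \<in> U"
proof -
  obtain l k s where c: "c = (l, k)" "E ! l ! k = Cross s" "(l, k) \<in> bricks E"
    using assms(2) by (auto simp: crossings_def)
  then have "brick_sys (E ! l ! k) (bottom_slice E \<gamma> u l k) (top_slice E \<gamma> u l k)"
    using assms(1) by (auto simp: diagram_sys_def)
  then show ?thesis using c assms(3) brick_states_slices[OF assms(4) c(3)]
    by (cases s) (auto simp: brick_sys_def bottom_slice_def top_slice_def crossing_points_def Let_def split: if_splits)
qed

text \<open>Every Wirtinger relation follows from the others: the loop around a level does not change when
  it passes a crossing whose relation holds.\<close>

lemma missing_crossing:
  assumes E: "oriented_diagram E" and c: "(l0, k0) \<in> crossings E"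
    and cp: "crossing_points E (l0, k0) = (p, q, r)"
    and shape: "\<And>l k. (l, k) \<in> bricks E \<Longrightarrow> brick_shape C (E ! l ! k) (bottom_slice E \<gamma> u l k) (top_slice E \<gamma> u l k)"
    and curves: "\<And>p q. (p, q) \<in> curves E \<Longrightarrow> u q \<approx> u p"
    and cross: "\<And>c p q r. c \<in> crossings E \<Longrightarrow> c \<noteq> (l0, k0) \<Longrightarrow> crossing_points E c = (p, q, r) \<Longrightarrow>
      cross_rel T (\<gamma> p) (u p) (u q) (\<gamma> r) (u r) \<in> U"
  shows "cross_rel T (\<gamma> p) (u p) (u q) (\<gamma> r) (u r) \<in> U"
proof -
  obtain s where l0: "l0 < length E" "k0 < length (E ! l0)" "E ! l0 ! k0 = Cross s" "(l0, k0) \<in> bricks E"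
    using c by (auto simp: crossings_def bricks_def)
  have sys: "brick_sys (E ! l ! k) (bottom_slice E \<gamma> u l k) (top_slice E \<gamma> u l k)"
    if "(l, k) \<in> bricks E" "(l, k) \<noteq> (l0, k0)" for l k
    using that by (intro brick_sys_slices[OF E] shape curves cross)
  let ?S = "\<lambda>l. foldl fox_step 0 (level E \<gamma> u l)"
  have step: "?S l \<approx> ?S (Suc l)" if "l < length E" "l \<noteq> l0" for l
  proof (rule wall_sys_fox)
    show "wall_ok brick_sys (E ! l) (level E \<gamma> u l) (level E \<gamma> u (Suc l))"
      unfolding wall_ok_nth using length_strands[OF E that(1)] sys that
      by (auto simp: bottom_slice_eq[OF E] top_slice_eq[OF E] bricks_def)
  qed simp
  have below: "?S l \<approx> 0" if "l \<le> l0" for l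
    using that
  proof (induction l)
    case 0
    then show ?case by (simp add: level_def)
  next
    case (Suc l)
    then have "?S l \<approx> ?S (Suc l)" using l0 by (intro step) auto
    then show ?case using Suc by (meson Suc_leD eqv_sym eqv_trans)
  qed
  have above: "?S l \<approx> 0" if "l0 < l" "l \<le> length E" for l
    using that(2,1)
  proof (induction l rule: inc_induct)
    case base
    then show ?case using E by (simp add: level_def)
  next
    case (step n)
    then show ?case using \<open>\<And>l. l < length E \<Longrightarrow> l \<noteq> l0 \<Longrightarrow> ?S l \<approx> ?S (Suc l)\<close>[of n]
      by (auto intro: eqv_trans)
  qed
  \<comment> \<open>The loop is trivial below and above the wall \<open>l0\<close>, and the other
    bricks of this wall preserve it. So it is preserved across the crossing \<open>k0\<close>, which
    is equivalent to the missing relation.\<close>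
  have "?S l0 \<approx> ?S (Suc l0)" using below[of l0] above[of "Suc l0"] l0(1) by (meson Suc_leI eqv_sym eqv_trans lessI order_refl)
  then have "\<exists>z z'. z \<approx> z' \<and>
      foldl fox_step z (bottom_slice E \<gamma> u l0 k0) \<approx> foldl fox_step z' (top_slice E \<gamma> u l0 k0)"
    unfolding bottom_slice_eq[OF E l0(4), symmetric] top_slice_eq[OF E l0(4), symmetric]
  proof (intro wall_fox_missing)
    fix k assume k: "k < length (E ! l0)" "k \<noteq> k0"
    then have lk: "(l0, k) \<in> bricks E" using l0(1) by (simp add: bricks_def)
    show "fox_preserving (E ! l0 ! k) (take (ins (E ! l0 ! k)) (drop (width_in (take k (E ! l0))) (level E \<gamma> u l0)))
        (take (outs (E ! l0 ! k)) (drop (width_out (take k (E ! l0))) (level E \<gamma> u (Suc l0))))"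
      unfolding bottom_slice_eq[OF E lk] top_slice_eq[OF E lk]
      by (rule brick_sys_fox_preserving[OF sys[OF lk]]) (use k in simp)
  qed (use length_strands[OF E l0(1)] l0(2) in simp_all)
  then obtain z z' where "z \<approx> z'" and
    "foldl fox_step z (bottom_slice E \<gamma> u l0 k0) \<approx> foldl fox_step z' (top_slice E \<gamma> u l0 k0)"
    by blast
  moreover have "hd (brick_rels T (E ! l0 ! k0) (bottom_slice E \<gamma> u l0 k0) (top_slice E \<gamma> u l0 k0)) \<in> U"
  proof -
    have "u q - u p \<in> U" if "(p, q) \<in> brick_curves (E ! l0 ! k0) l0 (bot_pos E l0 k0) (top_pos E l0 k0)" for p q
      using curves[of p q] that l0(4) by (auto simp: curves_def eqv_def)
    then show ?thesis using l0(3) by (cases s) (auto simp: bottom_slice_def top_slice_def)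
  qed
  ultimately have "set (brick_rels T (E ! l0 ! k0) (bottom_slice E \<gamma> u l0 k0) (top_slice E \<gamma> u l0 k0)) \<subseteq> U"
    using brick_fox_crossing[of s "bottom_slice E \<gamma> u l0 k0" "top_slice E \<gamma> u l0 k0" z z'] shape[OF l0(4)] l0(3)
    by simp
  then show ?thesis using cp l0(3) brick_states_slices[OF E l0(4)]
    by (cases s) (auto simp: bottom_slice_def top_slice_def crossing_points_def Let_def split: if_splits)
qed

end

section \<open>Chains of levels, and the levels of a symmetric union\<close>

fun path :: "('w \<Rightarrow> 'a \<Rightarrow> 'a \<Rightarrow> bool) \<Rightarrow> 'w list \<Rightarrow> 'a list \<Rightarrow> 'a \<Rightarrow> bool" where
  "path R [] [] b \<longleftrightarrow> True"
| "path R (w # ws) (x # xs) b \<longleftrightarrow> R w x (hd (xs @ [b])) \<and> path R ws xs b"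
| "path R _ _ b \<longleftrightarrow> False"

lemma path_length: "path R ws xs b \<Longrightarrow> length xs = length ws"
  by (induction R ws xs b rule: path.induct) auto

lemma path_append: "length ws = length xs \<Longrightarrow>
    path R (ws @ ws') (xs @ xs') b \<longleftrightarrow> path R ws xs (hd (xs' @ [b])) \<and> path R ws' xs' b"
proof (induction ws xs rule: list_induct2)
  case (Cons w ws x xs)
  then show ?case by (cases xs) auto
qed simp

lemma path_nth: "path R ws xs b \<longleftrightarrow> length xs = length ws \<and>
    (\<forall>j<length ws. R (ws ! j) (xs ! j) ((xs @ [b]) ! Suc j))"
proof (induction R ws xs b rule: path.induct)
  case (2 R w ws x xs b)
  have split: "(\<forall>k<Suc n. Q k) \<longleftrightarrow> Q 0 \<and> (\<forall>k<n. Q (Suc k))" for Q and n :: nat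
    using less_Suc_eq_0_disj by auto
  have "hd (xs @ [b]) = (xs @ [b]) ! 0" by (simp add: hd_conv_nth)
  then show ?case unfolding path.simps 2 length_Cons split by auto
qed auto

text \<open>The last argument of \<open>path\<close> is the level above the last wall. For a segment
  of the chain this is the lowest level \<open>h (Suc l)\<close> of the next segment.\<close>

lemma path_concat:
  assumes "\<And>l. l < n \<Longrightarrow> length (X l) = length (W l) \<and> X l \<noteq> [] \<and> hd (X l) = h l"
  shows "path R (concat (map W [0..<n])) (concat (map X [0..<n])) (h n) \<longleftrightarrow>
    (\<forall>l<n. path R (W l) (X l) (h (Suc l)))"
  using assms
proof (induction n)
  case (Suc n)
  have len: "length (concat (map W [0..<n])) = length (concat (map X [0..<n]))"
  proof -
    have "map (\<lambda>l. length (W l)) [0..<n] = map (\<lambda>l. length (X l)) [0..<n]"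
      using Suc.prems by (intro map_cong) auto
    then have "sum_list (map (\<lambda>l. length (W l)) [0..<n]) = sum_list (map (\<lambda>l. length (X l)) [0..<n])"
      by (rule arg_cong)
    then show ?thesis by (simp add: length_concat o_def)
  qed
  have "X n \<noteq> []" "hd (X n) = h n" using Suc.prems[of n] by auto
  then have "hd (X n @ [h (Suc n)]) = h n" by (cases "X n") auto
  then show ?case
    using Suc by (simp add: path_append[OF len] less_Suc_eq) blast
qed simp

text \<open>Mirroring keeps the vertical direction of a strand and reversing the orientation flips
  it. The order of the strands is reversed separately by \<open>rev\<close>.\<close>

definition reflect :: "bool \<times> 'g \<times> 'm \<Rightarrow> bool \<times> 'g \<times> 'm" where
  "reflect = (\<lambda>(a, g, x). (\<not> a, g, x))"

definition sym_level :: "diagram \<Rightarrow> (point \<Rightarrow> 'g) \<Rightarrow> (point \<Rightarrow> 'm) \<Rightarrow> (point \<Rightarrow> 'm) \<Rightarrow> nat \<Rightarrow> (bool \<times> 'g \<times> 'm) list" where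
  "sym_level D \<gamma> v v' l = level D \<gamma> v l @ rev (map reflect (level D \<gamma> v' l))"

definition last_pos :: "diagram \<Rightarrow> nat \<Rightarrow> nat" where
  "last_pos D l = length (strands D l) - 1"

definition axis_level :: "diagram \<Rightarrow> (point \<Rightarrow> 'g) \<Rightarrow> (point \<Rightarrow> 'm) \<Rightarrow> (point \<Rightarrow> 'm) \<Rightarrow> nat \<Rightarrow>
    (bool \<times> 'g \<times> 'm) list \<Rightarrow> (bool \<times> 'g \<times> 'm) list" where
  "axis_level D \<gamma> v v' l mid = butlast (level D \<gamma> v l) @ mid @ rev (map reflect (butlast (level D \<gamma> v' l)))"

lemma level_butlast:
  assumes "strands D l \<noteq> []"
  shows "level D \<gamma> v l = butlast (level D \<gamma> v l) @
    [(last (strands D l), \<gamma> (l, last_pos D l), v (l, last_pos D l))]"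
proof -
  have "level D \<gamma> v l \<noteq> []" using assms by (simp add: level_def)
  moreover have "last (level D \<gamma> v l) = (last (strands D l), \<gamma> (l, last_pos D l), v (l, last_pos D l))"
    using assms by (simp add: level_def last_pos_def last_map last_conv_nth)
  ultimately show ?thesis by (metis append_butlast_last_id)
qed

lemma sym_level_axis:
  assumes "strands D l \<noteq> []"
  shows "sym_level D \<gamma> v v' l = axis_level D \<gamma> v v' l
    [(last (strands D l), \<gamma> (l, last_pos D l), v (l, last_pos D l)),
     (\<not> last (strands D l), \<gamma> (l, last_pos D l), v' (l, last_pos D l))]"
  unfolding sym_level_def axis_level_def
  by (subst (1 2) level_butlast[OF assms]) (simp add: reflect_def)

lemma butlast_level_nth:
  "i < last_pos D l \<Longrightarrow> butlast (level D \<gamma> v l) ! i = (strands D l ! i, \<gamma> (l, i), v (l, i))"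
proof -
  assume "i < last_pos D l"
  moreover from this have "i < length (strands D l)" by (simp add: last_pos_def)
  ultimately show ?thesis by (simp add: nth_butlast last_pos_def level_def)
qed

lemma length_strands_minus_1 [simp]: "length (strands D l) - Suc 0 = last_pos D l"
  by (simp add: last_pos_def)

lemma wall_ok_axis:
  assumes "length zs = m" "length ws = m" "length zs' = m" "length ws' = m"
    "length xs = ins b" "length ys = outs b"
  shows "wall_ok P (axis_wall m b) (zs @ xs @ ws) (zs' @ ys @ ws') \<longleftrightarrow>
    P b xs ys \<and> (\<forall>i<m. P Vert [zs ! i] [zs' ! i]) \<and> (\<forall>i<m. P Vert [ws ! i] [ws' ! i])"
proof -
  have Vert: "sum_list (replicate m (Suc 0)) = m" by (simp add: sum_list_replicate)
  have "wall_ok P ([b] @ replicate m Vert) (xs @ ws) (ys @ ws') \<longleftrightarrow>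
      P b xs ys \<and> wall_ok P (replicate m Vert) ws ws'"
    using assms by (subst wall_ok_append) (auto simp: wall_ok_Cons_iff)
  then show ?thesis
    unfolding axis_wall_def using assms
    by (subst wall_ok_append) (auto simp: Vert wall_ok_replicate_Vert)
qed

definition shape :: "bool \<times> 'g \<times> 'm \<Rightarrow> bool \<times> 'g" where
  "shape = (\<lambda>(a, g, x). (a, g))"

text \<open>Starts with the level below the tangle and omits the level above it, which belongs to
  the wall of \<open>D\<close> that follows. The values are trivial, since only orientations and
  labels are recorded.\<close>

definition shape_tangle :: "diagram \<Rightarrow> (point \<Rightarrow> 'g) \<Rightarrow> nat \<Rightarrow> (nat \<times> int) list \<Rightarrow> nat \<Rightarrow> (bool \<times> 'g) list list" where
  "shape_tangle D \<gamma> h0 ts l = (let a = last (strands D l); g = \<gamma> (l, last_pos D l); z = (\<lambda>_. ()) in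
     map (\<lambda>mid. map shape (axis_level D \<gamma> z z l mid))
       (if l = h0 then [[(a, g, ()), (\<not> a, g, ())], []]
        else case map_of ts l of None \<Rightarrow> []
          | Some n \<Rightarrow> map (\<lambda>j. [(a = even j, g, ()), (a \<noteq> even j, g, ())]) [0..<nat \<bar>n\<bar>]))"

definition shape_levels :: "diagram \<Rightarrow> (point \<Rightarrow> 'g) \<Rightarrow> nat \<Rightarrow> (nat \<times> int) list \<Rightarrow> (bool \<times> 'g) list list" where
  "shape_levels D \<gamma> h0 ts = concat (map (\<lambda>l. shape_tangle D \<gamma> h0 ts l @
     [map shape (sym_level D \<gamma> (\<lambda>_. ()) (\<lambda>_. ()) l)]) [0..<length D])"

lemma map_shape_level: "map shape (level D \<gamma> v l) = map (\<lambda>i. (strands D l ! i, \<gamma> (l, i))) [0..<length (strands D l)]"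
  by (simp add: level_def shape_def)

lemma map_shape_reflect: "map shape (map reflect xs) = map (\<lambda>(a, g). (\<not> a, g)) (map shape xs)"
  by (simp add: shape_def reflect_def case_prod_unfold)

lemma map_shape_axis: "map shape (axis_level D \<gamma> v v' l mid) =
    map shape (butlast (level D \<gamma> (\<lambda>_. ()) l)) @ map shape mid @
    map shape (rev (map reflect (butlast (level D \<gamma> (\<lambda>_. ()) l))))"
  unfolding axis_level_def map_append rev_map[symmetric] map_shape_reflect map_butlast map_shape_level ..

lemma map_shape_sym_level: "map shape (sym_level D \<gamma> v v' l) = map shape (sym_level D \<gamma> (\<lambda>_. ()) (\<lambda>_. ()) l)"
  unfolding sym_level_def map_append rev_map[symmetric] map_shape_reflect map_shape_level ..

context actions
begin

definition twist_level :: "diagram \<Rightarrow> (point \<Rightarrow> 'g) \<Rightarrow> (point \<Rightarrow> 'm) \<Rightarrow> (point \<Rightarrow> 'm) \<Rightarrow> nat \<Rightarrow> bool \<Rightarrow> nat \<Rightarrow>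
    (bool \<times> 'g \<times> 'm) list" where
  "twist_level D \<gamma> v v' l s j = (let a = last (strands D l); g = \<gamma> (l, last_pos D l);
     p = twists g s a j (v (l, last_pos D l), v' (l, last_pos D l)) in
     axis_level D \<gamma> v v' l [(a = even j, g, fst p), (a \<noteq> even j, g, snd p)])"

definition tangle_levels :: "diagram \<Rightarrow> (point \<Rightarrow> 'g) \<Rightarrow> nat \<Rightarrow> (nat \<times> int) list \<Rightarrow> (point \<Rightarrow> 'm) \<Rightarrow> (point \<Rightarrow> 'm) \<Rightarrow>
    nat \<Rightarrow> (bool \<times> 'g \<times> 'm) list list" where
  "tangle_levels D \<gamma> h0 ts v v' l =
     (if l = h0 then [sym_level D \<gamma> v v' l, axis_level D \<gamma> v v' l []]
      else case map_of ts l of None \<Rightarrow> []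
        | Some n \<Rightarrow> map (twist_level D \<gamma> v v' l (n > 0)) [0..<nat \<bar>n\<bar>])"

text \<open>\<open>BL\<close>, \<open>BR\<close> are the values of the left and right half below the
  tangle of a level, \<open>UL\<close>, \<open>UR\<close> those above it. If the tangle is empty,
  only the latter are listed.\<close>

definition sym_levels :: "diagram \<Rightarrow> (point \<Rightarrow> 'g) \<Rightarrow> nat \<Rightarrow> (nat \<times> int) list \<Rightarrow> (point \<Rightarrow> 'm) \<Rightarrow> (point \<Rightarrow> 'm) \<Rightarrow>
    (point \<Rightarrow> 'm) \<Rightarrow> (point \<Rightarrow> 'm) \<Rightarrow> (bool \<times> 'g \<times> 'm) list list" where
  "sym_levels D \<gamma> h0 ts BL BR UL UR = concat (map (\<lambda>l. tangle_levels D \<gamma> h0 ts BL BR l @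
     [sym_level D \<gamma> UL UR l]) [0..<length D])"

lemma shape_tangle_levels:
  assumes "strands D l \<noteq> [] \<or> l \<noteq> h0"
  shows "map (map shape) (tangle_levels D \<gamma> h0 ts v v' l) = shape_tangle D \<gamma> h0 ts l"
proof (cases "l = h0")
  case True
  then show ?thesis using assms
    by (simp add: tangle_levels_def shape_tangle_def Let_def sym_level_axis map_shape_axis) (simp add: shape_def)
next
  case False
  then show ?thesis
    by (auto simp: tangle_levels_def shape_tangle_def Let_def twist_level_def map_shape_axis split: option.split)
      (simp_all add: shape_def)
qed

lemma shape_sym_levels:
  assumes "strands D h0 \<noteq> []"
  shows "map (map shape) (sym_levels D \<gamma> h0 ts BL BR UL UR) = shape_levels D \<gamma> h0 ts"
proof -
  have "map (map shape) (tangle_levels D \<gamma> h0 ts BL BR l) = shape_tangle D \<gamma> h0 ts l" for l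
    using assms by (intro shape_tangle_levels) auto
  then show ?thesis
    unfolding sym_levels_def shape_levels_def map_concat map_map o_def map_append
    by (simp add: map_shape_sym_level[of _ _ UL UR])
qed

lemma length_tangle_levels: "length (tangle_levels D \<gamma> h0 ts v v' l) = length (axis_tangle D h0 ts l)"
  by (simp add: tangle_levels_def axis_tangle_def Let_def split: option.split)

end

section \<open>Solving the relations of the walls and tangles of the union\<close>

context actions_mod
begin

text \<open>Mirroring in the axis and reversing the orientation each exchange the two sides of an
  overpass, so together they keep the crossing relation. This allows equal labels on both
  halves.\<close>

lemma brick_sys_mirror:
  assumes "brick_sys b xs ys"
  shows "brick_sys (mirror_brick b) (rev (map reflect xs)) (rev (map reflect ys))"
proof -
  have "y - x \<in> U" if "x - y \<in> U" for x y using U_minus[OF that] by simp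
  with assms show ?thesis
    by (cases "(C, b, xs, ys)" rule: brick_shape.cases) (auto simp: brick_sys_def reflect_def)
qed

lemma sym_wall:
  assumes "oriented_diagram D" "l < length D"
  shows "wall_ok brick_sys (D ! l @ mirror_wall (D ! l)) (sym_level D \<gamma> u u' l) (sym_level D \<gamma> v v' (Suc l)) \<longleftrightarrow>
    wall_ok brick_sys (D ! l) (level D \<gamma> u l) (level D \<gamma> v (Suc l)) \<and>
    wall_ok brick_sys (D ! l) (level D \<gamma> u' l) (level D \<gamma> v' (Suc l))"
proof -
  have "mirror_wall (mirror_wall (D ! l)) = D ! l"
  proof -
    have "mirror_brick (mirror_brick b) = b" for b by (cases b) auto
    then show ?thesis by (simp add: mirror_wall_def rev_map o_def)
  qed
  moreover have "map reflect (map reflect xs) = xs" for xs :: "(bool \<times> 'g \<times> 'm) list"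
    by (simp add: reflect_def o_def case_prod_unfold)
  ultimately have "wall_ok brick_sys (mirror_wall (D ! l)) (rev (map reflect xs)) (rev (map reflect ys)) \<longleftrightarrow>
      wall_ok brick_sys (D ! l) xs ys" for xs ys
    using wall_ok_mirror[of brick_sys "D ! l" xs ys brick_sys reflect reflect]
      wall_ok_mirror[of brick_sys "mirror_wall (D ! l)" "rev (map reflect xs)" "rev (map reflect ys)" brick_sys reflect reflect]
    by (auto simp: brick_sys_mirror rev_map[symmetric])
  then show ?thesis
    unfolding sym_level_def using length_strands[OF assms] by (subst wall_ok_append) auto
qed

lemma twist_eqv:
  assumes "x \<approx> x'" "y \<approx> y'"
  shows "fst (twist g s a (x, y)) \<approx> fst (twist g s a (x', y'))"
    "snd (twist g s a (x, y)) \<approx> snd (twist g s a (x', y'))"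
  using assms by (auto simp: twist_def Let_def intro!: eqv_diff eqv_add eqv_T eqv_Ti)

lemma twists_eqv:
  assumes "x \<approx> x'" "y \<approx> y'"
  shows "fst (twists g s a n (x, y)) \<approx> fst (twists g s a n (x', y')) \<and>
    snd (twists g s a n (x, y)) \<approx> snd (twists g s a n (x', y'))"
proof (induction n)
  case (Suc n)
  then show ?case
    using twist_eqv[of "fst (twists g s a n (x, y))" "fst (twists g s a n (x', y'))"
      "snd (twists g s a n (x, y))" "snd (twists g s a n (x', y'))"] by simp
qed (use assms in simp)

text \<open>With both labels equal to \<open>g\<close>, the crossing relation contains the unknown
  upper value either bare or under \<open>T g\<close>, so it can be solved in all four
  cases.\<close>

lemma brick_sys_twist:
  "brick_sys (Cross s) [(a, g, x), (\<not> a, g, y)] [(\<not> a, g, x'), (a, g, y')] \<longleftrightarrow>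
    x' \<approx> fst (twist g s a (x, y)) \<and> y' \<approx> snd (twist g s a (x, y))"
proof -
  have 1: "cross_rel T g x x' g y \<in> U \<longleftrightarrow> x' \<approx> x - Ti g (x - y)"
  proof -
    have "T g (x' - (x - Ti g (x - y))) = cross_rel T g x x' g y" by (simp add: T_diff cross_rel_def)
    then show ?thesis unfolding eqv_def by (metis U_T_iff)
  qed
  have 2: "cross_rel T g x y g x' \<in> U \<longleftrightarrow> x' \<approx> x - T g (x - y)"
  proof -
    have "x' - (x - T g (x - y)) = - cross_rel T g x y g x'" by (simp add: T_diff cross_rel_def)
    then show ?thesis unfolding eqv_def by (simp only: U_minus_iff)
  qed
  have 3: "cross_rel T g y x g y' \<in> U \<longleftrightarrow> y' \<approx> y + T g (x - y)"
  proof -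
    have "y' - (y + T g (x - y)) = - cross_rel T g y x g y'" by (simp add: T_diff cross_rel_def)
    then show ?thesis unfolding eqv_def by (simp only: U_minus_iff)
  qed
  have 4: "cross_rel T g y y' g x \<in> U \<longleftrightarrow> y' \<approx> y + Ti g (x - y)"
  proof -
    have "T g (y' - (y + Ti g (x - y))) = cross_rel T g y y' g x" by (simp add: T_diff T_add cross_rel_def)
    then show ?thesis unfolding eqv_def by (metis U_T_iff)
  qed
  show ?thesis
    by (cases s; cases a) (auto simp: brick_sys_def C_refl twist_def Let_def 1 2 3 4 simp flip: eqv_def)
qed

lemma brick_sys_Vert: "brick_sys Vert [(a, g, x)] [(a, g, x')] \<longleftrightarrow> x \<approx> x'"
  using eqv_sym by (auto simp: brick_sys_def simp flip: eqv_def)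

lemma wall_ok_axis_level:
  assumes "length mid = ins b" "length mid' = outs b"
  shows "wall_ok brick_sys (axis_wall (last_pos D l) b) (axis_level D \<gamma> u u' l mid) (axis_level D \<gamma> v v' l mid') \<longleftrightarrow>
    brick_sys b mid mid' \<and> (\<forall>i<last_pos D l. u (l, i) \<approx> v (l, i) \<and> u' (l, i) \<approx> v' (l, i))"
proof -
  let ?m = "last_pos D l"
  have R: "rev (map reflect (butlast (level D \<gamma> w l))) ! i =
      (\<not> strands D l ! (?m - Suc i), \<gamma> (l, ?m - Suc i), w (l, ?m - Suc i))" if "i < ?m" for w and i
  proof -
    have "rev (map reflect (butlast (level D \<gamma> w l))) ! i = map reflect (butlast (level D \<gamma> w l)) ! (?m - Suc i)"
      using that by (subst rev_nth) simp_all
    also have "\<dots> = reflect (butlast (level D \<gamma> w l) ! (?m - Suc i))"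
      using that by (intro nth_map) simp
    finally show ?thesis using that by (simp add: butlast_level_nth reflect_def)
  qed
  have "(\<forall>i<?m. brick_sys Vert [rev (map reflect (butlast (level D \<gamma> u' l))) ! i]
        [rev (map reflect (butlast (level D \<gamma> v' l))) ! i]) \<longleftrightarrow>
      (\<forall>i<?m. u' (l, ?m - Suc i) \<approx> v' (l, ?m - Suc i))"
    by (intro all_cong) (simp only: R brick_sys_Vert)
  also have "\<dots> \<longleftrightarrow> (\<forall>i<?m. u' (l, i) \<approx> v' (l, i))"
  proof (intro iffI allI impI)
    fix i assume *: "\<forall>i<?m. u' (l, ?m - Suc i) \<approx> v' (l, ?m - Suc i)" and "i < ?m"
    then show "u' (l, i) \<approx> v' (l, i)" using *[rule_format, of "?m - Suc i"] by simp
  qed auto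
  finally show ?thesis
    unfolding axis_level_def using assms
    by (subst wall_ok_axis) (auto simp: butlast_level_nth brick_sys_Vert)
qed

text \<open>In the \<open>\<infinity>\<close>-tangle the cap compares the two lower values and the
  cup the two upper ones, but on the axis nothing links lower to upper: here each half is cut open.
  In a twist region the upper values are prescribed by \<open>twists\<close>.\<close>

lemma tangle_path:
  assumes st: "strands D l \<noteq> []"
    and inner: "\<And>i. i < last_pos D l \<Longrightarrow> UL (l, i) = BL (l, i) \<and> UR (l, i) = BR (l, i)"
    and inf: "l = h0 \<Longrightarrow> BL (l, last_pos D l) \<approx> BR (l, last_pos D l) \<and> UL (l, last_pos D l) \<approx> UR (l, last_pos D l)"
    and tw: "\<And>n. l \<noteq> h0 \<Longrightarrow> map_of ts l = Some n \<Longrightarrow> even n \<and>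
      (UL (l, last_pos D l), UR (l, last_pos D l)) = twists (\<gamma> (l, last_pos D l)) (n > 0) (last (strands D l)) (nat \<bar>n\<bar>)
        (BL (l, last_pos D l), BR (l, last_pos D l))"
  shows "path (wall_ok brick_sys) (axis_tangle D h0 ts l) (tangle_levels D \<gamma> h0 ts BL BR l) (sym_level D \<gamma> UL UR l)"
proof -
  let ?m = "last_pos D l" and ?a = "last (strands D l)" and ?g = "\<gamma> (l, last_pos D l)"
  show ?thesis
  proof (cases "l = h0")
    case True
    have "brick_sys Cap [(?a, ?g, BL (l, ?m)), (\<not> ?a, ?g, BR (l, ?m))] []"
      "brick_sys (Cup ?a) [] [(?a, ?g, UL (l, ?m)), (\<not> ?a, ?g, UR (l, ?m))]"
      using inf[OF True] eqv_sym by (auto simp: brick_sys_def simp flip: eqv_def)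
    then show ?thesis
      using True inner st unfolding axis_tangle_def tangle_levels_def Let_def last_pos_def[symmetric]
      by (simp add: sym_level_axis wall_ok_axis_level)
  next
    case False
    show ?thesis
    proof (cases "map_of ts l")
      case None
      then show ?thesis using False by (simp add: axis_tangle_def tangle_levels_def Let_def)
    next
      case (Some n)
      define L where "L = (\<lambda>j. if j < nat \<bar>n\<bar> then twist_level D \<gamma> BL BR l (n > 0) j else sym_level D \<gamma> UL UR l)"
      have "wall_ok brick_sys (axis_wall ?m (Cross (n > 0))) (L j) (L (Suc j))" if "j < nat \<bar>n\<bar>" for j
      proof -
        define v v' where "v = (if Suc j < nat \<bar>n\<bar> then BL else UL)" and "v' = (if Suc j < nat \<bar>n\<bar> then BR else UR)"
        let ?p = "\<lambda>j. twists ?g (n > 0) ?a j (BL (l, ?m), BR (l, ?m))"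
        have "L (Suc j) = axis_level D \<gamma> v v' l [(?a = even (Suc j), ?g, fst (?p (Suc j))), (?a \<noteq> even (Suc j), ?g, snd (?p (Suc j)))]"
        proof (cases "Suc j < nat \<bar>n\<bar>")
          case True
          then show ?thesis by (simp add: L_def v_def v'_def twist_level_def Let_def)
        next
          case 2: False
          then have j: "nat \<bar>n\<bar> = Suc j" using that by simp
          \<comment> \<open>Only after an even number of half twists has the left strand its
            original direction again, so that the last twist ends on a level of the shape
            \<open>sym_level\<close>.\<close>
          then have "even (Suc j)" using tw[OF False Some] j[symmetric] by (simp add: even_nat_iff)
          then show ?thesis using 2 st tw[OF False Some] j
            by (simp add: L_def v_def v'_def sym_level_axis del: twists.simps) (metis fst_conv snd_conv)
        qed
        moreover have "L j = axis_level D \<gamma> BL BR l [(?a = even j, ?g, fst (?p j)), (?a \<noteq> even j, ?g, snd (?p j))]"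
          using that by (simp add: L_def twist_level_def Let_def)
        moreover have "brick_sys (Cross (n > 0)) [(?a = even j, ?g, fst (?p j)), (?a \<noteq> even j, ?g, snd (?p j))]
            [(?a = even (Suc j), ?g, fst (?p (Suc j))), (?a \<noteq> even (Suc j), ?g, snd (?p (Suc j)))]"
          using brick_sys_twist[of "n > 0" "?a = even j" ?g "fst (?p j)" "snd (?p j)" "fst (?p (Suc j))" "snd (?p (Suc j))"]
          by auto
        moreover have "\<forall>i<?m. BL (l, i) \<approx> v (l, i) \<and> BR (l, i) \<approx> v' (l, i)"
          using inner by (simp add: v_def v'_def)
        ultimately show ?thesis by (simp add: wall_ok_axis_level)
      qed
      moreover have "tangle_levels D \<gamma> h0 ts BL BR l = map L [0..<nat \<bar>n\<bar>]" "sym_level D \<gamma> UL UR l = L (nat \<bar>n\<bar>)"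
        using False Some by (auto simp: tangle_levels_def L_def)
      moreover have "axis_tangle D h0 ts l = replicate (nat \<bar>n\<bar>) (axis_wall ?m (Cross (n > 0)))"
        using False Some by (simp add: axis_tangle_def Let_def)
      ultimately show ?thesis
        by (auto simp: path_nth nth_append) (metis Suc_lessI)
    qed
  qed
qed

lemma symmetric_union_path:
  assumes D: "oriented_diagram D" "symmetric_union_data D h0 ts"
    and L: "diagram_sys brick_sys D \<gamma> UL BL" and R: "diagram_sys brick_sys D \<gamma> UR BR"
    and inner: "\<And>l i. l < length D \<Longrightarrow> i < last_pos D l \<Longrightarrow> UL (l, i) = BL (l, i) \<and> UR (l, i) = BR (l, i)"
    and inf: "BL (h0, last_pos D h0) \<approx> BR (h0, last_pos D h0) \<and> UL (h0, last_pos D h0) \<approx> UR (h0, last_pos D h0)"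
    and none: "\<And>l. l < length D \<Longrightarrow> l \<noteq> h0 \<Longrightarrow> map_of ts l = None \<Longrightarrow>
      UL (l, last_pos D l) = BL (l, last_pos D l) \<and> UR (l, last_pos D l) = BR (l, last_pos D l)"
    and tw: "\<And>l n. l \<noteq> h0 \<Longrightarrow> map_of ts l = Some n \<Longrightarrow> even n \<and>
      (UL (l, last_pos D l), UR (l, last_pos D l)) = twists (\<gamma> (l, last_pos D l)) (n > 0) (last (strands D l)) (nat \<bar>n\<bar>)
        (BL (l, last_pos D l), BR (l, last_pos D l))"
  shows "path (wall_ok brick_sys) (symmetric_union D h0 ts) (sym_levels D \<gamma> h0 ts BL BR UL UR) []"
proof -
  define X where "X = (\<lambda>l. tangle_levels D \<gamma> h0 ts BL BR l @ [sym_level D \<gamma> UL UR l])"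
  define W where "W = (\<lambda>l. axis_tangle D h0 ts l @ [D ! l @ mirror_wall (D ! l)])"
  have data: "h0 < length D" "strands D h0 \<noteq> []" "\<And>l n. map_of ts l = Some n \<Longrightarrow> l < length D \<and> strands D l \<noteq> []"
    using D(2) by (auto simp: symmetric_union_data_def dest!: map_of_SomeD)
  \<comment> \<open>An empty tangle, without twist number or with twist number 0, contributes no
    level of its own, and the level above it has to serve as the level below.\<close>
  have eq: "sym_level D \<gamma> UL UR l = sym_level D \<gamma> BL BR l"
    if "l < length D" "tangle_levels D \<gamma> h0 ts BL BR l = []" for l
  proof -
    have lh: "l \<noteq> h0" using that(2) by (auto simp: tangle_levels_def)
    have last: "UL (l, last_pos D l) = BL (l, last_pos D l) \<and> UR (l, last_pos D l) = BR (l, last_pos D l)"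
    proof (cases "map_of ts l")
      case (Some n)
      then have "nat \<bar>n\<bar> = 0" using that(2) lh by (auto simp: tangle_levels_def)
      then show ?thesis using tw[OF lh Some] by (simp only: twists.simps) simp
    qed (use none that(1) lh in simp)
    have "UL (l, i) = BL (l, i) \<and> UR (l, i) = BR (l, i)" if "i < length (strands D l)" for i
    proof -
      have "i < last_pos D l \<or> i = last_pos D l" using that unfolding last_pos_def by linarith
      then show ?thesis using inner[OF \<open>l < length D\<close>, of i] last by auto
    qed
    then show ?thesis by (simp add: sym_level_def level_def)
  qed
  have hd_X: "hd (X l) = sym_level D \<gamma> BL BR l" if l: "l < length D" for l
  proof (cases "tangle_levels D \<gamma> h0 ts BL BR l")
    case Nil
    then show ?thesis using eq[OF l] by (simp add: X_def)
  next
    case (Cons y ys)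
    show ?thesis
    proof (cases "l = h0")
      case True
      then show ?thesis by (simp add: X_def tangle_levels_def)
    next
      case False
      then obtain n where n: "map_of ts l = Some n" "nat \<bar>n\<bar> \<noteq> 0"
        using Cons by (cases "map_of ts l"; cases "nat \<bar>the (map_of ts l)\<bar> = 0") (auto simp: tangle_levels_def)
      then have "[0..<nat \<bar>n\<bar>] = 0 # [1..<nat \<bar>n\<bar>]" by (simp add: upt_conv_Cons)
      then have "hd (X l) = twist_level D \<gamma> BL BR l (n > 0) 0"
        using n False by (simp add: X_def tangle_levels_def)
      then show ?thesis using data(3)[OF n(1)] by (simp add: twist_level_def sym_level_axis Let_def)
    qed
  qed
  have "path (wall_ok brick_sys) (concat (map W [0..<length D])) (concat (map X [0..<length D]))
      (sym_level D \<gamma> BL BR (length D))"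
  proof (subst path_concat)
    show "\<forall>l<length D. path (wall_ok brick_sys) (W l) (X l) (sym_level D \<gamma> BL BR (Suc l))"
    proof (intro allI impI)
      fix l assume l: "l < length D"
      have "path (wall_ok brick_sys) (axis_tangle D h0 ts l) (tangle_levels D \<gamma> h0 ts BL BR l) (sym_level D \<gamma> UL UR l)"
      proof (cases "strands D l = []")
        case True
        then have "axis_tangle D h0 ts l = []" "tangle_levels D \<gamma> h0 ts BL BR l = []"
          using data by (auto simp: axis_tangle_def tangle_levels_def Let_def split: option.split)
        then show ?thesis by simp
      next
        case False
        then show ?thesis by (rule tangle_path) (use inner[OF l] inf tw in auto)
      qed
      moreover have "wall_ok brick_sys (D ! l @ mirror_wall (D ! l)) (sym_level D \<gamma> UL UR l) (sym_level D \<gamma> BL BR (Suc l))"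
        using L R l by (simp add: sym_wall[OF D(1)] diagram_sys_walls[OF D(1)])
      ultimately show "path (wall_ok brick_sys) (W l) (X l) (sym_level D \<gamma> BL BR (Suc l))"
        by (simp add: W_def X_def path_append length_tangle_levels)
    qed
  qed (use hd_X in \<open>auto simp: X_def W_def length_tangle_levels\<close>)
  moreover have "sym_level D \<gamma> BL BR (length D) = []" using D(1) by (simp add: sym_level_def level_def)
  ultimately show ?thesis by (simp add: symmetric_union_def sym_levels_def W_def X_def)
qed

end

section \<open>Solutions on a symmetric union\<close>

definition val_at :: "(bool \<times> 'g \<times> 'm) list \<Rightarrow> nat \<Rightarrow> 'm" where
  "val_at xs i = snd (snd (xs ! i))"

lemma nth_shape:
  assumes "map shape xs = map shape ys" "i < length xs"
  shows "xs ! i = (fst (ys ! i), fst (snd (ys ! i)), val_at xs i)"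
proof -
  have "length xs = length ys" using assms(1) by (metis length_map)
  then have "shape (xs ! i) = shape (ys ! i)" using assms by (metis nth_map)
  then show ?thesis by (simp add: shape_def val_at_def case_prod_unfold prod_eq_iff)
qed

text \<open>The values can be read off by position: the mirror image of strand \<open>i\<close> is
  strand number \<open>2 * last_pos D l + length mid - Suc i\<close> from the left.\<close>

lemma axis_level_repr:
  assumes "map shape xs = map shape (axis_level D \<gamma> z z' l mid)"
  shows "xs = axis_level D \<gamma> (\<lambda>p. val_at xs (snd p)) (\<lambda>p. val_at xs (2 * last_pos D l + length mid - Suc (snd p))) l
    (map (\<lambda>i. (fst (mid ! i), fst (snd (mid ! i)), val_at xs (last_pos D l + i))) [0..<length mid])"
    (is "xs = ?R")
proof (rule nth_equalityI)
  let ?m = "last_pos D l"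
  have len: "length xs = 2 * ?m + length mid"
  proof -
    have "length xs = length (axis_level D \<gamma> z z' l mid)" using assms by (metis length_map)
    then show ?thesis by (simp add: axis_level_def)
  qed
  then show "length xs = length ?R" by (simp add: axis_level_def)
  have rev: "rev (map reflect (butlast (level D \<gamma> w l))) ! i =
      (\<not> strands D l ! (?m - Suc i), \<gamma> (l, ?m - Suc i), w (l, ?m - Suc i))" if "i < ?m" for w and i
  proof -
    have "rev (map reflect (butlast (level D \<gamma> w l))) ! i = map reflect (butlast (level D \<gamma> w l)) ! (?m - Suc i)"
      using that by (subst rev_nth) simp_all
    also have "\<dots> = reflect (butlast (level D \<gamma> w l) ! (?m - Suc i))"
      using that by (intro nth_map) simp
    finally show ?thesis using that by (simp add: butlast_level_nth reflect_def)
  qed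
  fix i assume i: "i < length xs"
  have *: "xs ! i = (fst (axis_level D \<gamma> z z' l mid ! i), fst (snd (axis_level D \<gamma> z z' l mid ! i)), val_at xs i)"
    by (rule nth_shape[OF assms i])
  consider "i < ?m" | "?m \<le> i" "i < ?m + length mid" | "?m + length mid \<le> i" by linarith
  then show "xs ! i = ?R ! i"
  proof cases
    case 1
    then show ?thesis unfolding * by (simp add: axis_level_def nth_append butlast_level_nth)
  next
    case 2
    then show ?thesis unfolding * by (auto simp: axis_level_def nth_append)
  next
    case 3
    then obtain k where k: "i = ?m + length mid + k" "k < ?m"
      using i len that[of "i - (?m + length mid)"] by auto
    then show ?thesis unfolding * by (auto simp: axis_level_def nth_append rev intro!: arg_cong[of _ _ "val_at xs"])
  qed
qed

context actions_mod
begin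

lemma wall_ok_axis_level_eq:
  assumes "xs = axis_level D \<gamma> u u' l mid" "ys = axis_level D \<gamma> v v' l mid'"
    "length mid = ins b" "length mid' = outs b" "wall_ok brick_sys (axis_wall (last_pos D l) b) xs ys"
  shows "brick_sys b mid mid'" and "i < last_pos D l \<Longrightarrow> u (l, i) \<approx> v (l, i) \<and> u' (l, i) \<approx> v' (l, i)"
  using assms wall_ok_axis_level[OF assms(3,4)] by auto

text \<open>Modulo \<open>U\<close> every solution in a tangle is that of
  \<open>tangle_path\<close>: values propagate upwards from the lowest level, except that the
  \<open>\<infinity>\<close>-tangle says no more of its upper axis strands than that they agree. By
  the last claim the levels within the tangle bring no generators beyond the lowest level. Among
  \<open>2 * m + 2\<close> strands the mirror image of \<open>i\<close> is
  \<open>2 * m + 1 - i\<close>.\<close>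

lemma tangle_converse:
  fixes LL :: "nat \<Rightarrow> (bool \<times> 'g \<times> 'm) list" and D :: diagram and h0 l :: nat and ts :: "(nat \<times> int) list"
  defines "N \<equiv> length (axis_tangle D h0 ts l)" and "m \<equiv> last_pos D l"
  assumes st: "strands D l \<noteq> []"
    and ev: "\<And>n. map_of ts l = Some n \<Longrightarrow> even n"
    and shp: "\<And>j. j < N \<Longrightarrow> map shape (LL j) = shape_tangle D \<gamma> h0 ts l ! j"
      "map shape (LL N) = map shape (sym_level D \<gamma> (\<lambda>_. ()) (\<lambda>_. ()) l)"
    and sys: "\<And>j. j < N \<Longrightarrow> wall_ok brick_sys (axis_tangle D h0 ts l ! j) (LL j) (LL (Suc j))"
  shows tangle_converse_inner: "i < m \<Longrightarrow> val_at (LL 0) i \<approx> val_at (LL N) i \<and>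
      val_at (LL 0) (2 * m + 1 - i) \<approx> val_at (LL N) (2 * m + 1 - i)"
    and tangle_converse_inf: "l = h0 \<Longrightarrow> val_at (LL 0) m \<approx> val_at (LL 0) (Suc m) \<and>
      val_at (LL N) m \<approx> val_at (LL N) (Suc m)"
    and tangle_converse_twist: "l \<noteq> h0 \<Longrightarrow> map_of ts l = Some n \<Longrightarrow>
      val_at (LL N) m \<approx> fst (twists (\<gamma> (l, m)) (n > 0) (last (strands D l)) (nat \<bar>n\<bar>) (val_at (LL 0) m, val_at (LL 0) (Suc m))) \<and>
      val_at (LL N) (Suc m) \<approx> snd (twists (\<gamma> (l, m)) (n > 0) (last (strands D l)) (nat \<bar>n\<bar>) (val_at (LL 0) m, val_at (LL 0) (Suc m)))"
    and tangle_converse_zero: "(\<And>i. i < 2 * m + 2 \<Longrightarrow> val_at (LL 0) i \<approx> 0) \<Longrightarrow> j < N \<Longrightarrow> i < length (LL j) \<Longrightarrow>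
      val_at (LL j) i \<approx> 0"
proof -
  let ?a = "last (strands D l)" and ?g = "\<gamma> (l, last_pos D l)"
  have upt2: "[0..<2] = [0, Suc 0]" by (simp add: upt_conv_Cons numeral_2_eq_2)
  have repr2: "xs = axis_level D \<gamma> (\<lambda>p. val_at xs (snd p)) (\<lambda>p. val_at xs (2 * m + 1 - snd p)) l
      [(b, ?g, val_at xs m), (b', ?g, val_at xs (Suc m))]"
    if "map shape xs = map shape (axis_level D \<gamma> (\<lambda>_. ()) (\<lambda>_. ()) l [(b, ?g, ()), (b', ?g, ())])" for xs :: "(bool \<times> 'g \<times> 'm) list" and b b'
    using axis_level_repr[OF that] by (simp add: m_def upt2 numeral_2_eq_2)
  have repr0: "xs = axis_level D \<gamma> (\<lambda>p. val_at xs (snd p)) (\<lambda>p. val_at xs (2 * m - Suc (snd p))) l []"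
    if "map shape xs = map shape (axis_level D \<gamma> (\<lambda>_. ()) (\<lambda>_. ()) l [])" for xs :: "(bool \<times> 'g \<times> 'm) list"
    using axis_level_repr[OF that] by (simp add: m_def)
  have LN: "LL N = axis_level D \<gamma> (\<lambda>p. val_at (LL N) (snd p)) (\<lambda>p. val_at (LL N) (2 * m + 1 - snd p)) l
      [(?a, ?g, val_at (LL N) m), (\<not> ?a, ?g, val_at (LL N) (Suc m))]"
    by (rule repr2) (use shp(2) st in \<open>simp add: sym_level_axis\<close>)
  have inf: "(i < m \<longrightarrow> val_at (LL 0) i \<approx> val_at (LL N) i \<and> val_at (LL 0) (2 * m + 1 - i) \<approx> val_at (LL N) (2 * m + 1 - i)) \<and>
      val_at (LL 0) m \<approx> val_at (LL 0) (Suc m) \<and> val_at (LL N) m \<approx> val_at (LL N) (Suc m) \<and>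
      ((\<forall>i<2 * m + 2. val_at (LL 0) i \<approx> 0) \<longrightarrow> (\<forall>j<N. \<forall>i<length (LL j). val_at (LL j) i \<approx> 0))" if l: "l = h0" for i
  proof -
    have N: "N = 2" "axis_tangle D h0 ts l = [axis_wall m Cap, axis_wall m (Cup ?a)]"
      unfolding N_def axis_tangle_def using l by (simp_all add: Let_def m_def)
    have L0: "LL 0 = axis_level D \<gamma> (\<lambda>p. val_at (LL 0) (snd p)) (\<lambda>p. val_at (LL 0) (2 * m + 1 - snd p)) l
        [(?a, ?g, val_at (LL 0) m), (\<not> ?a, ?g, val_at (LL 0) (Suc m))]"
      by (rule repr2) (use shp(1)[of 0] N l in \<open>simp add: shape_tangle_def Let_def\<close>)
    have L1: "LL 1 = axis_level D \<gamma> (\<lambda>p. val_at (LL 1) (snd p)) (\<lambda>p. val_at (LL 1) (2 * m - Suc (snd p))) l []"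
      by (rule repr0) (use shp(1)[of 1] N l in \<open>simp add: shape_tangle_def Let_def\<close>)
    have w: "wall_ok brick_sys (axis_wall (last_pos D l) Cap) (LL 0) (LL 1)"
      "wall_ok brick_sys (axis_wall (last_pos D l) (Cup ?a)) (LL 1) (LL N)"
      using sys[of 0] sys[of 1] N by (simp_all add: numeral_2_eq_2 m_def)
    have 0: "brick_sys Cap [(?a, ?g, val_at (LL 0) m), (\<not> ?a, ?g, val_at (LL 0) (Suc m))] []"
        "\<forall>i<m. val_at (LL 0) i \<approx> val_at (LL 1) i \<and> val_at (LL 0) (2 * m + 1 - i) \<approx> val_at (LL 1) (2 * m - Suc i)"
      and 1: "brick_sys (Cup ?a) [] [(?a, ?g, val_at (LL N) m), (\<not> ?a, ?g, val_at (LL N) (Suc m))]"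
        "\<forall>i<m. val_at (LL 1) i \<approx> val_at (LL N) i \<and> val_at (LL 1) (2 * m - Suc i) \<approx> val_at (LL N) (2 * m + 1 - i)"
      using wall_ok_axis_level_eq[OF L0 L1 _ _ w(1)] wall_ok_axis_level_eq[OF L1 LN _ _ w(2)]
      by (simp_all add: m_def)
    have "val_at (LL 0) m \<approx> val_at (LL 0) (Suc m)" "val_at (LL N) m \<approx> val_at (LL N) (Suc m)"
      using 0(1) 1(1) by (auto simp: brick_sys_def intro!: eqv_sym[of "val_at _ (Suc m)"] simp flip: eqv_def)
    moreover have "val_at (LL j) i \<approx> 0"
      if z: "\<forall>i<2 * m + 2. val_at (LL 0) i \<approx> 0" and j: "j < N" and i: "i < length (LL j)" for j i
    proof -
      have len: "length (LL 0) = 2 * m + 2" by (subst L0) (simp add: axis_level_def m_def)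
      have len1: "length (LL 1) = 2 * m" by (subst L1) (simp add: axis_level_def m_def)
      consider "j = 0" | "j = 1" "i < m" | k where "j = 1" "i = 2 * m - Suc k" "k < m"
      proof (cases "j = 1 \<and> m \<le> i")
        case True
        then show ?thesis using that(3)[of "2 * m - Suc i"] i len1 by auto
      qed (use j N that(1,2) in \<open>auto simp: not_le less_2_cases_iff\<close>)
      then show ?thesis
      proof cases
        case 1
        then show ?thesis using z i len by simp
      next
        case 2
        then have "val_at (LL 1) i \<approx> val_at (LL 0) i" using 0(2) by (auto intro: eqv_sym)
        also have "val_at (LL 0) i \<approx> 0" using z 2 by simp
        finally show ?thesis using 2 by simp
      next
        case 3
        then have "val_at (LL 1) i \<approx> val_at (LL 0) (2 * m + 1 - k)" using 0(2) by (auto intro: eqv_sym)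
        also have "val_at (LL 0) (2 * m + 1 - k) \<approx> 0" using z 3 by simp
        finally show ?thesis using 3 by simp
      qed
    qed
    moreover have "val_at (LL 0) i \<approx> val_at (LL N) i \<and> val_at (LL 0) (2 * m + 1 - i) \<approx> val_at (LL N) (2 * m + 1 - i)"
      if "i < m"
      using eqv_trans[OF 0(2)[rule_format, OF that, THEN conjunct1] 1(2)[rule_format, OF that, THEN conjunct1]]
        eqv_trans[OF 0(2)[rule_format, OF that, THEN conjunct2] 1(2)[rule_format, OF that, THEN conjunct2]] ..
    ultimately show ?thesis by blast
  qed
  have tw: "(i < m \<longrightarrow> val_at (LL 0) i \<approx> val_at (LL N) i \<and> val_at (LL 0) (2 * m + 1 - i) \<approx> val_at (LL N) (2 * m + 1 - i)) \<and>
      val_at (LL N) m \<approx> fst (twists ?g (n > 0) ?a (nat \<bar>n\<bar>) (val_at (LL 0) m, val_at (LL 0) (Suc m))) \<and>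
      val_at (LL N) (Suc m) \<approx> snd (twists ?g (n > 0) ?a (nat \<bar>n\<bar>) (val_at (LL 0) m, val_at (LL 0) (Suc m))) \<and>
      ((\<forall>i<2 * m + 2. val_at (LL 0) i \<approx> 0) \<longrightarrow> (\<forall>j<N. \<forall>i<length (LL j). val_at (LL j) i \<approx> 0))"
    if l: "l \<noteq> h0" "map_of ts l = Some n" for i n
  proof -
    let ?p = "\<lambda>j. twists ?g (n > 0) ?a j (val_at (LL 0) m, val_at (LL 0) (Suc m))"
    have N: "N = nat \<bar>n\<bar>" "axis_tangle D h0 ts l = replicate N (axis_wall m (Cross (n > 0)))"
      unfolding N_def axis_tangle_def using l by (simp_all add: Let_def m_def)
    have evN: "even N" using ev[OF l(2)] N(1) by (simp add: even_nat_iff)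
    have L: "LL j = axis_level D \<gamma> (\<lambda>p. val_at (LL j) (snd p)) (\<lambda>p. val_at (LL j) (2 * m + 1 - snd p)) l
        [(?a = even j, ?g, val_at (LL j) m), (?a \<noteq> even j, ?g, val_at (LL j) (Suc m))]" if "j \<le> N" for j
    proof (cases "j = N")
      case True
      then show ?thesis using LN evN by simp
    next
      case False
      then have j: "j < N" using that by simp
      show ?thesis
        by (rule repr2) (use shp(1)[OF j] j N(1) l in \<open>simp add: shape_tangle_def Let_def\<close>)
    qed
    have step: "(\<forall>i<m. val_at (LL 0) i \<approx> val_at (LL j) i \<and> val_at (LL 0) (2 * m + 1 - i) \<approx> val_at (LL j) (2 * m + 1 - i)) \<and>
        val_at (LL j) m \<approx> fst (?p j) \<and> val_at (LL j) (Suc m) \<approx> snd (?p j)" if "j \<le> N" for j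
      using that
    proof (induction j)
      case (Suc j)
      then have j: "j < N" by simp
      have w: "wall_ok brick_sys (axis_wall (last_pos D l) (Cross (n > 0))) (LL j) (LL (Suc j))"
        using sys[OF j] N(2) j by (simp add: m_def)
      have *: "brick_sys (Cross (n > 0)) [(?a = even j, ?g, val_at (LL j) m), (?a \<noteq> even j, ?g, val_at (LL j) (Suc m))]
          [(?a = even (Suc j), ?g, val_at (LL (Suc j)) m), (?a \<noteq> even (Suc j), ?g, val_at (LL (Suc j)) (Suc m))]"
        "\<forall>i<m. val_at (LL j) i \<approx> val_at (LL (Suc j)) i \<and> val_at (LL j) (2 * m + 1 - i) \<approx> val_at (LL (Suc j)) (2 * m + 1 - i)"
        using wall_ok_axis_level_eq[OF L[OF less_imp_le[OF j]] L[OF Suc.prems] _ _ w] by (simp_all add: m_def)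
      have "val_at (LL (Suc j)) m \<approx> fst (twist ?g (n > 0) (?a = even j) (val_at (LL j) m, val_at (LL j) (Suc m)))"
        "val_at (LL (Suc j)) (Suc m) \<approx> snd (twist ?g (n > 0) (?a = even j) (val_at (LL j) m, val_at (LL j) (Suc m)))"
        using *(1) brick_sys_twist[of "n > 0" "?a = even j"] by auto
      moreover have "val_at (LL j) m \<approx> fst (?p j)" "val_at (LL j) (Suc m) \<approx> snd (?p j)" using Suc by auto
      ultimately have "val_at (LL (Suc j)) m \<approx> fst (?p (Suc j))" "val_at (LL (Suc j)) (Suc m) \<approx> snd (?p (Suc j))"
        using twist_eqv[of "val_at (LL j) m" "fst (?p j)" "val_at (LL j) (Suc m)" "snd (?p j)"]
        by (auto intro: eqv_trans)
      moreover have "val_at (LL 0) i \<approx> val_at (LL (Suc j)) i \<and>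
          val_at (LL 0) (2 * m + 1 - i) \<approx> val_at (LL (Suc j)) (2 * m + 1 - i)" if "i < m" for i
      proof -
        have IH: "val_at (LL 0) i \<approx> val_at (LL j) i" "val_at (LL 0) (2 * m + 1 - i) \<approx> val_at (LL j) (2 * m + 1 - i)"
          using Suc.IH j that by auto
        show ?thesis
          using eqv_trans[OF IH(1) *(2)[rule_format, OF that, THEN conjunct1]]
            eqv_trans[OF IH(2) *(2)[rule_format, OF that, THEN conjunct2]] ..
      qed
      ultimately show ?case by blast
    qed simp
    have "val_at (LL j) i \<approx> 0"
      if z: "\<forall>i<2 * m + 2. val_at (LL 0) i \<approx> 0" and j: "j < N" and i: "i < length (LL j)" for j i
    proof -
      have len: "length (LL j) = 2 * m + 2" by (subst L) (use j in \<open>simp_all add: axis_level_def m_def\<close>)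
      have tw0: "twists ?g (n > 0) ?a j (0, 0) = (0, 0)" by (induction j) (simp_all add: twist_def)
      have p0: "fst (?p j) \<approx> 0" "snd (?p j) \<approx> 0"
        using twists_eqv[of "val_at (LL 0) m" 0 "val_at (LL 0) (Suc m)" 0 ?g "n > 0" ?a j] z by (simp_all add: tw0)
      consider "i < m" | "i = m" | "i = Suc m" | k where "i = 2 * m + 1 - k" "k < m"
      proof (cases "Suc m < i")
        case True
        then show ?thesis using that(4)[of "2 * m + 1 - i"] i len by auto
      qed (use that(1,2,3) in linarith)
      then show ?thesis
      proof cases
        case 1
        then have "val_at (LL j) i \<approx> val_at (LL 0) i" using step[of j] j by (auto intro: eqv_sym)
        also have "val_at (LL 0) i \<approx> 0" using z 1 by simp
        finally show ?thesis .
      next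
        case 4
        then have "val_at (LL j) i \<approx> val_at (LL 0) i" using step[of j] j by (auto intro: eqv_sym)
        also have "val_at (LL 0) i \<approx> 0" using z 4 by simp
        finally show ?thesis .
      qed (use step[of j] j p0 in \<open>auto intro: eqv_trans\<close>)
    qed
    then show ?thesis using step[of N] N(1) by simp
  qed
  have none: "N = 0" if "l \<noteq> h0" "map_of ts l = None"
    using that by (simp add: N_def axis_tangle_def Let_def)
  show "i < m \<Longrightarrow> val_at (LL 0) i \<approx> val_at (LL N) i \<and> val_at (LL 0) (2 * m + 1 - i) \<approx> val_at (LL N) (2 * m + 1 - i)"
  proof -
    assume i: "i < m"
    consider "l = h0" | n where "l \<noteq> h0" "map_of ts l = Some n" | "l \<noteq> h0" "map_of ts l = None"
      by (cases "map_of ts l") auto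
    then show ?thesis
    proof cases
      case 1
      show ?thesis using inf[OF 1, of i] i by blast
    next
      case 2
      show ?thesis using tw[OF 2, of i] i by blast
    next
      case 3
      show ?thesis by (simp add: none[OF 3])
    qed
  qed
  show "l = h0 \<Longrightarrow> val_at (LL 0) m \<approx> val_at (LL 0) (Suc m) \<and> val_at (LL N) m \<approx> val_at (LL N) (Suc m)"
    using inf by blast
  show "l \<noteq> h0 \<Longrightarrow> map_of ts l = Some n \<Longrightarrow>
      val_at (LL N) m \<approx> fst (twists (\<gamma> (l, m)) (n > 0) (last (strands D l)) (nat \<bar>n\<bar>) (val_at (LL 0) m, val_at (LL 0) (Suc m))) \<and>
      val_at (LL N) (Suc m) \<approx> snd (twists (\<gamma> (l, m)) (n > 0) (last (strands D l)) (nat \<bar>n\<bar>) (val_at (LL 0) m, val_at (LL 0) (Suc m)))"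
    using tw[of n] by (simp add: m_def)
  show "(\<And>i. i < 2 * m + 2 \<Longrightarrow> val_at (LL 0) i \<approx> 0) \<Longrightarrow> j < N \<Longrightarrow> i < length (LL j) \<Longrightarrow> val_at (LL j) i \<approx> 0"
  proof -
    assume z: "\<And>i. i < 2 * m + 2 \<Longrightarrow> val_at (LL 0) i \<approx> 0" and j: "j < N" "i < length (LL j)"
    consider "l = h0" | n where "l \<noteq> h0" "map_of ts l = Some n" | "l \<noteq> h0" "map_of ts l = None"
      by (cases "map_of ts l") auto
    then show ?thesis
    proof cases
      case 1
      show ?thesis using inf[OF 1] z j by blast
    next
      case 2
      show ?thesis using tw[OF 2] z j by blast
    next
      case 3
      show ?thesis using j none[OF 3] by simp
    qed
  qed
qed

end


lemma length_concat_upt: "length (concat (map f [0..<n])) = (\<Sum>i<n. length (f i))"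
  by (induction n) auto

lemma nth_concat_map:
  assumes "l < n" "j < length (f l)"
  shows "concat (map f [0..<n]) ! ((\<Sum>i<l. length (f i)) + j) = f l ! j"
    and "(\<Sum>i<l. length (f i)) + j < length (concat (map f [0..<n]))"
proof -
  have "[0..<n] = [0..<l] @ l # [Suc l..<n]" using assms(1) by (metis le_add1 less_imp_add_positive upt_add_eq_append upt_conv_Cons plus_nat.add_0)
  then have split: "concat (map f [0..<n]) = concat (map f [0..<l]) @ f l @ concat (map f [Suc l..<n])" by simp
  show "concat (map f [0..<n]) ! ((\<Sum>i<l. length (f i)) + j) = f l ! j"
    unfolding split length_concat_upt[symmetric] nth_append_length_plus using assms(2) by (simp add: nth_append)
  show "(\<Sum>i<l. length (f i)) + j < length (concat (map f [0..<n]))"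
    unfolding split length_concat_upt[symmetric] using assms(2) by simp
qed

lemma concat_map_position:
  assumes "k < length (concat (map f [0..<n]))"
  shows "\<exists>l j. l < n \<and> j < length (f l) \<and> k = (\<Sum>i<l. length (f i)) + j"
  using assms
proof (induction n)
  case (Suc n)
  note len = length_concat_upt[of f n]
  show ?case
  proof (cases "k < length (concat (map f [0..<n]))")
    case True
    then show ?thesis using Suc.IH less_SucI by blast
  next
    case False
    then have "k - (\<Sum>i<n. length (f i)) < length (f n)" "k = (\<Sum>i<n. length (f i)) + (k - (\<Sum>i<n. length (f i)))"
      using Suc.prems len by auto
    then show ?thesis by blast
  qed
qed simp

lemma sym_level_cong:
  assumes "\<And>i. i < length (strands D l) \<Longrightarrow> u (l, i) = v (l, i) \<and> u' (l, i) = v' (l, i)"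
  shows "sym_level D \<gamma> u u' l = sym_level D \<gamma> v v' l"
  using assms by (simp add: sym_level_def level_def)

lemma sym_level_repr:
  assumes "map shape xs = map shape (sym_level D \<gamma> z z' l)"
  shows "xs = sym_level D \<gamma> (\<lambda>p. val_at xs (snd p)) (\<lambda>p. val_at xs (2 * length (strands D l) - Suc (snd p))) l"
proof (cases "strands D l = []")
  case True
  have "length xs = length (sym_level D \<gamma> z z' l)" using assms by (metis length_map)
  with True show ?thesis by (simp add: sym_level_def level_def)
next
  case False
  have upt2: "[0..<2] = [0, Suc 0]" by (simp add: upt_conv_Cons numeral_2_eq_2)
  have len: "length (strands D l) = Suc (last_pos D l)" using Suc_pred[of "length (strands D l)"] False by simp
  show ?thesis
    using axis_level_repr[OF assms[unfolded sym_level_axis[OF False]]]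
    by (simp add: sym_level_axis[OF False] upt2 numeral_2_eq_2 len)
qed

lemma brick_shape_cong:
  assumes "brick_shape C b xs ys" "map shape xs = map shape xs'" "map shape ys = map shape ys'"
  shows "brick_shape C b xs' ys'"
  using assms
  by (cases "(C, b, xs, ys)" rule: brick_shape.cases)
    (auto simp: shape_def case_prod_unfold map_eq_Cons_conv Cons_eq_map_conv)

lemma brick_shape_states:
  assumes "brick_shape C b xs ys"
  shows "brick_states b (map fst xs) (map fst ys)"
  using assms by (cases "(C, b, xs, ys)" rule: brick_shape.cases) auto

section \<open>Levels, orientation and folding of the union\<close>

locale even_symmetric_union =
  fixes D :: diagram and h0 :: nat and ts :: "(nat \<times> int) list"
  assumes D: "oriented_diagram D" "symmetric_union_data D h0 ts"
    and even_twists: "\<And>l n. map_of ts l = Some n \<Longrightarrow> even n"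
begin

abbreviation "K \<equiv> symmetric_union D h0 ts"

text \<open>The level of \<open>K\<close> below the tangle that is inserted at level
  \<open>l\<close> of \<open>D\<close>. The level above this tangle is
  \<open>segment l + length (axis_tangle D h0 ts l)\<close>; the two coincide if the tangle is
  empty.\<close>

definition segment :: "nat \<Rightarrow> nat" where
  "segment l = (\<Sum>i<l. Suc (length (axis_tangle D h0 ts i)))"

definition fold_point :: "point \<Rightarrow> point" where
  "fold_point = (\<lambda>(l, i). folded_levels D h0 ts ! l ! i)"

lemma data: "h0 < length D" "strands D h0 \<noteq> []" "map_of ts l = Some n \<Longrightarrow> l < length D \<and> strands D l \<noteq> []"
  using D(2) by (auto simp: symmetric_union_data_def dest!: map_of_SomeD)

lemma shape_tangle_length: "length (shape_tangle D \<gamma> h0 ts l) = length (axis_tangle D h0 ts l)"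
  by (simp add: shape_tangle_def axis_tangle_def Let_def split: option.split)

lemma K_length: "length K = segment (length D)"
  by (simp add: symmetric_union_def segment_def length_concat_upt)

lemma segment_Suc: "segment (Suc l) = Suc (segment l + length (axis_tangle D h0 ts l))"
  by (simp add: segment_def)

lemma segment_bound: "l < length D \<Longrightarrow> j \<le> length (axis_tangle D h0 ts l) \<Longrightarrow> segment l + j < length K"
  using nth_concat_map(2)[of l "length D" j "\<lambda>l. axis_tangle D h0 ts l @ [D ! l @ mirror_wall (D ! l)]"]
  by (simp add: symmetric_union_def segment_def)

lemma K_nth:
  assumes "l < length D"
  shows "j < length (axis_tangle D h0 ts l) \<Longrightarrow> K ! (segment l + j) = axis_tangle D h0 ts l ! j"
    and "K ! (segment l + length (axis_tangle D h0 ts l)) = D ! l @ mirror_wall (D ! l)"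
  using nth_concat_map(1)[of l "length D" _ "\<lambda>l. axis_tangle D h0 ts l @ [D ! l @ mirror_wall (D ! l)]"] assms
  by (auto simp: symmetric_union_def segment_def nth_append)

lemma shape_levels_nth:
  assumes "l < length D"
  shows "j < length (axis_tangle D h0 ts l) \<Longrightarrow> shape_levels D \<gamma> h0 ts ! (segment l + j) = shape_tangle D \<gamma> h0 ts l ! j"
    and "shape_levels D \<gamma> h0 ts ! (segment l + length (axis_tangle D h0 ts l)) =
      map shape (sym_level D \<gamma> (\<lambda>_. ()) (\<lambda>_. ()) l)"
  using nth_concat_map(1)[of l "length D" _ "\<lambda>l. shape_tangle D \<gamma> h0 ts l @ [map shape (sym_level D \<gamma> (\<lambda>_. ()) (\<lambda>_. ()) l)]"] assms
  by (auto simp: shape_levels_def segment_def nth_append shape_tangle_length)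

lemma shape_levels_segment:
  assumes "l < length D"
  shows "shape_levels D \<gamma> h0 ts ! segment l = map shape (sym_level D \<gamma> (\<lambda>_. ()) (\<lambda>_. ()) l)"
proof (cases "axis_tangle D h0 ts l = []")
  case True
  then show ?thesis using shape_levels_nth(2)[OF assms, of \<gamma>] by simp
next
  case False
  then have st: "strands D l \<noteq> []" using data by (auto simp: axis_tangle_def Let_def split: if_splits option.splits)
  have "shape_tangle D \<gamma> h0 ts l ! 0 = map shape (sym_level D \<gamma> (\<lambda>_. ()) (\<lambda>_. ()) l)"
  proof (cases "l = h0")
    case True
    then show ?thesis using st by (simp add: shape_tangle_def Let_def sym_level_axis)
  next
    case 2: False
    then obtain n where "map_of ts l = Some n" "nat \<bar>n\<bar> > 0"
      using False by (auto simp: axis_tangle_def Let_def split: option.splits)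
    then show ?thesis using 2 st by (simp add: shape_tangle_def Let_def sym_level_axis)
  qed
  then show ?thesis using shape_levels_nth(1)[OF assms, of 0 \<gamma>] False by simp
qed

lemma length_shape_levels: "length (shape_levels D \<gamma> h0 ts) = length K"
  by (simp add: K_length shape_levels_def segment_def shape_tangle_length length_concat_upt)

text \<open>Connects the levels constructed here with \<open>folded_levels\<close>, through which
  the epimorphism is defined.\<close>

lemma shape_levels_snd: "map (map snd) (shape_levels D \<gamma> h0 ts) = map (map \<gamma>) (folded_levels D h0 ts)"
proof -
  have lev: "map snd (map shape (level D \<gamma> z l)) = map \<gamma> (level_points D l)" for l and z :: "point \<Rightarrow> unit"
    by (simp add: shape_def level_def level_points_def o_def)
  have refl: "map snd (map shape (map reflect xs)) = map snd (map shape xs)" for xs :: "(bool \<times> _ \<times> unit) list"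
    by (simp add: shape_def reflect_def case_prod_unfold)
  have 1: "map snd (map shape (sym_level D \<gamma> (\<lambda>_. ()) (\<lambda>_. ()) l)) = map \<gamma> (level_points D l @ rev (level_points D l))" for l
    unfolding sym_level_def map_append rev_map[symmetric] lev refl ..
  have 3: "map snd (map shape (axis_level D \<gamma> (\<lambda>_. ()) (\<lambda>_. ()) l mid)) =
      map \<gamma> (butlast (level_points D l)) @ map snd (map shape mid) @ map \<gamma> (rev (butlast (level_points D l)))" for l mid
    unfolding axis_level_def map_append rev_map[symmetric] map_butlast refl lev ..
  have 4: "level_points D l = butlast (level_points D l) @ [(l, last_pos D l)]" if "strands D l \<noteq> []" for l
  proof -
    have "level_points D l \<noteq> []" using that by (simp add: level_points_def)
    moreover have "last (level_points D l) = (l, last_pos D l)" using that by (simp add: level_points_def last_map)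
    ultimately show ?thesis by (metis append_butlast_last_id)
  qed
  have 5: "map \<gamma> (level_points D l @ rev (level_points D l)) =
      map \<gamma> (butlast (level_points D l)) @ [\<gamma> (l, last_pos D l), \<gamma> (l, last_pos D l)] @ map \<gamma> (rev (butlast (level_points D l)))"
    if "strands D l \<noteq> []" for l
    by (subst (1 2) 4[OF that]) simp
  have 2: "map (map snd) (shape_tangle D \<gamma> h0 ts l) = map (map \<gamma>) (folded_tangle D h0 ts l)" for l
  proof (cases "l = h0")
    case True
    then show ?thesis using data(2) unfolding shape_tangle_def folded_tangle_def Let_def
      by (simp only: True refl if_True list.map 3 5[OF data(2)]) (simp add: shape_def)
  next
    case False
    show ?thesis
    proof (cases "map_of ts l")
      case (Some n)
      have "map snd (map shape (axis_level D \<gamma> (\<lambda>_. ()) (\<lambda>_. ()) l [(b, \<gamma> (l, last_pos D l), ()), (b', \<gamma> (l, last_pos D l), ())])) =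
          map \<gamma> (level_points D l @ rev (level_points D l))" for b b'
        unfolding 3 5[OF data(3)[OF Some, THEN conjunct2]] by (simp add: shape_def)
      with False Some show ?thesis
        by (auto intro!: nth_equalityI simp: shape_tangle_def folded_tangle_def Let_def simp del: map_map)
    qed (use False in \<open>simp add: shape_tangle_def folded_tangle_def Let_def\<close>)
  qed
  show ?thesis unfolding shape_levels_def folded_levels_def map_concat map_map o_def map_append 2 using 1 by simp
qed


end

text \<open>Orientations are computed upwards from the empty bottom level, so a chain of levels that
  starts empty and satisfies all brick conditions must be the computed one.\<close>

lemma levels_states:
  assumes path: "path (wall_ok brick_states) E (map (map fst) LL) []" and L0: "E \<noteq> [] \<Longrightarrow> LL ! 0 = []"
  shows "oriented_diagram E" and "\<And>l. l < length E \<Longrightarrow> strands E l = map fst (LL ! l)"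
proof -
  let ?L = "map (map fst) LL @ [[]]"
  have len: "length LL = length E" using path_length[OF path] by simp
  have step: "wall_ok brick_states (E ! l) (?L ! l) (?L ! Suc l)" if "l < length E" for l
  proof -
    have eq: "?L ! l = map (map fst) LL ! l" using that len by (simp add: nth_append)
    show ?thesis using path that unfolding path_nth eq by blast
  qed
  have L0: "?L ! 0 = []" using L0 len by (cases LL; cases E) auto
  have "level_state E l = Some (?L ! l)" if "l \<le> length E" for l
    using that
  proof (induction l)
    case 0
    then show ?case using L0 by (simp add: level_state_def)
  next
    case (Suc l)
    then show ?case using level_state_Suc[of l E] step[of l] by (simp add: wall_top_iff)
  qed
  from this[of "length E"] this show "oriented_diagram E" "\<And>l. l < length E \<Longrightarrow> strands E l = map fst (LL ! l)"
    using len by (auto simp: oriented_diagram_def strands_def nth_append)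
qed

lemma path_map:
  assumes "path R ws xs b" "\<And>w x y. R w x y \<Longrightarrow> R' w (f x) (f y)"
  shows "path R' ws (map f xs) (f b)"
proof -
  have "(map f xs @ [f b]) ! j = f ((xs @ [b]) ! j)" if "j < Suc (length xs)" for j
    using that by (auto simp: nth_append less_Suc_eq)
  then show ?thesis using assms unfolding path_nth by simp
qed

lemma wall_ok_shape_cong:
  assumes "wall_ok (brick_shape C) w xs ys" "map shape xs = map shape xs'" "map shape ys = map shape ys'"
  shows "wall_ok (brick_shape C) w xs' ys'"
proof -
  have "length xs = length xs'" "length ys = length ys'" using assms(2,3) by (metis length_map)+
  moreover have "map shape (take n (drop k xs)) = map shape (take n (drop k xs'))"
    "map shape (take n (drop k ys)) = map shape (take n (drop k ys'))" for n k
    using assms(2,3) by (simp_all flip: take_map drop_map)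
  ultimately show ?thesis using assms(1) unfolding wall_ok_nth by (metis brick_shape_cong)
qed

lemma (in actions) twists_zero [simp]: "twists g s a n (0, 0) = (0, 0)"
  by (induction n) (simp_all add: twist_def)

context even_symmetric_union
begin

text \<open>Orientations and labels of \<open>K\<close> do not depend on values, so any solution
  reveals them. With coefficients \<open>int\<close>, trivial actions and \<open>U = UNIV\<close>
  every relation holds, and the zero solution already yields all levels of \<open>K\<close>. The
  lemma serves for every reflexive \<open>C\<close>, so for matrices and for relators alike.\<close>

lemma K_shape:
  assumes C_refl: "\<And>a. C a a a"
    and shape: "\<And>l k u v. (l, k) \<in> bricks D \<Longrightarrow>
      brick_shape C (D ! l ! k) (bottom_slice D \<gamma> (u :: point \<Rightarrow> int) l k) (top_slice D \<gamma> v l k)"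
  shows K_oriented: "oriented_diagram K"
    and K_level_shape: "l < length K \<Longrightarrow> map shape (level K (\<gamma> \<circ> fold_point) v l) = shape_levels D \<gamma> h0 ts ! l"
    and K_brick_shape: "diagram_sys (brick_shape C) K (\<gamma> \<circ> fold_point) u w"
proof -
  interpret triv: actions_mod "\<lambda>_ x. x :: int" "\<lambda>_ x. x" C UNIV
    by unfold_locales (use C_refl in auto)
  define LL where "LL = triv.sym_levels D \<gamma> h0 ts (\<lambda>_. 0) (\<lambda>_. 0) (\<lambda>_. 0) (\<lambda>_. 0)"
  have sys: "diagram_sys triv.brick_sys D \<gamma> (\<lambda>_. 0) (\<lambda>_. 0)"
  proof -
    have "triv.brick_sys (D ! l ! k) (bottom_slice D \<gamma> (\<lambda>_. 0) l k) (top_slice D \<gamma> (\<lambda>_. 0) l k)"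
      if "(l, k) \<in> bricks D" for l k
      unfolding triv.brick_sys_def by (intro conjI shape[OF that] subset_UNIV)
    then show ?thesis unfolding diagram_sys_def by blast
  qed
  have path: "path (wall_ok triv.brick_sys) K LL []"
    unfolding LL_def
  proof (rule triv.symmetric_union_path[OF D sys sys])
    fix l n assume "map_of ts l = Some n"
    then show "even n \<and> (0, 0) = triv.twists (\<gamma> (l, last_pos D l)) (0 < n) (last (strands D l)) (nat \<bar>n\<bar>) (0, 0)"
      using even_twists triv.twists_zero by metis
  qed (rule conjI refl triv.eqv_refl)+
  have shapes: "map (map shape) LL = shape_levels D \<gamma> h0 ts"
    unfolding LL_def by (rule triv.shape_sym_levels[OF data(2)])
  have len: "length LL = length K" using path_length[OF path] .
  have "path (wall_ok brick_states) K (map (map fst) LL) []"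
  proof -
    have "wall_ok brick_states w (map fst x) (map fst y)" if "wall_ok triv.brick_sys w x y" for w x y
      using that by (rule wall_ok_map) (auto simp: triv.brick_sys_def intro: brick_shape_states)
    from path_map[OF path, of "wall_ok brick_states" "map fst"] this show ?thesis by simp
  qed
  moreover have "LL ! 0 = []" if "K \<noteq> []"
  proof -
    have "0 < length D" using data(1) by (rule le_less_trans[OF le0])
    then have "map shape (LL ! 0) = []"
      using shape_levels_segment[of 0 \<gamma>] that len unfolding shapes[symmetric]
      by (simp add: segment_def sym_level_def level_def)
    then show ?thesis by simp
  qed
  ultimately have oriented: "oriented_diagram K" and st: "\<And>l. l < length K \<Longrightarrow> strands K l = map fst (LL ! l)"
    using levels_states[of K LL] by blast+
  show "oriented_diagram K" by (rule oriented)
  have lev: "map shape (level K (\<gamma> \<circ> fold_point) v l) = map shape (LL ! l)"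
    if l: "l < length K" for l and v :: "point \<Rightarrow> 'y"
  proof (rule nth_equalityI)
    show "length (map shape (level K (\<gamma> \<circ> fold_point) v l)) = length (map shape (LL ! l))"
      using st[OF l] by simp
    fix i assume "i < length (map shape (level K (\<gamma> \<circ> fold_point) v l))"
    then have i: "i < length (LL ! l)" using st[OF l] by simp
    have "map snd (map shape (LL ! l)) = map \<gamma> (folded_levels D h0 ts ! l)"
    proof -
      have "map (map snd) (map (map shape) LL) = map (map \<gamma>) (folded_levels D h0 ts)"
        unfolding shapes by (rule shape_levels_snd)
      moreover have "length (folded_levels D h0 ts) = length K"
        using arg_cong[OF calculation, of length] len by simp
      ultimately show ?thesis using l len by (metis length_map nth_map)
    qed
    then have "snd (shape (LL ! l ! i)) = \<gamma> (folded_levels D h0 ts ! l ! i)"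
      using i by (metis length_map nth_map)
    then show "map shape (level K (\<gamma> \<circ> fold_point) v l) ! i = map shape (LL ! l) ! i"
      using i st[OF l] by (simp add: level_def shape_def fold_point_def case_prod_unfold prod_eq_iff)
  qed
  show "l < length K \<Longrightarrow> map shape (level K (\<gamma> \<circ> fold_point) v l) = shape_levels D \<gamma> h0 ts ! l"
    using lev[of l v] shapes len by (metis nth_map)
  have "wall_ok (brick_shape C) (K ! l) (level K (\<gamma> \<circ> fold_point) u l) (level K (\<gamma> \<circ> fold_point) w (Suc l))"
    if l: "l < length K" for l
  proof -
    have "wall_ok triv.brick_sys (K ! l) (LL ! l) ((LL @ [[]]) ! Suc l)"
      using path l unfolding path_nth by blast
    then have "wall_ok (brick_shape C) (K ! l) (LL ! l) ((LL @ [[]]) ! Suc l)"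
      by (rule wall_ok_mono) (simp add: triv.brick_sys_def)
    then show ?thesis
    proof (rule wall_ok_shape_cong)
      show "map shape ((LL @ [[]]) ! Suc l) = map shape (level K (\<gamma> \<circ> fold_point) w (Suc l))"
      proof (cases "Suc l < length K")
        case True
        then show ?thesis using lev[of "Suc l" w] len by (simp add: nth_append)
      next
        case False
        then have "Suc l = length K" using l by simp
        then show ?thesis using oriented len by (simp add: nth_append level_def)
      qed
    qed (rule lev[OF l, symmetric])
  qed
  then show "diagram_sys (brick_shape C) K (\<gamma> \<circ> fold_point) u w"
    by (simp add: diagram_sys_walls[OF oriented])
qed

end

lemma strands_last_pos: "strands D l \<noteq> [] \<Longrightarrow> length (strands D l) = Suc (last_pos D l)"
  using Suc_pred[of "length (strands D l)"] by simp

locale even_symmetric_union_mod = even_symmetric_union D h0 ts + actions_mod T Ti C U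
  for D h0 ts and T Ti :: "'g \<Rightarrow> 'm::ab_group_add \<Rightarrow> 'm" and C and U :: "'m set" +
  fixes \<gamma> :: "point \<Rightarrow> 'g"
  assumes shape_D: "\<And>l k (u :: point \<Rightarrow> int) v. (l, k) \<in> bricks D \<Longrightarrow>
      brick_shape C (D ! l ! k) (bottom_slice D \<gamma> u l k) (top_slice D \<gamma> v l k)"
begin

abbreviation "\<gamma>K \<equiv> \<gamma> \<circ> fold_point"

lemma K_oriented': "oriented_diagram K"
  by (rule K_oriented[of C \<gamma>]) (rule C_refl, erule shape_D)

lemma K_level_shape': "l < length K \<Longrightarrow> map shape (level K \<gamma>K v l) = shape_levels D \<gamma> h0 ts ! l"
  by (rule K_level_shape[of C \<gamma>]) (rule C_refl, erule shape_D)

lemma K_brick_shape': "diagram_sys (brick_shape C) K \<gamma>K u w"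
  by (rule K_brick_shape[of C \<gamma>]) (rule C_refl, erule shape_D)

abbreviation jump :: "nat \<Rightarrow> int \<Rightarrow> 'm \<times> 'm \<Rightarrow> 'm \<times> 'm" where
  "jump l n \<equiv> twists (\<gamma> (l, last_pos D l)) (n > 0) (last (strands D l)) (nat \<bar>n\<bar>)"

section \<open>Gluing and cutting solutions along the axis\<close>

definition glued :: "(point \<Rightarrow> 'm) \<Rightarrow> (point \<Rightarrow> 'm) \<Rightarrow> (point \<Rightarrow> 'm) \<Rightarrow> (point \<Rightarrow> 'm) \<Rightarrow> point \<Rightarrow> 'm" where
  "glued BL BR UL UR = (\<lambda>(l, i). val_at (sym_levels D \<gamma> h0 ts BL BR UL UR ! l) i)"

lemma glued_level:
  assumes "l < length K"
  shows "level K \<gamma>K (glued BL BR UL UR) l = sym_levels D \<gamma> h0 ts BL BR UL UR ! l"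
proof -
  let ?LL = "sym_levels D \<gamma> h0 ts BL BR UL UR"
  have eq: "map (map shape) ?LL = shape_levels D \<gamma> h0 ts" by (rule shape_sym_levels[OF data(2)])
  then have "length ?LL = length K" using length_shape_levels[of \<gamma>] unfolding eq[symmetric] by simp
  then have shp: "map shape (level K \<gamma>K (glued BL BR UL UR) l) = map shape (?LL ! l)"
    unfolding K_level_shape'[OF assms] eq[symmetric] using assms by simp
  show ?thesis
  proof (rule nth_equalityI)
    show "length (level K \<gamma>K (glued BL BR UL UR) l) = length (?LL ! l)" using shp by (metis length_map)
    fix i assume i: "i < length (level K \<gamma>K (glued BL BR UL UR) l)"
    have val: "val_at (level K \<gamma>K (glued BL BR UL UR) l) i = val_at (?LL ! l) i"
      using i by (simp add: val_at_def level_def glued_def)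
    have "level K \<gamma>K (glued BL BR UL UR) l ! i = (fst (?LL ! l ! i), fst (snd (?LL ! l ! i)), val_at (?LL ! l) i)"
      unfolding val[symmetric] by (rule nth_shape[OF shp i])
    then show "level K \<gamma>K (glued BL BR UL UR) l ! i = ?LL ! l ! i" by (simp add: val_at_def)
  qed
qed

lemma glued_sys:
  assumes L: "diagram_sys brick_sys D \<gamma> UL BL" and R: "diagram_sys brick_sys D \<gamma> UR BR"
    and inner: "\<And>l i. l < length D \<Longrightarrow> i < last_pos D l \<Longrightarrow> UL (l, i) = BL (l, i) \<and> UR (l, i) = BR (l, i)"
    and inf: "BL (h0, last_pos D h0) \<approx> BR (h0, last_pos D h0) \<and> UL (h0, last_pos D h0) \<approx> UR (h0, last_pos D h0)"
    and none: "\<And>l. l < length D \<Longrightarrow> l \<noteq> h0 \<Longrightarrow> map_of ts l = None \<Longrightarrow>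
      UL (l, last_pos D l) = BL (l, last_pos D l) \<and> UR (l, last_pos D l) = BR (l, last_pos D l)"
    and tw: "\<And>l n. l \<noteq> h0 \<Longrightarrow> map_of ts l = Some n \<Longrightarrow>
      (UL (l, last_pos D l), UR (l, last_pos D l)) = jump l n (BL (l, last_pos D l), BR (l, last_pos D l))"
  shows "diagram_sys brick_sys K \<gamma>K (glued BL BR UL UR) (glued BL BR UL UR)"
proof -
  let ?LL = "sym_levels D \<gamma> h0 ts BL BR UL UR"
  have path: "path (wall_ok brick_sys) K ?LL []"
    by (rule symmetric_union_path[OF D L R]) (use inner inf none tw even_twists in auto)
  have "wall_ok brick_sys (K ! l) (level K \<gamma>K (glued BL BR UL UR) l) (level K \<gamma>K (glued BL BR UL UR) (Suc l))"
    if l: "l < length K" for l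
  proof -
    have len: "length ?LL = length K" using path_length[OF path] .
    have "wall_ok brick_sys (K ! l) (?LL ! l) ((?LL @ [[]]) ! Suc l)"
      using path l unfolding path_nth by blast
    also have "(?LL @ [[]]) ! Suc l = level K \<gamma>K (glued BL BR UL UR) (Suc l)"
    proof (cases "Suc l < length K")
      case True
      then show ?thesis using glued_level[OF True, of BL BR UL UR] len by (simp add: nth_append)
    next
      case False
      then have "Suc l = length K" using l by simp
      then show ?thesis using K_oriented' len by (simp add: nth_append level_def)
    qed
    finally show ?thesis by (simp add: glued_level[OF l])
  qed
  then show ?thesis by (simp add: diagram_sys_walls[OF K_oriented'])
qed

text \<open>Converse of \<open>glued\<close>: this and the next three read off a solution on
  \<open>K\<close> the values of the two halves below and above the tangle of each level.\<close>

definition left_lower :: "(point \<Rightarrow> 'm) \<Rightarrow> point \<Rightarrow> 'm" where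
  "left_lower \<chi> = (\<lambda>(l, i). \<chi> (segment l, i))"

definition right_lower :: "(point \<Rightarrow> 'm) \<Rightarrow> point \<Rightarrow> 'm" where
  "right_lower \<chi> = (\<lambda>(l, i). \<chi> (segment l, 2 * length (strands D l) - Suc i))"

definition left_upper :: "(point \<Rightarrow> 'm) \<Rightarrow> point \<Rightarrow> 'm" where
  "left_upper \<chi> = (\<lambda>(l, i). \<chi> (segment l + length (axis_tangle D h0 ts l), i))"

definition right_upper :: "(point \<Rightarrow> 'm) \<Rightarrow> point \<Rightarrow> 'm" where
  "right_upper \<chi> = (\<lambda>(l, i). \<chi> (segment l + length (axis_tangle D h0 ts l), 2 * length (strands D l) - Suc i))"

lemma level_repr:
  assumes k: "k < length K" and shp: "shape_levels D \<gamma> h0 ts ! k = map shape (sym_level D \<gamma> (\<lambda>_. ()) (\<lambda>_. ()) l)"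
  shows "level K \<gamma>K \<chi> k = sym_level D \<gamma> (\<lambda>(l, i). \<chi> (k, i)) (\<lambda>(l', i). \<chi> (k, 2 * length (strands D l) - Suc i)) l"
    and "length (strands K k) = 2 * length (strands D l)"
proof -
  have s: "map shape (level K \<gamma>K \<chi> k) = map shape (sym_level D \<gamma> (\<lambda>_. ()) (\<lambda>_. ()) l)"
    using K_level_shape'[OF k, of \<chi>] shp by simp
  have len: "length (strands K k) = length (sym_level D \<gamma> (\<lambda>_. ()) (\<lambda>_. ()) l)"
    using arg_cong[OF s, of length] by simp
  then show len: "length (strands K k) = 2 * length (strands D l)"
    by (simp add: sym_level_def)
  have v: "val_at (level K \<gamma>K \<chi> k) i = \<chi> (k, i)" if "i < 2 * length (strands D l)" for i
    using that len by (simp add: val_at_def level_def)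
  show "level K \<gamma>K \<chi> k = sym_level D \<gamma> (\<lambda>(l, i). \<chi> (k, i)) (\<lambda>(l', i). \<chi> (k, 2 * length (strands D l) - Suc i)) l"
    by (subst sym_level_repr[OF s], rule sym_level_cong) (auto simp: v)
qed

lemma lower_level:
  assumes "l < length D"
  shows "level K \<gamma>K \<chi> (segment l) = sym_level D \<gamma> (left_lower \<chi>) (right_lower \<chi>) l"
    and "length (strands K (segment l)) = 2 * length (strands D l)"
proof -
  have k: "segment l < length K" using segment_bound[OF assms, of 0] by simp
  show "level K \<gamma>K \<chi> (segment l) = sym_level D \<gamma> (left_lower \<chi>) (right_lower \<chi>) l"
    unfolding level_repr(1)[OF k shape_levels_segment[OF assms]]
    by (rule sym_level_cong) (simp add: left_lower_def right_lower_def)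
  show "length (strands K (segment l)) = 2 * length (strands D l)"
    by (rule level_repr(2)[OF k shape_levels_segment[OF assms]])
qed

lemma upper_level:
  assumes "l < length D"
  shows "level K \<gamma>K \<chi> (segment l + length (axis_tangle D h0 ts l)) = sym_level D \<gamma> (left_upper \<chi>) (right_upper \<chi>) l"
    and "length (strands K (segment l + length (axis_tangle D h0 ts l))) = 2 * length (strands D l)"
proof -
  have k: "segment l + length (axis_tangle D h0 ts l) < length K" using segment_bound[OF assms] by simp
  show "level K \<gamma>K \<chi> (segment l + length (axis_tangle D h0 ts l)) = sym_level D \<gamma> (left_upper \<chi>) (right_upper \<chi>) l"
    unfolding level_repr(1)[OF k shape_levels_nth(2)[OF assms]]
    by (rule sym_level_cong) (simp add: left_upper_def right_upper_def)
  show "length (strands K (segment l + length (axis_tangle D h0 ts l))) = 2 * length (strands D l)"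
    by (rule level_repr(2)[OF k shape_levels_nth(2)[OF assms]])
qed

context
  fixes \<chi>
  assumes sys: "diagram_sys brick_sys K \<gamma>K \<chi> \<chi>"
begin

lemma unglue_sys:
  "diagram_sys brick_sys D \<gamma> (left_upper \<chi>) (left_lower \<chi>)"
  "diagram_sys brick_sys D \<gamma> (right_upper \<chi>) (right_lower \<chi>)"
proof -
  have "wall_ok brick_sys (D ! l) (level D \<gamma> (left_upper \<chi>) l) (level D \<gamma> (left_lower \<chi>) (Suc l)) \<and>
      wall_ok brick_sys (D ! l) (level D \<gamma> (right_upper \<chi>) l) (level D \<gamma> (right_lower \<chi>) (Suc l))"
    if l: "l < length D" for l
  proof -
    let ?k = "segment l + length (axis_tangle D h0 ts l)"
    have k: "?k < length K" using segment_bound[OF l] by simp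
    have "level K \<gamma>K \<chi> (Suc ?k) = sym_level D \<gamma> (left_lower \<chi>) (right_lower \<chi>) (Suc l)"
    proof (cases "Suc l < length D")
      case True
      then show ?thesis using lower_level(1)[OF True] by (simp add: segment_Suc)
    next
      case False
      then have *: "Suc l = length D" using l by simp
      then have "Suc ?k = length K" by (simp add: K_length segment_Suc flip: *)
      then show ?thesis using K_oriented' D(1) by (simp add: level_def sym_level_def *)
    qed
    moreover have "wall_ok brick_sys (K ! ?k) (level K \<gamma>K \<chi> ?k) (level K \<gamma>K \<chi> (Suc ?k))"
      using sys k by (simp add: diagram_sys_walls[OF K_oriented'])
    ultimately show ?thesis
      by (simp add: K_nth(2)[OF l] upper_level(1)[OF l] sym_wall[OF D(1) l])
  qed
  then show "diagram_sys brick_sys D \<gamma> (left_upper \<chi>) (left_lower \<chi>)"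
    "diagram_sys brick_sys D \<gamma> (right_upper \<chi>) (right_lower \<chi>)"
    by (simp_all add: diagram_sys_walls[OF D(1)])
qed

lemma unglue_tangle:
  fixes l :: nat
  defines "m \<equiv> last_pos D l"
  assumes l: "l < length D" and st: "strands D l \<noteq> []"
  shows unglue_inner: "i < m \<Longrightarrow> left_lower \<chi> (l, i) \<approx> left_upper \<chi> (l, i) \<and> right_lower \<chi> (l, i) \<approx> right_upper \<chi> (l, i)"
    and unglue_inf: "l = h0 \<Longrightarrow> left_lower \<chi> (l, m) \<approx> right_lower \<chi> (l, m) \<and> left_upper \<chi> (l, m) \<approx> right_upper \<chi> (l, m)"
    and unglue_none: "l \<noteq> h0 \<Longrightarrow> map_of ts l = None \<Longrightarrow> left_upper \<chi> (l, i) = left_lower \<chi> (l, i) \<and> right_upper \<chi> (l, i) = right_lower \<chi> (l, i)"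
    and unglue_twist: "l \<noteq> h0 \<Longrightarrow> map_of ts l = Some n \<Longrightarrow>
      left_upper \<chi> (l, m) \<approx> fst (jump l n (left_lower \<chi> (l, m), right_lower \<chi> (l, m))) \<and>
      right_upper \<chi> (l, m) \<approx> snd (jump l n (left_lower \<chi> (l, m), right_lower \<chi> (l, m)))"
    and unglue_zero: "(\<And>i. i \<le> m \<Longrightarrow> left_lower \<chi> (l, i) \<approx> 0 \<and> right_lower \<chi> (l, i) \<approx> 0) \<Longrightarrow>
      j < length (axis_tangle D h0 ts l) \<Longrightarrow> i < length (strands K (segment l + j)) \<Longrightarrow> \<chi> (segment l + j, i) \<approx> 0"
proof -
  let ?N = "length (axis_tangle D h0 ts l)"
  define LL where "LL = (\<lambda>j. level K \<gamma>K \<chi> (segment l + j))"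
  have k: "segment l + j < length K" if "j \<le> ?N" for j using segment_bound[OF l that] .
  have shp: "map shape (LL j) = shape_tangle D \<gamma> h0 ts l ! j" if "j < ?N" for j
    unfolding LL_def K_level_shape'[OF k[OF less_imp_le[OF that]]] by (rule shape_levels_nth(1)[OF l that])
  have shpN: "map shape (LL ?N) = map shape (sym_level D \<gamma> (\<lambda>_. ()) (\<lambda>_. ()) l)"
    unfolding LL_def K_level_shape'[OF k[OF le_refl]] by (rule shape_levels_nth(2)[OF l])
  have w: "wall_ok brick_sys (axis_tangle D h0 ts l ! j) (LL j) (LL (Suc j))" if "j < ?N" for j
  proof -
    have "wall_ok brick_sys (K ! (segment l + j)) (level K \<gamma>K \<chi> (segment l + j)) (level K \<gamma>K \<chi> (Suc (segment l + j)))"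
      using sys k[OF less_imp_le[OF that]] unfolding diagram_sys_walls[OF K_oriented'] by blast
    then show ?thesis using K_nth(1)[OF l that] by (simp add: LL_def)
  qed
  have conv1: "i < m \<Longrightarrow> val_at (LL 0) i \<approx> val_at (LL ?N) i \<and> val_at (LL 0) (2 * m + 1 - i) \<approx> val_at (LL ?N) (2 * m + 1 - i)" for i
    unfolding m_def by (rule tangle_converse_inner) (rule st shpN | erule even_twists | erule shp | erule w | assumption)+
  have conv2: "l = h0 \<Longrightarrow> val_at (LL 0) m \<approx> val_at (LL 0) (Suc m) \<and> val_at (LL ?N) m \<approx> val_at (LL ?N) (Suc m)"
    unfolding m_def by (rule tangle_converse_inf) (rule st shpN | erule even_twists | erule shp | erule w | assumption)+
  have conv3: "?N = 0" if "l \<noteq> h0" "map_of ts l = None"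
    using that by (simp add: axis_tangle_def Let_def)
  have conv4: "l \<noteq> h0 \<Longrightarrow> map_of ts l = Some n \<Longrightarrow>
      val_at (LL ?N) m \<approx> fst (jump l n (val_at (LL 0) m, val_at (LL 0) (Suc m))) \<and>
      val_at (LL ?N) (Suc m) \<approx> snd (jump l n (val_at (LL 0) m, val_at (LL 0) (Suc m)))" for n
    unfolding m_def by (rule tangle_converse_twist) (rule st shpN | erule even_twists | erule shp | erule w | assumption)+
  have conv5: "(\<And>i. i < 2 * m + 2 \<Longrightarrow> val_at (LL 0) i \<approx> 0) \<Longrightarrow> j < ?N \<Longrightarrow> i < length (LL j) \<Longrightarrow> val_at (LL j) i \<approx> 0" for i j
    unfolding m_def by (rule tangle_converse_zero) (rule st shpN | erule even_twists | erule shp | erule w | assumption)+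
  note conv = conv1 conv2 conv3 conv4 conv5
  have len: "length (strands D l) = Suc m" using strands_last_pos[OF st] by (simp add: m_def)
  have val: "val_at (LL j) i = \<chi> (segment l + j, i)" if "i < length (strands K (segment l + j))" for i j
    using that by (simp add: LL_def val_at_def level_def)
  have lower: "val_at (LL 0) i = left_lower \<chi> (l, i)" "val_at (LL 0) (2 * m + 1 - i) = right_lower \<chi> (l, i)" if "i \<le> m" for i
    using that lower_level(2)[OF l] len by (simp_all add: val left_lower_def right_lower_def)
  have upper: "val_at (LL ?N) i = left_upper \<chi> (l, i)" "val_at (LL ?N) (2 * m + 1 - i) = right_upper \<chi> (l, i)" if "i \<le> m" for i
    using that upper_level(2)[OF l] len by (simp_all add: val left_upper_def right_upper_def)
  have Suc_m: "val_at (LL 0) (Suc m) = right_lower \<chi> (l, m)" "val_at (LL ?N) (Suc m) = right_upper \<chi> (l, m)"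
    using lower(2)[of m] upper(2)[of m] by simp_all
  show "i < m \<Longrightarrow> left_lower \<chi> (l, i) \<approx> left_upper \<chi> (l, i) \<and> right_lower \<chi> (l, i) \<approx> right_upper \<chi> (l, i)"
    using conv(1)[of i] lower upper by simp
  show "l = h0 \<Longrightarrow> left_lower \<chi> (l, m) \<approx> right_lower \<chi> (l, m) \<and> left_upper \<chi> (l, m) \<approx> right_upper \<chi> (l, m)"
    using conv(2) lower(1)[of m] upper(1)[of m] Suc_m by simp
  show "l \<noteq> h0 \<Longrightarrow> map_of ts l = None \<Longrightarrow> left_upper \<chi> (l, i) = left_lower \<chi> (l, i) \<and> right_upper \<chi> (l, i) = right_lower \<chi> (l, i)"
    using conv(3) by (simp add: left_lower_def left_upper_def right_lower_def right_upper_def)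
  show "l \<noteq> h0 \<Longrightarrow> map_of ts l = Some n \<Longrightarrow>
      left_upper \<chi> (l, m) \<approx> fst (jump l n (left_lower \<chi> (l, m), right_lower \<chi> (l, m))) \<and>
      right_upper \<chi> (l, m) \<approx> snd (jump l n (left_lower \<chi> (l, m), right_lower \<chi> (l, m)))"
    using conv(4)[of n] lower(1)[of m] upper(1)[of m] Suc_m by (simp add: m_def)
  show "\<chi> (segment l + j, i) \<approx> 0"
    if z: "\<And>i. i \<le> m \<Longrightarrow> left_lower \<chi> (l, i) \<approx> 0 \<and> right_lower \<chi> (l, i) \<approx> 0"
      and j: "j < ?N" and i: "i < length (strands K (segment l + j))"
  proof -
    have "val_at (LL 0) i \<approx> 0" if "i < 2 * m + 2" for i
    proof (cases "i \<le> m")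
      case True
      then show ?thesis using z[of i] lower(1)[of i] by simp
    next
      case False
      then have "i = 2 * m + 1 - (2 * m + 1 - i)" "2 * m + 1 - i \<le> m" using that by auto
      then show ?thesis using z[of "2 * m + 1 - i"] lower(2)[of "2 * m + 1 - i"] by simp
    qed
    then have "val_at (LL j) i \<approx> 0" using i by (intro conv(5)[OF _ j]) (auto simp: LL_def)
    then show ?thesis by (simp add: val[OF i])
  qed
qed

text \<open>A point of \<open>K\<close> lies above the tangle of its segment or on one of the levels
  listed for the tangle; the latter are controlled from the lowest one by
  \<open>unglue_zero\<close>.\<close>

lemma unglue_all_zero:
  assumes z: "\<And>p. p \<in> points D \<Longrightarrow> left_lower \<chi> p \<approx> 0 \<and> right_lower \<chi> p \<approx> 0 \<and> left_upper \<chi> p \<approx> 0 \<and> right_upper \<chi> p \<approx> 0"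
    and q: "q \<in> points K"
  shows "\<chi> q \<approx> 0"
proof -
  obtain k i where q: "q = (k, i)" "k \<le> length K" "i < length (strands K k)" using q by (auto simp: points_def)
  then have "k < length K" using K_oriented' by (metis le_neq_implies_less length_0_conv not_less_zero strands_length)
  then obtain l j where l: "l < length D" and j: "j \<le> length (axis_tangle D h0 ts l)" and k: "k = segment l + j"
    using concat_map_position[of k "\<lambda>l. axis_tangle D h0 ts l @ [D ! l @ mirror_wall (D ! l)]" "length D"]
    by (auto simp: symmetric_union_def segment_def less_Suc_eq_le)
  show ?thesis
  proof (cases "j = length (axis_tangle D h0 ts l)")
    case True
    then have i: "i < 2 * length (strands D l)" using q(3) upper_level(2)[OF l] k by simp
    show ?thesis
    proof (cases "i < length (strands D l)")
      case True
      then have "left_upper \<chi> (l, i) \<approx> 0" using z[of "(l, i)"] l by (simp add: points_def)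
      then show ?thesis using \<open>j = _\<close> q(1) k by (simp add: left_upper_def)
    next
      case False
      then have "right_upper \<chi> (l, 2 * length (strands D l) - Suc i) \<approx> 0" using z[of "(l, 2 * length (strands D l) - Suc i)"] l i
        by (simp add: points_def)
      then show ?thesis using \<open>j = _\<close> q(1) k i by (simp add: right_upper_def)
    qed
  next
    case False
    then have j: "j < length (axis_tangle D h0 ts l)" using j by simp
    then have "axis_tangle D h0 ts l \<noteq> []" by auto
    then have st: "strands D l \<noteq> []" using data by (auto simp: axis_tangle_def Let_def split: if_splits option.splits)
    show ?thesis unfolding q(1) k
    proof (rule unglue_zero[OF l st _ j])
      fix i assume "i \<le> last_pos D l"
      then have "(l, i) \<in> points D" using strands_last_pos[OF st] l by (simp add: points_def)
      then show "left_lower \<chi> (l, i) \<approx> 0 \<and> right_lower \<chi> (l, i) \<approx> 0" using z by blast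
    qed (use q(3) k in simp)
  qed
qed

end

end

section \<open>Counting points, arcs and crossings\<close>

lemma card_classes:
  assumes "finite Ed" "finite V"
  shows "card V \<le> card ((\<lambda>p. {q. equivclp (\<lambda>x y. (x, y) \<in> Ed) p q}) ` V) + card Ed"
  using assms(1)
proof (induction Ed rule: finite_induct)
  case empty
  have "equivclp (\<lambda>x y. (x, y) \<in> {}) p q \<Longrightarrow> p = q" for p q :: 'a
    by (induction rule: equivclp_induct) auto
  then have "inj_on (\<lambda>p. {q. equivclp (\<lambda>x y. (x, y) \<in> {}) p q}) V"
    by (intro inj_onI) (metis (no_types, lifting) equivclp_refl mem_Collect_eq)
  then show ?case by (simp add: card_image)
next
  case (insert e Ed)
  obtain a b where e: "e = (a, b)" by (cases e)
  let ?R = "equivclp (\<lambda>x y. (x, y) \<in> Ed)" and ?R' = "equivclp (\<lambda>x y. (x, y) \<in> insert e Ed)"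
  let ?f = "\<lambda>p. {q. ?R p q}" and ?f' = "\<lambda>p. {q. ?R' p q}"
  have sub: "?R' p q" if "?R p q" for p q
    using that by (induction rule: equivclp_induct) (auto intro: equivclp_trans r_into_equivclp equivclp_sym)
  have split: "?R p q \<or> (?R p a \<or> ?R p b) \<and> (?R a q \<or> ?R b q)" if "?R' p q" for p q
    using that
  proof (induction rule: equivclp_induct)
    case base
    then show ?case by simp
  next
    case (step y z)
    then consider "?R y z" | "y = a" "z = b" | "y = b" "z = a"
      using e by (auto intro: r_into_equivclp equivclp_sym)
    then show ?case
    proof cases
      case 1
      then show ?thesis using step.IH by (meson equivclp_trans)
    next
      case 2
      then show ?thesis using step.IH by (meson equivclp_refl)
    next
      case 3
      then show ?thesis using step.IH by (meson equivclp_refl)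
    qed
  qed
  have cls: "?f p = ?f q \<longleftrightarrow> ?R p q" for p q
    by (auto intro: equivclp_trans equivclp_sym)
  have cls': "?f' p = ?f' q \<longleftrightarrow> ?R' p q" for p q
    by (auto intro: equivclp_trans equivclp_sym)
  let ?g = "\<lambda>c. \<Union> (?f' ` c)"
  have g: "?g (?f p) = ?f' p" for p
    using sub by (blast intro: equivclp_trans equivclp_refl)
  \<comment> \<open>A new edge can only merge the classes of \<open>a\<close> and \<open>b\<close>.
    Leaving out that of \<open>b\<close> makes the passage to the coarser classes injective, so at
    most one class is lost.\<close>
  have inj: "inj_on ?g (?f ` V - {?f b})"
  proof (rule inj_onI)
    fix c c' assume c: "c \<in> ?f ` V - {?f b}" and c': "c' \<in> ?f ` V - {?f b}" and eq: "?g c = ?g c'"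
    then obtain p q where p: "c = ?f p" and q: "c' = ?f q" by blast
    have "?R' p q" using eq unfolding p q g cls' .
    moreover have "\<not> ?R p b" "\<not> ?R b q" "\<not> ?R q b"
      using c c' unfolding p q by (auto simp: cls intro: equivclp_sym)
    ultimately show "c = c'" using split[of p q] unfolding p q cls by (meson equivclp_trans)
  qed
  have "?g ` (?f ` V - {?f b}) \<subseteq> ?f' ` V" using g by auto
  then have "card (?f ` V - {?f b}) \<le> card (?f' ` V)"
    using card_inj_on_le[OF inj] assms(2) by blast
  moreover have "card (?f ` V) \<le> Suc (card (?f ` V - {?f b}))"
    using card_Suc_Diff1[of "?f ` V" "?f b"] assms(2) by (cases "?f b \<in> ?f ` V") auto
  ultimately show ?case using insert by simp
qed

lemma finite_bricks [simp]: "finite (bricks E)"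
proof -
  have "bricks E = (SIGMA l:{..<length E}. {..<length (E ! l)})" by (auto simp: bricks_def)
  then show ?thesis by simp
qed

lemma finite_points [simp]: "finite (points E)"
proof -
  have "points E = (SIGMA l:{..length E}. {..<length (strands E l)})" by (auto simp: points_def)
  then show ?thesis by simp
qed

lemma finite_arcs [simp]: "finite (arcs E)" by (simp add: arcs_def)

lemma finite_crossings [simp]: "finite (crossings E)"
  by (rule finite_subset[of _ "bricks E"]) (auto simp: crossings_def)

lemma sum_bricks:
  "(\<Sum>(l, k)\<in>bricks E. f (E ! l ! k)) = (\<Sum>l<length E. sum_list (map f (E ! l)))"
proof -
  have "bricks E = (SIGMA l:{..<length E}. {..<length (E ! l)})" by (auto simp: bricks_def)
  then have "(\<Sum>(l, k)\<in>bricks E. f (E ! l ! k)) = (\<Sum>l<length E. \<Sum>k<length (E ! l). f (E ! l ! k))"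
    by (simp add: sum.Sigma)
  also have "\<dots> = (\<Sum>l<length E. sum_list (map f (E ! l)))"
    by (intro sum.cong refl) (simp add: sum_list_sum_nth lessThan_atLeast0)
  finally show ?thesis .
qed

text \<open>Every point is an upper end of a brick below it and a lower end of a brick above it,
  because the first and the last level are empty.\<close>

lemma double_card_points:
  assumes "oriented_diagram E"
  shows "2 * card (points E) = (\<Sum>(l, k)\<in>bricks E. ins (E ! l ! k) + outs (E ! l ! k))"
proof -
  let ?m = "\<lambda>l. length (strands E l)"
  have "points E = (SIGMA l:{..length E}. {..<?m l})" by (auto simp: points_def)
  then have card: "card (points E) = (\<Sum>l\<le>length E. ?m l)" by simp
  have "(\<Sum>(l, k)\<in>bricks E. ins (E ! l ! k) + outs (E ! l ! k)) = (\<Sum>l<length E. width_in (E ! l) + width_out (E ! l))"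
    by (simp add: sum_bricks[of "\<lambda>b. ins b + outs b"] sum_list_addf)
  also have "\<dots> = (\<Sum>l<length E. ?m l + ?m (Suc l))"
    using length_strands[OF assms] by (intro sum.cong) auto
  also have "\<dots> = (\<Sum>l<length E. ?m l) + (\<Sum>l<length E. ?m (Suc l))" by (simp add: sum.distrib)
  also have "(\<Sum>l<length E. ?m l) = (\<Sum>l\<le>length E. ?m l)"
    using assms by (simp add: lessThan_Suc_atMost[symmetric])
  also have "(\<Sum>l<length E. ?m (Suc l)) = (\<Sum>l\<le>length E. ?m l)"
    using sum.lessThan_Suc_shift[of ?m "length E"] by (simp add: lessThan_Suc_atMost)
  finally show ?thesis by (simp add: card)
qed

text \<open>A crossing has four ends and any other brick two, so there are as many points as bricks
  and crossings together. A brick joins points by at most one curve, which leaves at least as many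
  arcs as crossings. Hence a Wirtinger presentation omits at most one crossing.\<close>

lemma card_crossings_le_arcs:
  assumes "oriented_diagram E"
  shows "card (crossings E) \<le> card (arcs E)"
proof -
  have "(\<Sum>(l, k)\<in>bricks E. ins (E ! l ! k) + outs (E ! l ! k)) =
      (\<Sum>c\<in>bricks E. 2 + (if c \<in> crossings E then 2 else 0))"
  proof (intro sum.cong refl)
    fix c assume "c \<in> bricks E"
    then show "(case c of (l, k) \<Rightarrow> ins (E ! l ! k) + outs (E ! l ! k)) = 2 + (if c \<in> crossings E then 2 else 0)"
      by (cases c; cases "E ! fst c ! snd c") (auto simp: crossings_def)
  qed
  also have "\<dots> = 2 * card (bricks E) + 2 * card (bricks E \<inter> crossings E)"
    unfolding sum.distrib by (simp add: sum.If_cases)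
  also have "bricks E \<inter> crossings E = crossings E" by (auto simp: crossings_def)
  finally have pts: "card (points E) = card (bricks E) + card (crossings E)"
    using double_card_points[OF assms] by simp
  have "card (curves E) \<le> (\<Sum>c\<in>bricks E. card (case c of (l, k) \<Rightarrow> brick_curves (E ! l ! k) l (bot_pos E l k) (top_pos E l k)))"
    unfolding curves_def by (rule card_UN_le) simp
  also have "\<dots> \<le> (\<Sum>c\<in>bricks E. 1)"
  proof (rule sum_mono)
    fix c
    show "card (case c of (l, k) \<Rightarrow> brick_curves (E ! l ! k) l (bot_pos E l k) (top_pos E l k)) \<le> 1"
      by (cases c; cases "E ! fst c ! snd c") auto
  qed
  finally have curves: "card (curves E) \<le> card (bricks E)" by simp
  have "finite (brick_curves b l i j)" for b l i j by (cases b) auto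
  then have "finite (curves E)" by (auto simp: curves_def)
  from card_classes[OF this finite_points[of E]]
  have "card (points E) \<le> card (arcs E) + card (curves E)"
    by (simp add: arcs_def arc_of_def[abs_def])
  with pts curves show ?thesis by simp
qed

lemma arc_of_curve: "(p, q) \<in> curves E \<Longrightarrow> arc_of E q = arc_of E p"
  unfolding arc_of_def by (auto intro: equivclp_trans equivclp_sym r_into_equivclp)

lemma equivclp_const:
  assumes "equivclp r p q" "\<And>x y. r x y \<Longrightarrow> f x = f y"
  shows "f p = f q"
  using assms(1) by (induction rule: equivclp_induct) (auto dest: assms(2))

lemma arc_of_const:
  assumes "arc_of E p = arc_of E q" "\<And>x y. (x, y) \<in> curves E \<Longrightarrow> f x = f y"
  shows "f p = f q"
proof -
  have "q \<in> arc_of E p" using assms(1) by (simp add: arc_of_def)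
  then have "equivclp (\<lambda>x y. (x, y) \<in> curves E) p q" by (simp add: arc_of_def)
  then show ?thesis by (rule equivclp_const) (rule assms(2))
qed

lemma crossing_points_in:
  assumes "oriented_diagram E" "c \<in> crossings E" "crossing_points E c = (p, q, r)"
  shows "p \<in> points E" "q \<in> points E" "r \<in> points E"
proof -
  obtain l k s where c: "c = (l, k)" "E ! l ! k = Cross s" "l < length E" "k < length (E ! l)"
    using assms(2) by (auto simp: crossings_def bricks_def)
  have "bot_pos E l k + 2 \<le> length (strands E l)" "top_pos E l k + 2 \<le> length (strands E (Suc l))"
    using width_take[OF c(4)] length_strands[OF assms(1) c(3)] c(2) by (auto simp: bot_pos_def top_pos_def)
  then show "p \<in> points E" "q \<in> points E" "r \<in> points E"
    using assms(3) c by (auto simp: crossing_points_def Let_def points_def split: if_splits)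
qed

lemma block_actions:
  assumes "\<And>g. M g \<in> carrier_mat d d" "\<And>g. N g \<in> carrier_mat d d"
    "\<And>g. M g * N g = 1\<^sub>m d" "\<And>g. N g * M g = 1\<^sub>m d"
  shows "actions (\<lambda>g. block_act d (M g :: 'r::comm_ring_1 mat)) (\<lambda>g. block_act d (N g))
    (\<lambda>a b e. M a * M b = M e * M a)"
proof unfold_locales
  show "block_act d (M a) (block_act d (M b) x) = block_act d (M e) (block_act d (M a) x)"
    if "M a * M b = M e * M a" for a b e and x :: "nat \<Rightarrow> 'w \<Rightarrow> 'r"
    using that assms(1) by (simp flip: block_act_mult)
qed (use assms in \<open>simp_all add: block_act_add block_act_one flip: block_act_mult\<close>)

lemma block_actions_mod:
  assumes "\<And>g. M g \<in> carrier_mat d d" "\<And>g. N g \<in> carrier_mat d d"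
    "\<And>g. M g * N g = 1\<^sub>m d" "\<And>g. N g * M g = 1\<^sub>m d" and L: "forms.subspace L"
  shows "actions_mod (\<lambda>g. block_act d (M g :: 'r::comm_ring_1 mat)) (\<lambda>g. block_act d (N g))
    (\<lambda>a b e. M a * M b = M e * M a) (blocks d L)"
proof -
  have neg: "- x \<in> L" if "x \<in> L" for x using forms.subspace_neg[OF L that] .
  have add: "x + y \<in> L" if "x \<in> L" "y \<in> L" for x y using forms.subspace_add[OF L that] .
  have zero: "0 \<in> L" using forms.subspace_0[OF L] .
  show ?thesis
  proof (intro actions_mod.intro block_actions assms(1-4) actions_mod_axioms.intro)
    show "0 \<in> blocks d L" using zero unfolding blocks_def zero_fun_def by simp
    show "x + y \<in> blocks d L" if "x \<in> blocks d L" "y \<in> blocks d L" for x y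
      using that add unfolding blocks_def plus_fun_apply by simp
    show "- x \<in> blocks d L" if "x \<in> blocks d L" for x
      using that neg unfolding blocks_def fun_Compl_def by simp
  qed (use block_act_closed[OF L] in auto)
qed

lemma block_act_var:
  "k < d \<Longrightarrow> j < d \<Longrightarrow> block_act d M (var b) k (x, j) = (if x = b then M $$ (k, j) else 0)"
  by (simp add: block_act_def var_def unit_form_def if_distrib[of "\<lambda>u. _ * u"] cong: if_cong)

text \<open>Reordering the columns is multiplication by the 0-1 matrix \<open>P\<close>. One
  divisibility suffices, as the lemma can be applied in both directions.\<close>

lemma form_det_perm:
  fixes fs :: "('w \<Rightarrow> 'r::idom) list"
  assumes "distinct ws" "distinct ws'" "set ws = set ws'" "length fs = length ws"
  shows "form_det fs ws dvd form_det fs ws'"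
proof -
  define n where "n = length ws"
  have n: "length ws' = n" using assms by (metis distinct_card n_def)
  define A where "A = mat n n (\<lambda>(i, j). (fs ! i) (ws ! j))"
  define P :: "'r mat" where "P = mat n n (\<lambda>(i, j). if ws ! i = ws' ! j then 1 else 0)"
  have "A * P = mat n n (\<lambda>(i, j). (fs ! i) (ws' ! j))"
  proof (rule eq_matI, goal_cases)
    case (1 i j)
    then have ij: "i < n" "j < n" by auto
    have "ws' ! j \<in> set ws" using ij n assms(3) by (metis nth_mem)
    have "(A * P) $$ (i, j) = (\<Sum>k<n. (fs ! i) (ws ! k) * (if ws ! k = ws' ! j then 1 else 0))"
      using ij by (simp add: A_def P_def scalar_prod_def lessThan_atLeast0)
    also have "\<dots> = (\<Sum>w\<in>set ws. (fs ! i) w * (if w = ws' ! j then 1 else 0))"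
      unfolding n_def by (rule sum_nth_distinct[OF assms(1)])
    also have "\<dots> = (fs ! i) (ws' ! j)"
      using \<open>ws' ! j \<in> set ws\<close> by (simp add: if_distrib[of "\<lambda>u. _ * u"] cong: if_cong)
    finally show ?case using ij by simp
  qed (simp_all add: A_def P_def)
  moreover have "det (A * P) = det A * det P" by (rule det_mult[of _ n]) (simp_all add: A_def P_def)
  ultimately show ?thesis
    using assms(4) n by (simp add: form_det_def A_def flip: n_def)
qed

section \<open>Fox calculus\<close>

text \<open>The additive extension of a function on the group to the group ring; the entries of
  \<open>Phi\<close> have this form.\<close>

definition group_ring_sum :: "('w \<Rightarrow> 'r::comm_ring_1) \<Rightarrow> ('w \<Rightarrow>\<^sub>0 int) \<Rightarrow> 'r" where
  "group_ring_sum f z = (\<Sum>w\<in>Poly_Mapping.keys z. of_int (Poly_Mapping.lookup z w) * f w)"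

lemma group_ring_sum_superset:
  assumes "finite A" "Poly_Mapping.keys z \<subseteq> A"
  shows "group_ring_sum f z = (\<Sum>w\<in>A. of_int (Poly_Mapping.lookup z w) * f w)"
  unfolding group_ring_sum_def
  by (rule sum.mono_neutral_left) (use assms in \<open>auto simp: in_keys_iff\<close>)

lemma group_ring_sum_add: "group_ring_sum f (z + z') = group_ring_sum f z + group_ring_sum f z'"
proof -
  let ?A = "Poly_Mapping.keys z \<union> Poly_Mapping.keys z'"
  have "group_ring_sum f (z + z') = (\<Sum>w\<in>?A. of_int (Poly_Mapping.lookup (z + z') w) * f w)"
    by (rule group_ring_sum_superset) (use Poly_Mapping.keys_add[of z z'] in auto)
  also have "\<dots> = (\<Sum>w\<in>?A. of_int (Poly_Mapping.lookup z w) * f w) + (\<Sum>w\<in>?A. of_int (Poly_Mapping.lookup z' w) * f w)"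
    by (simp add: lookup_add ring_distribs sum.distrib)
  finally show ?thesis using group_ring_sum_superset[of ?A z f] group_ring_sum_superset[of ?A z' f] by simp
qed

lemma group_ring_sum_uminus: "group_ring_sum f (- z) = - group_ring_sum f z"
  by (simp add: group_ring_sum_def sum_negf)

lemma group_ring_sum_diff: "group_ring_sum f (z - z') = group_ring_sum f z - group_ring_sum f z'"
  using group_ring_sum_add[of f z "- z'"] by (simp add: group_ring_sum_uminus)

lemma group_ring_sum_single: "group_ring_sum f (Poly_Mapping.single w 1) = f w"
  by (simp add: group_ring_sum_def)

lemma group_ring_sum_0: "group_ring_sum f 0 = 0"
  by (simp add: group_ring_sum_def)

lemma fox_of_word: "fox x (of_word u) = fox_word x u"
  by transfer simp

lemma of_word_append: "of_word (u @ v) = of_word u + of_word v"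
  by transfer simp

lemma uminus_gen: "- gen x = of_word [(x, False)]"
  unfolding gen_def by transfer (simp add: inv_word_def)

lemma relator_word: "gen a + gen b - gen a - gen e = of_word [(a, True), (b, True), (a, False), (e, False)]"
proof -
  have "gen a + gen b - gen a - gen e = of_word [(a, True)] + of_word [(b, True)] + of_word [(a, False)] + of_word [(e, False)]"
    by (simp only: diff_conv_add_uminus uminus_gen) (simp only: gen_def)
  then show ?thesis by (simp flip: of_word_append)
qed

lemma fox_relator:
  "fox x (gen a + gen b - gen a - gen e) =
    (if x = a then Poly_Mapping.single 0 1 else 0) + (if x = b then Poly_Mapping.single (gen a) 1 else 0)
    - (if x = a then Poly_Mapping.single (gen a + gen b - gen a) 1 else 0)
    - (if x = e then Poly_Mapping.single (gen a + gen b - gen a - gen e) 1 else 0)"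
  unfolding relator_word fox_of_word
  by (simp add: relator_word[symmetric] algebra_simps mult_single single_one)

section \<open>Free groups and exponent sums\<close>

lemma group_free_group_on: "Group.group (free_group_on X)"
proof (rule groupI)
  have inv: "of_word (inv_word u) \<in> of_word ` {u. fst ` set u \<subseteq> X}" if "fst ` set u \<subseteq> X" for u
    using that by (intro imageI) (auto simp: inv_word_def)
  fix x y z assume "x \<in> carrier (free_group_on X)" "y \<in> carrier (free_group_on X)" "z \<in> carrier (free_group_on X)"
  then obtain u v where u: "x = of_word u" "fst ` set u \<subseteq> X" and v: "y = of_word v" "fst ` set v \<subseteq> X"
    by (auto simp: free_group_on_def)
  show "x \<otimes>\<^bsub>free_group_on X\<^esub> y \<in> carrier (free_group_on X)"
    using u v by (auto simp: free_group_on_def of_word_append[symmetric] image_Un)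
  show "x \<otimes>\<^bsub>free_group_on X\<^esub> y \<otimes>\<^bsub>free_group_on X\<^esub> z = x \<otimes>\<^bsub>free_group_on X\<^esub> (y \<otimes>\<^bsub>free_group_on X\<^esub> z)"
    by (simp add: free_group_on_def add.assoc)
  have "- x = of_word (inv_word u)" unfolding u(1) by transfer simp
  then have "- x \<in> carrier (free_group_on X)" using inv[OF u(2)] by (simp add: free_group_on_def)
  then show "\<exists>y\<in>carrier (free_group_on X). y \<otimes>\<^bsub>free_group_on X\<^esub> x = \<one>\<^bsub>free_group_on X\<^esub>"
    by (intro bexI[of _ "- x"]) (simp_all add: free_group_on_def)
next
  show "\<one>\<^bsub>free_group_on X\<^esub> \<in> carrier (free_group_on X)"
    by (auto simp: free_group_on_def zero_free_group_def of_word_def intro!: image_eqI[of _ _ "[]"])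
qed (simp add: free_group_on_def)

lemma free_group_on_simps [simp]:
  "x \<otimes>\<^bsub>free_group_on X\<^esub> y = x + y" "\<one>\<^bsub>free_group_on X\<^esub> = 0"
  by (simp_all add: free_group_on_def)

lemma free_group_on_inv:
  assumes "x \<in> carrier (free_group_on X)"
  shows "inv\<^bsub>free_group_on X\<^esub> x = - x" "- x \<in> carrier (free_group_on X)"
proof -
  interpret Group.group "free_group_on X" by (rule group_free_group_on)
  have "inv\<^bsub>free_group_on X\<^esub> x + x = 0" using l_inv[OF assms] by simp
  then show eq: "inv\<^bsub>free_group_on X\<^esub> x = - x" by (rule eq_neg_iff_add_eq_0[THEN iffD2])
  show "- x \<in> carrier (free_group_on X)" using inv_closed[OF assms] eq by simp
qed

lemma free_group_on_add: "x \<in> carrier (free_group_on X) \<Longrightarrow> y \<in> carrier (free_group_on X) \<Longrightarrow> x + y \<in> carrier (free_group_on X)"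
  using monoid.m_closed[OF Group.group.is_monoid[OF group_free_group_on], of x X y] by simp

lemma free_group_on_0: "0 \<in> carrier (free_group_on X)"
  using monoid.one_closed[OF Group.group.is_monoid[OF group_free_group_on], of X] by simp

lemma free_group_on_gen: "a \<in> X \<Longrightarrow> gen a \<in> carrier (free_group_on X)"
  by (auto simp: free_group_on_def gen_def)

lemma exponent_sum_add: "exponent_sum (x + y) = exponent_sum x + exponent_sum y"
  by transfer simp

lemma exponent_sum_0: "exponent_sum 0 = 0"
  by transfer simp

lemma exponent_sum_uminus: "exponent_sum (- x) = - exponent_sum x"
  using exponent_sum_add[of "- x" x] by (simp add: exponent_sum_0)

lemma exponent_sum_gen: "exponent_sum (gen a) = 1"
  unfolding gen_def by transfer simp

lemma exponent_sum_diff: "exponent_sum (x - y) = exponent_sum x - exponent_sum y"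
  using exponent_sum_add[of "x - y" y] by simp

lemma free_group_on_diff: "x \<in> carrier (free_group_on X) \<Longrightarrow> y \<in> carrier (free_group_on X) \<Longrightarrow> x - y \<in> carrier (free_group_on X)"
  unfolding diff_conv_add_uminus by (intro free_group_on_add free_group_on_inv)

lemma exponent_sum_relator: "exponent_sum (relator E c) = 0"
  by (simp add: relator_def exponent_sum_add exponent_sum_diff exponent_sum_gen)

section \<open>Laurent matrices and the degree of the denominator\<close>

definition lmat :: "int \<Rightarrow> 'a::field mat \<Rightarrow> 'a laurent mat" where
  "lmat n A = map_mat (Poly_Mapping.single n) A"

lemma lmat_carrier [simp]: "A \<in> carrier_mat m n \<Longrightarrow> lmat k A \<in> carrier_mat m n"
  by (simp add: lmat_def)

lemma single_sum: "Poly_Mapping.single n (sum f A) = (\<Sum>x\<in>A. Poly_Mapping.single n (f x))"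
  by (induction A rule: infinite_finite_induct) (auto simp: single_add)

lemma lmat_mult:
  assumes "A \<in> carrier_mat d d" "B \<in> carrier_mat d d"
  shows "lmat (m + n) (A * B) = lmat m A * lmat n B"
  using assms by (intro eq_matI) (auto simp: lmat_def scalar_prod_def single_sum mult_single)

lemma lmat_one: "lmat 0 (1\<^sub>m d) = (1\<^sub>m d :: 'a::field laurent mat)"
  by (intro eq_matI) (auto simp: lmat_def)

lemma lookup_mult_single:
  fixes p :: "'a::field laurent"
  shows "Poly_Mapping.lookup (p * Poly_Mapping.single m c) n = Poly_Mapping.lookup p (n - m) * c"
proof -
  have "(\<Sum>q. Poly_Mapping.lookup (Poly_Mapping.single m c) q when n = l + q) = (c when l = n - m)" for l
  proof -
    have "(\<Sum>q. Poly_Mapping.lookup (Poly_Mapping.single m c) q when n = l + q) =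
        (\<Sum>q. Poly_Mapping.lookup (Poly_Mapping.single m c) q when q = n - l)"
      by (intro Sum_any.cong) (auto simp: when_def)
    then show ?thesis by (auto simp: when_def lookup_single)
  qed
  then have "Poly_Mapping.lookup (p * Poly_Mapping.single m c) n = (\<Sum>l. Poly_Mapping.lookup p l * (c when l = n - m))"
    by (simp add: lookup_mult)
  also have "\<dots> = (\<Sum>l. (Poly_Mapping.lookup p l * c) when l = n - m)"
    by (intro Sum_any.cong) (auto simp: when_def)
  finally show ?thesis by simp
qed

lemma prod_linear_lookup:
  fixes a b :: "'i \<Rightarrow> 'a::field"
  assumes "finite I"
  defines "P \<equiv> (\<Prod>i\<in>I. Poly_Mapping.single 1 (a i) + Poly_Mapping.single 0 (b i) :: 'a laurent)"
  shows "Poly_Mapping.lookup P (int (card I)) = (\<Prod>i\<in>I. a i) \<and> Poly_Mapping.lookup P 0 = (\<Prod>i\<in>I. b i) \<and>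
    (\<forall>n. n < 0 \<or> n > int (card I) \<longrightarrow> Poly_Mapping.lookup P n = 0)"
  using assms(1) unfolding P_def
proof (induction I rule: finite_induct)
  case empty
  then show ?case by (auto simp: lookup_one when_def)
next
  case (insert i I)
  have "Poly_Mapping.lookup (Poly_Mapping.single m c * p) n = c * Poly_Mapping.lookup p (n - m)"
    for m n and c :: 'a and p :: "'a laurent"
    using lookup_mult_single[of p m c n] by (simp add: mult.commute)
  with insert show ?case by (simp add: distrib_right lookup_add)
qed

text \<open>In the Leibniz expansion every summand is a product of \<open>d\<close> factors
  \<open>a t + b\<close>. So all exponents lie between 0 and \<open>d\<close>, the coefficient of
  \<open>t ^ d\<close> is \<open>det A\<close> and the constant coefficient is a sign; invertibility
  of \<open>A\<close> makes the degree exactly \<open>d\<close>.\<close>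

lemma det_lmat_minus_one:
  fixes A :: "'a::field mat"
  assumes A: "A \<in> carrier_mat d d" and nz: "det A \<noteq> 0"
  shows "det (lmat 1 A - 1\<^sub>m d) \<noteq> 0" and "laurent_degree (det (lmat 1 A - 1\<^sub>m d)) = ereal (real d)"
proof -
  let ?p = "det (lmat 1 A - 1\<^sub>m d)" and ?S = "{p. p permutes {0..<d}}"
  let ?b = "\<lambda>i j. if i = j then - 1 else 0 :: 'a"
  let ?P = "\<lambda>p. \<Prod>i\<in>{0..<d}. Poly_Mapping.single 1 (A $$ (i, p i)) + Poly_Mapping.single 0 (?b i (p i)) :: 'a laurent"
  have carr: "lmat 1 A - 1\<^sub>m d \<in> carrier_mat d d" using A by (intro minus_carrier_mat) simp
  have entry: "(lmat 1 A - 1\<^sub>m d) $$ (i, j) = Poly_Mapping.single 1 (A $$ (i, j)) + Poly_Mapping.single 0 (?b i j)"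
    if "i < d" "j < d" for i j
    using that A by (auto simp: lmat_def single_uminus)
  have perm_less: "p i < d" if "p \<in> ?S" "i < d" for p i
    using that permutes_in_image[of p "{0..<d}" i] by simp
  have p: "?p = (\<Sum>p\<in>?S. signof p * ?P p)"
    unfolding det_def'[OF carr]
  proof (intro sum.cong refl arg_cong2[of _ _ _ _ "(*)"] prod.cong)
    fix p i assume "p \<in> ?S" "i \<in> {0..<d}"
    then have "i < d" "p i < d" using perm_less by auto
    then show "(lmat 1 A - 1\<^sub>m d) $$ (i, p i) = Poly_Mapping.single 1 (A $$ (i, p i)) + Poly_Mapping.single 0 (?b i (p i))"
      by (rule entry)
  qed
  have sgn: "Poly_Mapping.lookup (signof p * q) n = signof p * Poly_Mapping.lookup q n" for p and q :: "'a laurent" and n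
    by (simp add: sign_def)
  have sum: "Poly_Mapping.lookup (sum f S) n = (\<Sum>x\<in>S. Poly_Mapping.lookup (f x) n)" for f :: "(nat \<Rightarrow> nat) \<Rightarrow> 'a laurent" and S n
    by (induction S rule: infinite_finite_induct) (auto simp: lookup_add)
  have lin: "Poly_Mapping.lookup (?P p) (int d) = (\<Prod>i\<in>{0..<d}. A $$ (i, p i))"
    "Poly_Mapping.lookup (?P p) 0 = (\<Prod>i\<in>{0..<d}. ?b i (p i))"
    "n < 0 \<or> n > int d \<Longrightarrow> Poly_Mapping.lookup (?P p) n = 0" for p n
    using prod_linear_lookup[of "{0..<d}" "\<lambda>i. A $$ (i, p i)" "\<lambda>i. ?b i (p i)"] by (simp_all, blast)
  have top: "Poly_Mapping.lookup ?p (int d) = det A"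
    unfolding p sum sgn det_def'[OF A] lin ..
  have "Poly_Mapping.lookup ?p 0 = det (mat d d (\<lambda>(i, j). ?b i j))"
    unfolding p sum sgn lin by (subst det_def'[of _ d]) (auto intro!: sum.cong prod.cong simp: perm_less)
  also have "mat d d (\<lambda>(i, j). ?b i j) = (- 1) \<cdot>\<^sub>m 1\<^sub>m d" by (intro eq_matI) auto
  finally have bot: "Poly_Mapping.lookup ?p 0 = (- 1) ^ d" by (simp add: det_smult)
  have out: "Poly_Mapping.lookup ?p n = 0" if "n < 0 \<or> n > int d" for n
    unfolding p sum sgn lin(3)[OF that] by simp
  show "?p \<noteq> 0" using bot by (metis lookup_zero power_eq_0_iff neg_equal_0_iff_equal zero_neq_one)
  have "Max (Poly_Mapping.keys ?p) = int d"
    using top nz out by (intro Max_eqI) (auto simp: in_keys_iff not_less[symmetric])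
  moreover have "Min (Poly_Mapping.keys ?p) = 0"
    using bot out by (intro Min_eqI) (auto simp: in_keys_iff not_less[symmetric])
  ultimately show "laurent_degree ?p = ereal (real d)"
    using \<open>?p \<noteq> 0\<close> by (simp add: laurent_degree_def)
qed

section \<open>Twisted Fox matrices of a diagram with a representation\<close>

lemma crossing_arcs_in:
  assumes "oriented_diagram E" "c \<in> crossings E"
  shows "over_arc E c \<in> arcs E" "left_arc E c \<in> arcs E" "right_arc E c \<in> arcs E"
proof -
  obtain p q r where c: "crossing_points E c = (p, q, r)" by (cases "crossing_points E c") auto
  show "over_arc E c \<in> arcs E" "left_arc E c \<in> arcs E" "right_arc E c \<in> arcs E"
    using crossing_points_in[OF assms c] by (auto simp: over_arc_def left_arc_def right_arc_def arcs_def c)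
qed

lemma relators_carrier:
  assumes "oriented_diagram E"
  shows "relator E ` crossings E \<subseteq> carrier (free_group_on (arcs E))"
  unfolding relator_def
  by (intro image_subsetI free_group_on_diff free_group_on_add free_group_on_gen crossing_arcs_in[OF assms])

text \<open>\<open>R\<close> is the representation on words, and all matrices are computed from it;
  \<open>\<rho>\<close> is met only inside \<open>Phi\<close>. For the union, \<open>R\<close> will
  be the pullback along the folding of words, so that no classes have to be evaluated.\<close>

locale diagram_rep =
  fixes E :: diagram and d :: nat and \<rho> :: "arc free_group set \<Rightarrow> 'a::field mat"
    and R :: "arc free_group \<Rightarrow> 'a mat"
  assumes oriented: "oriented_diagram E"
    and R_carrier: "w \<in> carrier (free_group_on (arcs E)) \<Longrightarrow> R w \<in> carrier_mat d d"
    and R_add: "w \<in> carrier (free_group_on (arcs E)) \<Longrightarrow> v \<in> carrier (free_group_on (arcs E)) \<Longrightarrow>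
      R (w + v) = R w * R v"
    and R_0: "R 0 = 1\<^sub>m d"
    and R_rel: "c \<in> crossings E \<Longrightarrow> R (relator E c) = 1\<^sub>m d"
    and R_class: "w \<in> carrier (free_group_on (arcs E)) \<Longrightarrow> \<rho> (group_class E w) = R w"
begin

abbreviation "F \<equiv> carrier (free_group_on (arcs E))"

lemmas crossing_arcs = crossing_arcs_in[OF oriented]

lemma relator_in: "c \<in> crossings E \<Longrightarrow> relator E c \<in> F"
  using relators_carrier[OF oriented] by blast

lemma relator_closure_kernel:
  assumes "h \<in> relator_closure E"
  shows "h \<in> F \<and> exponent_sum h = 0"
proof -
  let ?G = "free_group_on (arcs E)"
  have conj: "x \<in> F \<and> exponent_sum x = 0"
    if "x \<in> {g \<otimes>\<^bsub>?G\<^esub> r \<otimes>\<^bsub>?G\<^esub> inv\<^bsub>?G\<^esub> g | g r. g \<in> carrier ?G \<and> r \<in> relator E ` crossings E}" for x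
  proof -
    obtain g c where x: "x = g \<otimes>\<^bsub>?G\<^esub> relator E c \<otimes>\<^bsub>?G\<^esub> inv\<^bsub>?G\<^esub> g" "g \<in> F" "c \<in> crossings E"
      using \<open>x \<in> _\<close> by blast
    then have "x = g + relator E c - g" by (simp add: free_group_on_inv(1))
    then show ?thesis using x(2) relator_in[OF x(3)]
      by (simp add: exponent_sum_add exponent_sum_diff exponent_sum_relator free_group_on_add free_group_on_diff)
  qed
  have "h \<in> generate ?G {g \<otimes>\<^bsub>?G\<^esub> r \<otimes>\<^bsub>?G\<^esub> inv\<^bsub>?G\<^esub> g | g r. g \<in> carrier ?G \<and> r \<in> relator E ` crossings E}"
    using assms by (simp only: relator_closure_def normal_closure_def)
  then show ?thesis
  proof (induction rule: generate.induct)
    case one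
    then show ?case by (simp add: free_group_on_0 exponent_sum_0)
  next
    case (incl h)
    then show ?case by (rule conj)
  next
    case (inv h)
    then show ?case using conj[OF inv] by (auto simp: free_group_on_inv exponent_sum_uminus)
  next
    case (eng h1 h2)
    then show ?case by (auto simp: free_group_on_add exponent_sum_add)
  qed
qed

lemma abelianization_class:
  assumes "w \<in> F"
  shows "abelianization E (group_class E w) = exponent_sum w"
proof -
  have "0 \<in> relator_closure E"
    unfolding relator_closure_def normal_closure_def using generate.one[of "free_group_on (arcs E)"] by simp
  then have "exponent_sum ` (group_class E w) = {exponent_sum w}"
    using relator_closure_kernel by (force simp: group_class_def r_coset_def exponent_sum_add)
  then show ?thesis by (simp add: abelianization_def)
qed

definition Mw :: "arc free_group \<Rightarrow> 'a laurent mat" where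
  "Mw w = lmat (exponent_sum w) (R w)"

lemma Mw_add: "w \<in> F \<Longrightarrow> v \<in> F \<Longrightarrow> Mw (w + v) = Mw w * Mw v"
  by (simp add: Mw_def exponent_sum_add R_add lmat_mult[OF R_carrier R_carrier])

lemma Mw_0: "Mw 0 = 1\<^sub>m d"
  by (simp add: Mw_def exponent_sum_0 R_0 lmat_one)

lemma Mw_carrier: "w \<in> F \<Longrightarrow> Mw w \<in> carrier_mat d d"
  by (simp add: Mw_def R_carrier)

text \<open>The identity matrix outside \<open>arcs E\<close> gives every label an invertible
  matrix, as the locale \<open>actions\<close> requires.\<close>

definition M :: "arc \<Rightarrow> 'a laurent mat" where
  "M a = (if a \<in> arcs E then Mw (gen a) else 1\<^sub>m d)"

definition Mi :: "arc \<Rightarrow> 'a laurent mat" where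
  "Mi a = (if a \<in> arcs E then Mw (- gen a) else 1\<^sub>m d)"

lemma M_carrier [simp]: "M a \<in> carrier_mat d d" and Mi_carrier [simp]: "Mi a \<in> carrier_mat d d"
  by (simp_all add: M_def Mi_def Mw_carrier free_group_on_gen free_group_on_inv)

lemma M_dims [simp]: "dim_row (M a) = d" "dim_col (M a) = d"
  by (rule carrier_matD[OF M_carrier])+

lemma M_Mi: "M a * Mi a = 1\<^sub>m d" "Mi a * M a = 1\<^sub>m d"
  using Mw_add[of "gen a" "- gen a"] Mw_add[of "- gen a" "gen a"]
  by (simp_all add: M_def Mi_def free_group_on_gen free_group_on_inv Mw_0)

lemma M_crossing:
  assumes "c \<in> crossings E"
  shows "M (over_arc E c) * M (left_arc E c) = M (right_arc E c) * M (over_arc E c)"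
    and "Mw (gen (over_arc E c) + gen (left_arc E c) - gen (over_arc E c)) = M (right_arc E c)"
    and "Mw (relator E c) = 1\<^sub>m d"
proof -
  let ?a = "gen (over_arc E c)" and ?b = "gen (left_arc E c)" and ?e = "gen (right_arc E c)"
  have in_F: "?a \<in> F" "?b \<in> F" "?e \<in> F" using crossing_arcs[OF assms] by (simp_all add: free_group_on_gen)
  have M: "M (over_arc E c) = Mw ?a" "M (left_arc E c) = Mw ?b" "M (right_arc E c) = Mw ?e"
    using crossing_arcs[OF assms] by (simp_all add: M_def)
  show rel: "Mw (relator E c) = 1\<^sub>m d"
    by (simp add: Mw_def R_rel[OF assms] exponent_sum_relator lmat_one)
  have eq: "?a + ?b - ?a = relator E c + ?e" by (simp add: relator_def)
  have "Mw (relator E c + ?e) = Mw (relator E c) * Mw ?e" by (rule Mw_add[OF relator_in[OF assms] in_F(3)])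
  then show right: "Mw (?a + ?b - ?a) = M (right_arc E c)"
    unfolding eq rel M by (simp only: left_mult_one_mat[OF Mw_carrier[OF in_F(3)]])
  have "Mw (?a + ?b) = Mw (?a + ?b - ?a) * Mw ?a"
    using Mw_add[of "?a + ?b - ?a" ?a] in_F by (simp add: free_group_on_add free_group_on_diff)
  then show "M (over_arc E c) * M (left_arc E c) = M (right_arc E c) * M (over_arc E c)"
    unfolding right M using Mw_add[OF in_F(1,2)] by simp
qed

lemma Phi_entry:
  assumes "i < d" "j < d"
  shows "Phi E d \<rho> z $$ (i, j) = group_ring_sum
    (\<lambda>w. Poly_Mapping.single (abelianization E (group_class E w)) (\<rho> (group_class E w) $$ (i, j))) z"
  using assms by (simp add: Phi_def group_ring_sum_def)

lemma Mw_entry: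
  assumes "i < d" "j < d" "w \<in> F"
  shows "Poly_Mapping.single (abelianization E (group_class E w)) (\<rho> (group_class E w) $$ (i, j)) = Mw w $$ (i, j)"
  using assms R_carrier[OF assms(3)] by (simp add: abelianization_class R_class Mw_def lmat_def)

lemma Phi_gen:
  assumes "a \<in> arcs E"
  shows "Phi E d \<rho> (Poly_Mapping.single (gen a) 1 - 1) = M a - 1\<^sub>m d"
proof (rule eq_matI, goal_cases)
  case (1 i j)
  then have ij: "i < d" "j < d" using M_carrier[of a] by auto
  have "Phi E d \<rho> (Poly_Mapping.single (gen a) 1 - Poly_Mapping.single 0 1) $$ (i, j) = Mw (gen a) $$ (i, j) - Mw 0 $$ (i, j)"
    unfolding Phi_entry[OF ij] group_ring_sum_diff group_ring_sum_single
    by (simp add: Mw_entry[OF ij] free_group_on_gen[OF assms] free_group_on_0)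
  then show ?case using ij assms M_carrier[of a] by (simp add: M_def Mw_0 single_one)
qed (use M_carrier[of a] in \<open>auto simp: Phi_def\<close>)

definition T :: "arc \<Rightarrow> (nat \<Rightarrow> 'w \<Rightarrow> 'a laurent) \<Rightarrow> nat \<Rightarrow> 'w \<Rightarrow> 'a laurent" where
  "T a = block_act d (M a)"

definition Ti :: "arc \<Rightarrow> (nat \<Rightarrow> 'w \<Rightarrow> 'a laurent) \<Rightarrow> nat \<Rightarrow> 'w \<Rightarrow> 'a laurent" where
  "Ti a = block_act d (Mi a)"

definition relation :: "arc \<Rightarrow> arc \<Rightarrow> arc \<Rightarrow> bool" where
  "relation a b e \<longleftrightarrow> M a * M b = M e * M a"

definition rel :: "nat \<times> nat \<Rightarrow> nat \<Rightarrow> arc \<times> nat \<Rightarrow> 'a laurent" where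
  "rel c = cross_rel T (over_arc E c) (var (over_arc E c)) (var (left_arc E c)) (right_arc E c) (var (right_arc E c))"

text \<open>The coefficients in the Fox derivative of the relator are 1, the over generator, the
  prefix \<open>over + left - over\<close> and the relator itself. The representation sends the
  prefix to the matrix of the right arc and the relator to 1, which leaves the coefficients of
  \<open>cross_rel\<close>.\<close>

lemma Phi_fox:
  assumes c: "c \<in> crossings E" and ij: "i < d" "j < d"
  shows "Phi E d \<rho> (fox x (relator E c)) $$ (i, j) = rel c i (x, j)"
proof -
  let ?a = "over_arc E c" and ?b = "left_arc E c" and ?e = "right_arc E c"
  have in_F: "gen ?a \<in> F" "gen ?a + gen ?b - gen ?a \<in> F" "0 \<in> F"
    using crossing_arcs[OF c]
    by (auto intro!: free_group_on_add free_group_on_gen free_group_on_diff free_group_on_0)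
  have if0: "group_ring_sum f (if Q then z else 0) = (if Q then group_ring_sum f z else 0)" for f Q and z :: "arc free_group \<Rightarrow>\<^sub>0 int"
    by (simp add: group_ring_sum_0)
  have "Phi E d \<rho> (fox x (relator E c)) $$ (i, j) =
      (if x = ?a then Mw 0 $$ (i, j) else 0) + (if x = ?b then Mw (gen ?a) $$ (i, j) else 0)
      - (if x = ?a then Mw (gen ?a + gen ?b - gen ?a) $$ (i, j) else 0)
      - (if x = ?e then Mw (relator E c) $$ (i, j) else 0)"
    unfolding relator_def fox_relator Phi_entry[OF ij] group_ring_sum_add group_ring_sum_diff if0 group_ring_sum_single
    by (simp add: Mw_entry[OF ij] in_F relator_in[OF c, unfolded relator_def])
  also have "\<dots> = rel c i (x, j)"
    using ij crossing_arcs[OF c] unfolding rel_def cross_rel_def T_def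
    by (simp add: M_crossing[OF c] Mw_0 M_def[of ?a] block_act_var) (simp add: var_def unit_form_def)
  finally show ?thesis .
qed

text \<open>A submodule of forms. With all crossings among its generators it depends neither on the
  omitted relator nor on a numbering, so every Wirtinger presentation leads to it.\<close>

definition ideal_of :: "arc \<Rightarrow> (arc \<times> nat \<Rightarrow> 'a laurent) set" where
  "ideal_of y = forms.span (rows d (rel ` crossings E \<union> {var y}))"

lemma rows_map: "set (map (\<lambda>(c, k). f c k) (List.product cs [0..<d])) = rows d (f ` set cs)"
  by (force simp: rows_def)

lemma fox_matrix_det:
  assumes cs: "set cs \<subseteq> crossings E"
    and len: "length cs = length ys"
  shows "det (fox_matrix E d \<rho> (map (relator E) cs) ys) =
    form_det (map (\<lambda>(c, k). rel c k) (List.product cs [0..<d])) (List.product ys [0..<d])"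
proof -
  have "fox_matrix E d \<rho> (map (relator E) cs) ys = mat (length cs * d) (length ys * d)
      (\<lambda>(i, j). (map (\<lambda>(c, k). rel c k) (List.product cs [0..<d]) ! i) (List.product ys [0..<d] ! j))"
  proof (rule eq_matI, goal_cases)
    case (1 i j)
    then have ij: "i < length cs * d" "j < length ys * d" by auto
    then have d: "0 < d" by (cases d) auto
    have "i div d < length cs" using ij d by (simp add: less_mult_imp_div_less)
    then have "cs ! (i div d) \<in> crossings E" using cs by auto
    then show ?case using ij d
      by (simp add: fox_matrix_def block_mat_def product_nth Phi_fox less_mult_imp_div_less)
  qed (simp_all add: fox_matrix_def block_mat_def)
  then show ?thesis by (simp add: form_det_def)
qed

lemma actions_T: "actions (T :: arc \<Rightarrow> (nat \<Rightarrow> 'w \<Rightarrow> 'a laurent) \<Rightarrow> _) Ti relation"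
  unfolding T_def[abs_def] Ti_def[abs_def] relation_def[abs_def]
  by (rule block_actions) (simp_all add: M_Mi)

lemma actions_mod_T: "forms.subspace L \<Longrightarrow> actions_mod (T :: arc \<Rightarrow> (nat \<Rightarrow> 'w \<Rightarrow> 'a laurent) \<Rightarrow> _) Ti relation (blocks d L)"
  unfolding T_def[abs_def] Ti_def[abs_def] relation_def[abs_def]
  by (rule block_actions_mod) (simp_all add: M_Mi)

lemma shape_arcs:
  assumes "(l, k) \<in> bricks E"
  shows "brick_shape relation (E ! l ! k) (bottom_slice E (arc_of E) u l k) (top_slice E (arc_of E) v l k)"
proof (rule brick_shape_slices[OF oriented assms])
  fix p q r assume "(l, k) \<in> crossings E" "crossing_points E (l, k) = (p, q, r)"
  then show "relation (arc_of E p) (arc_of E q) (arc_of E r)"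
    using M_crossing(1)[of "(l, k)"] by (simp add: relation_def over_arc_def left_arc_def right_arc_def)
qed (rule arc_of_curve)

lemma rel_points:
  assumes "crossing_points E c = (p, q, r)"
  shows "rel c = cross_rel T (arc_of E p) (var (arc_of E p)) (var (arc_of E q)) (arc_of E r) (var (arc_of E r))"
  using assms by (simp add: rel_def over_arc_def left_arc_def right_arc_def)

text \<open>By the count of arcs and crossings at most one crossing is missing. Its relation follows
  by \<open>missing_crossing\<close> for the tautological solution, which assigns to each point the
  variables of its arc.\<close>

lemma span_missing:
  assumes "distinct cs" "set cs \<subseteq> crossings E" "length cs + 1 = card (arcs E)"
  shows "forms.span (rows d (rel ` set cs)) = forms.span (rows d (rel ` crossings E))"
proof -
  let ?L = "forms.span (rows d (rel ` set cs))"
  interpret am: actions_mod T Ti relation "blocks d ?L"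
    by (rule actions_mod_T) (rule forms.subspace_span)
  have "rel c0 \<in> blocks d ?L" if c0: "c0 \<in> crossings E" for c0
  proof (cases "c0 \<in> set cs")
    case True
    then show ?thesis using subset_blocks_span_rows[of "rel ` set cs" d] by blast
  next
    case False
    have others: "c \<in> set cs" if c: "c \<in> crossings E" "c \<noteq> c0" for c
    proof (rule ccontr)
      assume "c \<notin> set cs"
      then have "card (insert c (insert c0 (set cs))) = length cs + 2"
        using False c(2) assms(1) by (simp add: distinct_card)
      moreover have "insert c (insert c0 (set cs)) \<subseteq> crossings E" using c(1) c0 assms(2) by blast
      ultimately have "length cs + 2 \<le> card (crossings E)" by (metis card_mono finite_crossings)
      then show False using card_crossings_le_arcs[OF oriented] assms(3) by linarith
    qed
    obtain l0 k0 where lk: "c0 = (l0, k0)" by (cases c0)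
    obtain p q r where cp: "crossing_points E (l0, k0) = (p, q, r)" by (cases "crossing_points E (l0, k0)") auto
    have "cross_rel T (arc_of E p) (var (arc_of E p)) (var (arc_of E q)) (arc_of E r) (var (arc_of E r)) \<in> blocks d ?L"
    proof (rule am.missing_crossing[OF oriented c0[unfolded lk] cp, where \<gamma> = "arc_of E" and u = "\<lambda>p. var (arc_of E p)"])
      fix p q assume "(p, q) \<in> curves E"
      then show "am.eqv (var (arc_of E q)) (var (arc_of E p))" by (simp add: arc_of_curve)
    next
      fix c p q r assume c: "c \<in> crossings E" "c \<noteq> (l0, k0)" "crossing_points E c = (p, q, r)"
      then have "rel c \<in> blocks d ?L"
        using others lk subset_blocks_span_rows[of "rel ` set cs" d] by blast
      then show "cross_rel T (arc_of E p) (var (arc_of E p)) (var (arc_of E q)) (arc_of E r) (var (arc_of E r)) \<in> blocks d ?L"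
        by (simp only: rel_points[OF c(3)])
    qed (rule shape_arcs)
    then show ?thesis unfolding lk rel_points[OF cp] .
  qed
  then have "rows d (rel ` crossings E) \<subseteq> ?L" by (intro rows_subset) auto
  then have "forms.span (rows d (rel ` crossings E)) \<subseteq> ?L"
    by (rule forms.span_minimal) (rule forms.subspace_span)
  moreover have "?L \<subseteq> forms.span (rows d (rel ` crossings E))"
    using assms(2) by (intro forms.span_mono) (auto simp: rows_def)
  ultimately show ?thesis by blast
qed

lemma rel_support:
  assumes "c \<in> crossings E" "i < d" "x \<notin> arcs E \<times> {..<d}"
  shows "rel c i x = 0"
proof (cases x)
  case (Pair a j)
  show ?thesis
  proof (cases "j < d")
    case True
    then have "a \<notin> arcs E" using assms(3) Pair by simp
    then have "a \<noteq> over_arc E c" "a \<noteq> left_arc E c" "a \<noteq> right_arc E c" using crossing_arcs[OF assms(1)] by auto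
    then show ?thesis using assms(2) Pair by (simp add: rel_def cross_rel_def T_def block_act_def var_def unit_form_def)
  next
    case False
    then have "j \<noteq> i" "\<And>k. k < d \<Longrightarrow> j \<noteq> k" using assms(2) by auto
    then show ?thesis using assms(2) Pair by (simp add: rel_def cross_rel_def T_def block_act_def var_def unit_form_def)
  qed
qed

text \<open>Deleting the block column of \<open>y\<close> amounts to adding the relations that kill
  \<open>y\<close>: the enlarged matrix is triangular, with an identity block in the place of
  \<open>y\<close>.\<close>

lemma wirtinger_presents:
  assumes w: "wirtinger_presentation E xs rs" and y: "y \<in> arcs E"
  shows "presents (arcs E \<times> {..<d}) (ideal_of y) (det (fox_matrix E d \<rho> rs (remove1 y xs)))"
proof -
  obtain cs where cs: "distinct cs" "set cs \<subseteq> crossings E" "rs = map (relator E) cs"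
    and xs: "distinct xs" "set xs = arcs E" "length xs = length rs + 1"
    using w by (auto simp: wirtinger_presentation_def)
  let ?ys = "remove1 y xs"
  let ?fs = "map (\<lambda>(c, k). rel c k) (List.product cs [0..<d])" and ?ws = "List.product ?ys [0..<d]"
  have len: "length cs = length ?ys" using xs cs y by (simp add: length_remove1)
  have set_ys: "set ?ys = arcs E - {y}" using xs by (simp add: set_remove1_eq)
  have V: "set ?ws \<union> {y} \<times> {..<d} = arcs E \<times> {..<d}" using y by (auto simp: set_ys)
  have "presents ({y} \<times> {..<d}) (forms.span (unit_form ` ({y} \<times> {..<d}))) (1 :: 'a laurent)"
    by (rule presents_unit_forms) simp
  then have "presents (set ?ws \<union> {y} \<times> {..<d})
      (forms.span (set ?fs \<union> forms.span (unit_form ` ({y} \<times> {..<d})))) (form_det ?fs ?ws * 1)"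
  proof (rule presents_triangular[rotated 2])
    show "distinct ?ws" using xs by (intro distinct_product) auto
    show "length ?fs = length ?ws" by (simp add: len)
    show "set ?ws \<inter> {y} \<times> {..<d} = {}" by (auto simp: set_ys)
    fix f x assume "f \<in> set ?fs" "x \<notin> set ?ws \<union> {y} \<times> {..<d}"
    then show "f x = 0" unfolding V using cs(2) by (auto intro!: rel_support)
  qed
  moreover have "forms.span (set ?fs \<union> forms.span (unit_form ` ({y} \<times> {..<d}))) = ideal_of y"
  proof -
    have "unit_form ` ({y} \<times> {..<d}) = rows d {var y :: nat \<Rightarrow> _ \<Rightarrow> 'a laurent}" by (auto simp: rows_def var_def)
    moreover have "forms.span (set ?fs) = forms.span (rows d (rel ` crossings E))"
      unfolding rows_map using cs xs by (intro span_missing) (auto simp: distinct_card[symmetric])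
    ultimately show ?thesis
      unfolding ideal_of_def rows_Un by (simp add: forms.span_Un forms.span_span)
  qed
  ultimately show ?thesis
    unfolding V cs(3) fox_matrix_det[OF cs(2) len] by simp
qed

lemma
  assumes "y \<in> arcs E"
  shows det_M_nonzero: "det (M y - 1\<^sub>m d) \<noteq> 0"
    and det_M_degree: "laurent_degree (det (M y - 1\<^sub>m d)) = ereal (real d)"
proof -
  have g: "gen y \<in> F" "- gen y \<in> F" using assms by (simp_all add: free_group_on_gen free_group_on_inv)
  have "R (gen y) * R (- gen y) = 1\<^sub>m d" using R_add[OF g] R_0 by simp
  then have "det (R (gen y)) * det (R (- gen y)) = 1" using det_mult[OF R_carrier[OF g(1)] R_carrier[OF g(2)]] by simp
  then have "det (R (gen y)) \<noteq> 0" by auto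
  from det_lmat_minus_one[OF R_carrier[OF g(1)] this]
  show "det (M y - 1\<^sub>m d) \<noteq> 0" "laurent_degree (det (M y - 1\<^sub>m d)) = ereal (real d)"
    using assms by (simp_all add: M_def Mw_def exponent_sum_gen)
qed

text \<open>The fundamental formula of Fox calculus: the derivatives of the relation
  \<open>a b = e a\<close>, each multiplied by generator minus 1, add up to
  \<open>a b - e a\<close>, which the representation sends to 0.\<close>

lemma rel_annihilates:
  assumes c: "c \<in> crossings E" and ik: "i < d" "k < d"
  shows "(\<Sum>w\<in>arcs E \<times> {..<d}. rel c i w * (case w of (a, j) \<Rightarrow> (M a - 1\<^sub>m d) $$ (j, k))) = 0"
proof -
  let ?s = "\<lambda>a j (k :: nat). (M a - 1\<^sub>m d) $$ (j, k)"
  let ?a = "over_arc E c" and ?b = "left_arc E c" and ?e = "right_arc E c"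
  have act: "block_act d (M a) (block_ext d (arcs E) ?s (var b)) i k = (M a * (M b - 1\<^sub>m d)) $$ (i, k)"
    if "b \<in> arcs E" for a b
  proof -
    have "block_act d (M a) (block_ext d (arcs E) ?s (var b)) i k = (\<Sum>j<d. M a $$ (i, j) * (M b - 1\<^sub>m d) $$ (j, k))"
      using ik that by (simp add: block_act_def block_ext_var)
    also have "\<dots> = (M a * (M b - 1\<^sub>m d)) $$ (i, k)"
      using ik by (simp add: scalar_prod_def lessThan_atLeast0)
    finally show ?thesis .
  qed
  have "(\<Sum>w\<in>arcs E \<times> {..<d}. rel c i w * (case w of (a, j) \<Rightarrow> (M a - 1\<^sub>m d) $$ (j, k))) =
      block_ext d (arcs E) ?s (rel c) i k"
    by (simp add: block_ext_def linear_ext_def case_prod_unfold)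
  also have "\<dots> = (M ?a - 1\<^sub>m d) $$ (i, k) + (M ?a * (M ?b - 1\<^sub>m d)) $$ (i, k) - (M ?e - 1\<^sub>m d) $$ (i, k)
      - (M ?e * (M ?a - 1\<^sub>m d)) $$ (i, k)"
    using crossing_arcs[OF c] ik unfolding rel_def cross_rel_def T_def block_ext_diff block_ext_add block_ext_act
    by (simp add: act block_ext_var)
  also have "\<dots> = (M ?a * M ?b) $$ (i, k) - (M ?e * M ?a) $$ (i, k)"
  proof -
    have "M g * (M h - 1\<^sub>m d) = M g * M h - M g" for g h
      using mult_minus_distrib_mat[OF M_carrier[of g] M_carrier[of h], of "1\<^sub>m d"] M_carrier[of g] by simp
    then show ?thesis using ik M_carrier[of ?a] M_carrier[of ?b] M_carrier[of ?e] by simp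
  qed
  also have "\<dots> = 0" by (simp add: M_crossing(1)[OF c])
  finally show ?thesis .
qed

text \<open>Wada's independence of the deleted column. By \<open>rel_annihilates\<close> the blocks
  \<open>M a - 1\<close> form vectors in the kernel of the Fox matrix, and Cramer's rule compares
  the columns of \<open>x\<close> and \<open>y\<close>; reordering columns costs only units.\<close>

lemma wirtinger_exchange:
  assumes w: "wirtinger_presentation E xs rs" and x: "x \<in> arcs E" and y: "y \<in> arcs E"
  shows "\<exists>u. u dvd 1 \<and> det (fox_matrix E d \<rho> rs (remove1 x xs)) * det (M y - 1\<^sub>m d) =
    u * (det (fox_matrix E d \<rho> rs (remove1 y xs)) * det (M x - 1\<^sub>m d))"
proof (cases "x = y")
  case True
  then show ?thesis by (intro exI[of _ 1]) simp
next
  case False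
  obtain cs where cs: "distinct cs" "set cs \<subseteq> crossings E" "rs = map (relator E) cs"
    and xs: "distinct xs" "set xs = arcs E" "length xs = length rs + 1"
    using w by (auto simp: wirtinger_presentation_def)
  let ?fs = "map (\<lambda>(c, k). rel c k) (List.product cs [0..<d])"
  define zs where "zs = remove1 x (remove1 y xs)"
  have zs: "distinct zs" "set zs = arcs E - {x, y}" using xs by (auto simp: zs_def set_remove1_eq distinct_remove1)
  have len: "length cs = length zs + 1"
  proof -
    have "card {x, y} \<le> card (set xs)" using xs(2) x y by (intro card_mono) auto
    then have "2 \<le> length xs" using False distinct_card[OF xs(1)] by simp
    then show ?thesis using xs cs x y False by (simp add: zs_def length_remove1 set_remove1_eq)
  qed
  let ?ws = "List.product zs [0..<d]" and ?col = "\<lambda>x. List.product [x] [0..<d]"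
  have dist: "distinct (?ws @ ?col z)" if "z \<in> {x, y}" for z
  proof -
    have "z \<notin> set zs" using that zs(2) by blast
    then show ?thesis unfolding distinct_append
      by (intro conjI distinct_product zs(1) distinct_upt) auto
  qed
  have perm: "det (fox_matrix E d \<rho> rs (remove1 z xs)) dvd form_det ?fs (?ws @ ?col z') \<and>
      form_det ?fs (?ws @ ?col z') dvd det (fox_matrix E d \<rho> rs (remove1 z xs))"
    if z: "{z, z'} = {x, y}" for z z'
  proof -
    have "z \<in> arcs E" "z' \<in> arcs E" "z \<noteq> z'" using z x y False by (auto simp: doubleton_eq_iff)
    then have L: "length cs = length (remove1 z xs)" "set (remove1 z xs) = insert z' (set zs)"
      using xs cs(3) zs(2) z by (auto simp: length_remove1 set_remove1_eq doubleton_eq_iff)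
    moreover from this have "set (List.product (remove1 z xs) [0..<d]) = set (?ws @ ?col z')" by auto
    moreover have "distinct (?ws @ ?col z')" using z by (intro dist) auto
    moreover have "distinct (List.product (remove1 z xs) [0..<d])" using xs by (intro distinct_product) auto
    moreover have "length (remove1 z xs) * d = length zs * d + d" using L(1) len by (metis Suc_eq_plus1 mult_Suc add.commute)
    ultimately show ?thesis
      unfolding cs(3) using len by (subst (1 2) fox_matrix_det[OF cs(2)]) (auto intro!: form_det_perm)
  qed
  obtain u1 where u1: "u1 dvd 1" "det (fox_matrix E d \<rho> rs (remove1 x xs)) = u1 * form_det ?fs (?ws @ ?col y)"
    using dvd_antisym_unit perm[of x y] by blast
  obtain u2 where u2: "u2 dvd 1" "form_det ?fs (?ws @ ?col x) = u2 * det (fox_matrix E d \<rho> rs (remove1 y xs))"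
    using dvd_antisym_unit perm[of y x] by blast
  let ?c = "\<lambda>k (a, j). (M a - 1\<^sub>m d) $$ (j, k)"
  have colmat: "mat d d (\<lambda>(i, k). ?c k (?col z ! i)) = M z - 1\<^sub>m d" for z
    using M_carrier[of z] by (intro eq_matI) auto
  have "form_det ?fs (?ws @ ?col y) * det (mat d d (\<lambda>(i, k). ?c k (?col y ! i))) =
      (- 1) ^ d * (form_det ?fs (?ws @ ?col x) * det (mat d d (\<lambda>(i, k). ?c k (?col x ! i))))"
  proof (rule form_det_exchange)
    have "x \<notin> set zs" "y \<notin> set zs" using zs(2) by blast+
    then show "distinct (?ws @ ?col y @ ?col x)" unfolding distinct_append
      using False by (intro conjI distinct_product zs(1) distinct_upt) auto
    show "length ?fs = length ?ws + d" using len by simp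
    fix f k assume f: "f \<in> set ?fs" and k: "k < d"
    then obtain c i where c: "c \<in> set cs" "i < d" and f: "f = rel c i" by auto
    have S: "set (?ws @ ?col y @ ?col x) = arcs E \<times> {..<d}"
    proof -
      have "set (?ws @ ?col y @ ?col x) = (set zs \<union> {x, y}) \<times> {..<d}" by auto
      also have "set zs \<union> {x, y} = arcs E" using zs(2) x y by blast
      finally show ?thesis .
    qed
    show "(\<Sum>w\<in>set (?ws @ ?col y @ ?col x). f w * ?c k w) = 0"
      unfolding S f by (rule rel_annihilates[OF subsetD[OF cs(2) c(1)] c(2) k])
  qed simp_all
  then have exch: "form_det ?fs (?ws @ ?col y) * det (M y - 1\<^sub>m d) =
      (- 1) ^ d * (u2 * det (fox_matrix E d \<rho> rs (remove1 y xs)) * det (M x - 1\<^sub>m d))"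
    unfolding colmat u2(2) .
  have "det (fox_matrix E d \<rho> rs (remove1 x xs)) * det (M y - 1\<^sub>m d) =
      (u1 * (- 1) ^ d * u2) * (det (fox_matrix E d \<rho> rs (remove1 y xs)) * det (M x - 1\<^sub>m d))"
    unfolding u1(2) mult.assoc exch ..
  moreover have "u1 * (- 1) ^ d * u2 dvd 1"
  proof -
    have "(- 1 :: 'a laurent) ^ d dvd 1" by (cases "even d") auto
    then show ?thesis using u1(1) u2(1) by (metis mult_dvd_mono mult_1)
  qed
  ultimately show ?thesis by blast
qed

text \<open>Brings every choice of a presentation and of a deleted column to the module with a
  prescribed arc \<open>y\<close> killed. Later \<open>y\<close> is taken in
  \<open>B\<^sub>0\<close>.\<close>

lemma twisted_alexander_presents:
  assumes "twisted_alexander E d \<rho> \<Delta>" and y: "y \<in> arcs E"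
  shows "\<exists>\<delta>. presents (arcs E \<times> {..<d}) (ideal_of y) \<delta> \<and>
    eq_up_to_unit \<Delta> (Fraction_Field.Fract \<delta> (det (M y - 1\<^sub>m d)))"
proof -
  obtain xs rs x where w: "wirtinger_presentation E xs rs" and x: "x \<in> set xs"
    and \<Delta>: "\<Delta> = Fraction_Field.Fract (det (fox_matrix E d \<rho> rs (remove1 x xs)))
      (det (Phi E d \<rho> (Poly_Mapping.single (gen x) 1 - 1)))"
    using assms(1) by (auto simp: twisted_alexander_def)
  have x: "x \<in> arcs E" using w x by (simp add: wirtinger_presentation_def)
  obtain u where u: "u dvd 1" "det (fox_matrix E d \<rho> rs (remove1 x xs)) * det (M y - 1\<^sub>m d) =
      u * (det (fox_matrix E d \<rho> rs (remove1 y xs)) * det (M x - 1\<^sub>m d))"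
    using wirtinger_exchange[OF w x y] by blast
  have "\<Delta> = Fraction_Field.Fract u 1 * Fraction_Field.Fract (det (fox_matrix E d \<rho> rs (remove1 y xs))) (det (M y - 1\<^sub>m d))"
    unfolding \<Delta> Phi_gen[OF x] using u(2) det_M_nonzero[OF x] det_M_nonzero[OF y]
    by (simp add: eq_fract mult.assoc)
  then show ?thesis using u(1) wirtinger_presents[OF w y] by (auto simp: eq_up_to_unit_def)
qed

end

section \<open>Presentations on the points of a diagram\<close>

lemma presents_rename:
  fixes \<iota> :: "'v \<Rightarrow> 'w" and S :: "('v \<Rightarrow> 'r::comm_ring_1) set"
  assumes p: "presents V (forms.span S) \<delta>" and inj: "inj_on \<iota> V"
  shows "presents (\<iota> ` V) (forms.span (linear_ext V (\<lambda>v. unit_form (\<iota> v)) ` S)) \<delta>"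
proof -
  let ?h = "linear_ext V (\<lambda>v. unit_form (\<iota> v)) :: ('v \<Rightarrow> 'r) \<Rightarrow> _"
  obtain ws fs where ws: "distinct ws" "set ws = V" "length fs = length ws"
    "forms.span (set fs) = forms.span S" "\<delta> = form_det fs ws"
    using p unfolding presents_def by blast
  have fin: "finite V" using ws(2) by auto
  have h: "?h f (\<iota> w) = f w" if "w \<in> V" for f w
  proof -
    have "?h f (\<iota> w) = (\<Sum>v\<in>V. if v = w then f v else 0)"
      unfolding linear_ext_def unit_form_def using that inj by (intro sum.cong) (auto dest: inj_onD)
    then show ?thesis using that fin by simp
  qed
  have supp: "?h f x = 0" if "x \<notin> \<iota> ` V" for f x
    unfolding linear_ext_def unit_form_def using that by (intro sum.neutral) auto
  have sub: "forms.span (?h ` A) \<subseteq> forms.span (?h ` B)" if "forms.span A = forms.span B" for A B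
  proof (rule forms.span_minimal)
    show "?h ` A \<subseteq> forms.span (?h ` B)"
    proof
      fix x assume "x \<in> ?h ` A"
      then obtain a where a: "a \<in> A" "x = ?h a" by blast
      then have "a \<in> forms.span B" using that forms.span_base by blast
      then show "x \<in> forms.span (?h ` B)" unfolding a(2)
      proof (rule linear_ext_span[OF _ _ forms.subspace_span])
        fix g assume "g \<in> B"
        then show "?h g \<in> forms.span (?h ` B)" by (intro forms.span_base imageI)
      qed
    qed
  qed (rule forms.subspace_span)
  have "forms.span (set (map ?h fs)) = forms.span (?h ` S)"
    unfolding set_map by (rule equalityI[OF sub[OF ws(4)] sub[OF ws(4)[symmetric]]])
  moreover have "form_det (map ?h fs) (map \<iota> ws) = \<delta>"
  proof -
    have "mat (length fs) (length ws) (\<lambda>(i, j). (map ?h fs ! i) (map \<iota> ws ! j)) =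
        mat (length fs) (length ws) (\<lambda>(i, j). (fs ! i) (ws ! j))"
    proof (rule eq_matI, goal_cases)
      case (1 i j)
      then have "ws ! j \<in> V" using ws(2) by auto
      then show ?case using 1 by (simp add: h)
    qed simp_all
    then show ?thesis unfolding ws(5) form_det_def by simp
  qed
  moreover have "distinct (map \<iota> ws)" using ws(1,2) inj by (simp add: distinct_map)
  ultimately show ?thesis
    unfolding presents_def using ws supp by (intro exI[of _ "map \<iota> ws"] exI[of _ "map ?h fs"]) auto
qed

text \<open>Linear equivariant maps transport a system from one module of forms to another in
  different variables.\<close>

lemma brick_rels_natural:
  assumes "\<And>x y. h (x + y) = h x + h y" "\<And>x y. h (x - y) = h x - h y" "\<And>g x. h (T g x) = T' g (h x)"
  shows "brick_rels T' b (map (\<lambda>(a, g, x). (a, g, h x)) xs) (map (\<lambda>(a, g, x). (a, g, h x)) ys) = map h (brick_rels T b xs ys)"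
  by (cases "(T, b, xs, ys)" rule: brick_rels.cases) (auto simp: assms cross_rel_def)

lemma map_bottom_slice: "map (\<lambda>(a, g, x). (a, g, h x)) (bottom_slice E \<gamma> u l k) = bottom_slice E \<gamma> (\<lambda>p. h (u p)) l k"
  and map_top_slice: "map (\<lambda>(a, g, x). (a, g, h x)) (top_slice E \<gamma> u l k) = top_slice E \<gamma> (\<lambda>p. h (u p)) l k"
  by (simp_all add: bottom_slice_def top_slice_def)

lemma slice_points:
  assumes "oriented_diagram E" "(l, k) \<in> bricks E"
  shows "i < bot_pos E l k + ins (E ! l ! k) \<Longrightarrow> (l, i) \<in> points E"
    and "i < top_pos E l k + outs (E ! l ! k) \<Longrightarrow> (Suc l, i) \<in> points E"
proof -
  have l: "l < length E" and k: "k < length (E ! l)" using assms(2) by (auto simp: bricks_def)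
  show "i < bot_pos E l k + ins (E ! l ! k) \<Longrightarrow> (l, i) \<in> points E"
    "i < top_pos E l k + outs (E ! l ! k) \<Longrightarrow> (Suc l, i) \<in> points E"
    using width_take[OF k] length_strands[OF assms(1) l] l by (auto simp: points_def bot_pos_def top_pos_def)
qed

definition brick_list :: "diagram \<Rightarrow> (nat \<times> nat) list" where
  "brick_list E = concat (map (\<lambda>l. map (Pair l) [0..<length (E ! l)]) [0..<length E])"

definition diagram_rels :: "('g \<Rightarrow> 'm \<Rightarrow> 'm::ab_group_add) \<Rightarrow> diagram \<Rightarrow> (point \<Rightarrow> 'g) \<Rightarrow> (point \<Rightarrow> 'm) \<Rightarrow> (point \<Rightarrow> 'm) \<Rightarrow> 'm list" where
  "diagram_rels T E \<gamma> u v = concat (map (\<lambda>(l, k). brick_rels T (E ! l ! k) (bottom_slice E \<gamma> u l k) (top_slice E \<gamma> v l k))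
     (brick_list E))"

lemma set_brick_list: "set (brick_list E) = bricks E"
  by (auto simp: brick_list_def bricks_def)

lemma distinct_brick_list: "distinct (brick_list E)"
proof -
  have "distinct (concat (map (\<lambda>l. map (Pair l) [0..<f l]) [0..<n]))" for f :: "nat \<Rightarrow> nat" and n :: nat
    by (induction n) (auto simp: distinct_map inj_on_def)
  then show ?thesis unfolding brick_list_def .
qed

lemma set_diagram_rels: "set (diagram_rels T E \<gamma> u v) =
    (\<Union>(l, k)\<in>bricks E. set (brick_rels T (E ! l ! k) (bottom_slice E \<gamma> u l k) (top_slice E \<gamma> v l k)))"
  unfolding diagram_rels_def by (auto simp: set_brick_list)

lemma length_diagram_rels:
  assumes "oriented_diagram E"
  shows "length (diagram_rels T E \<gamma> u v) = card (points E)"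
proof -
  let ?r = "\<lambda>l k. brick_rels T (E ! l ! k) (bottom_slice E \<gamma> u l k) (top_slice E \<gamma> v l k)"
  have two: "2 * length (?r l k) = ins (E ! l ! k) + outs (E ! l ! k)" for l k
    by (cases "E ! l ! k") (auto simp: bottom_slice_def top_slice_def)
  have "2 * length (diagram_rels T E \<gamma> u v) = (\<Sum>c\<leftarrow>brick_list E. 2 * length (case c of (l, k) \<Rightarrow> ?r l k))"
    unfolding diagram_rels_def length_concat map_map o_def by (simp add: sum_list_const_mult case_prod_unfold)
  also have "\<dots> = (\<Sum>c\<in>bricks E. 2 * length (case c of (l, k) \<Rightarrow> ?r l k))"
    by (simp only: sum_list_distinct_conv_sum_set[OF distinct_brick_list] set_brick_list)
  also have "\<dots> = (\<Sum>(l, k)\<in>bricks E. ins (E ! l ! k) + outs (E ! l ! k))"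
    using two by (intro sum.cong) auto
  also have "\<dots> = 2 * card (points E)" by (rule double_card_points[OF assms, symmetric])
  finally show ?thesis by simp
qed

lemma map_diagram_rels:
  assumes "\<And>x y. h (x + y) = h x + h y" "\<And>x y. h (x - y) = h x - h y" "\<And>g x. h (T g x) = T' g (h x)"
  shows "map h (diagram_rels T E \<gamma> u v) = diagram_rels T' E \<gamma> (\<lambda>p. h (u p)) (\<lambda>p. h (v p))"
  unfolding diagram_rels_def map_concat map_map o_def
  by (intro arg_cong[of _ _ concat] map_cong refl)
    (auto simp: brick_rels_natural[of h T T', OF assms, symmetric] map_bottom_slice map_top_slice)

definition rep_point :: "diagram \<Rightarrow> arc \<Rightarrow> point" where
  "rep_point E a = (SOME p. p \<in> points E \<and> arc_of E p = a)"

lemma rep_point: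
  assumes "a \<in> arcs E"
  shows "rep_point E a \<in> points E" "arc_of E (rep_point E a) = a"
proof -
  have "\<exists>p. p \<in> points E \<and> arc_of E p = a" using assms by (auto simp: arcs_def)
  then have "rep_point E a \<in> points E \<and> arc_of E (rep_point E a) = a" unfolding rep_point_def by (rule someI_ex)
  then show "rep_point E a \<in> points E" "arc_of E (rep_point E a) = a" by auto
qed

text \<open>The twist terms are formed in the variables of the union module and have to be pushed to
  the arcs of \<open>K\<close> and to the points of \<open>D\<close> cut open.\<close>

lemma (in actions) twist_natural:
  assumes "actions T' Ti' C" "\<And>x y. h (x + y) = h x + h y" "\<And>x y. h (x - y) = h x - h y"
    "\<And>g x. h (T g x) = T' g (h x)" "\<And>g x. h (Ti g x) = Ti' g (h x)"
  shows "h (twist_jump g s a n x) = actions.twist_jump T' Ti' g s a n (h x)"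
proof -
  interpret A: actions T' Ti' C by fact
  have h0: "h 0 = 0" using assms(2)[of 0 0] by simp
  have "map_prod h h (twists g s a n p) = A.twists g s a n (map_prod h h p)" for p
  proof (induction n)
    case (Suc n)
    then show ?case
      by (cases "twists g s a n p"; cases "A.twists g s a n (map_prod h h p)")
        (auto simp: twist_def A.twist_def Let_def assms(2-))
  qed simp
  from this[of "(x, 0)"] show ?thesis
    by (simp add: twist_jump_def A.twist_jump_def h0 prod_eq_iff)
qed

context actions_mod
begin

lemma twist_jump_eqv: "x \<approx> y \<Longrightarrow> twist_jump g s a n x \<approx> twist_jump g s a n y"
  using twists_eqv[of x y 0 0] by (simp add: twist_jump_def)

lemma diagram_sys_iff:
  "diagram_sys brick_sys E \<gamma> u v \<longleftrightarrow> diagram_sys (brick_shape C) E \<gamma> u v \<and> set (diagram_rels T E \<gamma> u v) \<subseteq> U"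
  unfolding diagram_sys_def set_diagram_rels brick_sys_def by blast

lemma brick_sys_cong:
  assumes "brick_sys b xs ys" "list_all2 (\<lambda>(a, g, x) (a', g', x'). a = a' \<and> g = g' \<and> x \<approx> x') xs xs'"
    "list_all2 (\<lambda>(a, g, x) (a', g', x'). a = a' \<and> g = g' \<and> x \<approx> x') ys ys'"
  shows "brick_sys b xs' ys'"
proof -
  have d: "y' - x' \<in> U" if "y - x \<in> U" "x \<approx> x'" "y \<approx> y'" for x y x' y'
  proof -
    have "y \<approx> x" using that(1) by (simp add: eqv_def)
    then have "y' \<approx> x'" using that(2,3) by (meson eqv_sym eqv_trans)
    then show ?thesis by (simp add: eqv_def)
  qed
  show ?thesis
    using assms by (cases "(C, b, xs, ys)" rule: brick_shape.cases)
      (auto simp: brick_sys_def list_all2_Cons1 intro: d cross_rel_cong split: if_splits)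
qed

lemma diagram_sys_cong:
  assumes E: "oriented_diagram E" and sys: "diagram_sys brick_sys E \<gamma> u v"
    and "\<And>p. p \<in> points E \<Longrightarrow> u p \<approx> u' p" "\<And>p. p \<in> points E \<Longrightarrow> v p \<approx> v' p"
  shows "diagram_sys brick_sys E \<gamma> u' v'"
  unfolding diagram_sys_def
proof (intro ballI, clarify)
  fix l k assume lk: "(l, k) \<in> bricks E"
  show "brick_sys (E ! l ! k) (bottom_slice E \<gamma> u' l k) (top_slice E \<gamma> v' l k)"
  proof (rule brick_sys_cong)
    show "brick_sys (E ! l ! k) (bottom_slice E \<gamma> u l k) (top_slice E \<gamma> v l k)"
      using sys lk by (auto simp: diagram_sys_def)
  qed (use assms(3,4) slice_points[OF E lk] in
      \<open>auto simp: bottom_slice_def top_slice_def list_all2_map1 list_all2_map2 list.rel_refl intro!: list_all2_all_nthI\<close>)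
qed

lemma diagram_sys_diff:
  assumes "diagram_sys brick_sys E \<gamma> u v" "diagram_sys brick_sys E \<gamma> u' v'"
  shows "diagram_sys brick_sys E \<gamma> (\<lambda>p. u p - u' p) (\<lambda>p. v p - v' p)"
  unfolding diagram_sys_def
proof (intro ballI, clarify)
  fix l k assume lk: "(l, k) \<in> bricks E"
  have U_diff: "x - y \<in> U" if "x \<in> U" "y \<in> U" for x y using U_add[OF that(1) U_minus[OF that(2)]] by simp
  have d: "(x - x') - (y - y') \<in> U" if "x - y \<in> U" "x' - y' \<in> U" for x x' y y'
    using U_diff[OF that] by (simp add: algebra_simps)
  have c: "cross_rel T a (x - x') (y - y') e (z - z') \<in> U" if "cross_rel T a x y e z \<in> U" "cross_rel T a x' y' e z' \<in> U"
    for a x x' y y' e z z'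
    using U_diff[OF that] by (simp add: cross_rel_def T_diff algebra_simps)
  have 1: "brick_sys (E ! l ! k) (bottom_slice E \<gamma> u l k) (top_slice E \<gamma> v l k)"
    "brick_sys (E ! l ! k) (bottom_slice E \<gamma> u' l k) (top_slice E \<gamma> v' l k)"
    using assms lk by (auto simp: diagram_sys_def)
  then show "brick_sys (E ! l ! k) (bottom_slice E \<gamma> (\<lambda>p. u p - u' p) l k) (top_slice E \<gamma> (\<lambda>p. v p - v' p) l k)"
    by (cases "E ! l ! k") (auto simp: brick_sys_def bottom_slice_def top_slice_def intro: d c split: if_splits)
qed

text \<open>A solution on a knot cut open at one point extends to the closed knot: the loop around the
  level of the cut is trivial as seen from below and from above.\<close>

lemma cut_closes:
  assumes D: "oriented_diagram D" and h: "h < length D" "strands D h \<noteq> []"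
    and sys: "diagram_sys brick_sys D \<gamma> u v"
    and eq: "\<And>p. p \<noteq> (h, last_pos D h) \<Longrightarrow> v p = u p"
  shows "u (h, last_pos D h) \<approx> v (h, last_pos D h)"
proof -
  let ?S = "\<lambda>u l. foldl fox_step 0 (level D \<gamma> u l)"
  have step: "?S u l \<approx> ?S v (Suc l)" if "l < length D" for l
    using sys that unfolding diagram_sys_walls[OF D] by (intro wall_sys_fox) auto
  have same: "?S u l = ?S v l" if "l \<noteq> h" for l
    using eq that by (simp add: level_def)
  have below: "?S v l \<approx> 0" if "l \<le> h" for l
    using that
  proof (induction l)
    case 0
    then show ?case by (simp add: level_def)
  next
    case (Suc l)
    then have "?S v (Suc l) \<approx> ?S u l" using h(1) by (intro eqv_sym[OF step]) simp
    also have "?S u l = ?S v l" using Suc by (intro same) simp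
    also have "?S v l \<approx> 0" using Suc by simp
    finally show ?case .
  qed
  have above: "?S u l \<approx> 0" if "h \<le> l" "l \<le> length D" for l
    using that(2,1)
  proof (induction l rule: inc_induct)
    case base
    then show ?case using D by (simp add: level_def)
  next
    case (step n)
    then have "?S u n \<approx> ?S v (Suc n)" by (intro \<open>\<And>l. l < length D \<Longrightarrow> ?S u l \<approx> ?S v (Suc l)\<close>)
    also have "?S v (Suc n) = ?S u (Suc n)" using step by (intro same[symmetric]) simp
    also have "?S u (Suc n) \<approx> 0" using step by simp
    finally show ?case .
  qed
  have "?S u h \<approx> ?S v h" using above[of h] below[of h] h(1) by (meson eqv_sym eqv_trans less_imp_le order_refl)
  \<comment> \<open>The two loops at level \<open>h\<close> start with the same strands and end with
    the cut one, whose value is then determined by the loop.\<close>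
  moreover have "butlast (level D \<gamma> u h) = butlast (level D \<gamma> v h)"
    by (rule nth_equalityI) (auto simp: butlast_level_nth eq)
  ultimately show ?thesis
    by (subst (asm) (1 2) level_butlast[OF h(2)]) (auto intro: fox_step_cancel_value)
qed

end

section \<open>Left values and differences of a solution\<close>

context even_symmetric_union_mod
begin

abbreviation p0 :: point where "p0 \<equiv> (h0, last_pos D h0)"

text \<open>What the tangle at a level adds to the left values from below to above, as a function of
  the differences \<open>G\<close>. It is 0 off the axis and on levels without a ball; at
  \<open>h0\<close> the value 0 is a mere default, as the axis values below and above are unrelated
  there.\<close>

definition shift :: "(point \<Rightarrow> 'm) \<Rightarrow> point \<Rightarrow> 'm" where
  "shift G = (\<lambda>(l, i). if i = last_pos D l \<and> l \<noteq> h0 then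
     (case map_of ts l of None \<Rightarrow> 0 | Some n \<Rightarrow> twist_jump (\<gamma> (l, i)) (n > 0) (last (strands D l)) (nat \<bar>n\<bar>) (G (l, i))) else 0)"

definition left_right :: "(point \<Rightarrow> 'm) \<Rightarrow> point \<Rightarrow> 'm" where
  "left_right \<chi> p = left_upper \<chi> p - right_upper \<chi> p"

lemma shift_eqv: "(\<And>p. p \<in> points D \<Longrightarrow> G p \<approx> G' p) \<Longrightarrow> p \<in> points D \<Longrightarrow> shift G p \<approx> shift G' p"
  by (cases p) (auto simp: shift_def split: option.split intro: twist_jump_eqv)

lemma point_cases:
  assumes p: "(l, i) \<in> points D"
  shows "l < length D" "strands D l \<noteq> []" "i < last_pos D l \<or> i = last_pos D l"
proof -
  have i: "i < length (strands D l)" "l \<le> length D" using p by (auto simp: points_def)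
  then show l: "l < length D" using D(1) by (cases "l = length D") auto
  show st: "strands D l \<noteq> []" using i by auto
  show "i < last_pos D l \<or> i = last_pos D l" using strands_last_pos[OF st] i by auto
qed

context
  fixes \<chi>
  assumes sys: "diagram_sys brick_sys K \<gamma>K \<chi> \<chi>"
begin

text \<open>Even twist regions keep the difference of the two halves, and in
  \<open>B\<^sub>0\<close> it vanishes on both sides. Hence the differences, unlike the left values,
  solve the system of the closed diagram \<open>D\<close>.\<close>

lemma lower_difference:
  assumes "p \<in> points D"
  shows "left_lower \<chi> p - right_lower \<chi> p \<approx> left_right \<chi> p"
proof (cases p)
  case (Pair l i)
  note pc = point_cases[OF assms[unfolded Pair]]
  note un = unglue_inner[OF sys pc(1,2)] unglue_inf[OF sys pc(1,2)] unglue_none[OF sys pc(1,2)] unglue_twist[OF sys pc(1,2)]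
  show ?thesis unfolding Pair left_right_def
  proof (cases "i < last_pos D l")
    case True
    then show "left_lower \<chi> (l, i) - right_lower \<chi> (l, i) \<approx> left_upper \<chi> (l, i) - right_upper \<chi> (l, i)"
      using un(1) by (intro eqv_diff) auto
  next
    case False
    then have i: "i = last_pos D l" using pc by simp
    show "left_lower \<chi> (l, i) - right_lower \<chi> (l, i) \<approx> left_upper \<chi> (l, i) - right_upper \<chi> (l, i)"
    proof (cases "l = h0")
      case True
      then have "left_lower \<chi> (l, i) - right_lower \<chi> (l, i) \<approx> 0" "left_upper \<chi> (l, i) - right_upper \<chi> (l, i) \<approx> 0"
        using un(2) unfolding i by (simp_all add: eqv_def)
      then show ?thesis by (meson eqv_sym eqv_trans)
    next
      case l: False
      show ?thesis
      proof (cases "map_of ts l")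
        case None
        then show ?thesis using un(3)[OF l None] by simp
      next
        case (Some n)
        let ?j = "jump l n (left_lower \<chi> (l, i), right_lower \<chi> (l, i))"
        have "left_upper \<chi> (l, i) - right_upper \<chi> (l, i) \<approx> fst ?j - snd ?j"
          using un(4)[OF l Some] unfolding i by (intro eqv_diff) auto
        also have "fst ?j - snd ?j = left_lower \<chi> (l, i) - right_lower \<chi> (l, i)"
          using even_twists[OF Some] by (simp add: twists_even_diff even_nat_iff)
        finally show ?thesis by (rule eqv_sym)
      qed
    qed
  qed
qed

lemma left_right_sys: "diagram_sys brick_sys D \<gamma> (left_right \<chi>) (left_right \<chi>)"
  by (rule diagram_sys_cong[OF D(1) diagram_sys_diff[OF unglue_sys[OF sys]]])
    (use lower_difference in \<open>auto simp: left_right_def\<close>)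

lemma left_right_p0: "left_right \<chi> p0 \<approx> 0"
  using unglue_inf[OF sys data(1,2)] by (simp add: left_right_def eqv_def)

lemma left_lower_eqv:
  assumes "p \<in> points D" "p \<noteq> p0"
  shows "left_lower \<chi> p \<approx> left_upper \<chi> p - shift (left_right \<chi>) p"
proof (cases p)
  case (Pair l i)
  note pc = point_cases[OF assms(1)[unfolded Pair]]
  note un = unglue_inner[OF sys pc(1,2)] unglue_inf[OF sys pc(1,2)] unglue_none[OF sys pc(1,2)] unglue_twist[OF sys pc(1,2)]
  show ?thesis unfolding Pair
  proof (cases "i < last_pos D l")
    case True
    then show "left_lower \<chi> (l, i) \<approx> left_upper \<chi> (l, i) - shift (left_right \<chi>) (l, i)"
      using un(1) by (simp add: shift_def)
  next
    case False
    then have i: "i = last_pos D l" using pc by simp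
    then have l: "l \<noteq> h0" using assms(2) Pair by auto
    show "left_lower \<chi> (l, i) \<approx> left_upper \<chi> (l, i) - shift (left_right \<chi>) (l, i)"
    proof (cases "map_of ts l")
      case None
      then show ?thesis using un(3)[OF l None] i l by (simp add: shift_def)
    next
      case (Some n)
      let ?J = "twist_jump (\<gamma> (l, i)) (n > 0) (last (strands D l)) (nat \<bar>n\<bar>)"
      have "left_upper \<chi> (l, i) \<approx> left_lower \<chi> (l, i) + ?J (left_lower \<chi> (l, i) - right_lower \<chi> (l, i))"
        using un(4)[OF l Some] even_twists[OF Some] unfolding i by (simp add: twists_even even_nat_iff)
      also have "\<dots> \<approx> left_lower \<chi> (l, i) + ?J (left_right \<chi> (l, i))"
        using lower_difference[OF assms(1)] Pair by (intro eqv_add eqv_refl twist_jump_eqv) simp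
      finally have "left_upper \<chi> (l, i) \<approx> left_lower \<chi> (l, i) + ?J (left_right \<chi> (l, i))" .
      then have "left_upper \<chi> (l, i) - ?J (left_right \<chi> (l, i)) \<approx> left_lower \<chi> (l, i)"
        by (simp add: eqv_def algebra_simps)
      then show ?thesis using Some i l eqv_sym by (simp add: shift_def)
    qed
  qed
qed

text \<open>The left upper values, the differences and the lower value at \<open>p0\<close>
  determine a solution. Stated modulo \<open>U\<close>, this yields surjectivity: \<open>U\<close>
  may be the submodule generated by these values and the relations.\<close>

lemma all_zero:
  assumes "\<And>p. p \<in> points D \<Longrightarrow> left_upper \<chi> p \<approx> 0 \<and> left_right \<chi> p \<approx> 0" "left_lower \<chi> p0 \<approx> 0"
    and q: "q \<in> points K"
  shows "\<chi> q \<approx> 0"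
proof (rule unglue_all_zero[OF sys _ q])
  fix p assume p: "p \<in> points D"
  have u: "left_upper \<chi> p \<approx> 0" "left_right \<chi> p \<approx> 0" using assms(1)[OF p] by auto
  have "right_upper \<chi> p = left_upper \<chi> p - left_right \<chi> p" by (simp add: left_right_def)
  then have ru: "right_upper \<chi> p \<approx> 0" using eqv_diff[OF u] by simp
  have ll: "left_lower \<chi> p \<approx> 0"
  proof (cases "p = p0")
    case False
    have J0: "twist_jump g s a n 0 = 0" for g s a n by (simp add: twist_jump_def)
    have "shift (left_right \<chi>) p \<approx> shift (\<lambda>_. 0) p" using assms(1) p by (intro shift_eqv) auto
    also have "shift (\<lambda>_. 0) p = 0" by (simp add: shift_def J0 split: prod.split option.split)
    finally have "left_upper \<chi> p - shift (left_right \<chi>) p \<approx> 0" using eqv_diff[OF u(1)] by fastforce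
    then show ?thesis using left_lower_eqv[OF p False] by (rule eqv_trans[rotated])
  qed (use assms(2) in simp)
  have "right_lower \<chi> p = left_lower \<chi> p - (left_lower \<chi> p - right_lower \<chi> p)" by simp
  also have "\<dots> \<approx> 0 - 0" using ll eqv_trans[OF lower_difference[OF p] u(2)] by (rule eqv_diff)
  finally have "right_lower \<chi> p \<approx> 0" by simp
  with u(1) ru ll show "left_lower \<chi> p \<approx> 0 \<and> right_lower \<chi> p \<approx> 0 \<and> left_upper \<chi> p \<approx> 0 \<and> right_upper \<chi> p \<approx> 0" by simp
qed

end

lemma glued_upper:
  assumes "p \<in> points D"
  shows "left_upper (glued BL BR UL UR) p = UL p" "right_upper (glued BL BR UL UR) p = UR p"
proof -
  obtain l i where p: "p = (l, i)" by (cases p)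
  have i: "i < length (strands D l)" "l \<le> length D" using assms p by (auto simp: points_def)
  then have l: "l < length D" using D(1) by (cases "l = length D") auto
  have "sym_levels D \<gamma> h0 ts BL BR UL UR ! (segment l + length (axis_tangle D h0 ts l)) = sym_level D \<gamma> UL UR l"
    using nth_concat_map(1)[OF l, of "length (axis_tangle D h0 ts l)" "\<lambda>l. tangle_levels D \<gamma> h0 ts BL BR l @ [sym_level D \<gamma> UL UR l]"]
    by (simp add: sym_levels_def segment_def length_tangle_levels nth_append)
  then show "left_upper (glued BL BR UL UR) p = UL p" "right_upper (glued BL BR UL UR) p = UR p"
    using i by (auto simp: p left_upper_def right_upper_def glued_def val_at_def sym_level_def nth_append rev_nth level_def reflect_def)
qed

lemma glued_p0: "left_lower (glued BL BR UL UR) p0 = BL p0"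
proof -
  have t: "tangle_levels D \<gamma> h0 ts BL BR h0 = [sym_level D \<gamma> BL BR h0, axis_level D \<gamma> BL BR h0 []]"
    by (simp add: tangle_levels_def)
  have "sym_levels D \<gamma> h0 ts BL BR UL UR ! (segment h0 + 0) = sym_level D \<gamma> BL BR h0"
    using nth_concat_map(1)[OF data(1), of 0 "\<lambda>l. tangle_levels D \<gamma> h0 ts BL BR l @ [sym_level D \<gamma> UL UR l]"] t
    by (simp add: sym_levels_def segment_def length_tangle_levels)
  then show ?thesis using strands_last_pos[OF data(2)]
    by (simp add: left_lower_def glued_def val_at_def sym_level_def nth_append level_def)
qed

end

lemma (in actions_mod) sys_of_arcs:
  assumes E: "oriented_diagram E" and shape: "diagram_sys (brick_shape C) E \<gamma> u u"
    and curves: "\<And>p q. (p, q) \<in> curves E \<Longrightarrow> u q \<approx> u p"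
    and cross: "\<And>c p q r. c \<in> crossings E \<Longrightarrow> crossing_points E c = (p, q, r) \<Longrightarrow>
      cross_rel T (\<gamma> p) (u p) (u q) (\<gamma> r) (u r) \<in> U"
  shows "diagram_sys brick_sys E \<gamma> u u"
  unfolding diagram_sys_def
proof (intro ballI, clarify)
  fix l k assume lk: "(l, k) \<in> bricks E"
  show "brick_sys (E ! l ! k) (bottom_slice E \<gamma> u l k) (top_slice E \<gamma> u l k)"
  proof (rule brick_sys_slices[OF E lk])
    show "brick_shape C (E ! l ! k) (bottom_slice E \<gamma> u l k) (top_slice E \<gamma> u l k)"
      using shape lk by (auto simp: diagram_sys_def)
  qed (use curves cross in blast)+
qed

lemma block_ext_var_eq: "finite V \<Longrightarrow> a \<in> V \<Longrightarrow> forms.subspace L \<Longrightarrow> block_ext d V s (var a) - s a \<in> blocks d L"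
  using forms.subspace_0[of L] by (simp add: blocks_def block_ext_var zero_fun_def fun_diff_def)

section \<open>From arcs to points and back; the diagram cut open\<close>

context diagram_rep
begin

text \<open>The tautological solution: each point carries the variables of its arc. The labels
  \<open>\<gamma>\<close> need not be the arcs themselves but only have the same matrices, which
  admits folded labels on the union.\<close>

lemma rel_sys:
  assumes am: "actions_mod (\<lambda>g. block_act d (N g)) Ni C (blocks d L)"
    and shape: "\<And>u. diagram_sys (brick_shape C) E \<gamma> u (u :: point \<Rightarrow> nat \<Rightarrow> arc \<times> nat \<Rightarrow> 'a laurent)"
    and compat: "\<And>q. q \<in> points E \<Longrightarrow> M (arc_of E q) = N (\<gamma> q)"
    and rel: "\<And>c. c \<in> crossings E \<Longrightarrow> rel c \<in> blocks d L"
  shows "diagram_sys (actions_mod.brick_sys (\<lambda>g. block_act d (N g)) C (blocks d L)) E \<gamma>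
    (\<lambda>p. var (arc_of E p)) (\<lambda>p. var (arc_of E p))"
proof -
  interpret am: actions_mod "\<lambda>g. block_act d (N g)" Ni C "blocks d L" by (rule am)
  show ?thesis
  proof (rule am.sys_of_arcs[OF oriented shape])
    fix p q assume "(p, q) \<in> curves E"
    then show "am.eqv (var (arc_of E q)) (var (arc_of E p))" by (simp add: arc_of_curve)
  next
    fix c p q r assume c: "c \<in> crossings E" "crossing_points E c = (p, q, r)"
    then have "M (arc_of E p) = N (\<gamma> p)" "M (arc_of E r) = N (\<gamma> r)"
      using crossing_points_in[OF oriented c] by (auto intro: compat)
    then show "cross_rel (\<lambda>g. block_act d (N g)) (\<gamma> p) (var (arc_of E p)) (var (arc_of E q)) (\<gamma> r) (var (arc_of E r)) \<in> blocks d L"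
      using rel[OF c(1)] by (simp add: rel_points[OF c(2)] cross_rel_def T_def)
  qed
qed

text \<open>Converse of \<open>rel_sys\<close>: a solution is constant along curves, so its values
  at chosen points of the arcs satisfy the crossing relations.\<close>

lemma sys_arcs:
  fixes \<chi> :: "point \<Rightarrow> nat \<Rightarrow> 'w \<Rightarrow> 'a laurent"
  assumes am: "actions_mod (\<lambda>g. block_act d (N g)) Ni C (blocks d L)" and L: "forms.subspace L"
    and sys: "diagram_sys (actions_mod.brick_sys (\<lambda>g. block_act d (N g)) C (blocks d L)) E \<gamma> \<chi> \<chi>"
    and compat: "\<And>q. q \<in> points E \<Longrightarrow> M (arc_of E q) = N (\<gamma> q)"
  shows "p \<in> points E \<Longrightarrow> \<chi> (rep_point E (arc_of E p)) - \<chi> p \<in> blocks d L"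
    and "c \<in> crossings E \<Longrightarrow> block_ext d (arcs E) (\<lambda>a. \<chi> (rep_point E a)) (rel c) \<in> blocks d L"
proof -
  interpret am: actions_mod "\<lambda>g. block_act d (N g)" Ni C "blocks d L" by (rule am)
  have eq: "am.eqv (\<chi> p) (\<chi> q)" if "arc_of E p = arc_of E q" for p q
  proof -
    have "am.eqv (\<chi> p) (\<chi> p) = am.eqv (\<chi> q) (\<chi> p)"
      using that
    proof (rule arc_of_const)
      fix x y assume "(x, y) \<in> curves E"
      then have xy: "am.eqv (\<chi> x) (\<chi> y)" by (rule am.diagram_sys_curves[OF sys])
      show "am.eqv (\<chi> x) (\<chi> p) = am.eqv (\<chi> y) (\<chi> p)"
        by (rule am.eqv_cong[OF xy am.eqv_refl])
    qed
    then show ?thesis by (simp add: am.eqv_sym)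
  qed
  show rep: "\<chi> (rep_point E (arc_of E p)) - \<chi> p \<in> blocks d L" if "p \<in> points E" for p
    using eq[of "rep_point E (arc_of E p)" p] rep_point(2)[of "arc_of E p" E] that
    by (simp add: am.eqv_def arcs_def)
  show "block_ext d (arcs E) (\<lambda>a. \<chi> (rep_point E a)) (rel c) \<in> blocks d L" if c: "c \<in> crossings E"
  proof -
    obtain p q r where cp: "crossing_points E c = (p, q, r)" by (cases "crossing_points E c") auto
    note pts = crossing_points_in[OF oriented c cp]
    let ?h = "block_ext d (arcs E) (\<lambda>a. \<chi> (rep_point E a))"
    have h: "am.eqv (\<chi> p) (?h (var (arc_of E p)))" if "p \<in> points E" for p
    proof -
      have "am.eqv (?h (var (arc_of E p))) (\<chi> (rep_point E (arc_of E p)))"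
        unfolding am.eqv_def using that by (intro block_ext_var_eq L) (auto simp: arcs_def)
      then show ?thesis using rep[OF that] by (meson am.eqv_def am.eqv_sym am.eqv_trans)
    qed
    have "cross_rel (\<lambda>g. block_act d (N g)) (\<gamma> p) (\<chi> p) (\<chi> q) (\<gamma> r) (\<chi> r) \<in> blocks d L"
      by (rule am.diagram_sys_crossing[OF sys c cp oriented])
    then have "cross_rel (\<lambda>g. block_act d (N g)) (\<gamma> p) (?h (var (arc_of E p))) (?h (var (arc_of E q))) (\<gamma> r) (?h (var (arc_of E r))) \<in> blocks d L"
      by (rule am.cross_rel_cong) (use h pts in auto)
    then show ?thesis
      unfolding rel_points[OF cp] cross_rel_def T_def block_ext_diff block_ext_add block_ext_act
      by (simp add: compat pts)
  qed
qed

lemma rel_in_ideal: "c \<in> crossings E \<Longrightarrow> rel c \<in> blocks d (ideal_of y)" "var y \<in> blocks d (ideal_of y)"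
  using subset_blocks_span_rows[of "rel ` crossings E \<union> {var y}" d] unfolding ideal_of_def by auto

lemma subspace_ideal_of: "forms.subspace (ideal_of y)"
  unfolding ideal_of_def by (rule forms.subspace_span)

lemma shape_arcs': "diagram_sys (brick_shape relation) E (arc_of E) u v"
  using shape_arcs by (auto simp: diagram_sys_def)

lemma T_eq: "(\<lambda>g. block_act d (M g)) = T"
  by (auto simp: T_def)

lemma rel_sys_self:
  assumes L: "forms.subspace L" and rel: "\<And>c. c \<in> crossings E \<Longrightarrow> rel c \<in> blocks d L"
  shows "diagram_sys (actions_mod.brick_sys T relation (blocks d L)) E (arc_of E)
    (\<lambda>p. var (arc_of E p)) (\<lambda>p. var (arc_of E p))"
  unfolding T_eq[symmetric]
  by (rule rel_sys[where N = M and Ni = Ti]) (simp_all add: T_eq actions_mod_T L rel shape_arcs')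

lemma sys_arcs_self:
  fixes \<chi> :: "point \<Rightarrow> nat \<Rightarrow> 'w \<Rightarrow> 'a laurent"
  assumes L: "forms.subspace L" and sys: "diagram_sys (actions_mod.brick_sys T relation (blocks d L)) E (arc_of E) \<chi> \<chi>"
  shows "p \<in> points E \<Longrightarrow> \<chi> (rep_point E (arc_of E p)) - \<chi> p \<in> blocks d L"
    and "c \<in> crossings E \<Longrightarrow> block_ext d (arcs E) (\<lambda>a. \<chi> (rep_point E a)) (rel c) \<in> blocks d L"
  using sys_arcs[where N = M and Ni = Ti and C = relation and L = L and \<gamma> = "arc_of E" and \<chi> = \<chi>] sys L
  by (simp_all add: T_eq actions_mod_T)

lemma ideal_of_image:
  assumes L: "forms.subspace L" and rel: "\<And>c. c \<in> crossings E \<Longrightarrow> block_ext d (arcs E) s (rel c) \<in> blocks d L"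
    and y: "y \<in> arcs E" "s y \<in> blocks d L" and f: "f \<in> ideal_of y"
  shows "linear_ext (arcs E \<times> {..<d}) (\<lambda>(v, j). s v j) f \<in> L"
proof (rule block_ext_span[OF f[unfolded ideal_of_def] _ L])
  fix X assume "X \<in> rel ` crossings E \<union> {var y}"
  moreover have "block_ext d (arcs E) s (var y) \<in> blocks d L"
    using y by (auto simp: blocks_def block_ext_var)
  ultimately show "block_ext d (arcs E) s X \<in> blocks d L" using rel by auto
qed

text \<open>Puts 0 on the lower of the two ends that arise when the last strand of level
  \<open>h\<close> is cut. The upper end keeps its variables, as \<open>cut\<close> is used only for
  the values below the levels.\<close>

definition cut :: "nat \<Rightarrow> (point \<Rightarrow> 'm::zero) \<Rightarrow> point \<Rightarrow> 'm" where
  "cut h v p = (if p = (h, last_pos E h) then 0 else v p)"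

definition cut_ideal :: "nat \<Rightarrow> (point \<times> nat \<Rightarrow> 'a laurent) set" where
  "cut_ideal h = forms.span (rows d (set (diagram_rels T E (arc_of E) var (cut h var))))"

text \<open>With the lower end 0, the upper end is 0 too by \<open>cut_closes\<close>. So the points
  of the cut diagram present the module of the arcs of \<open>D\<close> with the arc of the cut
  killed, and there are surjections in both directions.\<close>

lemma cut_presents:
  assumes h: "h < length E" "strands E h \<noteq> []"
    and \<delta>1: "presents (points E \<times> {..<d}) (cut_ideal h) \<delta>1"
    and \<delta>: "presents (arcs E \<times> {..<d}) (ideal_of (arc_of E (h, last_pos E h))) \<delta>"
  shows "\<delta> dvd \<delta>1" "\<delta>1 dvd \<delta>"
proof -
  let ?p0 = "(h, last_pos E h)"
  let ?x0 = "arc_of E ?p0"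
  have p0: "?p0 \<in> points E" using h strands_last_pos[OF h(2)] by (simp add: points_def)
  then have x0: "?x0 \<in> arcs E" by (simp add: arcs_def)
  show "\<delta> dvd \<delta>1"
  proof (rule presents_dvd[OF \<delta> \<delta>1])
    interpret am: actions_mod T Ti relation "blocks d (ideal_of ?x0)"
      by (rule actions_mod_T) (rule subspace_ideal_of)
    let ?s = "\<lambda>p. var (arc_of E p) :: nat \<Rightarrow> arc \<times> nat \<Rightarrow> 'a laurent"
    let ?h = "block_ext d (points E) ?s"
    fix g assume g: "g \<in> cut_ideal h"
    show "linear_ext (points E \<times> {..<d}) (\<lambda>(p, j). ?s p j) g \<in> ideal_of ?x0"
    proof (rule block_ext_span[OF g[unfolded cut_ideal_def] _ subspace_ideal_of])
      fix X assume X: "X \<in> set (diagram_rels T E (arc_of E) var (cut h var))"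
      have sys: "diagram_sys am.brick_sys E (arc_of E) ?s ?s"
        by (rule rel_sys_self) (rule subspace_ideal_of rel_in_ideal | assumption)+
      have hv: "am.eqv (?s p) (?h (var p))" if "p \<in> points E" for p
        unfolding am.eqv_def[of "?s p"] using block_ext_var_eq[OF finite_points that subspace_ideal_of, of d ?s] am.U_minus by fastforce
      have "diagram_sys am.brick_sys E (arc_of E) (\<lambda>p. ?h (var p)) (\<lambda>p. ?h (cut h var p))"
      proof (rule am.diagram_sys_cong[OF oriented sys])
        fix p assume p: "p \<in> points E"
        show "am.eqv (?s p) (?h (var p))" by (rule hv[OF p])
        have "?h 0 = 0" using block_ext_diff[of d "points E" ?s 0 0] by simp
        then show "am.eqv (?s p) (?h (cut h var p))"
          using hv[OF p] rel_in_ideal(2)[of ?x0] by (auto simp: cut_def am.eqv_def)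
      qed
      then have sub: "set (diagram_rels T E (arc_of E) (\<lambda>p. ?h (var p)) (\<lambda>p. ?h (cut h var p))) \<subseteq> blocks d (ideal_of ?x0)"
        by (simp add: am.diagram_sys_iff)
      have eq: "map ?h (diagram_rels T E (arc_of E) var (cut h var)) = diagram_rels T E (arc_of E) (\<lambda>p. ?h (var p)) (\<lambda>p. ?h (cut h var p))"
        by (rule map_diagram_rels) (simp_all add: block_ext_add block_ext_diff T_def block_ext_act)
      have "?h X \<in> set (map ?h (diagram_rels T E (arc_of E) var (cut h var)))" using X by simp
      then show "?h X \<in> blocks d (ideal_of ?x0)" unfolding eq by (rule subsetD[OF sub])
    qed
  next
    fix v assume "v \<in> arcs E \<times> {..<d}"
    then obtain p k where v: "v = (arc_of E p, k)" "p \<in> points E" "k < d" by (auto simp: arcs_def)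
    then have "linear_ext (points E \<times> {..<d}) (\<lambda>(p, j). var (arc_of E p) j) (unit_form (p, k)) - unit_form v = 0"
      by (subst linear_ext_unit) (auto simp: var_def)
    then show "\<exists>g. linear_ext (points E \<times> {..<d}) (\<lambda>(p, j). var (arc_of E p) j) g - unit_form v \<in> ideal_of ?x0"
      using forms.subspace_0[OF subspace_ideal_of] by metis
  qed
  show "\<delta>1 dvd \<delta>"
  proof -
    have sub: "forms.subspace (cut_ideal h)" unfolding cut_ideal_def by (rule forms.subspace_span)
    interpret am: actions_mod T Ti relation "blocks d (cut_ideal h)" by (rule actions_mod_T[OF sub])
    have "set (diagram_rels T E (arc_of E) var (cut h var)) \<subseteq> blocks d (cut_ideal h)"
      unfolding cut_ideal_def by (rule subset_blocks_span_rows)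
    then have sys0: "diagram_sys am.brick_sys E (arc_of E) var (cut h var)"
      using shape_arcs' by (simp add: am.diagram_sys_iff)
    have closes: "am.eqv (var ?p0) (cut h var ?p0)"
      by (rule am.cut_closes[OF oriented h sys0]) (simp add: cut_def)
    have sys: "diagram_sys am.brick_sys E (arc_of E) var var"
      by (rule am.diagram_sys_cong[OF oriented sys0]) (use closes am.eqv_sym in \<open>auto simp: cut_def\<close>)
    have rep: "var (rep_point E (arc_of E p)) - var p \<in> blocks d (cut_ideal h)" if "p \<in> points E" for p
      by (rule sys_arcs_self(1)[OF sub sys that])
    let ?s = "\<lambda>a. var (rep_point E a) :: nat \<Rightarrow> point \<times> nat \<Rightarrow> 'a laurent"
    show ?thesis
    proof (rule presents_dvd[OF \<delta>1 \<delta>])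
      fix f assume "f \<in> ideal_of ?x0"
      then show "linear_ext (arcs E \<times> {..<d}) (\<lambda>(a, j). ?s a j) f \<in> cut_ideal h"
      proof (rule ideal_of_image[OF sub _ x0, rotated 2])
        show "block_ext d (arcs E) ?s (rel c) \<in> blocks d (cut_ideal h)" if "c \<in> crossings E" for c
          by (rule sys_arcs_self(2)[OF sub sys that])
        have "am.eqv (?s ?x0) (var ?p0)" using rep[OF p0] by (simp add: am.eqv_def)
        also have "am.eqv (var ?p0) (cut h var ?p0)" by (rule closes)
        finally show "?s ?x0 \<in> blocks d (cut_ideal h)" by (simp add: am.eqv_def cut_def)
      qed
    next
      fix v assume "v \<in> points E \<times> {..<d}"
      then obtain p k where v: "v = (p, k)" "p \<in> points E" "k < d" by auto
      have "linear_ext (arcs E \<times> {..<d}) (\<lambda>(a, j). ?s a j) (unit_form (arc_of E p, k)) = ?s (arc_of E p) k"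
        using v by (subst linear_ext_unit) (auto simp: arcs_def)
      moreover have "?s (arc_of E p) k - unit_form v \<in> cut_ideal h"
        using rep[OF v(2)] v(1,3) by (simp add: blocks_def var_def fun_diff_def)
      ultimately show "\<exists>g. linear_ext (arcs E \<times> {..<d}) (\<lambda>(a, j). ?s a j) g - unit_form v \<in> cut_ideal h"
        by metis
    qed
  qed
qed

end

lemma linear_ext_compose:
  "linear_ext W s (linear_ext V t f) = linear_ext V (\<lambda>v. linear_ext W s (t v)) f"
proof
  fix x
  have "(\<Sum>w\<in>W. (\<Sum>v\<in>V. f v * t v w) * s w x) = (\<Sum>w\<in>W. \<Sum>v\<in>V. f v * (t v w * s w x))"
    by (simp add: sum_distrib_right mult.assoc)
  also have "\<dots> = (\<Sum>v\<in>V. f v * (\<Sum>w\<in>W. t v w * s w x))"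
    by (subst sum.swap) (simp add: sum_distrib_left)
  finally show "linear_ext W s (linear_ext V t f) x = linear_ext V (\<lambda>v. linear_ext W s (t v)) f x"
    by (simp add: linear_ext_def)
qed

lemma block_ext_compose:
  "block_ext d W s (block_ext d V t X) = block_ext d V (\<lambda>a. block_ext d W s (t a)) X"
  by (rule ext) (simp add: block_ext_def linear_ext_compose case_prod_unfold)

lemma block_ext_cong:
  assumes "\<And>a k. a \<in> V \<Longrightarrow> k < d \<Longrightarrow> s a k = t a k"
  shows "block_ext d V s X = block_ext d V t X"
  unfolding block_ext_def linear_ext_def using assms by (intro ext sum.cong) auto

lemma block_ext_0: "block_ext d V s 0 = 0"
  using block_ext_diff[of d V s 0 0] by simp

text \<open>The zero map is linear and equivariant, so naturality makes the relations between zero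
  values 0 without a look at the bricks.\<close>

lemma diagram_rels_zero: "set (diagram_rels (\<lambda>g. block_act d (M g)) E \<gamma> (\<lambda>_. 0) (\<lambda>_. 0)) \<subseteq> {0 :: nat \<Rightarrow> 'w \<Rightarrow> 'r::comm_ring_1}"
proof -
  have eq: "map (\<lambda>_. 0) (diagram_rels (\<lambda>g. block_act d (M g)) E \<gamma> (\<lambda>_. 0) (\<lambda>_. 0)) =
      diagram_rels (\<lambda>g. block_act d (M g)) E \<gamma> (\<lambda>_. 0) (\<lambda>_. 0 :: nat \<Rightarrow> 'w \<Rightarrow> 'r)"
    by (rule map_diagram_rels) (auto simp: block_act_def fun_eq_iff)
  have "(\<lambda>_. 0) ` set (diagram_rels (\<lambda>g. block_act d (M g)) E \<gamma> (\<lambda>_. 0) (\<lambda>_. 0)) =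
      set (diagram_rels (\<lambda>g. block_act d (M g)) E \<gamma> (\<lambda>_. 0) (\<lambda>_. 0 :: nat \<Rightarrow> 'w \<Rightarrow> 'r))"
    using arg_cong[OF eq, of set] unfolding set_map .
  then show ?thesis by blast
qed

lemma set_block_rows: "set (map (\<lambda>(r, k). r k) (List.product rs [0..<d])) = rows d (set rs)"
  by (force simp: rows_def)

section \<open>Comparison of the two modules\<close>

locale comparison = even_symmetric_union D h0 ts + repD: diagram_rep D d \<rho> R +
    repK: diagram_rep "symmetric_union D h0 ts" d \<rho>K RK
  for D h0 ts d and \<rho> \<rho>K :: "arc free_group set \<Rightarrow> 'a::field mat" and R RK +
  assumes fold_M: "q \<in> points (symmetric_union D h0 ts) \<Longrightarrow>
    repK.M (arc_of (symmetric_union D h0 ts) q) = repD.M (arc_of D (fold_point q))"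
begin

lemma mod_interp:
  "forms.subspace L \<Longrightarrow> even_symmetric_union_mod D h0 ts repD.T repD.Ti repD.relation (blocks d L) (arc_of D)"
  by (intro even_symmetric_union_mod.intro even_symmetric_union_axioms repD.actions_mod_T
      even_symmetric_union_mod_axioms.intro repD.shape_arcs)

definition cut_point :: point where "cut_point = (h0, last_pos D h0)"
definition cut_arc :: arc where "cut_arc = arc_of D cut_point"
text \<open>The left lower end in the \<open>\<infinity>\<close>-tangle. Killing its arc sets the
  value of the left half below the cut to 0.\<close>

definition cut_point_K :: point where "cut_point_K = (segment h0, last_pos D h0)"
definition cut_arc_K :: arc where "cut_arc_K = arc_of K cut_point_K"

definition upper_left :: "point \<Rightarrow> point" where
  "upper_left = (\<lambda>(l, i). (segment l + length (axis_tangle D h0 ts l), i))"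

definition upper_right :: "point \<Rightarrow> point" where
  "upper_right = (\<lambda>(l, i). (segment l + length (axis_tangle D h0 ts l), 2 * length (strands D l) - Suc i))"

text \<open>The generators \<open>Inl p\<close> are the values \<open>f\<close> just above the axis tangle of the level of \<open>p\<close>, the
  generators \<open>Inr a\<close> are the differences \<open>g\<close>; \<open>f_low\<close> is the value
  below the tangle, normalised to \<open>0\<close> on the deleted arc.\<close>

abbreviation vars :: "(point + arc) set" where
  "vars \<equiv> Inl ` points D \<union> Inr ` arcs D"

lemma finite_vars: "finite vars" by simp

definition f_val :: "point \<Rightarrow> nat \<Rightarrow> (point + arc) \<times> nat \<Rightarrow> 'a laurent" where
  "f_val p = var (Inl p)"

definition g_val :: "point \<Rightarrow> nat \<Rightarrow> (point + arc) \<times> nat \<Rightarrow> 'a laurent" where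
  "g_val p = var (Inr (arc_of D p))"

definition f_low :: "point \<Rightarrow> nat \<Rightarrow> (point + arc) \<times> nat \<Rightarrow> 'a laurent" where
  "f_low p = (if p = cut_point then 0
     else f_val p - even_symmetric_union_mod.shift D h0 ts repD.T repD.Ti (arc_of D) g_val p)"

definition g_rels :: "(nat \<Rightarrow> (point + arc) \<times> nat \<Rightarrow> 'a laurent) set" where
  "g_rels = block_ext d (arcs D) (\<lambda>a. var (Inr a)) ` (repD.rel ` crossings D \<union> {var cut_arc})"

definition f_rels :: "(nat \<Rightarrow> (point + arc) \<times> nat \<Rightarrow> 'a laurent) list" where
  "f_rels = diagram_rels repD.T D (arc_of D) f_val f_low"

definition union_ideal :: "((point + arc) \<times> nat \<Rightarrow> 'a laurent) set" where
  "union_ideal = forms.span (rows d (set f_rels \<union> g_rels))"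

lemma cut_point_in: "cut_point \<in> points D" "cut_arc \<in> arcs D"
  using data(1) strands_last_pos[OF data(2)] by (auto simp: cut_point_def cut_arc_def points_def arcs_def)

lemma subspace_union_ideal: "forms.subspace union_ideal"
  unfolding union_ideal_def by (rule forms.subspace_span)

lemma rels_in_union_ideal: "set f_rels \<subseteq> blocks d union_ideal" "g_rels \<subseteq> blocks d union_ideal"
  using subset_blocks_span_rows[of "set f_rels \<union> g_rels" d] unfolding union_ideal_def by auto

lemma upper_in_points:
  assumes "p \<in> points D"
  shows "upper_left p \<in> points K" "upper_right p \<in> points K"
proof -
  interpret A: even_symmetric_union_mod D h0 ts repD.T repD.Ti repD.relation "blocks d (UNIV :: (nat \<Rightarrow> 'a laurent) set)" "arc_of D"
    by (rule mod_interp) simp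
  obtain l i where p: "p = (l, i)" by (cases p)
  note l = A.point_cases[OF assms[unfolded p]]
  have "i < length (strands D l)" using assms p by (simp add: points_def)
  then show "upper_left p \<in> points K" "upper_right p \<in> points K"
    using A.upper_level(2)[OF l(1)] segment_bound[OF l(1), of "length (axis_tangle D h0 ts l)"]
    by (auto simp: p upper_left_def upper_right_def points_def)
qed

lemma cut_point_K_in: "cut_point_K \<in> points K"
proof -
  interpret A: even_symmetric_union_mod D h0 ts repD.T repD.Ti repD.relation "blocks d (UNIV :: (nat \<Rightarrow> 'a laurent) set)" "arc_of D"
    by (rule mod_interp) simp
  show ?thesis
    using A.lower_level(2)[OF data(1)] segment_bound[OF data(1), of 0] strands_last_pos[OF data(2)]
    by (simp add: cut_point_K_def points_def)
qed

lemma cut_arc_K_in: "cut_arc_K \<in> arcs K"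
  using cut_point_K_in by (simp add: cut_arc_K_def arcs_def)

lemma fold_cut_point: "arc_of D (fold_point cut_point_K) = cut_arc"
proof -
  interpret A: even_symmetric_union_mod D h0 ts repD.T repD.Ti repD.relation "blocks d (UNIV :: (nat \<Rightarrow> 'a laurent) set)" "arc_of D"
    by (rule mod_interp) simp
  let ?m = "last_pos D h0"
  have "level K (arc_of D \<circ> fold_point) (\<lambda>_. 0 :: nat \<Rightarrow> nat \<Rightarrow> 'a laurent) (segment h0) ! ?m =
      sym_level D (arc_of D) (A.left_lower (\<lambda>_. 0)) (A.right_lower (\<lambda>_. 0)) h0 ! ?m"
    by (simp only: A.lower_level(1)[OF data(1)])
  then show ?thesis
    using A.lower_level(2)[OF data(1)] strands_last_pos[OF data(2)]
    by (simp add: level_def sym_level_def nth_append cut_point_K_def cut_arc_def cut_point_def del: upt_Suc)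
qed

text \<open>The relations on \<open>f\<close> involve \<open>f\<close> and \<open>g\<close>, those
  on \<open>g\<close> only \<open>g\<close>, so \<open>presents_triangular\<close> applies. The
  diagonal block of \<open>f\<close> is seen by putting \<open>g = 0\<close>: the twist terms vanish
  and \<open>D\<close> cut open remains.\<close>

lemma union_presents:
  assumes \<delta>: "presents (arcs D \<times> {..<d}) (repD.ideal_of cut_arc) \<delta>"
  shows "\<exists>\<delta>1. presents (vars \<times> {..<d}) union_ideal (\<delta>1 * \<delta>) \<and> presents (points D \<times> {..<d}) (repD.cut_ideal h0) \<delta>1"
proof -
  obtain pl where pl: "distinct pl" "set pl = points D" using finite_distinct_list[OF finite_points] by blast
  let ?in = "\<lambda>(p, k). (Inl p :: point + arc, k :: nat)"
  let ?ws = "map ?in (List.product pl [0..<d])" and ?fs = "map (\<lambda>(r, k). r k) (List.product f_rels [0..<d])"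
  let ?V2 = "(Inr ` arcs D :: (point + arc) set) \<times> {..<d}"
  let ?S = "{f :: (point + arc) \<times> nat \<Rightarrow> 'a laurent. \<forall>x. x \<notin> vars \<times> {..<d} \<longrightarrow> f x = 0}"
  have inj: "inj ?in" by (auto simp: inj_on_def)
  have dist: "distinct (List.product pl [0..<d])" using pl(1) by (intro distinct_product) auto
  have len_rels: "length f_rels = length pl"
    unfolding f_rels_def length_diagram_rels[OF D(1)] using distinct_card[OF pl(1)] pl(2) by simp
  have ws: "set ?ws = Inl ` points D \<times> {..<d}" using pl(2) by force
  have V: "set ?ws \<union> ?V2 = vars \<times> {..<d}" unfolding ws by auto
  have sub_S: "forms.subspace ?S"
    by (rule forms.subspaceI) (auto simp: scale_form_def)
  \<comment> \<open>Modulo the forms supported on \<open>vars\<close>, the values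
    \<open>f_val\<close> and \<open>g_val\<close> at points of \<open>D\<close> are 0. The system is
    then congruent to that of the zero solution, so all relations have their support in
    \<open>vars\<close>.\<close>
  have rels_S: "set f_rels \<subseteq> blocks d ?S"
  proof -
    interpret A: even_symmetric_union_mod D h0 ts repD.T repD.Ti repD.relation "blocks d ?S" "arc_of D"
      by (rule mod_interp[OF sub_S])
    have fS: "A.eqv 0 (f_val p)" "A.eqv 0 (g_val p)" if "p \<in> points D" for p
    proof -
      have "f_val p \<in> blocks d ?S" "g_val p \<in> blocks d ?S"
        using that by (auto simp: blocks_def f_val_def g_val_def var_def unit_form_def arcs_def)
      then show "A.eqv 0 (f_val p)" "A.eqv 0 (g_val p)" using A.eqv_0 A.eqv_sym by blast+
    qed
    have J0: "A.twist_jump g s a n 0 = 0" for g s a n by (simp add: A.twist_jump_def)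
    have "A.eqv 0 (f_low p)" if "p \<in> points D" for p
    proof (cases "p = cut_point")
      case False
      have "A.eqv (A.shift (\<lambda>_. 0) p) (A.shift g_val p)" by (rule A.shift_eqv[OF fS(2) that])
      moreover have "A.shift (\<lambda>_. 0) p = 0" by (simp add: A.shift_def J0 split: prod.split option.split)
      ultimately have "A.eqv (0 - 0) (f_val p - A.shift g_val p)" using fS(1)[OF that] by (intro A.eqv_diff) simp_all
      then show ?thesis using False by (simp add: f_low_def)
    next
      case True
      then have "f_low p = 0" by (simp add: f_low_def)
      then show ?thesis by (simp only: A.eqv_refl)
    qed
    moreover have "diagram_sys A.brick_sys D (arc_of D) (\<lambda>_. 0) (\<lambda>_. 0)"
      unfolding A.diagram_sys_iff
    proof
      show "diagram_sys (brick_shape repD.relation) D (arc_of D) (\<lambda>_. 0) (\<lambda>_. 0)" by (rule repD.shape_arcs')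
      have "set (diagram_rels repD.T D (arc_of D) (\<lambda>_. 0) (\<lambda>_. 0)) \<subseteq> {0}"
        unfolding repD.T_eq[symmetric] by (rule diagram_rels_zero)
      then show "set (diagram_rels repD.T D (arc_of D) (\<lambda>_. 0) (\<lambda>_. 0)) \<subseteq> blocks d ?S" using A.U_0 by blast
    qed
    ultimately have "diagram_sys A.brick_sys D (arc_of D) f_val f_low"
      using A.diagram_sys_cong[OF D(1), of "arc_of D" "\<lambda>_. 0" "\<lambda>_. 0" f_val f_low] fS(1) by blast
    then show ?thesis unfolding A.diagram_sys_iff f_rels_def by blast
  qed
  have supp: "f x = 0" if "f \<in> set ?fs" "x \<notin> vars \<times> {..<d}" for f x
  proof -
    have "f \<in> ?S" using that(1) rows_subset[OF rels_S] unfolding set_block_rows by blast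
    then show ?thesis using that(2) by blast
  qed
  let ?\<delta>1 = "form_det ?fs ?ws"
  have "presents (vars \<times> {..<d}) union_ideal (?\<delta>1 * \<delta>)"
  proof -
    let ?\<iota> = "\<lambda>(a, k). (Inr a :: point + arc, k :: nat)"
    have "presents (?\<iota> ` (arcs D \<times> {..<d})) (forms.span (linear_ext (arcs D \<times> {..<d}) (\<lambda>v. unit_form (?\<iota> v)) `
        rows d (repD.rel ` crossings D \<union> {var cut_arc}))) \<delta>"
      by (rule presents_rename[OF \<delta>[unfolded repD.ideal_of_def]]) (auto simp: inj_on_def)
    also have "?\<iota> ` (arcs D \<times> {..<d}) = ?V2" by force
    also have "linear_ext (arcs D \<times> {..<d}) (\<lambda>v. unit_form (?\<iota> v)) ` rows d (repD.rel ` crossings D \<union> {var cut_arc}) = rows d g_rels"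
      by (force simp: g_rels_def rows_def block_ext_def var_def case_prod_unfold)
    finally have "presents (set ?ws \<union> ?V2) (forms.span (set ?fs \<union> forms.span (rows d g_rels))) (?\<delta>1 * \<delta>)"
    proof (rule presents_triangular[rotated 2])
      show "distinct ?ws" using dist inj by (simp add: distinct_map inj_on_def)
      show "length ?fs = length ?ws" using len_rels by simp
      show "set ?ws \<inter> ?V2 = {}" unfolding ws by auto
      show "f x = 0" if "f \<in> set ?fs" "x \<notin> set ?ws \<union> ?V2" for f x using supp that unfolding V by blast
    qed
    also have "forms.span (set ?fs \<union> forms.span (rows d g_rels)) = union_ideal"
      unfolding union_ideal_def rows_Un set_block_rows by (simp add: forms.span_Un forms.span_span)
    finally show ?thesis unfolding V .
  qed
  moreover have "presents (points D \<times> {..<d}) (repD.cut_ideal h0) ?\<delta>1"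
  proof -
    \<comment> \<open>Forgetting the coefficients of the \<open>Inr\<close> generators commutes with
      sums and actions. It carries \<open>f_rels\<close> to the relations of the cut diagram and
      does not change the entries in the columns \<open>?ws\<close>.\<close>
    let ?pull = "\<lambda>f :: (point + arc) \<times> nat \<Rightarrow> 'a laurent. \<lambda>x. f (?in x)"
    let ?Pull = "\<lambda>X k. ?pull (X k)"
    interpret A: even_symmetric_union_mod D h0 ts repD.T repD.Ti repD.relation "blocks d (UNIV :: ((point + arc) \<times> nat \<Rightarrow> 'a laurent) set)" "arc_of D"
      by (rule mod_interp) simp
    have add: "?Pull (X + Y) = ?Pull X + ?Pull Y" and diff: "?Pull (X - Y) = ?Pull X - ?Pull Y" for X Y
      by (simp_all add: fun_eq_iff)
    have act: "?Pull (block_act d N X) = block_act d N (?Pull X)" for N X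
      by (auto simp: block_act_def fun_eq_iff)
    have f: "?Pull (f_val p) = var p" and g: "?Pull (g_val p) = 0" for p
      by (auto simp: f_val_def g_val_def var_def unit_form_def fun_eq_iff)
    have jump: "?Pull (A.twist_jump a s b n X) = actions.twist_jump repD.T repD.Ti a s b n (?Pull X)" for a s b n X
      by (rule A.twist_natural[OF repD.actions_T]) (simp_all only: add diff repD.T_def repD.Ti_def act)
    have jump0: "actions.twist_jump repD.T repD.Ti a s b n (0 :: nat \<Rightarrow> point \<times> nat \<Rightarrow> 'a laurent) = 0" for a s b n
    proof -
      interpret Q: actions "repD.T :: arc \<Rightarrow> (nat \<Rightarrow> point \<times> nat \<Rightarrow> 'a laurent) \<Rightarrow> _" repD.Ti repD.relation
        by (rule repD.actions_T)
      show ?thesis by (simp add: Q.twist_jump_def)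
    qed
    have pull0: "?Pull 0 = 0" "(\<lambda>k x. 0) = (0 :: nat \<Rightarrow> point \<times> nat \<Rightarrow> 'a laurent)" by (simp_all add: fun_eq_iff)
    have "?Pull (A.shift g_val p) = 0" for p
    proof (cases p)
      case (Pair l i)
      then show ?thesis by (cases "map_of ts l") (simp_all add: A.shift_def pull0 jump g jump0)
    qed
    note shift = this
    have low: "?Pull (f_low p) = repD.cut h0 var p" for p
    proof (cases "p = cut_point")
      case True
      then have "f_low p = 0" "repD.cut h0 var p = (0 :: nat \<Rightarrow> point \<times> nat \<Rightarrow> 'a laurent)"
        by (simp_all add: f_low_def repD.cut_def cut_point_def)
      then show ?thesis by (simp only: pull0)
    next
      case False
      then have "f_low p = f_val p - A.shift g_val p" "repD.cut h0 var p = (var p :: nat \<Rightarrow> point \<times> nat \<Rightarrow> 'a laurent)"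
        by (simp_all add: f_low_def repD.cut_def cut_point_def)
      then show ?thesis by (simp only: diff f shift diff_0_right)
    qed
    have rels: "map ?Pull f_rels = diagram_rels repD.T D (arc_of D) var (repD.cut h0 var)"
    proof -
      have "map ?Pull f_rels = diagram_rels repD.T D (arc_of D) (\<lambda>p. ?Pull (f_val p)) (\<lambda>p. ?Pull (f_low p))"
        unfolding f_rels_def by (rule map_diagram_rels) (simp_all only: add diff repD.T_def act)
      then show ?thesis unfolding f low .
    qed
    have "set (map ?pull ?fs) = rows d (set (map ?Pull f_rels))"
      unfolding set_map set_block_rows[of f_rels, unfolded set_map] by (force simp: rows_def)
    then have span: "forms.span (set (map ?pull ?fs)) = repD.cut_ideal h0"
      unfolding rels repD.cut_ideal_def by simp
    have det: "form_det ?fs ?ws = form_det (map ?pull ?fs) (List.product pl [0..<d])"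
    proof -
      have "mat (length ?fs) (length ?ws) (\<lambda>(i, j). (?fs ! i) (?ws ! j)) =
          mat (length ?fs) (length ?ws) (\<lambda>(i, j). (map ?pull ?fs ! i) (List.product pl [0..<d] ! j))"
        by (rule eq_matI) auto
      then show ?thesis by (simp add: form_det_def)
    qed
    have supp': "?pull f x = 0" if "f \<in> set ?fs" "x \<notin> points D \<times> {..<d}" for f x
    proof (rule supp[OF that(1)])
      show "?in x \<notin> vars \<times> {..<d}" using that(2) by (cases x) auto
    qed
    have "\<forall>f\<in>set (map ?pull ?fs). \<forall>x. x \<notin> points D \<times> {..<d} \<longrightarrow> f x = 0"
    proof (intro ballI allI impI)
      fix f x assume "f \<in> set (map ?pull ?fs)" and x: "x \<notin> points D \<times> {..<d}"
      then obtain f' where "f' \<in> set ?fs" "f = ?pull f'" unfolding set_map[of ?pull ?fs] by (elim imageE)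
      then show "f x = 0" using supp'[OF _ x] by (simp only:)
    qed
    moreover have "set (List.product pl [0..<d]) = points D \<times> {..<d}"
      by (simp only: set_product pl(2) set_upt atLeast0LessThan)
    moreover have "length (map ?pull ?fs) = length (List.product pl [0..<d])" using len_rels by simp
    ultimately show ?thesis
      unfolding presents_def det
      apply (intro exI[of _ "List.product pl [0..<d]"] exI[of _ "map ?pull ?fs"] conjI)
      using dist span by (simp_all only: )
  qed
  ultimately show ?thesis by blast
qed

lemma compat: "q \<in> points K \<Longrightarrow> repK.M (arc_of K q) = repD.M ((arc_of D \<circ> fold_point) q)"
  using fold_M by simp

text \<open>A map of the union module onto that of \<open>K\<close>: \<open>f\<close> goes to the
  left upper values of the tautological solution on \<open>K\<close>, and \<open>g\<close> to the
  differences of its halves.\<close>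

lemma union_dvd_K:
  assumes \<delta>K: "presents (arcs K \<times> {..<d}) (repK.ideal_of cut_arc_K) \<delta>K"
    and \<delta>T: "presents (vars \<times> {..<d}) union_ideal \<delta>T"
  shows "\<delta>K dvd \<delta>T"
proof -
  let ?I = "repK.ideal_of cut_arc_K"
  note I = repK.subspace_ideal_of[of cut_arc_K]
  interpret A: even_symmetric_union_mod D h0 ts repD.T repD.Ti repD.relation "blocks d ?I" "arc_of D"
    by (rule mod_interp[OF I])
  let ?\<chi> = "\<lambda>q. var (arc_of K q) :: nat \<Rightarrow> arc \<times> nat \<Rightarrow> 'a laurent"
  let ?s = "\<lambda>v. case v of Inl p \<Rightarrow> A.left_upper ?\<chi> p | Inr a \<Rightarrow> A.left_right ?\<chi> (rep_point D a)"
  let ?H = "block_ext d vars ?s"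
  have am: "actions_mod (\<lambda>g. block_act d (repD.M g)) repD.Ti repD.relation (blocks d ?I)"
    unfolding repD.T_eq by (rule repD.actions_mod_T[OF I])
  have sys: "diagram_sys A.brick_sys K (arc_of D \<circ> fold_point) ?\<chi> ?\<chi>"
    using repK.rel_sys[OF am A.K_brick_shape' compat repK.rel_in_ideal(1)] unfolding repD.T_eq .
  note lr_sys = A.left_right_sys[OF sys]
  have lr_rep: "A.eqv (A.left_right ?\<chi> (rep_point D (arc_of D p))) (A.left_right ?\<chi> p)" if "p \<in> points D" for p
    unfolding A.eqv_def by (rule repD.sys_arcs_self(1)[OF I lr_sys that])
  have H_f: "A.eqv (A.left_upper ?\<chi> p) (?H (f_val p))" if "p \<in> points D" for p
    using block_ext_var_eq[OF finite_vars _ I, of "Inl p" d ?s] that A.eqv_sym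
    by (auto simp: f_val_def A.eqv_def[symmetric])
  have H_g: "A.eqv (A.left_right ?\<chi> p) (?H (g_val p))" if "p \<in> points D" for p
  proof -
    have "A.eqv (?H (g_val p)) (A.left_right ?\<chi> (rep_point D (arc_of D p)))"
      using block_ext_var_eq[OF finite_vars _ I, of "Inr (arc_of D p)" d ?s] that
      by (auto simp: g_val_def A.eqv_def[symmetric] arcs_def)
    then show ?thesis using lr_rep[OF that] by (meson A.eqv_sym A.eqv_trans)
  qed
  have p0: "A.left_lower ?\<chi> cut_point \<in> blocks d ?I"
    using repK.rel_in_ideal(2)[of cut_arc_K] by (simp add: A.left_lower_def cut_point_def cut_arc_K_def cut_point_K_def)
  have H_low: "A.eqv (A.left_lower ?\<chi> p) (?H (f_low p))" if p: "p \<in> points D" for p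
  proof (cases "p = cut_point")
    case True
    then show ?thesis using p0 by (simp add: f_low_def block_ext_0 A.eqv_def)
  next
    case False
    interpret B: even_symmetric_union_mod D h0 ts repD.T repD.Ti repD.relation "blocks d (UNIV :: ((point + arc) \<times> nat \<Rightarrow> 'a laurent) set)" "arc_of D"
      by (rule mod_interp) simp
    have jump: "?H (B.twist_jump a s b n X) = A.twist_jump a s b n (?H X)" for a s b n X
      by (rule B.twist_natural[OF repD.actions_T]) (simp_all only: block_ext_add block_ext_diff repD.T_def repD.Ti_def block_ext_act)
    have "?H (B.shift g_val p) = A.shift (\<lambda>p. ?H (g_val p)) p"
      by (cases p; cases "map_of ts (fst p)") (simp_all add: B.shift_def A.shift_def jump block_ext_0)
    then have eq: "?H (f_low p) = ?H (f_val p) - A.shift (\<lambda>p. ?H (g_val p)) p"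
      using False by (simp add: f_low_def block_ext_diff)
    have "A.eqv (A.left_lower ?\<chi> p) (A.left_upper ?\<chi> p - A.shift (A.left_right ?\<chi>) p)"
      using A.left_lower_eqv[OF sys p] False by (simp add: cut_point_def)
    also have "A.eqv (A.left_upper ?\<chi> p - A.shift (A.left_right ?\<chi>) p) (?H (f_low p))"
      unfolding eq by (intro A.eqv_diff H_f[OF p] A.shift_eqv[OF H_g p])
    finally show ?thesis .
  qed
  have g_image: "?H (block_ext d (arcs D) (\<lambda>a. var (Inr a)) Y) = block_ext d (arcs D) (\<lambda>a. A.left_right ?\<chi> (rep_point D a)) Y" for Y
    unfolding block_ext_compose by (rule block_ext_cong) (simp add: block_ext_var finite_vars)
  show ?thesis
  proof (rule presents_dvd[OF \<delta>K \<delta>T])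
    fix f assume "f \<in> union_ideal"
    then show "linear_ext (vars \<times> {..<d}) (\<lambda>(v, j). ?s v j) f \<in> ?I"
      unfolding union_ideal_def
    proof (rule block_ext_span[OF _ _ I])
      fix X assume "X \<in> set f_rels \<union> g_rels"
      then consider "X \<in> set f_rels" | Y where "Y \<in> repD.rel ` crossings D \<union> {var cut_arc}" "X = block_ext d (arcs D) (\<lambda>a. var (Inr a)) Y"
        by (auto simp: g_rels_def)
      then show "?H X \<in> blocks d ?I"
      proof cases
        case 1
        have "diagram_sys A.brick_sys D (arc_of D) (\<lambda>p. ?H (f_val p)) (\<lambda>p. ?H (f_low p))"
          by (rule A.diagram_sys_cong[OF D(1) A.unglue_sys(1)[OF sys] H_f H_low])
        then have sub: "set (diagram_rels repD.T D (arc_of D) (\<lambda>p. ?H (f_val p)) (\<lambda>p. ?H (f_low p))) \<subseteq> blocks d ?I"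
          unfolding A.diagram_sys_iff by blast
        have eq: "map ?H f_rels = diagram_rels repD.T D (arc_of D) (\<lambda>p. ?H (f_val p)) (\<lambda>p. ?H (f_low p))"
          unfolding f_rels_def by (rule map_diagram_rels) (simp_all only: block_ext_add block_ext_diff repD.T_def block_ext_act)
        have "?H X \<in> set (map ?H f_rels)" using 1 by simp
        then show ?thesis unfolding eq by (rule subsetD[OF sub])
      next
        case 2
        have "A.eqv (A.left_right ?\<chi> (rep_point D cut_arc)) 0"
          using A.eqv_trans[OF lr_rep[OF cut_point_in(1)]] A.left_right_p0[OF sys] by (simp add: cut_arc_def cut_point_def)
        then have "A.left_right ?\<chi> (rep_point D cut_arc) \<in> blocks d ?I" by (simp only: A.eqv_0)
        then have "block_ext d (arcs D) (\<lambda>a. A.left_right ?\<chi> (rep_point D a)) (var cut_arc) \<in> blocks d ?I"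
          using cut_point_in(2) by (auto simp: blocks_def block_ext_var)
        then show ?thesis
          using 2(1) repD.sys_arcs_self(2)[OF I lr_sys] unfolding 2(2) g_image by auto
      qed
    qed
  next
    \<comment> \<open>\<open>?L\<close> is the image of the map plus the relations. Modulo
      \<open>?L\<close> the left upper values, the differences and the killed arc vanish, hence by
      \<open>all_zero\<close> the whole tautological solution: the map is onto.\<close>
    let ?L = "{y. \<exists>g. linear_ext (vars \<times> {..<d}) (\<lambda>(v, j). ?s v j) g - y \<in> ?I}"
    have sub_L: "forms.subspace ?L"
    proof (rule forms.subspaceI)
      show "0 \<in> ?L" using forms.subspace_0[OF I] linear_ext_0[of "vars \<times> {..<d}" "\<lambda>(v, j). ?s v j"]
        by (auto intro!: exI[of _ 0])
      fix x y assume "x \<in> ?L" "y \<in> ?L"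
      then obtain g g' where "linear_ext (vars \<times> {..<d}) (\<lambda>(v, j). ?s v j) g - x \<in> ?I"
        "linear_ext (vars \<times> {..<d}) (\<lambda>(v, j). ?s v j) g' - y \<in> ?I" by blast
      from forms.subspace_add[OF I this]
      have "linear_ext (vars \<times> {..<d}) (\<lambda>(v, j). ?s v j) (g + g') - (x + y) \<in> ?I"
        unfolding linear_ext_add by (simp add: algebra_simps)
      then show "x + y \<in> ?L" by blast
    next
      fix c x assume "x \<in> ?L"
      then obtain g where "linear_ext (vars \<times> {..<d}) (\<lambda>(v, j). ?s v j) g - x \<in> ?I" by blast
      from forms.subspace_scale[OF I this]
      have "linear_ext (vars \<times> {..<d}) (\<lambda>(v, j). ?s v j) (scale_form c g) - scale_form c x \<in> ?I"
        unfolding linear_ext_scale forms.scale_right_diff_distrib .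
      then show "scale_form c x \<in> ?L" by blast
    qed
    have I_L: "x \<in> ?L" if "x \<in> ?I" for x
    proof -
      have "linear_ext (vars \<times> {..<d}) (\<lambda>(v, j). ?s v j) 0 - x \<in> ?I"
        using forms.subspace_neg[OF I that] by (simp only: linear_ext_0 diff_0)
      then show ?thesis by blast
    qed
    then have U_L: "blocks d ?I \<subseteq> blocks d ?L" by (auto simp: blocks_def)
    have s_L: "?s v \<in> blocks d ?L" if "v \<in> vars" for v
      unfolding blocks_def
    proof (intro CollectI allI impI)
      fix k assume "k < d"
      then have "linear_ext (vars \<times> {..<d}) (\<lambda>(v, j). ?s v j) (unit_form (v, k)) = ?s v k"
        using that by (subst linear_ext_unit) auto
      then have "linear_ext (vars \<times> {..<d}) (\<lambda>(v, j). ?s v j) (unit_form (v, k)) - ?s v k \<in> ?I"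
        using forms.subspace_0[OF I] by simp
      then show "\<exists>g. linear_ext (vars \<times> {..<d}) (\<lambda>(v, j). ?s v j) g - ?s v k \<in> ?I" by blast
    qed
    interpret B: even_symmetric_union_mod D h0 ts repD.T repD.Ti repD.relation "blocks d ?L" "arc_of D"
      by (rule mod_interp[OF sub_L])
    have B_sys: "diagram_sys B.brick_sys K (arc_of D \<circ> fold_point) ?\<chi> ?\<chi>"
      using sys U_L unfolding A.diagram_sys_iff B.diagram_sys_iff by blast
    fix v assume "v \<in> arcs K \<times> {..<d}"
    then obtain q k where v: "v = (arc_of K q, k)" "q \<in> points K" "k < d" by (auto simp: arcs_def)
    have "B.eqv (?\<chi> q) 0"
    proof (rule B.all_zero[OF B_sys _ _ v(2)])
      fix p assume p: "p \<in> points D"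
      have "B.left_upper ?\<chi> p \<in> blocks d ?L" using s_L[of "Inl p"] p by simp
      moreover have "B.left_right ?\<chi> p \<in> blocks d ?L"
      proof -
        have "B.left_right ?\<chi> (rep_point D (arc_of D p)) \<in> blocks d ?L"
          using s_L[of "Inr (arc_of D p)"] p by (simp add: arcs_def)
        moreover have "B.eqv (A.left_right ?\<chi> p) (A.left_right ?\<chi> (rep_point D (arc_of D p)))"
          using A.eqv_sym[OF lr_rep[OF p]] U_L unfolding A.eqv_def B.eqv_def by blast
        ultimately show ?thesis using B.eqv_0 B.eqv_trans by blast
      qed
      ultimately show "B.eqv (B.left_upper ?\<chi> p) 0 \<and> B.eqv (B.left_right ?\<chi> p) 0" by (simp add: B.eqv_def)
    next
      show "B.eqv (B.left_lower ?\<chi> (h0, last_pos D h0)) 0"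
        using p0 U_L by (auto simp: B.eqv_def cut_point_def)
    qed
    then have "?\<chi> q \<in> blocks d ?L" by (simp only: B.eqv_0)
    then have "\<forall>k<d. ?\<chi> q k \<in> ?L" unfolding blocks_def by (rule CollectD)
    then have "?\<chi> q k \<in> ?L" using v(3) by blast
    then have "unit_form v \<in> ?L" unfolding v(1) var_def .
    then show "\<exists>g. linear_ext (vars \<times> {..<d}) (\<lambda>(v, j). ?s v j) g - unit_form v \<in> ?I" by blast
  qed
qed

text \<open>The opposite map is a solution on \<open>K\<close> with values in the union module,
  glued from \<open>f\<close> on the left and \<open>f - g\<close> on the right. It is onto because
  \<open>f\<close> and \<open>g\<close> reappear as a value and a difference of values on the levels
  above the tangles.\<close>

lemma K_dvd_union:
  assumes \<delta>K: "presents (arcs K \<times> {..<d}) (repK.ideal_of cut_arc_K) \<delta>K"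
    and \<delta>T: "presents (vars \<times> {..<d}) union_ideal \<delta>T"
  shows "\<delta>T dvd \<delta>K"
proof -
  note I = subspace_union_ideal
  interpret A: even_symmetric_union_mod D h0 ts repD.T repD.Ti repD.relation "blocks d union_ideal" "arc_of D"
    by (rule mod_interp[OF I])
  have f_sys: "diagram_sys A.brick_sys D (arc_of D) f_val f_low"
    using repD.shape_arcs' rels_in_union_ideal(1) by (simp add: A.diagram_sys_iff f_rels_def)
  let ?\<iota> = "block_ext d (arcs D) (\<lambda>a. var (Inr a)) :: _ \<Rightarrow> nat \<Rightarrow> (point + arc) \<times> nat \<Rightarrow> 'a laurent"
  have \<iota>: "A.eqv (?\<iota> (var (arc_of D p))) (g_val p)" if "p \<in> points D" for p
    using block_ext_var_eq[OF finite_arcs _ I, of "arc_of D p" D d "\<lambda>a. var (Inr a)"] that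
    by (auto simp: g_val_def A.eqv_def[symmetric] arcs_def)
  have g_sys: "diagram_sys A.brick_sys D (arc_of D) g_val g_val"
  proof (rule A.sys_of_arcs[OF D(1) repD.shape_arcs'])
    show "A.eqv (g_val q) (g_val p)" if "(p, q) \<in> curves D" for p q
      using arc_of_curve[OF that] by (simp add: g_val_def)
    fix c p q r assume c: "c \<in> crossings D" and cp: "crossing_points D c = (p, q, r)"
    have "?\<iota> (repD.rel c) \<in> blocks d union_ideal" using c rels_in_union_ideal(2) by (auto simp: g_rels_def)
    then have "cross_rel repD.T (arc_of D p) (?\<iota> (var (arc_of D p))) (?\<iota> (var (arc_of D q))) (arc_of D r) (?\<iota> (var (arc_of D r))) \<in> blocks d union_ideal"
      unfolding repD.rel_points[OF cp] cross_rel_def block_ext_diff block_ext_add repD.T_def block_ext_act .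
    then show "cross_rel repD.T (arc_of D p) (g_val p) (g_val q) (arc_of D r) (g_val r) \<in> blocks d union_ideal"
      by (rule A.cross_rel_cong) (use \<iota> crossing_points_in[OF D(1) c cp] in auto)
  qed
  have cut: "A.eqv (g_val cut_point) 0"
  proof -
    have "?\<iota> (var cut_arc) \<in> blocks d union_ideal" using rels_in_union_ideal(2) by (auto simp: g_rels_def)
    then have "A.eqv (?\<iota> (var (arc_of D cut_point))) 0" by (simp add: cut_arc_def A.eqv_def)
    then show ?thesis using \<iota>[OF cut_point_in(1)] by (meson A.eqv_sym A.eqv_trans)
  qed
  let ?UR = "\<lambda>p. f_val p - g_val p" and ?BR = "\<lambda>p. f_low p - g_val p"
  define \<chi> where "\<chi> = A.glued f_low ?BR f_val ?UR"
  have sys: "diagram_sys A.brick_sys K (arc_of D \<circ> fold_point) \<chi> \<chi>"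
    unfolding \<chi>_def
  proof (rule A.glued_sys[OF f_sys A.diagram_sys_diff[OF f_sys g_sys]])
    show "f_val (l, i) = f_low (l, i) \<and> ?UR (l, i) = ?BR (l, i)" if "i < last_pos D l" for l i
      using that by (auto simp: f_low_def cut_point_def A.shift_def)
    show "A.eqv (f_low (h0, last_pos D h0)) (?BR (h0, last_pos D h0)) \<and> A.eqv (f_val (h0, last_pos D h0)) (?UR (h0, last_pos D h0))"
      using cut by (simp add: A.eqv_def cut_point_def)
    show "f_val (l, last_pos D l) = f_low (l, last_pos D l) \<and> ?UR (l, last_pos D l) = ?BR (l, last_pos D l)"
      if "l \<noteq> h0" "map_of ts l = None" for l
      using that by (auto simp: f_low_def cut_point_def A.shift_def)
    fix l n assume l: "l \<noteq> h0" and n: "map_of ts l = Some n"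
    \<comment> \<open>An even region moves both strands by the same jump, and \<open>f_low\<close>
      is \<open>f\<close> minus this jump; so the pair \<open>f_low\<close>,
      \<open>f_low - g\<close> is carried to \<open>f\<close>, \<open>f - g\<close>.\<close>
    have "even (nat \<bar>n\<bar>)" using even_twists[OF n] by (simp add: even_nat_iff)
    then show "(f_val (l, last_pos D l), ?UR (l, last_pos D l)) =
        A.jump l n (f_low (l, last_pos D l), ?BR (l, last_pos D l))"
      using l n by (simp add: A.twists_even f_low_def cut_point_def A.shift_def)
  qed
  have am: "actions_mod (\<lambda>g. block_act d (repD.M g)) repD.Ti repD.relation (blocks d union_ideal)"
    unfolding repD.T_eq by (rule repD.actions_mod_T[OF I])
  note sa = repK.sys_arcs[OF am I, unfolded repD.T_eq, OF sys compat]
  have upper: "\<chi> (upper_left p) = f_val p" "\<chi> (upper_right p) = ?UR p" if "p \<in> points D" for p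
    using A.glued_upper[OF that, of f_low ?BR f_val ?UR]
    by (cases p; simp add: \<chi>_def A.left_upper_def A.right_upper_def upper_left_def upper_right_def)+
  have lower: "\<chi> cut_point_K = 0"
    using A.glued_p0[of f_low ?BR f_val ?UR]
    by (simp add: \<chi>_def A.left_lower_def cut_point_K_def f_low_def cut_point_def)
  let ?s = "\<lambda>a. \<chi> (rep_point K a)"
  have image: "linear_ext (arcs K \<times> {..<d}) (\<lambda>(a, j). ?s a j) (unit_form (arc_of K q, k)) - \<chi> q k \<in> union_ideal"
    if "q \<in> points K" "k < d" for q k
  proof -
    have "linear_ext (arcs K \<times> {..<d}) (\<lambda>(a, j). ?s a j) (unit_form (arc_of K q, k)) = ?s (arc_of K q) k"
      using that by (subst linear_ext_unit) (auto simp: arcs_def)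
    then show ?thesis using sa(1)[OF _ that(1)] that(2) by (simp add: blocks_def)
  qed
  show ?thesis
  proof (rule presents_dvd[OF \<delta>T \<delta>K])
    fix f assume "f \<in> repK.ideal_of cut_arc_K"
    then show "linear_ext (arcs K \<times> {..<d}) (\<lambda>(a, j). ?s a j) f \<in> union_ideal"
    proof (rule repK.ideal_of_image[OF I _ cut_arc_K_in, rotated 2])
      show "block_ext d (arcs K) ?s (repK.rel c) \<in> blocks d union_ideal" if "c \<in> crossings K" for c
        using sa(2)[OF _ that] by simp
      show "?s cut_arc_K \<in> blocks d union_ideal"
        using sa(1)[OF _ cut_point_K_in] by (simp add: lower cut_arc_K_def)
    qed
  next
    fix v assume "v \<in> vars \<times> {..<d}"
    then consider p k where "v = (Inl p, k)" "p \<in> points D" "k < d" | a k where "v = (Inr a, k)" "a \<in> arcs D" "k < d"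
      by auto
    then show "\<exists>g. linear_ext (arcs K \<times> {..<d}) (\<lambda>(a, j). ?s a j) g - unit_form v \<in> union_ideal"
    proof cases
      case 1
      then show ?thesis using image[OF upper_in_points(1)[OF 1(2)] 1(3)] upper(1)[OF 1(2)]
        by (auto simp: f_val_def var_def)
    next
      case 2
      let ?p = "rep_point D a"
      note p = rep_point[OF 2(2)]
      let ?e = "\<lambda>q. unit_form (arc_of K q, k) :: _ \<Rightarrow> 'a laurent"
      let ?l = "linear_ext (arcs K \<times> {..<d}) (\<lambda>(a, j). ?s a j)"
      have "(?l (?e (upper_left ?p)) - \<chi> (upper_left ?p) k) - (?l (?e (upper_right ?p)) - \<chi> (upper_right ?p) k) \<in> union_ideal"
        by (intro forms.subspace_diff[OF I] image upper_in_points p 2(3))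
      also have "(?l (?e (upper_left ?p)) - \<chi> (upper_left ?p) k) - (?l (?e (upper_right ?p)) - \<chi> (upper_right ?p) k) =
          ?l (?e (upper_left ?p) - ?e (upper_right ?p)) - unit_form v"
        unfolding linear_ext_diff upper[OF p(1)] by (simp add: g_val_def p(2) var_def 2(1) algebra_simps)
      finally show ?thesis by blast
    qed
  qed
qed

text \<open>One factor \<open>\<delta>\<close> belongs to the differences \<open>g\<close>. The
  other factor \<open>\<delta>1\<close> belongs to \<open>D\<close> cut open and equals
  \<open>\<delta>\<close> up to a unit by \<open>cut_presents\<close>.\<close>

theorem fitting_symmetric_union:
  assumes "presents (arcs K \<times> {..<d}) (repK.ideal_of cut_arc_K) \<delta>K"
    and "presents (arcs D \<times> {..<d}) (repD.ideal_of cut_arc) \<delta>"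
  shows "\<exists>u. u dvd 1 \<and> \<delta>K = u * \<delta> ^ 2"
proof -
  obtain \<delta>1 where \<delta>1: "presents (vars \<times> {..<d}) union_ideal (\<delta>1 * \<delta>)"
    "presents (points D \<times> {..<d}) (repD.cut_ideal h0) \<delta>1"
    using union_presents[OF assms(2)] by blast
  obtain u where u: "u dvd 1" "\<delta>K = u * (\<delta>1 * \<delta>)"
    using dvd_antisym_unit[OF union_dvd_K[OF assms(1) \<delta>1(1)] K_dvd_union[OF assms(1) \<delta>1(1)]] by blast
  note cut = repD.cut_presents[OF data(1,2) \<delta>1(2) assms(2)[unfolded cut_arc_def cut_point_def]]
  obtain w where w: "w dvd 1" "\<delta>1 = w * \<delta>"
    using dvd_antisym_unit[OF cut(2,1)] by blast
  have "\<delta>K = (u * w) * \<delta> ^ 2" unfolding u(2) w(2) by (simp add: power2_eq_square mult.assoc)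
  moreover have "u * w dvd 1" using u(1) w(1) by (metis mult_dvd_mono mult_1)
  ultimately show ?thesis by blast
qed

end

section \<open>Representations of the knot group\<close>

lemma normal_closure_normal:
  assumes "Group.group G" "S \<subseteq> carrier G"
  shows "normal (normal_closure G S) G"
proof -
  interpret Group.group G by fact
  show ?thesis unfolding normal_closure_def
  proof (rule normal_generateI)
    show "{g \<otimes>\<^bsub>G\<^esub> r \<otimes>\<^bsub>G\<^esub> inv\<^bsub>G\<^esub> g | g r. g \<in> carrier G \<and> r \<in> S} \<subseteq> carrier G"
      using assms(2) by auto
    fix h x assume "h \<in> {g \<otimes>\<^bsub>G\<^esub> r \<otimes>\<^bsub>G\<^esub> inv\<^bsub>G\<^esub> g | g r. g \<in> carrier G \<and> r \<in> S}" and x: "x \<in> carrier G"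
    then obtain g r where h: "h = g \<otimes>\<^bsub>G\<^esub> r \<otimes>\<^bsub>G\<^esub> inv\<^bsub>G\<^esub> g" "g \<in> carrier G" "r \<in> S" by blast
    then have r: "r \<in> carrier G" using assms(2) by blast
    have "x \<otimes>\<^bsub>G\<^esub> h \<otimes>\<^bsub>G\<^esub> inv\<^bsub>G\<^esub> x = (x \<otimes>\<^bsub>G\<^esub> g) \<otimes>\<^bsub>G\<^esub> r \<otimes>\<^bsub>G\<^esub> inv\<^bsub>G\<^esub> (x \<otimes>\<^bsub>G\<^esub> g)"
      unfolding h(1) using x h(2) r by (simp add: inv_mult_group m_assoc)
    then show "x \<otimes>\<^bsub>G\<^esub> h \<otimes>\<^bsub>G\<^esub> inv\<^bsub>G\<^esub> x \<in> {g \<otimes>\<^bsub>G\<^esub> r \<otimes>\<^bsub>G\<^esub> inv\<^bsub>G\<^esub> g | g r. g \<in> carrier G \<and> r \<in> S}"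
      using x h(2,3) m_closed[OF x h(2)] by blast
  qed
qed

lemma normal_closure_incl:
  assumes "Group.group G" "S \<subseteq> carrier G" "r \<in> S"
  shows "r \<in> normal_closure G S"
proof -
  interpret Group.group G by fact
  have "r = \<one>\<^bsub>G\<^esub> \<otimes>\<^bsub>G\<^esub> r \<otimes>\<^bsub>G\<^esub> inv\<^bsub>G\<^esub> \<one>\<^bsub>G\<^esub>" using assms(2,3) by auto
  then show ?thesis unfolding normal_closure_def using assms(3) by (intro generate.incl) blast
qed

context
  fixes E :: diagram
  assumes E: "oriented_diagram E"
begin

interpretation N: normal "relator_closure E" "free_group_on (arcs E)"
  unfolding relator_closure_def by (rule normal_closure_normal[OF group_free_group_on relators_carrier[OF E]])

lemma relator_in_closure: "c \<in> crossings E \<Longrightarrow> relator E c \<in> relator_closure E"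
  unfolding relator_closure_def by (rule normal_closure_incl[OF group_free_group_on relators_carrier[OF E]]) blast

lemma closure_carrier: "h \<in> relator_closure E \<Longrightarrow> h \<in> carrier (free_group_on (arcs E))"
  by (rule N.mem_carrier)

lemma closure_add: "g \<in> relator_closure E \<Longrightarrow> h \<in> relator_closure E \<Longrightarrow> g + h \<in> relator_closure E"
  using N.subgroup_axioms subgroup.m_closed by fastforce

lemma closure_uminus: "g \<in> relator_closure E \<Longrightarrow> - g \<in> relator_closure E"
  using N.m_inv_closed[of g] free_group_on_inv(1)[OF closure_carrier] by metis

lemma closure_0: "0 \<in> relator_closure E"
  using N.subgroup_axioms subgroup.one_closed by fastforce

lemma closure_conj:
  assumes "g \<in> carrier (free_group_on (arcs E))" "h \<in> relator_closure E"
  shows "g + h - g \<in> relator_closure E"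
  using N.inv_op_closed2[OF assms] by (simp add: free_group_on_inv(1)[OF assms(1)])

lemma group_class_carrier: "w \<in> carrier (free_group_on (arcs E)) \<Longrightarrow> group_class E w \<in> carrier (knot_group E)"
  unfolding group_class_def knot_group_def carrier_FactGroup by blast

lemma knot_group_elem:
  assumes "g \<in> carrier (knot_group E)"
  obtains w where "w \<in> carrier (free_group_on (arcs E))" "g = group_class E w"
  using assms unfolding group_class_def knot_group_def carrier_FactGroup by blast

lemma group_class_add:
  assumes "w \<in> carrier (free_group_on (arcs E))" "v \<in> carrier (free_group_on (arcs E))"
  shows "group_class E w \<otimes>\<^bsub>knot_group E\<^esub> group_class E v = group_class E (w + v)"
  unfolding group_class_def knot_group_def mult_FactGroup using N.rcos_sum[OF assms] by simp

lemma group_knot_group: "Group.group (knot_group E)"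
  unfolding knot_group_def by (rule N.factorgroup_is_group)

lemma group_class_closure:
  assumes "h \<in> relator_closure E" "w \<in> carrier (free_group_on (arcs E))"
  shows "group_class E (h + w) = group_class E w"
  unfolding group_class_def
  using N.coset_mult_assoc[OF N.subset closure_carrier[OF assms(1)] assms(2)]
    N.coset_join2[OF closure_carrier[OF assms(1)] N.subgroup_axioms assms(1)] by simp

lemma group_class_uminus:
  assumes "w \<in> carrier (free_group_on (arcs E))"
  shows "inv\<^bsub>knot_group E\<^esub> group_class E w = group_class E (- w)"
proof -
  interpret K: Group.group "knot_group E" by (rule group_knot_group)
  have w: "- w \<in> carrier (free_group_on (arcs E))" using free_group_on_inv(2)[OF assms] .
  have "group_class E 0 = \<one>\<^bsub>knot_group E\<^esub>"
    unfolding group_class_def knot_group_def one_FactGroup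
    using N.coset_join2[OF free_group_on_0 N.subgroup_axioms closure_0] .
  then have "group_class E (- w) \<otimes>\<^bsub>knot_group E\<^esub> group_class E w = \<one>\<^bsub>knot_group E\<^esub>"
    using group_class_add[OF w assms] by simp
  then show ?thesis using K.inv_equality group_class_carrier[OF w] group_class_carrier[OF assms] by blast
qed

end

lemma GL_simps:
  "A \<in> carrier (GL d) \<Longrightarrow> A \<in> carrier_mat d d"
  "A \<in> carrier (GL d) \<Longrightarrow> \<exists>B \<in> carrier_mat d d. B * A = 1\<^sub>m d"
  "A \<otimes>\<^bsub>GL d\<^esub> B = A * B"
  by (auto simp: GL_def units_of_def Units_def ring_mat_simps)

lemma diagram_rep_hom:
  assumes E: "oriented_diagram E" and \<rho>: "\<rho> \<in> hom (knot_group E) (GL d)"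
  shows "diagram_rep E d \<rho> (\<lambda>w. \<rho> (group_class E w))"
proof
  have GL: "\<rho> (group_class E w) \<in> carrier (GL d)" if "w \<in> carrier (free_group_on (arcs E))" for w
    using \<rho> group_class_carrier[OF E that] by (auto simp: hom_def)
  show "oriented_diagram E" by (rule E)
  show "\<rho> (group_class E w) \<in> carrier_mat d d" if "w \<in> carrier (free_group_on (arcs E))" for w
    by (rule GL_simps(1)[OF GL[OF that]])
  show add: "\<rho> (group_class E (w + v)) = \<rho> (group_class E w) * \<rho> (group_class E v)"
    if "w \<in> carrier (free_group_on (arcs E))" "v \<in> carrier (free_group_on (arcs E))" for w v
    using hom_mult[OF \<rho> group_class_carrier[OF E that(1)] group_class_carrier[OF E that(2)]]
    by (simp only: group_class_add[OF E that] GL_simps(3))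
  let ?A = "\<rho> (group_class E 0)"
  \<comment> \<open>An idempotent matrix with a left inverse is the identity.\<close>
  show one: "?A = 1\<^sub>m d"
  proof -
    have A: "?A \<in> carrier_mat d d" by (rule GL_simps(1)[OF GL[OF free_group_on_0]])
    obtain B where B: "B \<in> carrier_mat d d" "B * ?A = 1\<^sub>m d" using GL_simps(2)[OF GL[OF free_group_on_0]] by blast
    have "?A = (B * ?A) * ?A" unfolding B(2) using A by simp
    also have "\<dots> = B * (?A * ?A)" by (rule assoc_mult_mat[OF B(1) A A])
    also have "?A * ?A = ?A" using add[OF free_group_on_0 free_group_on_0] by simp
    finally show ?thesis unfolding B(2) .
  qed
  show "\<rho> (group_class E (relator E c)) = 1\<^sub>m d" if "c \<in> crossings E" for c
    using group_class_closure[OF E relator_in_closure[OF E that] free_group_on_0] one by simp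
qed simp

section \<open>Homomorphisms induced on knot groups, and meridians\<close>

lemma map_free_of_word: "map_free f (of_word u) = of_word (map (\<lambda>(x, b). (f x, b)) u)"
  by transfer simp

lemma map_free_add: "map_free f (x + y) = map_free f x + map_free f y"
  by transfer simp

lemma map_free_0: "map_free f 0 = 0"
  by transfer simp

lemma map_free_uminus: "map_free f (- x) = - map_free f x"
  by (rule minus_unique[symmetric]) (simp add: map_free_add[symmetric] map_free_0)

lemma map_free_diff: "map_free f (x - y) = map_free f x - map_free f y"
  by (simp only: diff_conv_add_uminus map_free_add map_free_uminus)

lemma map_free_gen: "map_free f (gen a) = gen (f a)"
  by (simp add: gen_def map_free_of_word)

lemma map_free_carrier:
  assumes "f ` X \<subseteq> Y" "w \<in> carrier (free_group_on X)"
  shows "map_free f w \<in> carrier (free_group_on Y)"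
proof -
  obtain u where u: "w = of_word u" "fst ` set u \<subseteq> X" using assms(2) by (auto simp: free_group_on_def)
  have "fst ` set (map (\<lambda>(x, b). (f x, b)) u) \<subseteq> Y" using u(2) assms(1) by force
  then show ?thesis unfolding u(1) map_free_of_word by (auto simp: free_group_on_def)
qed

lemma map_free_relator_closure:
  assumes E: "oriented_diagram E" "oriented_diagram E'"
    and f: "f ` arcs E \<subseteq> arcs E'" "\<And>c. c \<in> crossings E \<Longrightarrow> map_free f (relator E c) \<in> relator_closure E'"
    and h: "h \<in> relator_closure E"
  shows "map_free f h \<in> relator_closure E'"
proof -
  let ?G = "free_group_on (arcs E)"
  let ?S = "{g \<otimes>\<^bsub>?G\<^esub> r \<otimes>\<^bsub>?G\<^esub> inv\<^bsub>?G\<^esub> g | g r. g \<in> carrier ?G \<and> r \<in> relator E ` crossings E}"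
  have conj: "map_free f x \<in> relator_closure E'" "x \<in> carrier ?G" if x: "x \<in> ?S" for x
  proof -
    obtain g c where x: "x = g \<otimes>\<^bsub>?G\<^esub> relator E c \<otimes>\<^bsub>?G\<^esub> inv\<^bsub>?G\<^esub> g" "g \<in> carrier ?G" "c \<in> crossings E"
      using x by blast
    then have eq: "x = g + relator E c - g" by (simp add: free_group_on_inv(1))
    show "map_free f x \<in> relator_closure E'" unfolding eq map_free_diff map_free_add
      by (rule closure_conj[OF E(2) map_free_carrier[OF f(1) x(2)] f(2)[OF x(3)]])
    show "x \<in> carrier ?G" unfolding eq using x(2,3) relators_carrier[OF E(1)]
      by (intro free_group_on_diff free_group_on_add) auto
  qed
  have "h \<in> generate ?G ?S" using h by (simp only: relator_closure_def normal_closure_def)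
  then show ?thesis
  proof (induction rule: generate.induct)
    case one
    then show ?case by (simp add: map_free_0 closure_0[OF E(2)])
  next
    case (incl h)
    then show ?case by (rule conj(1))
  next
    case (inv h)
    then show ?case
      using closure_uminus[OF E(2) conj(1)[OF inv]] by (simp only: free_group_on_inv(1)[OF conj(2)[OF inv]] map_free_uminus)
  next
    case (eng h1 h2)
    then show ?case by (simp add: map_free_add closure_add[OF E(2)])
  qed
qed

lemma hom_group_class:
  assumes E: "oriented_diagram E" "oriented_diagram E'"
    and f: "f ` arcs E \<subseteq> arcs E'" "\<And>c. c \<in> crossings E \<Longrightarrow> map_free f (relator E c) \<in> relator_closure E'"
    and w: "w \<in> carrier (free_group_on (arcs E))"
  shows "the_elem ((\<lambda>w. group_class E' (map_free f w)) ` group_class E w) = group_class E' (map_free f w)"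
proof -
  have "group_class E' (map_free f (h + w)) = group_class E' (map_free f w)" if "h \<in> relator_closure E" for h
    unfolding map_free_add
    by (rule group_class_closure[OF E(2) map_free_relator_closure[OF E f that] map_free_carrier[OF f(1) w]])
  moreover have "group_class E w = (\<lambda>h. h + w) ` relator_closure E"
    by (auto simp: group_class_def r_coset_def)
  ultimately have "(\<lambda>w. group_class E' (map_free f w)) ` group_class E w = {group_class E' (map_free f w)}"
    using closure_0[OF E(1)] by auto
  then show ?thesis by simp
qed

text \<open>Invariance under conjugation, stated without an inverse of \<open>A\<close>: in a domain
  it is enough to cancel \<open>det A\<close>.\<close>

lemma det_minus_one_conj:
  fixes A :: "'r::idom mat"
  assumes carr: "A \<in> carrier_mat d d" "B \<in> carrier_mat d d" "C \<in> carrier_mat d d"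
    and eq: "A * B = C * A" and nz: "det A \<noteq> 0"
  shows "det (B - 1\<^sub>m d) = det (C - 1\<^sub>m d)"
proof -
  have "A * (B - 1\<^sub>m d) = (C - 1\<^sub>m d) * A"
    using mult_minus_distrib_mat[OF carr(1,2) one_carrier_mat] minus_mult_distrib_mat[OF carr(3) one_carrier_mat carr(1)]
      carr(1) eq by simp
  moreover have "B - 1\<^sub>m d \<in> carrier_mat d d" "C - 1\<^sub>m d \<in> carrier_mat d d"
    by (rule minus_carrier_mat[OF one_carrier_mat])+
  ultimately have "det A * det (B - 1\<^sub>m d) = det (C - 1\<^sub>m d) * det A"
    using det_mult[OF carr(1), of "B - 1\<^sub>m d"] det_mult[OF _ carr(1), of "C - 1\<^sub>m d"] by metis
  then show ?thesis using nz by simp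
qed

text \<open>The matrix is constant along curves, and the two arcs that meet under a crossing have
  conjugate matrices. As the diagram has one component, every arc is reached.\<close>

lemma (in diagram_rep) det_M_const:
  assumes knot: "knot_diagram E" and "x \<in> arcs E" "y \<in> arcs E"
  shows "det (M x - 1\<^sub>m d) = det (M y - 1\<^sub>m d)"
proof -
  let ?f = "\<lambda>p. det (M (arc_of E p) - 1\<^sub>m d)"
  have cross: "det (M (left_arc E c) - 1\<^sub>m d) = det (M (right_arc E c) - 1\<^sub>m d)" if "c \<in> crossings E" for c
  proof -
    let ?A = "M (over_arc E c)" and ?B = "M (left_arc E c)" and ?C = "M (right_arc E c)"
    have "det ?A \<noteq> 0" using det_mult[of ?A d "Mi (over_arc E c)"] by (auto simp: M_Mi)
    then show ?thesis by (rule det_minus_one_conj[OF M_carrier M_carrier M_carrier M_crossing(1)[OF that]])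
  qed
  have step: "?f p = ?f q" if "(p, q) \<in> curves E \<union> unders E" for p q
  proof (cases "(p, q) \<in> curves E")
    case True
    then show ?thesis by (simp add: arc_of_curve)
  next
    case False
    then have "(p, q) \<in> unders E" using that by simp
    then obtain l k where lk: "(l, k) \<in> bricks E" "(p, q) \<in> brick_unders (E ! l ! k) l (bot_pos E l k) (top_pos E l k)"
      by (auto simp: unders_def)
    then obtain s where s: "E ! l ! k = Cross s" by (cases "E ! l ! k") auto
    then have "(l, k) \<in> crossings E" using lk(1) by (simp add: crossings_def)
    from cross[OF this] show ?thesis using lk(2) s
      by (auto simp: left_arc_def right_arc_def crossing_points_def Let_def split: if_splits)
  qed
  obtain p q where "p \<in> points E" "x = arc_of E p" "q \<in> points E" "y = arc_of E q"
    using assms(2,3) by (auto simp: arcs_def)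
  then show ?thesis
    using knot equivclp_const[of "\<lambda>x y. (x, y) \<in> curves E \<union> unders E" p q ?f, OF _ step]
    unfolding knot_diagram_def by blast
qed

text \<open>A meridian is a conjugate of some Wirtinger generator and has exponent sum 1, so it
  gives the determinant of that generator; \<open>det_M_const\<close> passes on to
  \<open>y\<close>.\<close>

lemma det_meridian:
  assumes E: "knot_diagram E" and \<rho>: "\<rho> \<in> hom (knot_group E) (GL d)" and \<mu>: "\<mu> \<in> meridians E"
    and y: "y \<in> arcs E"
  shows "det_At_minus_I d (\<rho> \<mu>) = det (diagram_rep.M E d (\<lambda>w. \<rho> (group_class E w)) y - 1\<^sub>m d)"
proof -
  have or: "oriented_diagram E" using E by (simp add: knot_diagram_def)
  interpret diagram_rep E d \<rho> "\<lambda>w. \<rho> (group_class E w)" by (rule diagram_rep_hom[OF or \<rho>])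
  obtain g x where g: "g \<in> carrier (knot_group E)" and x: "x \<in> arcs E"
    and \<mu>': "\<mu> = g \<otimes>\<^bsub>knot_group E\<^esub> group_class E (gen x) \<otimes>\<^bsub>knot_group E\<^esub> inv\<^bsub>knot_group E\<^esub> g"
    using \<mu> by (auto simp: meridians_def)
  obtain w where w: "w \<in> F" "g = group_class E w" using knot_group_elem[OF or g] .
  have in_F: "gen x \<in> F" "- w \<in> F" "w + gen x \<in> F" "w + gen x + - w \<in> F"
    using w(1) x by (simp_all add: free_group_on_gen free_group_on_inv free_group_on_add del: add_uminus_conv_diff)
  have \<mu>w: "\<mu> = group_class E (w + gen x + - w)"
    unfolding \<mu>' w(2) group_class_uminus[OF or w(1)] group_class_add[OF or w(1) in_F(1)]
    by (rule group_class_add[OF or in_F(3,2)])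
  let ?X = "w + gen x + - w"
  have "exponent_sum ?X = 1" by (simp add: exponent_sum_add exponent_sum_uminus exponent_sum_gen del: add_uminus_conv_diff)
  then have "lmat 1 (\<rho> \<mu>) = Mw ?X" by (simp only: Mw_def \<mu>w)
  have "?X + w = w + gen x" by (simp add: add.assoc)
  then have "Mw ?X * Mw w = Mw w * Mw (gen x)"
    using Mw_add[OF in_F(4) w(1)] Mw_add[OF w(1) in_F(1)] by simp
  then have conj: "Mw w * Mw (gen x) = Mw ?X * Mw w" by simp
  have "Mw w * Mw (- w) = 1\<^sub>m d" using Mw_add[OF w(1) in_F(2)] by (simp add: Mw_0)
  then have "det (Mw w) \<noteq> 0"
    using det_mult[OF Mw_carrier[OF w(1)] Mw_carrier[OF in_F(2)]] by auto
  then have "det (Mw ?X - 1\<^sub>m d) = det (M x - 1\<^sub>m d)"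
    using det_minus_one_conj[OF Mw_carrier[OF w(1)] Mw_carrier[OF in_F(1)] Mw_carrier[OF in_F(4)] conj] x
    by (simp add: M_def)
  then show ?thesis
    using det_M_const[OF E x y] \<open>lmat 1 (\<rho> \<mu>) = Mw ?X\<close> by (simp add: det_At_minus_I_def lmat_def)
qed

context even_symmetric_union
begin

text \<open>An instance of \<open>K_shape\<close> with \<open>C\<close> as membership of the
  Wirtinger word in the relator closure of \<open>D\<close>. Crossings off the axis are copies of
  crossings of \<open>D\<close>, and on the axis all three labels agree, so that the word is
  trivial. This makes folding a homomorphism of knot groups.\<close>

lemma fold_relations:
  shows fold_curves: "(p, q) \<in> curves K \<Longrightarrow> arc_of D (fold_point p) = arc_of D (fold_point q)"
    and fold_crossing: "c \<in> crossings K \<Longrightarrow> crossing_points K c = (p, q, r) \<Longrightarrow>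
      gen (arc_of D (fold_point p)) + gen (arc_of D (fold_point q)) - gen (arc_of D (fold_point p)) -
      gen (arc_of D (fold_point r)) \<in> relator_closure D"
    and oriented_K: "oriented_diagram K"
proof -
  let ?C = "\<lambda>a b e. gen a + gen b - gen a - gen e \<in> relator_closure D"
  have shape: "brick_shape ?C (D ! l ! k) (bottom_slice D (arc_of D) (u :: point \<Rightarrow> int) l k) (top_slice D (arc_of D) v l k)"
    if "(l, k) \<in> bricks D" for l k u v
  proof (rule brick_shape_slices[OF D(1) that])
    fix p q r assume "(l, k) \<in> crossings D" "crossing_points D (l, k) = (p, q, r)"
    then show "?C (arc_of D p) (arc_of D q) (arc_of D r)"
      using relator_in_closure[OF D(1), of "(l, k)"] by (simp add: relator_def over_arc_def left_arc_def right_arc_def)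
  qed (rule arc_of_curve)
  have refl: "?C a a a" for a using closure_0[OF D(1)] by simp
  let ?\<gamma> = "arc_of D \<circ> fold_point" and ?z = "\<lambda>_ :: point. 0 :: int"
  have sys: "diagram_sys (brick_shape ?C) K ?\<gamma> ?z ?z"
    by (rule K_brick_shape[of ?C "arc_of D"]) (rule refl, rule shape)
  show or: "oriented_diagram K"
    by (rule K_oriented[of ?C "arc_of D"]) (rule refl, rule shape)
  {
    assume "(p, q) \<in> curves K"
    then obtain l k where lk: "(l, k) \<in> bricks K" "(p, q) \<in> brick_curves (K ! l ! k) l (bot_pos K l k) (top_pos K l k)"
      by (auto simp: curves_def)
    then have "brick_shape ?C (K ! l ! k) (bottom_slice K ?\<gamma> ?z l k) (top_slice K ?\<gamma> ?z l k)"
      using sys by (auto simp: diagram_sys_def)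
    then show "arc_of D (fold_point p) = arc_of D (fold_point q)" using lk(2)
      by (cases "K ! l ! k") (auto simp: bottom_slice_def top_slice_def split: if_splits)
  }
  {
    assume "c \<in> crossings K" and cp: "crossing_points K c = (p, q, r)"
    then obtain l k s where c: "c = (l, k)" "K ! l ! k = Cross s" "(l, k) \<in> bricks K"
      by (auto simp: crossings_def)
    then have "brick_shape ?C (K ! l ! k) (bottom_slice K ?\<gamma> ?z l k) (top_slice K ?\<gamma> ?z l k)"
      using sys by (auto simp: diagram_sys_def)
    then show "?C (arc_of D (fold_point p)) (arc_of D (fold_point q)) (arc_of D (fold_point r))"
      using c cp brick_states_slices[OF or c(3)]
      by (cases s) (auto simp: bottom_slice_def top_slice_def crossing_points_def Let_def split: if_splits)
  }
qed

lemma fold_point_in: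
  assumes "q \<in> points K"
  shows "fold_point q \<in> points D"
proof -
  obtain l i where q: "q = (l, i)" "l \<le> length K" "i < length (strands K l)"
    using assms by (auto simp: points_def)
  have l: "l < length K"
  proof (rule ccontr)
    assume "\<not> l < length K"
    then have "l = length K" using q(2) by simp
    then show False using q(3) oriented_K by (simp add: strands_def oriented_diagram_def)
  qed
  have len: "map length (shape_levels D (arc_of D) h0 ts) = map length (folded_levels D h0 ts)"
    using arg_cong[OF shape_levels_snd[of "arc_of D"], of "map length"] by (simp add: o_def)
  then have lf: "length (folded_levels D h0 ts) = length K" using length_shape_levels map_eq_imp_length_eq by metis
  have "length (strands K l) = length (folded_levels D h0 ts ! l)"
  proof -
    have "map shape (level K ((\<lambda>_. ()) \<circ> fold_point) (\<lambda>_. ()) l) = shape_levels D (\<lambda>_. ()) h0 ts ! l"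
    proof (rule K_level_shape[of "\<lambda>_ _ _. True"])
      show "brick_shape (\<lambda>_ _ _. True) (D ! l ! k) (bottom_slice D (\<lambda>_. ()) u l k) (top_slice D (\<lambda>_. ()) v l k)"
        if "(l, k) \<in> bricks D" for l k and u v :: "point \<Rightarrow> int"
        by (rule brick_shape_slices[OF D(1) that]) simp_all
    qed (simp_all add: l)
    from arg_cong[OF this, of length]
    have "length (strands K l) = length (shape_levels D (\<lambda>_. ()) h0 ts ! l)" by (simp add: level_def)
    also have "\<dots> = length (map (map (\<lambda>_. ())) (folded_levels D h0 ts) ! l)"
      using l unfolding shape_levels_snd[symmetric] by (simp add: length_shape_levels)
    finally show ?thesis using l lf by simp
  qed
  then have "fold_point q \<in> set (folded_levels D h0 ts ! l)" using q by (simp add: fold_point_def)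
  moreover have "folded_levels D h0 ts ! l \<in> set (folded_levels D h0 ts)" using l lf by simp
  moreover have "x \<in> points D" if "x \<in> set ys" "ys \<in> set (folded_levels D h0 ts)" for x ys
    using that less_imp_le[OF data(1)] by (auto simp: folded_levels_def folded_tangle_def Let_def level_points_def points_def
        dest!: in_set_butlastD split: if_splits option.splits)
  ultimately show ?thesis by blast
qed

lemma fold_arc_of:
  shows "fold_arc D h0 ts (arc_of K q) = arc_of D (fold_point q)"
proof -
  have "arc_of D (fold_point p) = arc_of D (fold_point q)" if "p \<in> arc_of K q" for p
    using that equivclp_const[of "\<lambda>x y. (x, y) \<in> curves K" q p "\<lambda>p. arc_of D (fold_point p)", OF _ fold_curves]
    by (auto simp: arc_of_def)
  moreover have "q \<in> arc_of K q" by (simp add: arc_of_def)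
  ultimately have "(\<lambda>p. arc_of D (fold_point p)) ` arc_of K q = {arc_of D (fold_point q)}" by blast
  moreover have "(\<lambda>(l, i). arc_of D (folded_levels D h0 ts ! l ! i)) = (\<lambda>p. arc_of D (fold_point p))"
    by (simp add: fold_point_def case_prod_unfold)
  ultimately show ?thesis by (simp add: fold_arc_def)
qed

lemma fold_arc_in: "fold_arc D h0 ts ` arcs K \<subseteq> arcs D"
  using fold_point_in by (auto simp: arcs_def fold_arc_of)

lemma fold_relator: "c \<in> crossings K \<Longrightarrow> map_free (fold_arc D h0 ts) (relator K c) \<in> relator_closure D"
  using fold_crossing by (cases "crossing_points K c")
    (simp add: relator_def over_arc_def left_arc_def right_arc_def map_free_add map_free_diff map_free_gen fold_arc_of)

lemma phi_group_class:
  assumes "w \<in> carrier (free_group_on (arcs K))"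
  shows "phi D h0 ts (group_class K w) = group_class D (map_free (fold_arc D h0 ts) w)"
  unfolding phi_def by (rule hom_group_class[OF oriented_K D(1) fold_arc_in fold_relator assms])

lemma comparison_phi:
  fixes \<rho> :: "arc free_group set \<Rightarrow> 'a::field mat"
  assumes \<rho>: "\<rho> \<in> hom (knot_group D) (GL d)"
  shows "comparison D h0 ts d \<rho> (\<rho> \<circ> phi D h0 ts) (\<lambda>w. \<rho> (group_class D w))
    (\<lambda>w. \<rho> (group_class D (map_free (fold_arc D h0 ts) w)))"
proof -
  let ?m = "map_free (fold_arc D h0 ts)"
  interpret repD: diagram_rep D d \<rho> "\<lambda>w. \<rho> (group_class D w)" by (rule diagram_rep_hom[OF D(1) \<rho>])
  note m_in = map_free_carrier[OF fold_arc_in]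
  interpret repK: diagram_rep K d "\<rho> \<circ> phi D h0 ts" "\<lambda>w. \<rho> (group_class D (?m w))"
  proof
    show "oriented_diagram K" by (rule oriented_K)
    show "\<rho> (group_class D (?m (relator K c))) = 1\<^sub>m d" if "c \<in> crossings K" for c
      using group_class_closure[OF D(1) fold_relator[OF that] free_group_on_0] repD.R_0 by simp
  qed (simp_all add: m_in repD.R_carrier repD.R_add map_free_add map_free_0 repD.R_0 phi_group_class)
  show ?thesis
  proof
    fix q assume q: "q \<in> points K"
    then have "arc_of K q \<in> arcs K" "arc_of D (fold_point q) \<in> arcs D" using fold_point_in by (auto simp: arcs_def)
    then show "repK.M (arc_of K q) = repD.M (arc_of D (fold_point q))"
      by (simp add: repK.M_def repD.M_def repK.Mw_def repD.Mw_def map_free_gen fold_arc_of exponent_sum_gen)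
  qed
qed

end

section \<open>Degrees, and the formula for the union\<close>

lemma laurent_degree_mult:
  "laurent_degree (p * q) = laurent_degree p + laurent_degree (q :: 'a::field laurent)"
  by (cases "p = 0 \<or> q = 0") (auto simp: laurent_degree_def keys_mult_extremal)

text \<open>The degrees of a unit and of its inverse are nonnegative and add up to 0.\<close>

lemma laurent_degree_unit:
  fixes u :: "'a::field laurent"
  assumes "u dvd 1"
  shows "laurent_degree u = 0"
proof -
  obtain v where v: "1 = u * v" using assms by (elim dvdE)
  then have nz: "u \<noteq> 0" "v \<noteq> 0" by auto
  have ge: "Min (Poly_Mapping.keys p) \<le> Max (Poly_Mapping.keys p)" if "p \<noteq> 0" for p :: "'a laurent"
    using that by (intro Min_le Max_in) auto
  have "Max (Poly_Mapping.keys (u * v)) = 0" "Min (Poly_Mapping.keys (u * v)) = 0" by (simp_all add: v[symmetric])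
  then have "Max (Poly_Mapping.keys u) = Min (Poly_Mapping.keys u)"
    using ge[OF nz(1)] ge[OF nz(2)] keys_mult_extremal[OF nz] by linarith
  then show ?thesis using nz by (simp add: laurent_degree_def)
qed

theorem theorem1p6:
  fixes D :: diagram and h0 :: nat and ts :: "(nat \<times> int) list"
    and d :: nat and \<rho> :: "arc free_group set \<Rightarrow> 'a :: field mat"
    and \<mu> :: "arc free_group set" and \<Delta>\<^sub>K \<Delta>\<^sub>D :: "'a laurent fract"
  assumes "knot_diagram D"
    and "symmetric_union_data D h0 ts"
    and "\<forall>(h, n) \<in> set ts. even n"
    and "\<rho> \<in> hom (knot_group D) (GL d)"
    and "\<mu> \<in> meridians D"
    and "twisted_alexander (symmetric_union D h0 ts) d (\<rho> \<circ> phi D h0 ts) \<Delta>\<^sub>K"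
    and "twisted_alexander D d \<rho> \<Delta>\<^sub>D"
  shows "eq_up_to_unit \<Delta>\<^sub>K (\<Delta>\<^sub>D ^ 2 * Fraction_Field.Fract (det_At_minus_I d (\<rho> \<mu>)) 1) \<and>
    fract_degree \<Delta>\<^sub>K = 2 * fract_degree \<Delta>\<^sub>D + ereal (real d)"
proof -
  have D: "oriented_diagram D" using assms(1) by (simp add: knot_diagram_def)
  interpret even_symmetric_union D h0 ts
    using D assms(2,3) by unfold_locales (auto dest: map_of_SomeD)
  let ?RK = "\<lambda>w. \<rho> (group_class D (map_free (fold_arc D h0 ts) w))"
  interpret comparison D h0 ts d \<rho> "\<rho> \<circ> phi D h0 ts" "\<lambda>w. \<rho> (group_class D w)" ?RK
    by (rule comparison_phi[OF assms(4)])
  have arc: "cut_arc \<in> arcs D" using cut_point_in by (simp add: cut_arc_def arcs_def)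
  let ?q = "det (repD.M cut_arc - 1\<^sub>m d)"
  have q: "repK.M cut_arc_K = repD.M cut_arc" "?q = det_At_minus_I d (\<rho> \<mu>)" "?q \<noteq> 0"
    using fold_M[OF cut_point_K_in] det_meridian[OF assms(1,4,5) arc] repD.det_M_nonzero[OF arc]
    by (simp_all add: fold_cut_point cut_arc_K_def)
  obtain \<delta>K where \<delta>K: "presents (arcs K \<times> {..<d}) (repK.ideal_of cut_arc_K) \<delta>K"
    "eq_up_to_unit \<Delta>\<^sub>K (Fraction_Field.Fract \<delta>K ?q)"
    using repK.twisted_alexander_presents[OF assms(6) cut_arc_K_in] unfolding q(1) by blast
  obtain \<delta> where \<delta>: "presents (arcs D \<times> {..<d}) (repD.ideal_of cut_arc) \<delta>"
    "eq_up_to_unit \<Delta>\<^sub>D (Fraction_Field.Fract \<delta> ?q)"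
    using repD.twisted_alexander_presents[OF assms(7) arc] by blast
  obtain u where u: "u dvd 1" "\<delta>K = u * \<delta> ^ 2" using fitting_symmetric_union[OF \<delta>K(1) \<delta>(1)] by blast
  obtain v where v: "v dvd 1" "\<Delta>\<^sub>K = Fraction_Field.Fract (v * \<delta>K) ?q"
    using \<delta>K(2) by (auto simp: eq_up_to_unit_def)
  obtain w where w: "w dvd 1" "\<Delta>\<^sub>D = Fraction_Field.Fract (w * \<delta>) ?q"
    using \<delta>(2) by (auto simp: eq_up_to_unit_def)
  obtain w' where w': "w * w' = 1" using w(1) by (metis dvdE)
  \<comment> \<open>The square of \<open>\<Delta>\<^sub>D\<close> has the denominator
    \<open>?q ^ 2\<close> and \<open>\<Delta>\<^sub>K\<close> only \<open>?q\<close>; this is the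
    origin of the factor \<open>?q\<close>. The square of \<open>w'\<close> undoes the unit
    \<open>w\<close> in \<open>\<Delta>\<^sub>D ^ 2\<close>.\<close>
  have "\<Delta>\<^sub>K = Fraction_Field.Fract (v * u * w' ^ 2) 1 * (\<Delta>\<^sub>D ^ 2 * Fraction_Field.Fract ?q 1)"
  proof -
    have "v * u * w' ^ 2 * ((w * \<delta>) ^ 2 * ?q) = v * u * (w * w') ^ 2 * \<delta> ^ 2 * ?q"
      by (simp add: power_mult_distrib mult_ac)
    then show ?thesis using q(3) unfolding v(2) w(2) u(2) w'
      by (simp add: eq_fract power2_eq_square mult_ac)
  qed
  moreover have "v * u * w' ^ 2 dvd 1"
  proof -
    have "w' dvd 1" using w' by (metis dvd_triv_right)
    then show ?thesis using v(1) u(1) by (simp add: is_unit_mult_iff power2_eq_square)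
  qed
  ultimately have "eq_up_to_unit \<Delta>\<^sub>K (\<Delta>\<^sub>D ^ 2 * Fraction_Field.Fract (det_At_minus_I d (\<rho> \<mu>)) 1)"
    unfolding q(2)[symmetric] eq_up_to_unit_def by blast
  moreover have "fract_degree \<Delta>\<^sub>K = 2 * fract_degree \<Delta>\<^sub>D + ereal (real d)"
  proof -
    have deg: "laurent_degree ?q = ereal (real d)" by (rule repD.det_M_degree[OF arc])
    have K: "fract_degree \<Delta>\<^sub>K = laurent_degree \<delta> + laurent_degree \<delta> - ereal (real d)"
      unfolding v(2) fract_degree_Fract[OF q(3)] u(2) deg laurent_degree_mult power2_eq_square
        laurent_degree_unit[OF u(1)] laurent_degree_unit[OF v(1)] by simp
    have "fract_degree \<Delta>\<^sub>D = laurent_degree \<delta> - ereal (real d)"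
      unfolding w(2) fract_degree_Fract[OF q(3)] deg laurent_degree_mult laurent_degree_unit[OF w(1)] by simp
    \<comment> \<open>With \<open>n\<close> the degree of \<open>\<delta>\<close>, the claim is
      \<open>2 * n - d = 2 * (n - d) + d\<close>; for \<open>\<delta> = 0\<close> both sides are
      \<open>- \<infinity>\<close>.\<close>
    with K show ?thesis by (cases "\<delta> = 0") (simp_all add: laurent_degree_def)
  qed
  ultimately show ?thesis by blast
qed

end
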